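(* Let $X$ be a compact topological space, let $\mathcal{E},\mathcal{F}$ be Banach bundles over $X$ and let $L\in\mathfrak{F}(\mathcal{E},\mathcal{F})$ be a Fredholm morphism. Then $\operatorname{ind}(L)=0\in K(X)$ if and only if there exist a bundle isomorphism $M\in GL(\mathcal{E},\mathcal{F})$ and a fibrewise compact morphism $K\in\mathcal{L}(\mathcal{E},\mathcal{F})$ (i.e. each $K_\lambda:\mathcal{E}_\lambda\to\mathcal{F}_\lambda$ is a compact operator) such that $L=M+K$.
   Context: Scalars are $\mathbb{K}=\mathbb{R}$ or $\mathbb{C}$; $K(X)$ denotes the Grothendieck group of finite dimensional $\mathbb{K}$-vector bundles over $X$ (so $K(X)$ means $KO(X)$ in the real case). A Banach bundle $\mathcal{E}$ over $X$ is a locally trivial bundle with fibres $\mathcal{E}_\lambda$, $\lambda\in X$, isomorphic to a fixed model Banach space, with transition functions that are continuous into the bounded invertible operators with the norm topology. $\mathcal{L}(\mathcal{E},\mathcal{F})$ denotes the bundle morphisms over the identity of $X$, i.e. fibrewise bounded linear maps $L_\lambda:\mathcal{E}_\lambda\to\mathcal{F}_\lambda$ which in local trivialisations are norm-continuous families of bounded operators; $GL(\mathcal{E},\mathcal{F})\subset\mathcal{L}(\mathcal{E},\mathcal{F})$ denotes the bundle isomorphisms. $\mathfrak{F}_k(\mathcal{E},\mathcal{F})$, $k\in\mathbb{Z}$, is the set of morphisms for which each $L_\lambda$ is a bounded Fredholm operator of index $k$, and $\mathfrak{F}(\mathcal{E},\mathcal{F})=\bigcup_{k\in\mathbb{Z}}\mathfrak{F}_k(\mathcal{E},\mathcal{F})$;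 its elements are called Fredholm morphisms. Index bundle: for $L\in\mathfrak{F}(\mathcal{E},\mathcal{F})$ there exist finite dimensional subbundles $\mathcal{V}\subset\mathcal{F}$ transversal to the image of $L$, i.e. $\operatorname{im}(L_\lambda)+\mathcal{V}_\lambda=\mathcal{F}_\lambda$ for all $\lambda\in X$. For such $\mathcal{V}$, the spaces $E(L,\mathcal{V})_\lambda=\{u\in\mathcal{E}_\lambda:L_\lambda u\in\mathcal{V}_\lambda\}$ form a finite dimensional subbundle $E(L,\mathcal{V})$ of $\mathcal{E}$, and $\operatorname{ind}(L):=[E(L,\mathcal{V})]-[\mathcal{V}]\in K(X)$, which does not depend on the choice of $\mathcal{V}$.
   Formalization: X is taken compact Hausdorff (otherwise ind(L) may depend on the choice of V), and "ind(L)=0 implies L=M+K" is stated for infinite-dimensional model fibres, since it fails for L=0 from TS² to the trivial plane bundle over S²; the converse is stated without this restriction. *)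

theory Defs
  imports "HOL-Analysis.Analysis" "HOL-Algebra.Group" "HOL-Library.Function_Algebras"
begin

section \<open>Scalars and linear algebra on subspaces\<close>

text \<open>The real and the complex numbers are, up to isometric isomorphism, the only instances:
  the second disjunct says that the type is \<open>\<real>(i)\<close>, and a multiplicative norm extending the
  absolute value of \<open>\<real>\<close> to \<open>\<real>(i)\<close> is the usual modulus.\<close>

class real_or_complex = real_normed_field +
  assumes real_or_complex:
    "(\<forall>a. \<exists>x. a = x *\<^sub>R 1) \<or>
     (\<exists>i. i * i = - 1 \<and> (\<forall>a. \<exists>x y. a = x *\<^sub>R 1 + y *\<^sub>R i))"

instance real :: real_or_complex
  by standard simp

instance complex :: real_or_complex
proof
  have "\<exists>i::complex. i * i = - 1 \<and> (\<forall>a. \<exists>x y. a = x *\<^sub>R 1 + y *\<^sub>R i)"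
    by (rule exI[of _ \<i>]) (auto simp: complex_eq_iff)
  then show "(\<forall>a::complex. \<exists>x. a = x *\<^sub>R 1) \<or>
     (\<exists>i::complex. i * i = - 1 \<and> (\<forall>a. \<exists>x y. a = x *\<^sub>R 1 + y *\<^sub>R i))" ..
qed

definition lin_on ::
  "('k \<Rightarrow> 'a::plus \<Rightarrow> 'a) \<Rightarrow> ('k \<Rightarrow> 'b::plus \<Rightarrow> 'b) \<Rightarrow> 'a set \<Rightarrow> ('a \<Rightarrow> 'b) \<Rightarrow> bool" where
  "lin_on s t S f \<longleftrightarrow>
     (\<forall>u\<in>S. \<forall>v\<in>S. f (u + v) = f u + f v) \<and> (\<forall>c. \<forall>u\<in>S. f (s c u) = t c (f u))"

definition has_dim :: "('k::field \<Rightarrow> 'a::ab_group_add \<Rightarrow> 'a) \<Rightarrow> 'a set \<Rightarrow> nat \<Rightarrow> bool" where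
  "has_dim s S n \<longleftrightarrow>
     (\<exists>B. finite B \<and> card B = n \<and> \<not> module.dependent s B \<and> module.span s B = S)"

definition finite_dim :: "('k::field \<Rightarrow> 'a::ab_group_add \<Rightarrow> 'a) \<Rightarrow> 'a set \<Rightarrow> bool" where
  "finite_dim s S \<longleftrightarrow> (\<exists>n. has_dim s S n)"

text \<open>The space \<open>K\<^sup>n\<close>, as the sequences vanishing from index \<open>n\<close> on, so that the dimension can vary
  within one type. As a subspace of the product topology on \<^typ>\<open>nat \<Rightarrow> 'k\<close> it carries its
  usual topology.\<close>

definition coords :: "nat \<Rightarrow> (nat \<Rightarrow> 'k::zero) set" where
  "coords n = {v. \<forall>i\<ge>n. v i = 0}"

definition cscale :: "'k::times \<Rightarrow> (nat \<Rightarrow> 'k) \<Rightarrow> (nat \<Rightarrow> 'k)" where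
  "cscale c v = (\<lambda>i. c * v i)"


section \<open>Banach bundles and their morphisms\<close>

text \<open>A \<open>K\<close>-Banach space is a real Banach space with a compatible scalar multiplication;
  for \<open>K = \<real>\<close> the second clause forces the latter to be \<^const>\<open>scaleR\<close>.\<close>

definition banach_scale :: "('k::real_normed_field \<Rightarrow> 'm::banach \<Rightarrow> 'm) \<Rightarrow> bool" where
  "banach_scale s \<longleftrightarrow> vector_space s \<and> (\<forall>r x. s (of_real r) x = r *\<^sub>R x) \<and>
     (\<forall>c x. norm (s c x) = norm c * norm x)"

text \<open>A bundle over \<open>X\<close> is given by its fibres and a trivialising atlas. All fibres are linear
  subspaces of one ambient vector space, which carries no topology; as any family of vector spaces
  embeds into its direct sum, this is no restriction. The Banachable topology of a fibre is the one
  transported from the model \<^typ>\<open>'m\<close> by the charts.\<close>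

record ('k, 'x, 'e, 'm) banach_bundle =
  fibre :: "'x \<Rightarrow> 'e set"
  scale :: "'k \<Rightarrow> 'e \<Rightarrow> 'e"
  mscale :: "'k \<Rightarrow> 'm \<Rightarrow> 'm"
  atlas :: "('x set \<times> ('x \<Rightarrow> 'e \<Rightarrow> 'm)) set"

definition norm_continuous ::
  "'x topology \<Rightarrow> 'x set \<Rightarrow> ('x \<Rightarrow> 'm::real_normed_vector \<Rightarrow> 'n::real_normed_vector) \<Rightarrow> bool" where
  "norm_continuous X U T \<longleftrightarrow>
     (\<exists>B :: 'x \<Rightarrow> 'm \<Rightarrow>\<^sub>L 'n. continuous_map (subtopology X U) euclidean B \<and>
        (\<forall>x\<in>U. T x = blinfun_apply (B x)))"

text \<open>The family \<open>L\<close> of maps between fibres, read in the chart \<open>\<phi>\<close> of \<open>E\<close>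
  and a chart \<open>\<psi>\<close> of the target.\<close>

definition in_charts ::
  "('x \<Rightarrow> 'e set) \<Rightarrow> ('x \<Rightarrow> 'e \<Rightarrow> 'm) \<Rightarrow> ('x \<Rightarrow> 'f \<Rightarrow> 'n) \<Rightarrow> ('x \<Rightarrow> 'e \<Rightarrow> 'f) \<Rightarrow> 'x \<Rightarrow> 'm \<Rightarrow> 'n" where
  "in_charts E \<phi> \<psi> L x v = \<psi> x (L x (inv_into (E x) (\<phi> x) v))"

definition bundle_chart ::
  "'x topology \<Rightarrow> ('k, 'x, 'e::ab_group_add, 'm::banach) banach_bundle \<Rightarrow>
   'x set \<Rightarrow> ('x \<Rightarrow> 'e \<Rightarrow> 'm) \<Rightarrow> bool" where
  "bundle_chart X E U \<phi> \<longleftrightarrow> openin X U \<and>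
     (\<forall>x\<in>U. lin_on (scale E) (mscale E) (fibre E x) (\<phi> x) \<and> bij_betw (\<phi> x) (fibre E x) UNIV)"

definition charts_compatible ::
  "'x topology \<Rightarrow> ('k, 'x, 'e::ab_group_add, 'm::banach) banach_bundle \<Rightarrow>
   'x set \<Rightarrow> ('x \<Rightarrow> 'e \<Rightarrow> 'm) \<Rightarrow> 'x set \<Rightarrow> ('x \<Rightarrow> 'e \<Rightarrow> 'm) \<Rightarrow> bool" where
  "charts_compatible X E U \<phi> U' \<psi> \<longleftrightarrow>
     norm_continuous X (U \<inter> U') (in_charts (fibre E) \<phi> \<psi> (\<lambda>x u. u)) \<and>
     norm_continuous X (U \<inter> U') (in_charts (fibre E) \<psi> \<phi> (\<lambda>x u. u))"

definition banach_bundle ::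
  "'x topology \<Rightarrow> ('k::real_normed_field, 'x, 'e::ab_group_add, 'm::banach) banach_bundle \<Rightarrow> bool" where
  "banach_bundle X E \<longleftrightarrow>
     vector_space (scale E) \<and> banach_scale (mscale E) \<and>
     (\<forall>x\<in>topspace X. module.subspace (scale E) (fibre E x)) \<and>
     (\<forall>(U, \<phi>)\<in>atlas E. bundle_chart X E U \<phi>) \<and>
     (\<Union>(U, \<phi>)\<in>atlas E. U) = topspace X \<and>
     (\<forall>(U, \<phi>)\<in>atlas E. \<forall>(U', \<psi>)\<in>atlas E. charts_compatible X E U \<phi> U' \<psi>)"

definition bundle_morphisms ::
  "'x topology \<Rightarrow> ('k, 'x, 'e::ab_group_add, 'm::banach) banach_bundle \<Rightarrow>
   ('k, 'x, 'f::ab_group_add, 'n::banach) banach_bundle \<Rightarrow> ('x \<Rightarrow> 'e \<Rightarrow> 'f) set" where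
  "bundle_morphisms X E F =
     {L. (\<forall>x\<in>topspace X. lin_on (scale E) (scale F) (fibre E x) (L x) \<and>
            L x ` fibre E x \<subseteq> fibre F x) \<and>
         (\<forall>(U, \<phi>)\<in>atlas E. \<forall>(U', \<psi>)\<in>atlas F.
            norm_continuous X (U \<inter> U') (in_charts (fibre E) \<phi> \<psi> L))}"

definition bundle_isos ::
  "'x topology \<Rightarrow> ('k, 'x, 'e::ab_group_add, 'm::banach) banach_bundle \<Rightarrow>
   ('k, 'x, 'f::ab_group_add, 'n::banach) banach_bundle \<Rightarrow> ('x \<Rightarrow> 'e \<Rightarrow> 'f) set" where
  "bundle_isos X E F =
     {M \<in> bundle_morphisms X E F. \<exists>N \<in> bundle_morphisms X F E. \<forall>x\<in>topspace X.
        (\<forall>u\<in>fibre E x. N x (M x u) = u) \<and> (\<forall>v\<in>fibre F x. M x (N x v) = v)}"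

definition compact_operator ::
  "('m::real_normed_vector \<Rightarrow> 'n::real_normed_vector) \<Rightarrow> bool" where
  "compact_operator T \<longleftrightarrow> bounded_linear T \<and> (\<forall>B. bounded B \<longrightarrow> compact (closure (T ` B)))"

definition compact_morphisms ::
  "'x topology \<Rightarrow> ('k, 'x, 'e::ab_group_add, 'm::banach) banach_bundle \<Rightarrow>
   ('k, 'x, 'f::ab_group_add, 'n::banach) banach_bundle \<Rightarrow> ('x \<Rightarrow> 'e \<Rightarrow> 'f) set" where
  "compact_morphisms X E F =
     {K \<in> bundle_morphisms X E F. \<forall>(U, \<phi>)\<in>atlas E. \<forall>(U', \<psi>)\<in>atlas F. \<forall>x\<in>U \<inter> U'.
        compact_operator (in_charts (fibre E) \<phi> \<psi> K x)}"

text \<open>The dimension of the cokernel is that of any algebraic complement of the image. Closedness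
  of the image is automatic for bounded operators between Banach spaces.\<close>

definition fredholm_on ::
  "('k::field \<Rightarrow> 'e::ab_group_add \<Rightarrow> 'e) \<Rightarrow> ('k \<Rightarrow> 'f::ab_group_add \<Rightarrow> 'f) \<Rightarrow>
   'e set \<Rightarrow> 'f set \<Rightarrow> ('e \<Rightarrow> 'f) \<Rightarrow> int \<Rightarrow> bool" where
  "fredholm_on s t S T f k \<longleftrightarrow>
     (\<exists>m n C. has_dim s {u \<in> S. f u = 0} m \<and>
        has_dim t C n \<and> C \<subseteq> T \<and> C \<inter> f ` S = {0} \<and> {c + f u | c u. c \<in> C \<and> u \<in> S} = T \<and>
        k = int m - int n)"

definition fredholm_morphisms_of_index ::
  "'x topology \<Rightarrow> ('k::field, 'x, 'e::ab_group_add, 'm::banach) banach_bundle \<Rightarrow>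
   ('k, 'x, 'f::ab_group_add, 'n::banach) banach_bundle \<Rightarrow> int \<Rightarrow> ('x \<Rightarrow> 'e \<Rightarrow> 'f) set" where
  "fredholm_morphisms_of_index X E F k =
     {L \<in> bundle_morphisms X E F. \<forall>x\<in>topspace X.
        fredholm_on (scale E) (scale F) (fibre E x) (fibre F x) (L x) k}"

definition fredholm_morphisms ::
  "'x topology \<Rightarrow> ('k::field, 'x, 'e::ab_group_add, 'm::banach) banach_bundle \<Rightarrow>
   ('k, 'x, 'f::ab_group_add, 'n::banach) banach_bundle \<Rightarrow> ('x \<Rightarrow> 'e \<Rightarrow> 'f) set" where
  "fredholm_morphisms X E F = (\<Union>k. fredholm_morphisms_of_index X E F k)"


section \<open>Finite dimensional vector bundles and the Grothendieck group\<close>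

text \<open>Vector bundles are presented like Banach bundles, but the rank \<open>n\<close> of a chart
  \<open>(U, n, \<phi>)\<close> need not be the same for all charts. A family of linear maps between finite
  dimensional spaces is norm continuous if and only if it is pointwise continuous.\<close>

record ('k, 'x, 'v) vbundle =
  vfibre :: "'x \<Rightarrow> 'v set"
  vscale :: "'k \<Rightarrow> 'v \<Rightarrow> 'v"
  vatlas :: "('x set \<times> nat \<times> ('x \<Rightarrow> 'v \<Rightarrow> nat \<Rightarrow> 'k)) set"

definition coords_continuous ::
  "'x topology \<Rightarrow> 'x set \<Rightarrow> nat \<Rightarrow> ('x \<Rightarrow> (nat \<Rightarrow> 'k) \<Rightarrow> (nat \<Rightarrow> 'k::real_normed_field)) \<Rightarrow> bool" where
  "coords_continuous X U n T \<longleftrightarrow>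
     (\<forall>v\<in>coords n. continuous_map (subtopology X U) euclidean (\<lambda>x. T x v))"

definition vector_bundle ::
  "'x topology \<Rightarrow> ('k::real_normed_field, 'x, 'v::ab_group_add) vbundle \<Rightarrow> bool" where
  "vector_bundle X V \<longleftrightarrow>
     vector_space (vscale V) \<and>
     (\<forall>x\<in>topspace X. module.subspace (vscale V) (vfibre V x)) \<and>
     (\<forall>(U, n, \<phi>)\<in>vatlas V. openin X U \<and>
        (\<forall>x\<in>U. lin_on (vscale V) cscale (vfibre V x) (\<phi> x) \<and>
           bij_betw (\<phi> x) (vfibre V x) (coords n))) \<and>
     (\<Union>(U, n, \<phi>)\<in>vatlas V. U) = topspace X \<and>
     (\<forall>(U, n, \<phi>)\<in>vatlas V. \<forall>(U', m, \<psi>)\<in>vatlas V.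
        coords_continuous X (U \<inter> U') n (in_charts (vfibre V) \<phi> \<psi> (\<lambda>x u. u)))"

definition vb_morphisms ::
  "'x topology \<Rightarrow> ('k::real_normed_field, 'x, 'v::ab_group_add) vbundle \<Rightarrow>
   ('k, 'x, 'w::ab_group_add) vbundle \<Rightarrow> ('x \<Rightarrow> 'v \<Rightarrow> 'w) set" where
  "vb_morphisms X V W =
     {f. (\<forall>x\<in>topspace X. lin_on (vscale V) (vscale W) (vfibre V x) (f x) \<and>
            f x ` vfibre V x \<subseteq> vfibre W x) \<and>
         (\<forall>(U, n, \<phi>)\<in>vatlas V. \<forall>(U', m, \<psi>)\<in>vatlas W.
            coords_continuous X (U \<inter> U') n (in_charts (vfibre V) \<phi> \<psi> f))}"

definition vb_isomorphic ::
  "'x topology \<Rightarrow> ('k::real_normed_field, 'x, 'v::ab_group_add) vbundle \<Rightarrow>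
   ('k, 'x, 'w::ab_group_add) vbundle \<Rightarrow> bool" where
  "vb_isomorphic X V W \<longleftrightarrow>
     (\<exists>f \<in> vb_morphisms X V W. \<exists>g \<in> vb_morphisms X W V. \<forall>x\<in>topspace X.
        (\<forall>u\<in>vfibre V x. g x (f x u) = u) \<and> (\<forall>v\<in>vfibre W x. f x (g x v) = v))"

definition whitney_sum ::
  "('k::real_normed_field, 'x, 'v::ab_group_add) vbundle \<Rightarrow>
   ('k, 'x, 'w::ab_group_add) vbundle \<Rightarrow> ('k, 'x, 'v \<times> 'w) vbundle" where
  "whitney_sum V W =
     \<lparr>vfibre = (\<lambda>x. vfibre V x \<times> vfibre W x),
      vscale = (\<lambda>c (v, w). (vscale V c v, vscale W c w)),
      vatlas = {(U \<inter> U', n + m, \<lambda>x (v, w) i. if i < n then \<phi> x v i else \<psi> x w (i - n)) |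
                  U n \<phi> U' m \<psi>. (U, n, \<phi>) \<in> vatlas V \<and> (U', m, \<psi>) \<in> vatlas W}\<rparr>"

definition zero_vbundle :: "'x topology \<Rightarrow> ('k::real_normed_field, 'x, nat \<Rightarrow> 'k) vbundle" where
  "zero_vbundle X =
     \<lparr>vfibre = (\<lambda>x. {0}), vscale = cscale, vatlas = {(topspace X, 0, \<lambda>x v. v)}\<rparr>"

text \<open>To form the set of isomorphism classes of vector bundles, a class is represented by its
  members with fibres in \<^typ>\<open>nat \<Rightarrow> 'k\<close>. Every vector bundle is isomorphic to one of these,
  as each of its fibres can be identified with some \<^term>\<open>coords n\<close>.\<close>

type_synonym ('k, 'x) vb_class = "('k, 'x, nat \<Rightarrow> 'k) vbundle set"

definition vb_class ::
  "'x topology \<Rightarrow> ('k::real_normed_field, 'x, 'v::ab_group_add) vbundle \<Rightarrow> ('k, 'x) vb_class" where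
  "vb_class X V = {W. vector_bundle X W \<and> vb_isomorphic X W V}"

definition Vect :: "'x topology \<Rightarrow> ('k::real_normed_field, 'x) vb_class monoid" where
  "Vect X =
     \<lparr>carrier = vb_class X ` {V :: ('k, 'x, nat \<Rightarrow> 'k) vbundle. vector_bundle X V},
      mult = (\<lambda>p q. \<Union>V\<in>p. \<Union>W\<in>q. vb_class X (whitney_sum V W)),
      one = vb_class X (zero_vbundle X)\<rparr>"

text \<open>The Grothendieck group of a commutative monoid, in multiplicative notation: the class of a
  pair \<open>(a, b)\<close> is the formal difference of \<open>a\<close> and \<open>b\<close>.\<close>

definition grothendieck_rel :: "('a, 'b) monoid_scheme \<Rightarrow> (('a \<times> 'a) \<times> ('a \<times> 'a)) set" where
  "grothendieck_rel M =
     {((a, b), (c, d)). a \<in> carrier M \<and> b \<in> carrier M \<and> c \<in> carrier M \<and> d \<in> carrier M \<and>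
        (\<exists>e\<in>carrier M. a \<otimes>\<^bsub>M\<^esub> d \<otimes>\<^bsub>M\<^esub> e = c \<otimes>\<^bsub>M\<^esub> b \<otimes>\<^bsub>M\<^esub> e)}"

definition grothendieck_group :: "('a, 'b) monoid_scheme \<Rightarrow> ('a \<times> 'a) set monoid" where
  "grothendieck_group M =
     \<lparr>carrier = (carrier M \<times> carrier M) // grothendieck_rel M,
      mult = (\<lambda>p q. \<Union>(a, b)\<in>p. \<Union>(c, d)\<in>q. grothendieck_rel M `` {(a \<otimes>\<^bsub>M\<^esub> c, b \<otimes>\<^bsub>M\<^esub> d)}),
      one = grothendieck_rel M `` {(\<one>\<^bsub>M\<^esub>, \<one>\<^bsub>M\<^esub>)}\<rparr>"

definition K_group ::
  "'x topology \<Rightarrow> (('k::real_normed_field, 'x) vb_class \<times> ('k, 'x) vb_class) set monoid" where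
  "K_group X = grothendieck_group (Vect X)"

definition K_class ::
  "'x topology \<Rightarrow> ('k::real_normed_field, 'x, 'v::ab_group_add) vbundle \<Rightarrow>
   (('k, 'x) vb_class \<times> ('k, 'x) vb_class) set" where
  "K_class X V = grothendieck_rel (Vect X) `` {(vb_class X V, \<one>\<^bsub>Vect X\<^esub>)}"


section \<open>The index bundle\<close>

text \<open>A chart of \<open>E\<close>, compatible with the atlas, that maps the family \<open>V\<close> of subspaces of the
  fibres onto a constant subspace \<open>M\<close> of the model.\<close>

definition adapted_chart ::
  "'x topology \<Rightarrow> ('k, 'x, 'e::ab_group_add, 'm::banach) banach_bundle \<Rightarrow> ('x \<Rightarrow> 'e set) \<Rightarrow>
   'x set \<Rightarrow> ('x \<Rightarrow> 'e \<Rightarrow> 'm) \<Rightarrow> 'm set \<Rightarrow> bool" where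
  "adapted_chart X E V U \<phi> M \<longleftrightarrow> bundle_chart X E U \<phi> \<and>
     (\<forall>(U', \<psi>)\<in>atlas E. charts_compatible X E U \<phi> U' \<psi>) \<and> (\<forall>x\<in>U. \<phi> x ` V x = M)"

text \<open>Finite dimensional subspaces of the model are complemented, so the usual requirement
  that subbundles split need not be imposed.\<close>

definition findim_subbundle ::
  "'x topology \<Rightarrow> ('k::field, 'x, 'e::ab_group_add, 'm::banach) banach_bundle \<Rightarrow>
   ('x \<Rightarrow> 'e set) \<Rightarrow> bool" where
  "findim_subbundle X E V \<longleftrightarrow>
     (\<forall>x\<in>topspace X. V x \<subseteq> fibre E x) \<and>
     (\<forall>x\<in>topspace X. \<exists>U \<phi> M. x \<in> U \<and> adapted_chart X E V U \<phi> M \<and> finite_dim (mscale E) M)"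

definition subbundle_vb ::
  "'x topology \<Rightarrow> ('k::real_normed_field, 'x, 'e::ab_group_add, 'm::banach) banach_bundle \<Rightarrow>
   ('x \<Rightarrow> 'e set) \<Rightarrow> ('k, 'x, 'e) vbundle" where
  "subbundle_vb X E V =
     \<lparr>vfibre = V, vscale = scale E,
      vatlas = {(U, n, \<lambda>x v. c (\<phi> x v)) | U n \<phi> c. \<exists>M. adapted_chart X E V U \<phi> M \<and>
                  lin_on (mscale E) cscale M c \<and> bij_betw c M (coords n)}\<rparr>"

definition transversal ::
  "'x topology \<Rightarrow> ('k, 'x, 'e, 'm) banach_bundle \<Rightarrow> ('k, 'x, 'f::ab_group_add, 'n) banach_bundle \<Rightarrow>
   ('x \<Rightarrow> 'e \<Rightarrow> 'f) \<Rightarrow> ('x \<Rightarrow> 'f set) \<Rightarrow> bool" where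
  "transversal X E F L V \<longleftrightarrow>
     (\<forall>x\<in>topspace X. {L x u + v | u v. u \<in> fibre E x \<and> v \<in> V x} = fibre F x)"

definition index_domain ::
  "('k, 'x, 'e, 'm) banach_bundle \<Rightarrow> ('x \<Rightarrow> 'e \<Rightarrow> 'f) \<Rightarrow> ('x \<Rightarrow> 'f set) \<Rightarrow> 'x \<Rightarrow> 'e set" where
  "index_domain E L V x = {u \<in> fibre E x. L x u \<in> V x}"

text \<open>The value does not depend on the choice of the transversal subbundle \<open>V\<close>, which exists
  when \<open>X\<close> is compact Hausdorff.\<close>

definition index_bundle ::
  "'x topology \<Rightarrow> ('k::real_normed_field, 'x, 'e::ab_group_add, 'm::banach) banach_bundle \<Rightarrow>
   ('k, 'x, 'f::ab_group_add, 'n::banach) banach_bundle \<Rightarrow> ('x \<Rightarrow> 'e \<Rightarrow> 'f) \<Rightarrow>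
   (('k, 'x) vb_class \<times> ('k, 'x) vb_class) set" where
  "index_bundle X E F L =
     (let V = (SOME V. findim_subbundle X F V \<and> transversal X E F L V)
      in K_class X (subbundle_vb X E (index_domain E L V)) \<otimes>\<^bsub>K_group X\<^esub>
         inv\<^bsub>K_group X\<^esub> K_class X (subbundle_vb X F V))"

end

theory Submission
 imports Defs
begin

text \<open>Over a compact Hausdorff base, a finite dimensional subbundle of an infinite dimensional Banach bundle
 can be put into general position, as a section that meets such a subbundle can be perturbed off it chart by chart.

 If the index of \<open>L\<close> vanishes, then \<open>E(L,V) \<oplus> W\<close> and \<open>V \<oplus> W\<close> are isomorphic for some vector bundle \<open>W\<close>. Embedding
 \<open>W\<close> into \<open>F\<close> as a complement of \<open>V\<close> and replacing \<open>V\<close> by \<open>V \<oplus> W\<close>, one may assume that there is an isomorphism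
 \<open>A : E(L,V) \<rightarrow> V\<close>. With a right inverse \<open>R\<close> of \<open>L\<close> modulo \<open>V\<close>, the morphism \<open>M = L R L + A (1 - R L)\<close> is invertible and
 \<open>L - M\<close> takes its values in \<open>V\<close>.

 Conversely, let \<open>L = M + K\<close>. Some \<open>V\<close> is transversal to all \<open>M + t K\<close>, \<open>0 \<le> t \<le> 1\<close>. The isomorphism class of
 \<open>E(M + t K, V)\<close> is locally constant in \<open>t\<close>, and \<open>M\<close> identifies \<open>E(M, V)\<close> with \<open>V\<close>.\<close>

section \<open>Frames of finite dimensional spaces\<close>

text \<open>The obstacle is that vanishing in \<open>K(X)\<close> is a stable statement. If the
  fibres of \<open>F\<close> are finite dimensional, a trivial index need not give a decomposition:
  over the 2-sphere, with real scalars, let \<open>E\<close> be the tangent bundle, \<open>F\<close>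
  the trivial plane bundle and \<open>L = 0\<close>. The index vanishes since the tangent bundle is
  stably trivial, every morphism is compact, and an isomorphism would trivialise the tangent bundle.
  Hence the stabilising bundle must find room inside \<open>F\<close>, away from a given transversal
  subbundle. The room comes from Riesz's lemma, which supplies directions far from any given finite
  dimensional subspace, and from compactness, which makes small perturbations harmless. A
  perturbation must not spoil transversality, and for a pencil \<open>M + t K\<close> not at any
  \<open>t\<close>; so whatever has been achieved is carried along as an open condition depending on
  \<open>x\<close> and \<open>t\<close>. Morphisms, sections and partitions of unity are handled as
  germs at points, so that objects that make sense only over a chart can be cut off and
  glued.\<close>

definition comb :: "('k::field => 'a::ab_group_add => 'a) => nat => (nat => 'a) => (nat => 'k) => 'a" where
 "comb s n v c = (\<Sum>i<n. s (c i) (v i))"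

definition indep :: "('k::field => 'a::ab_group_add => 'a) => nat => (nat => 'a) => bool" where
 "indep s n v \<longleftrightarrow> (\<forall>c. comb s n v c = 0 --> (\<forall>i<n. c i = 0))"

text \<open>A basis is an indexed family, not a set, so that it can vary continuously with the base
  point. Entries and coefficients from index \<open>n\<close> on are ignored, which lets the
  dimension be a number inside one type.\<close>

definition frame :: "('k::field => 'a::ab_group_add => 'a) => nat => (nat => 'a) => 'a set => bool" where
 "frame s n v S \<longleftrightarrow> indep s n v \<and> range (comb s n v) = S"

text \<open>Only homogeneity is recorded, because \<open>klin\<close> is applied to bounded real
  linear maps, whose additivity is already known.\<close>

definition klin :: "('k => 'a => 'a) => ('k => 'b => 'b) => ('a => 'b) => bool" where
 "klin s t f \<longleftrightarrow> (\<forall>c x. f (s c x) = t c (f x))"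

lemma comb_cong: "(\<And>i. i < n ==> c i = d i) ==> (\<And>i. i < n ==> v i = w i) ==> comb s n v c = comb s n w d"
 by (simp add: comb_def)

context vector_space
begin

lemma comb_add: "comb scale n v (%i. c i + d i) = comb scale n v c + comb scale n v d"
 by (simp add: comb_def scale_left_distrib sum.distrib)

lemma comb_diff: "comb scale n v (%i. c i - d i) = comb scale n v c - comb scale n v d"
 by (simp add: comb_def scale_left_diff_distrib sum_subtractf)

lemma comb_scale: "comb scale n v (%i. k * c i) = scale k (comb scale n v c)"
 by (simp add: comb_def scale_sum_right)

lemma comb_delta: "j < n ==> comb scale n v (%i. if i = j then 1 else 0) = v j"
proof -
 assume "j < n"
 have "comb scale n v (%i. if i = j then 1 else 0) = (\<Sum>i<n. if i = j then v j else 0)"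
  unfolding comb_def by (intro sum.cong) auto
 also have "\<dots> = v j" using \<open>j < n\<close> by simp
 finally show ?thesis .
qed

lemma comb_in: "subspace S ==> (\<And>i. i < n ==> v i \<in> S) ==> comb scale n v c \<in> S"
 unfolding comb_def by (intro subspace_sum subspace_scale) auto

lemma indep_eq: "indep scale n v ==> comb scale n v c = comb scale n v d ==> i < n ==> c i = d i"
 using comb_diff[of n v c d] unfolding indep_def by force

lemma frame_mem: "frame scale n v S ==> i < n ==> v i \<in> S"
 unfolding frame_def by (metis comb_delta[of i n v] rangeI)

lemma subspace_range_comb: "subspace (range (comb scale n v))"
proof (rule subspaceI)
 show "0 \<in> range (comb scale n v)" by (rule range_eqI[of _ _ "%_. 0"]) (simp add: comb_def)
qed (auto simp: comb_add[symmetric] comb_scale[symmetric])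

lemma frame_subspace: "frame scale n v S ==> subspace S"
 unfolding frame_def using subspace_range_comb by blast

lemma range_comb_span: "range (comb scale n v) = span (v ` {..<n})"
proof
 show "range (comb scale n v) \<subseteq> span (v ` {..<n})"
  by (intro image_subsetI comb_in subspace_span span_base) auto
 show "span (v ` {..<n}) \<subseteq> range (comb scale n v)"
  by (metis comb_delta image_subsetI lessThan_iff rangeI span_minimal subspace_range_comb)
qed

lemma indep_inj: assumes "indep scale n v" shows "inj_on v {..<n}"
proof (rule inj_onI)
 fix i j assume ij: "i \<in> {..<n}" "j \<in> {..<n}" "v i = v j"
 have "comb scale n v (%k. if k = i then 1 else 0) = comb scale n v (%k. if k = j then 1 else 0)"
  using ij comb_delta by simp
 from indep_eq[OF assms this, of i] ij show "i = j" by (auto split: if_splits)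
qed

lemma has_dim_frame: "has_dim scale S n \<longleftrightarrow> (\<exists>v. frame scale n v S)"
proof
 assume "has_dim scale S n"
 then obtain B where B: "finite B" "card B = n" "\<not> dependent B" "span B = S"
  unfolding has_dim_def by auto
 obtain v where v: "bij_betw v {..<n} B"
  using ex_bij_betw_nat_finite[OF B(1)] B(2) by (auto simp: atLeast0LessThan)
 then have im: "v ` {..<n} = B" by (simp add: bij_betw_def)
 have "indep scale n v"
  unfolding indep_def
 proof (intro allI impI)
  fix c i assume c: "comb scale n v c = 0" and i: "i < n"
  define u where "u b = c (inv_into {..<n} v b)" for b
  have uv: "u (v j) = c j" if "j < n" for j
   using that v by (simp add: u_def bij_betw_inv_into_left)
  have "\<forall>b\<in>B. u b = 0"
   using sum.reindex_bij_betw[OF v, of "%b. scale (u b) b"] uv c B(1,3) by (auto simp: comb_def dependent_finite)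
  then show "c i = 0" using uv[OF i] im i by auto
 qed
 then have "frame scale n v S" by (simp add: frame_def range_comb_span im B(4))
 then show "\<exists>v. frame scale n v S" by (rule exI[of _ v])
next
 assume "\<exists>v. frame scale n v S"
 then obtain v where v: "indep scale n v" "range (comb scale n v) = S" unfolding frame_def by auto
 have inj: "inj_on v {..<n}" by (rule indep_inj[OF v(1)])
 have "\<not> dependent (v ` {..<n})"
 proof
  assume "dependent (v ` {..<n})"
  then obtain u where u: "\<exists>b\<in>v ` {..<n}. u b \<noteq> 0" "(\<Sum>b\<in>v ` {..<n}. scale (u b) b) = 0"
   by (auto simp: dependent_finite)
  show False
   using u(2) sum.reindex[OF inj, of "%b. scale (u b) b"] v(1) u(1) by (auto simp: comb_def indep_def)
 qed
 then show "has_dim scale S n"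
  unfolding has_dim_def using v(2) inj
  by (intro exI[of _ "v ` {..<n}"]) (simp add: card_image range_comb_span)
qed

lemma finite_dim_frame: "finite_dim scale S \<longleftrightarrow> (\<exists>n v. frame scale n v S)"
 by (simp add: finite_dim_def has_dim_frame)

lemma finite_dim_subspace: "finite_dim scale S ==> subspace S"
 by (auto simp: finite_dim_frame frame_subspace)

text \<open>Finite spanning sets pass to subspaces and sums at once, whereas a basis would have to
  be adjusted each time.\<close>

lemma finite_dim_alt: "finite_dim scale S \<longleftrightarrow> subspace S \<and> (\<exists>B. finite B \<and> S \<subseteq> span B)"
proof
 assume "finite_dim scale S"
 then show "subspace S \<and> (\<exists>B. finite B \<and> S \<subseteq> span B)"
  using finite_dim_subspace unfolding finite_dim_def has_dim_def by blast
next
 assume A: "subspace S \<and> (\<exists>B. finite B \<and> S \<subseteq> span B)"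
 then obtain B where B: "finite B" "S \<subseteq> span B" by auto
 obtain C where C: "C \<subseteq> S" "independent C" "S \<subseteq> span C"
  using maximal_independent_subset by blast
 have "finite C" using independent_span_bound[OF B(1) C(2)] C(1) B(2) by blast
 moreover have "span C = S" using C A by (meson span_minimal subset_antisym)
 ultimately show "finite_dim scale S" unfolding finite_dim_def has_dim_def using C by blast
qed

lemma finite_dim_mono: "finite_dim scale S ==> subspace T ==> T \<subseteq> S ==> finite_dim scale T"
 unfolding finite_dim_alt by blast

lemma finite_dim_comb: "finite_dim scale (range (comb scale n v))"
 unfolding finite_dim_alt using range_comb_span[of n v] by auto

lemma finite_dim_span: "finite B ==> finite_dim scale (span B)"
 unfolding finite_dim_alt by auto

lemma finite_dim_sums:
 assumes "finite_dim scale S" "finite_dim scale T"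
 shows "finite_dim scale {x + y |x y. x \<in> S \<and> y \<in> T}"
proof -
 obtain B C where "finite B" "S \<subseteq> span B" "finite C" "T \<subseteq> span C"
  using assms unfolding finite_dim_alt by auto
 then have "finite (B \<union> C)" "{x + y |x y. x \<in> S \<and> y \<in> T} \<subseteq> span (B \<union> C)"
  using span_mono[of B "B \<union> C"] span_mono[of C "B \<union> C"] by (auto intro!: span_add)
 then show ?thesis unfolding finite_dim_alt
  using subspace_sums assms finite_dim_subspace by blast
qed

lemma frame_coord:
 assumes "frame scale n v S"
 obtains c where "\<And>x. x \<in> S ==> comb scale n v (c x) = x"
  "\<And>x y i. x \<in> S ==> y \<in> S ==> i < n ==> c (x + y) i = c x i + c y i"
  "\<And>k x i. x \<in> S ==> i < n ==> c (scale k x) i = k * c x i"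
  "\<And>x i. i \<ge> n ==> c x i = 0"
proof -
 have "\<forall>x\<in>S. \<exists>c. comb scale n v c = x \<and> (\<forall>i\<ge>n. c i = 0)"
 proof
  fix x assume "x \<in> S"
  then obtain c where "comb scale n v c = x" using assms unfolding frame_def by blast
  then have "comb scale n v (%i. if i < n then c i else 0) = x"
   using comb_cong[of n "%i. if i < n then c i else 0" c v v] by simp
  then show "\<exists>c. comb scale n v c = x \<and> (\<forall>i\<ge>n. c i = 0)" by (intro exI conjI) auto
 qed
 then obtain c where c: "\<And>x. x \<in> S ==> comb scale n v (c x) = x" "\<And>x i. x \<in> S ==> i \<ge> n ==> c x i = 0"
  by metis
 define d where "d x i = (if i < n then c x i else 0)" for x i
 have d: "comb scale n v (d x) = x" if "x \<in> S" for x
  using c(1)[OF that] comb_cong[of n "d x" "c x" v v] by (simp add: d_def)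
 have ind: "indep scale n v" using assms frame_def by auto
 show thesis
 proof (rule that[of d])
  fix x y i assume xy: "x \<in> S" "y \<in> S" "i < n"
  have "comb scale n v (d (x + y)) = comb scale n v (%i. d x i + d y i)"
   using xy d assms frame_subspace by (simp add: comb_add subspace_add)
  from indep_eq[OF ind this xy(3)] show "d (x + y) i = d x i + d y i" .
 next
  fix k x i assume xy: "x \<in> S" "i < n"
  have "comb scale n v (d (scale k x)) = comb scale n v (%i. k * d x i)"
   using xy d assms frame_subspace by (simp add: comb_scale subspace_scale)
  from indep_eq[OF ind this xy(2)] show "d (scale k x) i = k * d x i" .
 qed (use d in \<open>auto simp: d_def\<close>)
qed

end

lemma finite_dim_image:
 assumes "vector_space s" "vector_space t" "finite_dim s S"
  and add: "\<And>x y. x \<in> S ==> y \<in> S ==> f (x + y) = f x + f y"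
  and sc: "\<And>c x. x \<in> S ==> f (s c x) = t c (f x)"
 shows "finite_dim t (f ` S)"
proof -
 interpret s: vector_space s by fact
 interpret t: vector_space t by fact
 obtain n v where v: "frame s n v S" using assms(3) s.finite_dim_frame by blast
 then have sub: "s.subspace S" and mem: "\<And>i. i < n ==> v i \<in> S"
  using s.frame_subspace s.frame_mem by auto
 have f0: "f 0 = 0" using add[of 0 0] s.subspace_0[OF sub] by simp
 have "f (comb s n v c) = comb t n (f \<circ> v) c" for c
  using mem
 proof (induction n)
  case (Suc n)
  show ?case using sub s.comb_in Suc s.subspace_scale[OF sub] by (simp add: comb_def add sc)
 qed (simp add: comb_def f0)
 then have "f ` S = range (comb t n (f \<circ> v))"
  using v unfolding frame_def by (auto simp: image_iff)
 then show ?thesis using t.finite_dim_comb by simp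
qed

text \<open>A frame of the part of \<open>D\<close> that is reached by \<open>f\<close> is lifted to
  vectors \<open>u i\<close>; every element of the preimage differs from a combination of these by
  an element of the kernel.\<close>

lemma finite_dim_preimage:
 assumes "vector_space s" "vector_space t" "module.subspace s S" "finite_dim t D"
  and add: "\<And>x y. x \<in> S ==> y \<in> S ==> f (x + y) = f x + f y"
  and sc: "\<And>c x. x \<in> S ==> f (s c x) = t c (f x)"
  and ker: "finite_dim s {x \<in> S. f x = 0}"
 shows "finite_dim s {x \<in> S. f x \<in> D}"
proof -
 interpret s: vector_space s by fact
 interpret t: vector_space t by fact
 have f0: "f 0 = 0" using add[of 0 0] s.subspace_0[OF assms(3)] by simp
 have tD: "t.subspace D" using assms(4) t.finite_dim_subspace by blast
 have sub: "s.subspace {x \<in> S. f x \<in> D}"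
  by (rule s.subspaceI)
   (auto simp: s.subspace_0 s.subspace_add s.subspace_scale assms(3) f0 add sc t.subspace_0 t.subspace_add t.subspace_scale tD)
 have subf: "t.subspace (f ` {x \<in> S. f x \<in> D})"
 proof (rule t.subspaceI)
  show "0 \<in> f ` {x \<in> S. f x \<in> D}" by (metis f0 s.subspace_0[OF sub] imageI)
 next
  fix x y assume "x \<in> f ` {x \<in> S. f x \<in> D}" "y \<in> f ` {x \<in> S. f x \<in> D}"
  then obtain u v where "u \<in> {x \<in> S. f x \<in> D}" "v \<in> {x \<in> S. f x \<in> D}" "x = f u" "y = f v" by blast
  then show "x + y \<in> f ` {x \<in> S. f x \<in> D}"
   using s.subspace_add[OF sub, of u v] add by (intro image_eqI[of _ _ "u + v"]) auto
 next
  fix c x assume "x \<in> f ` {x \<in> S. f x \<in> D}"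
  then obtain u where "u \<in> {x \<in> S. f x \<in> D}" "x = f u" by blast
  then show "t c x \<in> f ` {x \<in> S. f x \<in> D}"
   using s.subspace_scale[OF sub, of u c] sc by (intro image_eqI[of _ _ "s c u"]) auto
 qed
 have "finite_dim t (f ` {x \<in> S. f x \<in> D})"
  by (rule t.finite_dim_mono[OF assms(4) subf]) auto
 then obtain n w where w: "frame t n w (f ` {x \<in> S. f x \<in> D})" using t.finite_dim_frame by blast
 then have "\<forall>i<n. \<exists>u\<in>{x \<in> S. f x \<in> D}. f u = w i" using t.frame_mem by (metis (no_types, lifting) imageE)
 then obtain u where u: "\<And>i. i < n ==> u i \<in> S \<and> f (u i) = w i" by (metis (no_types, lifting) mem_Collect_eq)
 have fu: "f (comb s n u c) = comb t n w c" for c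
  using u
 proof (induction n)
  case (Suc n)
  show ?case using assms(3) s.comb_in Suc s.subspace_scale[OF assms(3)] by (simp add: comb_def add sc)
 qed (simp add: comb_def f0)
 have "{x \<in> S. f x \<in> D} \<subseteq> {x + y |x y. x \<in> range (comb s n u) \<and> y \<in> {x \<in> S. f x = 0}}"
 proof
  fix x assume x: "x \<in> {x \<in> S. f x \<in> D}"
  then have "f x \<in> f ` {x \<in> S. f x \<in> D}" by (rule imageI)
  also have "\<dots> = range (comb t n w)" using w by (simp add: frame_def)
  finally obtain c where c: "f x = comb t n w c" by (rule rangeE)
  have cS: "comb s n u c \<in> S" using assms(3) u by (intro s.comb_in) auto
  have "x - comb s n u c \<in> S" using s.subspace_diff[OF assms(3)] x cS by auto
  moreover have "f ((x - comb s n u c) + comb s n u c) = f (x - comb s n u c) + f (comb s n u c)"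
   using calculation cS by (rule add)
  ultimately have "x - comb s n u c \<in> {x \<in> S. f x = 0}" using c fu by simp
  then show "x \<in> {x + y |x y. x \<in> range (comb s n u) \<and> y \<in> {x \<in> S. f x = 0}}"
   by (intro CollectI exI[of _ "comb s n u c"] exI[of _ "x - comb s n u c"] conjI rangeI) simp_all
 qed
 then show ?thesis
  by (rule s.finite_dim_mono[OF s.finite_dim_sums[OF s.finite_dim_comb ker] sub])
qed

section \<open>Functional analysis\<close>

subsection \<open>Almost orthogonal vectors\<close>

text \<open>The distance from \<open>u\<close> to \<open>D\<close> need not be attained, so a point
  at less than twice the distance is taken. This is the origin of the factor 2 and of the constant
  1/2 in the sequel.\<close>

lemma riesz_nearly_orthogonal:
 fixes D :: "'a::real_normed_vector set"
 assumes "closed D" "D \<noteq> {}" "u \<notin> D"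
 shows "\<exists>d\<in>D. \<forall>m\<in>D. norm (u - d) \<le> 2 * norm (u - m)"
proof -
 have pos: "0 < infdist u D"
  using assms in_closed_iff_infdist_zero infdist_nonneg[of u D] by fastforce
 then have "infdist u D < 2 * infdist u D" by simp
 then have "\<exists>d\<in>D. dist u d < 2 * infdist u D"
  using cINF_less_iff[OF assms(2) bdd_below_image_dist[of u D], of "2 * infdist u D"]
  by (simp add: infdist_notempty[OF assms(2)])
 then obtain d where d: "d \<in> D" "dist u d < 2 * infdist u D" by blast
 have "norm (u - d) \<le> 2 * norm (u - m)" if "m \<in> D" for m
  using infdist_le[OF that, of u] d(2) by (simp add: dist_norm)
 then show ?thesis using d by blast
qed

text \<open>Riesz's lemma. Normalising \<open>u - d\<close> for a nearly closest point
  \<open>d\<close> turns the factor 2 into the distance 1/2. Working inside \<open>N\<close> allows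
  it to detect when \<open>D\<close> exhausts \<open>N\<close>.\<close>

lemma riesz_unit_vector:
 fixes D :: "'a::real_normed_vector set"
 assumes "closed D" "subspace D" "subspace N" "D \<subseteq> N" "u \<in> N" "u \<notin> D"
 shows "\<exists>w\<in>N. norm w = 1 \<and> (\<forall>m\<in>D. 1 / 2 \<le> norm (w - m))"
proof -
 have "D \<noteq> {}" using subspace_0[OF assms(2)] by blast
 then obtain d where d: "d \<in> D" "\<forall>m\<in>D. norm (u - d) \<le> 2 * norm (u - m)"
  using riesz_nearly_orthogonal[OF assms(1) _ assms(6)] by blast
 have pos: "norm (u - d) > 0" using assms(6) d(1) by auto
 define w where "w = (u - d) /\<^sub>R norm (u - d)"
 have "w \<in> N" unfolding w_def
  by (intro subspace_scale subspace_diff assms(3,5) subsetD[OF assms(4) d(1)])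
 moreover have "norm w = 1" using pos by (simp add: w_def)
 moreover have "1 / 2 \<le> norm (w - m)" if "m \<in> D" for m
 proof -
  have "norm (u - d) \<le> 2 * norm (u - (d + norm (u - d) *\<^sub>R m))"
   using that d assms by (simp add: subspace_add subspace_scale)
  also have "u - (d + norm (u - d) *\<^sub>R m) = norm (u - d) *\<^sub>R (w - m)"
   using pos by (simp add: w_def algebra_simps)
  finally show ?thesis using pos by simp
 qed
 ultimately show ?thesis by blast
qed

subsection \<open>The Hahn-Banach theorem\<close>

definition sublinear :: "('a::real_vector => real) => bool" where
 "sublinear p \<longleftrightarrow> (\<forall>x y. p (x + y) \<le> p x + p y) \<and> (\<forall>r x. r > 0 --> p (r *\<^sub>R x) = r * p x)"

lemma sublinearD:
 assumes "sublinear p"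
 shows "p (x + y) \<le> p x + p y" "r > 0 ==> p (r *\<^sub>R x) = r * p x" "p 0 = 0" "- p (- x) \<le> p x"
proof -
 have 1: "\<And>x y. p (x + y) \<le> p x + p y" and 2: "\<And>r x. r > 0 ==> p (r *\<^sub>R x) = r * p x"
  using assms unfolding sublinear_def by blast+
 show "p (x + y) \<le> p x + p y" "r > 0 ==> p (r *\<^sub>R x) = r * p x" by (fact 1, fact 2)
 show 3: "p 0 = 0" using 2[of 2 0] by simp
 show "- p (- x) \<le> p x" using 1[of x "- x"] 3 by simp
qed

text \<open>\<open>q y\<close> modifies \<open>p\<close> so as to be linear along \<open>y\<close>:
  the choice \<open>t = 1\<close> shows that \<open>q y (- y)\<close> is at most
  \<open>p 0 - p y = - p y\<close>. A sublinear functional that cannot be lowered in this way is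
  additive.\<close>

lemma sublinear_slope:
 assumes p: "sublinear p"
 defines "q \<equiv> %y x. INF t\<in>{0..}. p (x + t *\<^sub>R y) - t * p y"
 shows "sublinear (q y)" "q y x \<le> p x" "t \<ge> 0 ==> q y x \<le> p (x + t *\<^sub>R y) - t * p y"
proof -
 \<comment> \<open>A lower bound independent of \<open>t\<close>, so that the infimum is finite:
   subadditivity for \<open>t y\<close> as the sum of \<open>x + t y\<close> and
   \<open>- x\<close>.\<close>
 have lb: "- p (- x) \<le> p (x + t *\<^sub>R y) - t * p y" if "t \<ge> 0" for x t
 proof -
  have "t * p y = p (t *\<^sub>R y)" using that sublinearD(2,3)[OF p] by (cases "t = 0") auto
  also have "\<dots> \<le> p (x + t *\<^sub>R y) + p (- x)"
   using sublinearD(1)[OF p, of "x + t *\<^sub>R y" "- x"] by simp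
  finally show ?thesis by simp
 qed
 have bdd: "bdd_below ((%t. p (x + t *\<^sub>R y) - t * p y) ` {0..})" for x
  using lb by (intro bdd_belowI[of _ "- p (- x)"]) auto
 have ne: "{0..} \<noteq> ({}::real set)" by auto
 show le: "q y x \<le> p (x + t *\<^sub>R y) - t * p y" if "t \<ge> 0" for x t
  unfolding q_def using that by (intro cINF_lower bdd) auto
 show "q y x \<le> p x" for x using le[of 0 x] by simp
 have approx: "\<exists>t\<ge>0. p (x + t *\<^sub>R y) - t * p y < q y x + e" if "e > 0" for x e
  using cINF_less_iff[OF ne bdd[of x], of "q y x + e"] that unfolding q_def by auto
 show "sublinear (q y)"
  unfolding sublinear_def
 proof (intro conjI allI impI)
  fix x z
  show "q y (x + z) \<le> q y x + q y z"
  proof (rule field_le_epsilon)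
   fix e :: real assume e: "0 < e"
   obtain t u where t: "t \<ge> 0" "p (x + t *\<^sub>R y) - t * p y < q y x + e / 2"
    and u: "u \<ge> 0" "p (z + u *\<^sub>R y) - u * p y < q y z + e / 2"
    using approx[of "e / 2"] e by (meson half_gt_zero)
   have "q y (x + z) \<le> p (x + z + (t + u) *\<^sub>R y) - (t + u) * p y" using le t u by simp
   also have "\<dots> \<le> (p (x + t *\<^sub>R y) - t * p y) + (p (z + u *\<^sub>R y) - u * p y)"
    using sublinearD(1)[OF p, of "x + t *\<^sub>R y" "z + u *\<^sub>R y"] by (simp add: algebra_simps)
   finally show "q y (x + z) \<le> q y x + q y z + e" using t u by simp
  qed
 next
  fix r :: real and x assume r: "r > 0"
  have half: "q y (r *\<^sub>R x) \<le> r * q y x" if r: "r > 0" for r x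
  proof (rule field_le_epsilon)
   fix e :: real assume e: "0 < e"
   obtain t where t: "t \<ge> 0" "p (x + t *\<^sub>R y) - t * p y < q y x + e / r"
    using approx[of "e / r"] e r by auto
   have "q y (r *\<^sub>R x) \<le> p (r *\<^sub>R x + (r * t) *\<^sub>R y) - (r * t) * p y" using le t r by simp
   also have "r *\<^sub>R x + (r * t) *\<^sub>R y = r *\<^sub>R (x + t *\<^sub>R y)" by (simp add: algebra_simps)
   also have "p (r *\<^sub>R (x + t *\<^sub>R y)) - (r * t) * p y = r * (p (x + t *\<^sub>R y) - t * p y)"
    using sublinearD(2)[OF p r, of "x + t *\<^sub>R y"] by (simp only: right_diff_distrib mult.assoc)
   also have "\<dots> \<le> r * (q y x + e / r)" using t r by simp
   finally show "q y (r *\<^sub>R x) \<le> r * q y x + e" using r by (simp add: algebra_simps)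
  qed
  have "r * q y x \<le> q y (r *\<^sub>R x)"
   using half[of "inverse r" "r *\<^sub>R x"] r by (simp add: field_simps)
  with half[OF r] show "q y (r *\<^sub>R x) = r * q y x" by (simp add: antisym)
 qed
qed

text \<open>A minimal sublinear functional is linear: it agrees with the one obtained from it by
 \<open>sublinear_slope\<close>.\<close>

lemma minimal_sublinear_linear:
 assumes p: "sublinear p" and min: "\<And>q. sublinear q ==> (\<forall>x. q x \<le> p x) ==> q = p"
 shows "linear p"
proof -
 have add: "p (x + y) = p x + p y" for x y
 proof -
  have "(%x. INF t\<in>{0..}. p (x + t *\<^sub>R y) - t * p y) = p"
   using sublinear_slope(1,2)[OF p] by (intro min) auto
  then have "(INF t\<in>{0..}. p (x + t *\<^sub>R y) - t * p y) = p x" by (rule fun_cong)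
  then have "p x \<le> p (x + y) - p y"
   using sublinear_slope(3)[OF p, of 1 x y] by simp
  then show ?thesis using sublinearD(1)[OF p, of x y] by simp
 qed
 have neg: "p (- x) = - p x" for x using add[of x "- x"] sublinearD(3)[OF p] by simp
 have "p (r *\<^sub>R x) = r * p x" for r x
  using sublinearD(2)[OF p, of r x] sublinearD(2)[OF p, of "- r" x] sublinearD(3)[OF p] neg[of "(- r) *\<^sub>R x"]
  by (cases r "0 :: real" rule: linorder_cases) auto
 then show ?thesis by (intro linearI) (auto simp: add)
qed

text \<open>Hahn-Banach by descent: instead of extending a functional from a subspace, Zorn's lemma
  yields a minimal sublinear minorant of \<open>p\<close>, which is linear by
  \<open>minimal_sublinear_linear\<close>.\<close>

lemma exists_linear_below:
 assumes p: "sublinear p"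
 shows "\<exists>f. linear f \<and> (\<forall>x. f x \<le> p x)"
proof -
 define A where "A = {q. sublinear q \<and> (\<forall>x. q x \<le> p x)}"
 have low: "- p (- x) \<le> q x" if "q \<in> A" for q x
  using sublinearD(4)[of q x] that unfolding A_def by (smt (verit) mem_Collect_eq)
 have "\<exists>m\<in>A. \<forall>q\<in>A. q \<le> m --> q = m"
 proof -
  \<comment> \<open>The pointwise order is reversed, so that a maximal element in the sense of Zorn
    is a minimal functional.\<close>
  have po: "partial_order_on A {(q, r). q \<in> A \<and> r \<in> A \<and> r \<le> q}" (is "partial_order_on A ?R")
   by (auto simp: partial_order_on_def preorder_on_def refl_on_def trans_def antisym_def)
  have Field: "Field ?R = A" unfolding Field_def by auto
  have "\<exists>m\<in>Field ?R. \<forall>a\<in>Field ?R. (m, a) \<in> ?R --> a = m"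
  proof (rule Zorns_po_lemma)
   show "Partial_order ?R" using po Field by simp
   fix C assume C: "C \<in> Chains ?R"
   then have CA: "C \<subseteq> A" and chain: "\<And>q r. q \<in> C ==> r \<in> C ==> q \<le> r \<or> r \<le> q"
    unfolding Chains_def by auto
   show "\<exists>u\<in>Field ?R. \<forall>a\<in>C. (a, u) \<in> ?R"
   proof (cases "C = {}")
    case True
    have "p \<in> A" using p by (simp add: A_def)
    then show ?thesis unfolding Field True by blast
   next
    case False
    define m where "m x = (INF q\<in>C. q x)" for x
    have bdd: "bdd_below ((%q. q x) ` C)" for x
     using low CA by (intro bdd_belowI[of _ "- p (- x)"]) auto
    have le: "m x \<le> q x" if "q \<in> C" for q x
     unfolding m_def using that by (intro cINF_lower bdd)
    have approx: "\<exists>q\<in>C. q x < m x + e" if "e > 0" for x e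
     using cINF_less_iff[OF False bdd[of x], of "m x + e"] that unfolding m_def by auto
    have subl: "q \<in> C ==> sublinear q" for q using CA unfolding A_def by auto
    have "sublinear m"
     unfolding sublinear_def
    proof (intro conjI allI impI)
     fix x y
     show "m (x + y) \<le> m x + m y"
     proof (rule field_le_epsilon)
      fix e :: real assume "0 < e"
      then obtain q r where q: "q \<in> C" "q x < m x + e / 2" and r: "r \<in> C" "r y < m y + e / 2"
       using approx by (meson half_gt_zero)
      \<comment> \<open>The smaller of the two chain members lies below both, so it serves for the
        arguments \<open>x\<close> and \<open>y\<close> simultaneously; this is where the chain
        property enters.\<close>
      define l where "l = (if q \<le> r then q else r)"
      have l: "l \<in> C" "l x \<le> q x" "l y \<le> r y"
       using q r chain[of q r] by (auto simp: l_def le_fun_def)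
      have "m (x + y) \<le> l x + l y"
       using le[OF l(1)] sublinearD(1)[OF subl[OF l(1)]] order_trans by blast
      then show "m (x + y) \<le> m x + m y + e" using l q r by simp
     qed
    next
     fix r :: real and x assume r: "r > 0"
     have "m (r *\<^sub>R x) = (INF q\<in>C. r * q x)"
      unfolding m_def using sublinearD(2)[OF subl] r by (intro INF_cong) auto
     also have "\<dots> = r * m x"
     proof (rule antisym)
      have bdd': "bdd_below ((%q. r * q x) ` C)"
      using low CA r by (fastforce intro!: mult_left_mono)
      show "(INF q\<in>C. r * q x) \<le> r * m x"
      proof (rule field_le_epsilon)
       fix e :: real assume "0 < e"
       then obtain q where q: "q \<in> C" "q x < m x + e / r" using approx r by (meson divide_pos_pos)
       have "(INF q\<in>C. r * q x) \<le> r * q x" using q by (intro cINF_lower bdd')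
       also have "\<dots> \<le> r * (m x + e / r)" using q r by simp
       finally show "(INF q\<in>C. r * q x) \<le> r * m x + e" using r by (simp add: algebra_simps)
      qed
      show "r * m x \<le> (INF q\<in>C. r * q x)"
       using le r False by (intro cINF_greatest) auto
     qed
     finally show "m (r *\<^sub>R x) = r * m x" .
    qed
    moreover have "m x \<le> p x" for x
    proof -
     obtain q where "q \<in> C" using False by blast
     then show ?thesis using le[of q x] CA order_trans[of "m x" "q x" "p x"] unfolding A_def by blast
    qed
    ultimately have "m \<in> A" unfolding A_def by auto
    moreover have "(q, m) \<in> ?R" if "q \<in> C" for q
     using that CA le \<open>m \<in> A\<close> by (auto simp: le_fun_def)
    ultimately show ?thesis unfolding Field by blast
   qed
  qed
  then show ?thesis unfolding Field by blast
 qed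
 then obtain m where m: "m \<in> A" "\<And>q. q \<in> A ==> q \<le> m ==> q = m" by blast
 have "linear m"
 proof (rule minimal_sublinear_linear)
  show "sublinear m" using m A_def by auto
  fix q assume q: "sublinear q" "\<forall>x. q x \<le> m x"
  then have "q \<in> A" using m(1) unfolding A_def by (auto intro: order_trans)
  then show "q = m" using m(2) q by (simp add: le_fun_def)
 qed
 then show ?thesis using m A_def by auto
qed

text \<open>The functional is sought below the slope functional of the norm in direction
  \<open>v\<close>, whose value at \<open>- v\<close> is at most \<open>- norm v\<close>; a linear
  functional below it must reach \<open>norm v\<close> at \<open>v\<close>.\<close>

lemma norming_functional:
 fixes v :: "'a::real_normed_vector"
 shows "\<exists>f::'a => real. bounded_linear f \<and> norm v \<le> f v"
proof -
 have s: "sublinear (norm :: 'a => real)" by (auto simp: sublinear_def norm_triangle_ineq)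
 let ?q = "%x. INF t\<in>{0..}. norm (x + t *\<^sub>R v) - t * norm v"
 obtain f where f: "linear f" "\<And>x. f x \<le> ?q x"
  using exists_linear_below[OF sublinear_slope(1)[OF s, of v]] by blast
 have le: "f x \<le> norm x" for x using f(2)[of x] sublinear_slope(2)[OF s, of x v] by linarith
 have neg: "f (- x) = - f x" for x using f(1) by (rule linear_neg)
 have "\<bar>f x\<bar> \<le> norm x" for x using le[of x] le[of "- x"] neg by auto
 then have "bounded_linear f"
  by (intro bounded_linear.intro bounded_linear_axioms.intro f) (metis mult.right_neutral real_norm_def)
 moreover have "f (- v) \<le> - norm v"
  using f(2)[of "- v"] sublinear_slope(3)[OF s, of 1 "- v" v] by simp
 ultimately show ?thesis using neg by (intro exI[of _ f]) simp
qed

subsection \<open>Open mappings and perturbations of the identity\<close>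

text \<open>The geometric series argument behind the open mapping theorem and the Neumann series.\<close>

lemma approximate_preimage_series:
 fixes f :: "'a::banach => 'b::real_normed_vector"
 assumes f: "bounded_linear f" and S: "closed S" "subspace S" and "c \<ge> 0"
  and approx: "\<And>y. \<exists>x\<in>S. norm x \<le> c * norm y \<and> norm (y - f x) \<le> norm y / 2"
 shows "\<exists>x\<in>S. f x = y \<and> norm x \<le> 2 * c * norm y"
proof -
 obtain g where g: "\<And>y. g y \<in> S" "\<And>y. norm (g y) \<le> c * norm y" "\<And>y. norm (y - f (g y)) \<le> norm y / 2"
  by (metis approx)
 \<comment> \<open>\<open>r k\<close> is the residual after \<open>k\<close> corrections; its norm
   is at least halved at each step, and the corrections sum to the preimage.\<close>
 define r where "r k = ((%y. y - f (g y)) ^^ k) y" for k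
 have r0: "r 0 = y" and rS: "r (Suc k) = r k - f (g (r k))" for k by (simp_all add: r_def)
 have rle: "norm (r k) \<le> norm y * (1 / 2) ^ k" for k
 proof (induction k)
  case (Suc k)
  have "norm (r (Suc k)) \<le> norm (r k) / 2" using g(3) rS by simp
  then show ?case using Suc by simp
 qed (simp add: r0)
 have gle: "norm (g (r k)) \<le> c * norm y * (1 / 2) ^ k" for k
  using g(2)[of "r k"] mult_left_mono[OF rle \<open>c \<ge> 0\<close>, of k] by (simp add: mult.assoc)
 have geo: "(%k. c * norm y * (1 / 2) ^ k) sums (c * norm y * 2)"
  using geometric_sums[of "1 / 2 :: real"] by (intro sums_mult) simp
 have sn: "summable (%k. norm (g (r k)))"
  by (rule summable_comparison_test'[OF sums_summable[OF geo], of 0]) (use gle in simp)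
 then have sm: "summable (%k. g (r k))" by (rule summable_norm_cancel)
 define x where "x = (\<Sum>k. g (r k))"
 have lim: "(%n. \<Sum>k<n. g (r k)) \<longlonglongrightarrow> x"
  unfolding x_def using sm summable_LIMSEQ by blast
 have "x \<in> S"
  by (rule closed_sequentially[OF S(1) _ lim]) (intro subspace_sum S(2) g(1))
 moreover have "f x = y"
 proof -
  have part: "f (\<Sum>k<n. g (r k)) = y - r n" for n
  proof (induction n)
   case 0 then show ?case using linear_0[OF bounded_linear.linear[OF f]] r0 by simp
  next
   case (Suc n)
   then show ?case using rS linear_add[OF bounded_linear.linear[OF f]] by simp
  qed
  have "(%n. f (\<Sum>k<n. g (r k))) \<longlonglongrightarrow> f x"
   using bounded_linear.tendsto[OF f lim] .
  moreover have "r \<longlonglongrightarrow> 0"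
  proof (rule Lim_null_comparison)
   show "\<forall>\<^sub>F k in sequentially. norm (r k) \<le> norm y * (1 / 2) ^ k" using rle by simp
   show "(%k. norm y * (1 / 2) ^ k) \<longlonglongrightarrow> 0" by (intro tendsto_mult_right_zero LIMSEQ_power_zero) simp
  qed
  then have "(%n. y - r n) \<longlonglongrightarrow> y - 0" by (intro tendsto_diff tendsto_const)
  ultimately have "(%n. y - r n) \<longlonglongrightarrow> f x" "(%n. y - r n) \<longlonglongrightarrow> y"
   unfolding part by simp_all
  then show ?thesis by (rule LIMSEQ_unique)
 qed
 moreover have "norm x \<le> 2 * c * norm y"
 using summable_norm[OF sn] suminf_le[OF gle sn sums_summable[OF geo]] sums_unique[OF geo, symmetric] by (simp add: x_def)
 ultimately show ?thesis by blast
qed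

text \<open>By Baire some closure \<open>A n\<close> contains a ball. Subtracting approximate
  preimages of two points of this ball moves it to the origin, and the residual is at most half,
  which \<open>approximate_preimage_series\<close> removes. The closed subspace \<open>S\<close>
  stands for a Banach space that is not a type of its own.\<close>

theorem open_mapping:
 fixes f :: "'a::banach => 'b::banach"
 assumes f: "bounded_linear f" and S: "closed S" "subspace S" and onto: "f ` S = UNIV"
 shows "\<exists>c. \<forall>y. \<exists>x\<in>S. f x = y \<and> norm x \<le> c * norm y"
proof -
 interpret f: bounded_linear f by fact
 define A where "A n = closure (f ` (S \<inter> cball 0 (real n)))" for n
 have cover: "(\<Union>n. A n) = UNIV"
 proof -
  have "y \<in> (\<Union>n. A n)" for y
  proof -
   obtain x where x: "x \<in> S" "f x = y" by (metis onto UNIV_I imageE)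
   obtain n where "norm x \<le> real n" using real_arch_simple by blast
   then have "y \<in> f ` (S \<inter> cball 0 (real n))" using x by auto
   then have "y \<in> A n" unfolding A_def by (rule subsetD[OF closure_subset])
   then show ?thesis by blast
  qed
  then show ?thesis by auto
 qed
 have "\<exists>n. interior (A n) \<noteq> {}"
 proof (rule ccontr)
  assume no: "\<not> ?thesis"
  have "euclidean interior_of \<Union>(range A) = {}"
  using no by (intro Baire_category_alt; auto simp: completely_metrizable_space_euclidean A_def)
  then show False using cover by simp
 qed
 then obtain n y0 e where y0: "e > 0" "ball y0 e \<subseteq> A n"
  by (metis ex_in_conv mem_interior)
 have close: "\<exists>x\<in>S. norm x \<le> real n \<and> norm (y - f x) < d" if yd: "norm (y - y0) < e" "d > 0" for y d
 using yd y0 by (force simp: dist_norm norm_minus_commute A_def closure_approachable)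
 have "\<exists>x\<in>S. norm x \<le> (4 * real n / e) * norm y \<and> norm (y - f x) \<le> norm y / 2" for y
 proof (cases "y = 0")
  case True
  then show ?thesis using subspace_0[OF S(2)] by (intro bexI[of _ 0]) (auto simp: f.zero)
 next
  case False
  \<comment> \<open>Chosen so that \<open>k y\<close> has norm \<open>e / 2\<close> and
    \<open>y0 + k y\<close> stays in the ball. Two errors below \<open>e / 8\<close> then give a
    residual of at most \<open>e / 4 = k * (norm y / 2)\<close>.\<close>
  define k where "k = e / (2 * norm y)"
  have k: "k > 0" using False y0 by (simp add: k_def)
  obtain a where a: "a \<in> S" "norm a \<le> real n" "norm (y0 + k *\<^sub>R y - f a) < e / 8"
   using close[of "y0 + k *\<^sub>R y" "e / 8"] y0 False by (auto simp: k_def)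
  obtain b where b: "b \<in> S" "norm b \<le> real n" "norm (y0 - f b) < e / 8"
   using close[of y0 "e / 8"] y0 by auto
  define x where "x = (1 / k) *\<^sub>R (a - b)"
  have "x \<in> S" unfolding x_def using a b S by (simp add: subspace_diff subspace_scale)
  moreover have "norm x \<le> (4 * real n / e) * norm y"
  proof -
   have "norm x \<le> (1 / k) * (2 * real n)"
    using norm_triangle_ineq4[of a b] a b k by (simp add: x_def divide_right_mono)
   also have "\<dots> = (4 * real n / e) * norm y" unfolding k_def by (simp add: field_simps)
   finally show ?thesis .
  qed
  moreover have "norm (y - f x) \<le> norm y / 2"
  proof -
   have "norm ((y0 + k *\<^sub>R y - f a) - (y0 - f b)) \<le> e / 4"
    using norm_triangle_ineq4[of "y0 + k *\<^sub>R y - f a" "y0 - f b"] a b by linarith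
   moreover have "k *\<^sub>R (y - f x) = (y0 + k *\<^sub>R y - f a) - (y0 - f b)"
    using k by (simp add: x_def f.scaleR f.diff algebra_simps)
   ultimately have "k * norm (y - f x) \<le> e / 4" using k by (metis abs_of_pos norm_scaleR)
   moreover have "e / 4 = k * (norm y / 2)" unfolding k_def using False by (simp add: field_simps)
   ultimately show ?thesis using k by simp
  qed
  ultimately show ?thesis by blast
 qed
 then show ?thesis
  using approximate_preimage_series[OF f S, of "4 * real n / e"] y0(1) by (metis divide_nonneg_pos mult_nonneg_nonneg of_nat_0_le_iff zero_le_numeral)
qed

text \<open>The Neumann series: \<open>y\<close> itself is an approximate preimage of
  \<open>y\<close> with residual at most \<open>norm y / 2\<close>, so the series argument runs with
  constant 1.\<close>

lemma near_identity_surj: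
 fixes f :: "'a::banach => 'a"
 assumes f: "bounded_linear f" and near: "\<And>x. norm (f x - x) \<le> norm x / 2"
 shows "bij f" "norm x \<le> 2 * norm (f x)"
proof -
 interpret f: bounded_linear f by fact
 show le: "norm x \<le> 2 * norm (f x)" for x
  using near[of x] norm_triangle_ineq2[of x "x - f x"] norm_minus_commute[of x "f x"] by simp
 have "\<exists>x\<in>UNIV. f x = y \<and> norm x \<le> 2 * 1 * norm y" for y
  by (rule approximate_preimage_series[OF f])
   (use near in \<open>auto simp: norm_minus_commute intro!: exI[of _ "y" for y]\<close>)
 then have "surj f" by (metis surj_def)
 moreover have "inj f"
 proof (rule injI)
  fix x y assume "f x = f y"
  then have "f (x - y) = 0" by (simp add: f.diff)
  then show "x = y" using le[of "x - y"] by simp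
 qed
 ultimately show "bij f" by (simp add: bij_def)
qed

text \<open>A total function whose value has a meaning when the pointwise inverse is bounded; it is
  evaluated at operators within distance 1/2 of the identity.\<close>

definition blinv :: "('a::real_normed_vector \<Rightarrow>\<^sub>L 'b::real_normed_vector) => ('b \<Rightarrow>\<^sub>L 'a)" where
 "blinv B = Blinfun (inv_into UNIV (blinfun_apply B))"

lemma blinv_near_id:
 fixes B :: "'a::banach \<Rightarrow>\<^sub>L 'a"
 assumes "norm (B - id_blinfun) \<le> 1 / 2"
 shows "bij (blinfun_apply B)" "blinfun_apply (blinv B) = inv_into UNIV (blinfun_apply B)"
  "norm (blinv B) \<le> 2" "blinfun_apply B (blinv B y) = y" "blinv B (blinfun_apply B x) = x"
proof -
 have near: "norm (B x - x) \<le> norm x / 2" for x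
  using norm_blinfun[of "B - id_blinfun" x] mult_right_mono[OF assms norm_ge_zero[of x]] by (simp add: blinfun.diff_left)
 have bl: "bounded_linear (blinfun_apply B)" by (rule blinfun.bounded_linear_right)
 show bij: "bij (blinfun_apply B)" using near_identity_surj(1)[OF bl near] .
 let ?g = "inv_into UNIV (blinfun_apply B)"
 have Bg: "B (?g y) = y" for y using bij by (simp add: bij_is_surj surj_f_inv_f)
 have gB: "?g (B x) = x" for x using bij by (simp add: bij_is_inj)
 have le: "norm (?g y) \<le> norm y * 2" for y
  using near_identity_surj(2)[OF bl near, of "?g y"] Bg by (simp add: mult.commute)
 have "bounded_linear ?g"
 proof (rule bounded_linear_intro)
  show "?g (x + y) = ?g x + ?g y" for x y by (metis Bg gB blinfun.add_right)
  show "?g (r *\<^sub>R x) = r *\<^sub>R ?g x" for r x by (metis Bg gB blinfun.scaleR_right)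
 qed (rule le)
 then show eq: "blinfun_apply (blinv B) = ?g"
  unfolding blinv_def by (simp add: bounded_linear_Blinfun_apply)
 show "norm (blinv B) \<le> 2"
  by (rule norm_blinfun_bound) (use le eq in \<open>auto simp: mult.commute\<close>)
 show "blinfun_apply B (blinv B y) = y" "blinv B (blinfun_apply B x) = x" using eq Bg gB by auto
qed

text \<open>The difference of the inverses of \<open>B\<close> and \<open>B0\<close> is the inverse
  of \<open>B\<close> times \<open>B0 - B\<close> times the inverse of \<open>B0\<close>. Both
  inverses have norm at most 2, whence the factor 4.\<close>

lemma tendsto_blinv:
 fixes B :: "'z => ('a::banach \<Rightarrow>\<^sub>L 'a)"
 assumes lim: "(B \<longlongrightarrow> B0) G" and near: "norm (B0 - id_blinfun) \<le> 1 / 2"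
  and ev: "\<forall>\<^sub>F z in G. norm (B z - id_blinfun) \<le> 1 / 2"
 shows "((%z. blinv (B z)) \<longlongrightarrow> blinv B0) G"
proof (rule Lim_transform_bound[THEN Lim_null[THEN iffD2]])
 show "((%z. 4 * norm (B0 - B z)) \<longlongrightarrow> 0) G"
  using tendsto_norm[OF tendsto_diff[OF tendsto_const[of B0] lim]] by (intro tendsto_mult_right_zero) simp
 show "\<forall>\<^sub>F z in G. norm (blinv (B z) - blinv B0) \<le> norm (4 * norm (B0 - B z))"
  using ev
 proof eventually_elim
  case (elim z)
  have "blinv (B z) - blinv B0 = blinv (B z) o\<^sub>L (B0 - B z) o\<^sub>L blinv B0"
   by (rule blinfun_eqI)
    (simp add: blinfun.diff_left blinfun.diff_right blinv_near_id(4)[OF near] blinv_near_id(5)[OF elim])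
  then have "norm (blinv (B z) - blinv B0) \<le> norm (blinv (B z)) * norm (B0 - B z) * norm (blinv B0)"
   by (simp only:) (rule order_trans[OF norm_blinfun_compose mult_right_mono[OF norm_blinfun_compose norm_ge_zero]])
  also have "\<dots> \<le> 2 * norm (B0 - B z) * 2"
   using blinv_near_id(3)[OF near] blinv_near_id(3)[OF elim] by (intro mult_mono) auto
  finally show ?case by simp
 qed
qed

subsection \<open>Finite dimensional subspaces of a Banach space\<close>

text \<open>The scalar type is known only through its class. In the real case the ball is the image
  of an interval; in the other case the real linear map \<open>h\<close> from the complex numbers is
  bounded below, so that balls have compact preimages.\<close>

lemma compact_scalar_ball: "compact {c::'k::real_or_complex. norm c \<le> r}"
 using real_or_complex
proof
 assume real: "\<forall>a::'k. \<exists>x. a = x *\<^sub>R 1"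
 have "{c::'k. norm c \<le> r} = of_real ` {-r..r}"
 proof
  show "{c::'k. norm c \<le> r} \<subseteq> of_real ` {-r..r}"
  using real by (force intro: image_eqI simp: of_real_def)
 qed auto
 moreover have "continuous_on {-r..r} (of_real :: real => 'k)" by (intro continuous_intros)
 ultimately show ?thesis using compact_continuous_image[of "{-r..r}" "of_real :: real => 'k"] by simp
next
 assume "\<exists>i::'k. i * i = - 1 \<and> (\<forall>a. \<exists>x y. a = x *\<^sub>R 1 + y *\<^sub>R i)"
 then obtain i :: 'k where i: "i * i = - 1" "\<And>a. \<exists>x y. a = x *\<^sub>R 1 + y *\<^sub>R i" by blast
 define h :: "complex => 'k" where "h z = of_real (Re z) + of_real (Im z) * i" for z
 have cont: "continuous_on A h" for A unfolding h_def by (intro continuous_intros)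
 have onto: "\<exists>z. h z = a" for a
 proof -
  obtain x y where "a = x *\<^sub>R 1 + y *\<^sub>R i" using i(2) by blast
  then have "h (Complex x y) = a" by (simp add: h_def of_real_def)
  then show ?thesis ..
 qed
 \<comment> \<open>Multiplying by the conjugate expression gives the sum of the squares of the real
   and imaginary parts; only \<open>i * i = - 1\<close> enters.\<close>
 have nz: "h z \<noteq> 0" if "z \<noteq> 0" for z
 proof
  assume "h z = 0"
  then have "h z * (of_real (Re z) - of_real (Im z) * i) = 0" by simp
  also have "h z * (of_real (Re z) - of_real (Im z) * i)
    = of_real (Re z) * of_real (Re z) - of_real (Im z) * of_real (Im z) * (i * i)"
   unfolding h_def by (simp add: algebra_simps)
  also have "\<dots> = of_real ((Re z)\<^sup>2 + (Im z)\<^sup>2)" using i(1) by (simp add: power2_eq_square)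
  finally have "(Re z)\<^sup>2 + (Im z)\<^sup>2 = 0" by (simp only: of_real_eq_0_iff)
  then show False using that by (simp add: complex_eq_iff sum_power2_eq_zero_iff)
 qed
 have hr: "h (r *\<^sub>R z) = r *\<^sub>R h z" for r z by (simp add: h_def scaleR_conv_of_real algebra_simps)
 have "\<exists>z0\<in>sphere 0 1. \<forall>z\<in>sphere 0 1. norm (h z0) \<le> norm (h z)"
  by (intro continuous_attains_inf continuous_on_norm cont) auto
 then obtain z0 where z0: "norm z0 = 1" "\<And>z. norm z = 1 ==> norm (h z0) \<le> norm (h z)" by auto
 define e where "e = norm (h z0)"
 have e: "e > 0" using z0(1) nz[of z0] by (force simp: e_def)
 have low: "e * norm z \<le> norm (h z)" for z
 proof (cases "z = 0")
  case True then show ?thesis by simp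
 next
  case False
  have "e \<le> norm (h (inverse (norm z) *\<^sub>R z))" unfolding e_def using False by (intro z0(2)) simp
  also have "\<dots> = norm (h z) / norm z" by (simp only: hr) (simp add: field_simps)
  finally show ?thesis using False by (simp add: field_simps)
 qed
 have "closed {z. norm (h z) \<le> r}"
  using cont by (intro closed_Collect_le continuous_intros) auto
 moreover have "bounded {z. norm (h z) \<le> r}"
 proof (rule boundedI)
  fix z assume "z \<in> {z. norm (h z) \<le> r}"
  then have "e * norm z \<le> r" using low[of z] by simp
  then show "norm z \<le> r / e" using e by (simp add: field_simps)
 qed
 ultimately have "compact {z. norm (h z) \<le> r}" by (simp add: compact_eq_bounded_closed)
 then have "compact (h ` {z. norm (h z) \<le> r})" using compact_continuous_image cont by blast
 moreover have "h ` {z. norm (h z) \<le> r} = {c. norm c \<le> r}"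
 proof
  show "{c. norm c \<le> r} \<subseteq> h ` {z. norm (h z) \<le> r}"
  proof
   fix c :: 'k assume c: "c \<in> {c. norm c \<le> r}"
   obtain z where "h z = c" using onto by blast
   then show "c \<in> h ` {z. norm (h z) \<le> r}" using c by auto
  qed
 qed auto
 ultimately show ?thesis by simp
qed

lemma scalar_Cauchy_convergent:
 fixes c :: "nat => 'k::real_or_complex"
 assumes "Cauchy c"
 shows "\<exists>l. c \<longlonglongrightarrow> l"
proof -
 obtain r where "\<forall>k. norm (c k) \<le> r"
  using cauchy_imp_bounded[OF assms] unfolding bounded_iff by auto
 then have "\<forall>k. c k \<in> {c. norm c \<le> r}" by simp
 moreover have "complete {c::'k. norm c \<le> r}" by (intro compact_imp_complete compact_scalar_ball)
 ultimately show ?thesis using assms unfolding complete_def by blast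
qed

locale kbanach =
 fixes s :: "'k::real_or_complex => 'm::banach => 'm"
 assumes banach_scale: "banach_scale s"
begin

sublocale vector_space s
 using banach_scale unfolding banach_scale_def by blast

lemma scale_of_real: "s (of_real r) x = r *\<^sub>R x"
 using banach_scale unfolding banach_scale_def by blast

lemma norm_scale: "norm (s c x) = norm c * norm x"
 using banach_scale unfolding banach_scale_def by blast

lemma scale_scaleR: "s (r *\<^sub>R c) x = r *\<^sub>R s c x"
 by (metis scaleR_conv_of_real scale_of_real scale_scale)

lemma scale_scaleR_right: "s c (r *\<^sub>R x) = r *\<^sub>R s c x"
 by (metis scale_of_real scale_left_commute)

lemma bounded_bilinear_scale: "bounded_bilinear s"
 by (rule bounded_bilinear.intro)
  (auto simp: scale_left_distrib scale_right_distrib scale_scaleR scale_scaleR_right norm_scale intro!: exI[of _ 1])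

lemma subspace_real: "subspace S ==> Real_Vector_Spaces.subspace S"
 by (metis Real_Vector_Spaces.subspace_def scale_of_real subspace_def)

lemma tendsto_comb:
 assumes "\<And>i. i < n ==> ((%z. c z i) \<longlongrightarrow> c0 i) G" "\<And>i. i < n ==> ((%z. v z i) \<longlongrightarrow> v0 i) G"
 shows "((%z. comb s n (v z) (c z)) \<longlongrightarrow> comb s n v0 c0) G"
 unfolding comb_def using assms
 by (intro tendsto_sum bounded_bilinear.tendsto[OF bounded_bilinear_scale]) auto

text \<open>The lower bound turns a convergent sequence of combinations into Cauchy sequences of
  coefficients, whose limits exist by completeness of the scalars.\<close>

lemma closed_range_comb:
 assumes "\<eta> > 0" and bound: "\<And>c. \<eta> * (\<Sum>i<n. norm (c i)) \<le> norm (comb s n v c)"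
 shows "closed (range (comb s n v))"
 unfolding closed_sequential_limits
proof (intro allI impI, elim conjE)
 fix x l assume x: "\<forall>k. x k \<in> range (comb s n v)" and lim: "x \<longlonglongrightarrow> l"
 then obtain c where c: "\<And>k. x k = comb s n v (c k)" unfolding image_iff by metis
 have "\<exists>l. (%k. c k i) \<longlonglongrightarrow> l" if i: "i < n" for i
 proof (rule scalar_Cauchy_convergent, rule metric_CauchyI)
  fix e :: real assume "e > 0"
  then obtain M where M: "\<forall>j\<ge>M. \<forall>k\<ge>M. dist (x j) (x k) < \<eta> * e"
   using metric_CauchyD[OF LIMSEQ_imp_Cauchy[OF lim], of "\<eta> * e"] assms(1) by auto
  have "dist (c j i) (c k i) < e" if "j \<ge> M" "k \<ge> M" for j k
  proof -
   have "norm (c j i - c k i) \<le> (\<Sum>i<n. norm (c j i - c k i))"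
    using i by (intro member_le_sum) auto
   then have "\<eta> * norm (c j i - c k i) \<le> \<eta> * (\<Sum>i<n. norm (c j i - c k i))"
    using assms(1) by simp
   also have "\<dots> \<le> norm (x j - x k)" using bound[of "%i. c j i - c k i"] by (simp add: c comb_diff)
   also have "\<dots> < \<eta> * e" using M that by (simp add: dist_norm)
   finally show ?thesis using assms(1) by (simp add: dist_norm)
  qed
  then show "\<exists>M. \<forall>j\<ge>M. \<forall>k\<ge>M. dist (c j i) (c k i) < e" by blast
 qed
 then obtain c0 where c0: "\<And>i. i < n ==> (%k. c k i) \<longlonglongrightarrow> c0 i" by metis
 then have "(%k. comb s n v (c k)) \<longlonglongrightarrow> comb s n v c0" by (intro tendsto_comb tendsto_const)
 then have "x \<longlonglongrightarrow> comb s n v c0" unfolding c[symmetric] .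
 then have "l = comb s n v c0" by (rule LIMSEQ_unique[OF lim])
 then show "l \<in> range (comb s n v)" by simp
qed

text \<open>Induction on \<open>n\<close>: the span of the first \<open>n\<close> vectors is closed
  by the induction hypothesis, so \<open>v n\<close> has positive distance \<open>\<delta>\<close>
  from it, and this distance controls the last coefficient.\<close>

lemma indep_bound:
 "indep s n v ==> \<exists>\<eta>>0. \<forall>c. \<eta> * (\<Sum>i<n. norm (c i)) \<le> norm (comb s n v c)"
proof (induction n)
 case 0
 then show ?case by (intro exI[of _ 1]) (simp add: comb_def)
next
 case (Suc n)
 have ind: "indep s n v"
  unfolding indep_def
 proof (intro allI impI)
  fix c i assume c: "comb s n v c = 0" and i: "i < n"
  have "comb s (Suc n) v (%i. if i < n then c i else 0) = comb s n v (%i. if i < n then c i else 0)"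
   by (simp add: comb_def)
  also have "\<dots> = comb s n v c" by (intro comb_cong) auto
  finally have "comb s (Suc n) v (%i. if i < n then c i else 0) = 0" using c by simp
  from Suc.prems[unfolded indep_def, rule_format, OF this, of i] show "c i = 0" using i by simp
 qed
 then obtain \<eta> where \<eta>: "\<eta> > 0" "\<And>c. \<eta> * (\<Sum>i<n. norm (c i)) \<le> norm (comb s n v c)"
  using Suc.IH by blast
 let ?S = "range (comb s n v)"
 have nin: "v n \<notin> ?S"
 proof
  assume "v n \<in> ?S"
  then obtain c where c: "v n = comb s n v c" by blast
  have "comb s (Suc n) v (%i. if i < n then c i else -1)
    = comb s n v (%i. if i < n then c i else -1) - v n"
   by (simp add: comb_def)
  also have "comb s n v (%i. if i < n then c i else -1) = comb s n v c" by (intro comb_cong) auto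
  finally have "comb s (Suc n) v (%i. if i < n then c i else -1) = 0" using c by simp
  from Suc.prems[unfolded indep_def, rule_format, OF this, of n] show False by simp
 qed
 define \<delta> where "\<delta> = infdist (v n) ?S"
 have ne: "?S \<noteq> {}" by simp
 have \<delta>: "\<delta> > 0"
  using in_closed_iff_infdist_zero[OF closed_range_comb[OF \<eta>] ne, of "v n"] nin infdist_nonneg[of "v n" ?S]
  unfolding \<delta>_def by linarith
 have low: "\<delta> * norm (c n) \<le> norm (comb s (Suc n) v c)" for c
 proof (cases "c n = 0")
  case True then show ?thesis by simp
 next
  case False
  have "comb s (Suc n) v c = s (c n) (v n - comb s n v (%i. - inverse (c n) * c i))"
   using False by (simp only: comb_scale scale_right_diff_distrib) (simp add: comb_def)
  then have eq: "norm (comb s (Suc n) v c) = norm (c n) * dist (v n) (comb s n v (%i. - inverse (c n) * c i))"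
   by (simp only: norm_scale dist_norm)
  have "\<delta> \<le> dist (v n) (comb s n v (%i. - inverse (c n) * c i))"
   unfolding \<delta>_def by (intro infdist_le rangeI)
  then show ?thesis unfolding eq by (subst mult.commute) (intro mult_left_mono norm_ge_zero)
 qed
 \<comment> \<open>If the combination has norm \<open>N\<close>, the last coefficient is at most
   \<open>N / \<delta>\<close>. Removing the last term leaves a vector of norm at most
   \<open>N (1 + norm (v n) / \<delta>)\<close>, and the induction hypothesis divides this by
   \<open>\<eta>\<close> to bound the other coefficients.\<close>
 define C where "C = (1 + norm (v n) / \<delta>) / \<eta> + 1 / \<delta>"
 have C: "C > 0" unfolding C_def using \<eta>(1) \<delta> by (intro add_pos_pos divide_pos_pos add_pos_nonneg divide_nonneg_pos) auto
 have "(\<Sum>i<Suc n. norm (c i)) \<le> C * norm (comb s (Suc n) v c)" for c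
 proof -
  let ?N = "norm (comb s (Suc n) v c)"
  have n: "norm (c n) \<le> ?N / \<delta>" using low[of c] \<delta> by (simp add: field_simps)
  have "norm (comb s n v c) \<le> ?N + norm (c n) * norm (v n)"
   using norm_triangle_ineq4[of "comb s (Suc n) v c" "s (c n) (v n)"] by (simp add: comb_def norm_scale)
  also have "\<dots> \<le> ?N + ?N / \<delta> * norm (v n)" using n by (intro add_left_mono mult_right_mono) auto
  finally have "\<eta> * (\<Sum>i<n. norm (c i)) \<le> ?N * (1 + norm (v n) / \<delta>)"
   using \<eta>(2)[of c] by (simp add: algebra_simps)
  then have "(\<Sum>i<n. norm (c i)) \<le> ?N * ((1 + norm (v n) / \<delta>) / \<eta>)"
   using \<eta>(1) by (simp add: field_simps)
  then show ?thesis using n unfolding C_def by (simp add: algebra_simps)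
 qed
 then have "\<forall>c. (1 / C) * (\<Sum>i<Suc n. norm (c i)) \<le> norm (comb s (Suc n) v c)"
  using C by (simp add: field_simps)
 then show ?case using C by (intro exI[of _ "1 / C"]) simp
qed

lemma finite_dim_closed: "finite_dim s S ==> closed S"
 unfolding finite_dim_frame frame_def by (metis indep_bound closed_range_comb)

text \<open>Both the independence of nearby vectors and the continuity of coefficients come from the lower
 bound \<open>indep_bound\<close>; no determinants are needed.\<close>

lemma eventually_indep:
 assumes ind: "indep s n v0" and lim: "\<And>i. i < n ==> ((%z. v z i) \<longlongrightarrow> v0 i) G"
 shows "\<exists>\<eta>>0. \<forall>\<^sub>F z in G. \<forall>c. \<eta> * (\<Sum>i<n. norm (c i)) \<le> norm (comb s n (v z) c)"
proof -
 obtain \<eta> where \<eta>: "\<eta> > 0" "\<And>c. \<eta> * (\<Sum>i<n. norm (c i)) \<le> norm (comb s n v0 c)"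
  using indep_bound[OF ind] by blast
 have "\<forall>\<^sub>F z in G. \<forall>i\<in>{..<n}. norm (v z i - v0 i) < \<eta> / 2"
  using tendstoD[OF lim, of _ "\<eta> / 2"] \<eta>(1)
  by (intro eventually_ball_finite) (auto simp: dist_norm)
 then have "\<forall>\<^sub>F z in G. \<forall>c. (\<eta> / 2) * (\<Sum>i<n. norm (c i)) \<le> norm (comb s n (v z) c)"
 proof (eventually_elim, intro allI)
  fix z and c :: "nat => 'k" assume z: "\<forall>i\<in>{..<n}. norm (v z i - v0 i) < \<eta> / 2"
  have "comb s n v0 c - comb s n (v z) c = (\<Sum>i<n. s (c i) (v0 i - v z i))"
   by (simp add: comb_def scale_right_diff_distrib sum_subtractf)
  then have "norm (comb s n v0 c - comb s n (v z) c) \<le> (\<Sum>i<n. norm (c i) * norm (v z i - v0 i))"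
   using norm_sum[of "%i. s (c i) (v0 i - v z i)" "{..<n}"] by (simp add: norm_scale norm_minus_commute)
  also have "\<dots> \<le> (\<Sum>i<n. norm (c i) * (\<eta> / 2))"
   using z by (intro sum_mono mult_left_mono) (auto intro: less_imp_le)
  also have "\<dots> = \<eta> / 2 * (\<Sum>i<n. norm (c i))" by (simp add: sum_distrib_left mult.commute)
  finally show "\<eta> / 2 * (\<Sum>i<n. norm (c i)) \<le> norm (comb s n (v z) c)"
   using \<eta>(2)[of c] norm_triangle_ineq2[of "comb s n v0 c" "comb s n (v z) c"] by linarith
 qed
 then show ?thesis using \<eta>(1) by (intro exI[of _ "\<eta> / 2"]) simp
qed

lemma tendsto_coefficients:
 assumes ind: "indep s n v0" and lim: "\<And>i. i < n ==> ((%z. v z i) \<longlongrightarrow> v0 i) G"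
  and conv: "((%z. comb s n (v z) (c z)) \<longlongrightarrow> comb s n v0 c0) G" and i: "i < n"
 shows "((%z. c z i) \<longlongrightarrow> c0 i) G"
proof -
 obtain \<eta> where \<eta>: "\<eta> > 0" "\<forall>\<^sub>F z in G. \<forall>c. \<eta> * (\<Sum>i<n. norm (c i)) \<le> norm (comb s n (v z) c)"
  using eventually_indep[OF ind lim] by auto
 have "((%z. comb s n (v z) c0) \<longlongrightarrow> comb s n v0 c0) G" by (intro tendsto_comb lim tendsto_const)
 then have "((%z. norm (comb s n (v z) (c z) - comb s n (v z) c0) / \<eta>) \<longlongrightarrow> norm (comb s n v0 c0 - comb s n v0 c0) / \<eta>) G"
  using conv \<eta>(1) by (intro tendsto_intros) auto
 then have z: "((%z. norm (comb s n (v z) (c z) - comb s n (v z) c0) / \<eta>) \<longlongrightarrow> 0) G" by simp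
 have "((%z. c z i - c0 i) \<longlongrightarrow> 0) G"
 proof (rule Lim_null_comparison[OF _ z])
  show "\<forall>\<^sub>F z in G. norm (c z i - c0 i) \<le> norm (comb s n (v z) (c z) - comb s n (v z) c0) / \<eta>"
   using \<eta>(2)
  proof eventually_elim
   case (elim z)
   have "norm (c z i - c0 i) \<le> (\<Sum>i<n. norm (c z i - c0 i))"
    using i by (intro member_le_sum) auto
   then have "\<eta> * norm (c z i - c0 i) \<le> \<eta> * (\<Sum>i<n. norm (c z i - c0 i))" using \<eta>(1) by simp
   also have "\<dots> \<le> norm (comb s n (v z) (c z) - comb s n (v z) c0)"
    using elim[rule_format, of "%i. c z i - c0 i"] by (simp add: comb_diff)
   finally show ?case using \<eta>(1) by (simp add: field_simps)
  qed
 qed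
 then show ?thesis by (rule Lim_null[THEN iffD2])
qed

text \<open>A real norming functional \<open>g\<close> is made linear over the scalars: by the
  embedding of the reals in the first case, as \<open>g x - i g (i x)\<close> in the second.\<close>

lemma scalar_functional:
 assumes "v \<noteq> 0"
 shows "\<exists>f::'m \<Rightarrow>\<^sub>L 'k. klin s (*) f \<and> f v = 1"
proof -
 have "\<exists>f::'m \<Rightarrow>\<^sub>L 'k. klin s (*) f \<and> f v \<noteq> 0"
 proof -
  obtain g :: "'m => real" where g: "bounded_linear g" "norm v \<le> g v" using norming_functional by blast
  have gv: "g v \<noteq> 0" using g(2) assms by auto
  interpret g: bounded_linear g by fact
  show ?thesis
   using real_or_complex
  proof
   assume real: "\<forall>a::'k. \<exists>x. a = x *\<^sub>R 1"
   have bl: "bounded_linear (%x. of_real (g x) :: 'k)"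
    by (intro bounded_linear_compose[OF bounded_linear_of_real g(1)])
   have "of_real (g (s c x)) = c * (of_real (g x) :: 'k)" for c x
   proof -
    obtain r where "c = of_real r" using real by (auto simp: of_real_def)
    then show ?thesis by (simp add: scale_of_real g.scaleR)
   qed
   then show ?thesis using gv
    by (intro exI[of _ "Blinfun (%x. of_real (g x) :: 'k)"])
     (simp add: bounded_linear_Blinfun_apply[OF bl] klin_def)
  next
   assume "\<exists>i::'k. i * i = - 1 \<and> (\<forall>a. \<exists>x y. a = x *\<^sub>R 1 + y *\<^sub>R i)"
   then obtain i :: 'k where i: "i * i = - 1" "\<And>a. \<exists>x y. a = x *\<^sub>R 1 + y *\<^sub>R i" by blast
   define f :: "'m => 'k" where "f x = of_real (g x) - i * of_real (g (s i x))" for x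
   have bl: "bounded_linear f"
    unfolding f_def
    by (intro bounded_linear_sub bounded_linear_const_mult bounded_linear_compose[OF bounded_linear_of_real]
      g(1) bounded_linear_compose[OF g(1)] bounded_bilinear.bounded_linear_right[OF bounded_bilinear_scale])
   interpret f: bounded_linear f by fact
   have fi: "f (s i x) = i * f x" for x
   proof -
    have "f (s i x) = of_real (g (s i x)) + i * of_real (g x)"
     using i(1) by (simp add: f_def linear_neg[OF g.linear])
    also have "\<dots> = i * of_real (g x) - (i * i) * of_real (g (s i x))" using i(1) by simp
    finally show ?thesis by (simp add: f_def algebra_simps)
   qed
   have fk: "f (s c x) = c * f x" for c x
   proof -
    obtain a b where c: "c = of_real a + of_real b * i" using i(2)[of c] by (auto simp: scaleR_conv_of_real)
    have "s c x = a *\<^sub>R x + b *\<^sub>R s i x"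
     unfolding c by (simp add: scale_left_distrib scale_of_real flip: scale_scale)
    then show ?thesis unfolding c by (simp add: f.add f.scaleR fi scaleR_conv_of_real algebra_simps)
   qed
   \<comment> \<open>Otherwise squaring \<open>g v = i g (i v)\<close> exhibits the square of the
     nonzero real \<open>g v\<close> as the negative of a real square.\<close>
   have "f v \<noteq> 0"
   proof
    assume "f v = 0"
    then have e: "of_real (g v) = i * of_real (g (s i v))" by (simp add: f_def)
    have "of_real (g v * g v) = (i * of_real (g (s i v))) * (i * of_real (g (s i v)))"
     using e by (simp only: of_real_mult)
    also have "\<dots> = (i * i) * of_real (g (s i v) * g (s i v))" by (simp add: algebra_simps)
    also have "\<dots> = of_real (- (g (s i v) * g (s i v)))" unfolding i(1) by simp
    finally have "g v * g v = - (g (s i v) * g (s i v))" by (simp only: of_real_eq_iff)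
    then show False using gv zero_le_square[of "g (s i v)"] zero_le_square[of "g v"]
     by (metis add.right_inverse add_nonneg_eq_0_iff mult_eq_0_iff)
   qed
   then show ?thesis
    by (intro exI[of _ "Blinfun f"]) (simp add: bounded_linear_Blinfun_apply[OF bl] klin_def fk)
  qed
 qed
 then obtain f :: "'m \<Rightarrow>\<^sub>L 'k" where f: "klin s (*) f" "f v \<noteq> 0" by blast
 have bl: "bounded_linear (%x. inverse (f v) * f x)"
  by (intro bounded_linear_const_mult blinfun.bounded_linear_right)
 show ?thesis using f
  by (intro exI[of _ "Blinfun (%x. inverse (f v) * f x)"])
   (simp add: bounded_linear_Blinfun_apply[OF bl] klin_def)
qed

end

section \<open>Biorthogonal functionals, rank one operators and projections\<close>

definition dual :: "('k::real_or_complex => 'm::banach => 'm) => nat => (nat => 'm) => (nat => 'm \<Rightarrow>\<^sub>L 'k) => bool" where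
 "dual s n v a \<longleftrightarrow> (\<forall>i<n. klin s (*) (blinfun_apply (a i))) \<and>
   (\<forall>i<n. \<forall>j<n. a i (v j) = (if i = j then 1 else 0))"

definition rank_one :: "('k::real_or_complex => 'n::banach => 'n) => ('m::real_normed_vector \<Rightarrow>\<^sub>L 'k) => 'n => 'm \<Rightarrow>\<^sub>L 'n" where
 "rank_one t a v = Blinfun (%x. t (a x) v)"

context kbanach
begin

lemma rank_one_apply: "rank_one s a v x = s (a x) v"
by (metis bounded_linear_compose[OF bounded_bilinear.bounded_linear_left[OF bounded_bilinear_scale]] blinfun.bounded_linear_right rank_one_def bounded_linear_Blinfun_apply)

lemma tendsto_rank_one:
 assumes "(v \<longlongrightarrow> v0) G"
 shows "((%z. rank_one s a (v z)) \<longlongrightarrow> rank_one s a v0) G"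
proof (rule Lim_null_comparison[THEN Lim_null[THEN iffD2]])
 have le: "norm (rank_one s a (v z) - rank_one s a v0) \<le> norm a * norm (v z - v0)" for z
 proof (rule norm_blinfun_bound)
  show "norm ((rank_one s a (v z) - rank_one s a v0) x) \<le> norm a * norm (v z - v0) * norm x" for x
  using mult_right_mono norm_blinfun norm_ge_zero by (smt (verit, ccfv_threshold) blinfun.diff_left rank_one_apply norm_scale scale_right_diff_distrib mult_ac)
 qed simp
 then show "\<forall>\<^sub>F z in G. norm (rank_one s a (v z) - rank_one s a v0) \<le> norm a * norm (v z - v0)" by simp
 have "((%z. norm a * norm (v z - v0)) \<longlongrightarrow> norm a * norm (v0 - v0)) G"
  using assms by (intro tendsto_intros)
 then show "((%z. norm a * norm (v z - v0)) \<longlongrightarrow> 0) G" by simp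
qed

lemma indep_mono: assumes "indep s n v" "k \<le> n" shows "indep s k v"
 unfolding indep_def
proof (intro allI impI)
 fix c i assume c: "comb s k v c = 0" and i: "i < k"
 have "comb s n v (%i. if i < k then c i else 0) = (\<Sum>i<n. if i \<in> {..<k} then s (c i) (v i) else 0)"
  unfolding comb_def by (intro sum.cong) auto
 also have "\<dots> = (\<Sum>i\<in>{..<n} \<inter> {..<k}. s (c i) (v i))" by (rule sum.inter_restrict[symmetric]) simp
 also have "{..<n} \<inter> {..<k} = {..<k}" using assms(2) by auto
 also have "(\<Sum>i<k. s (c i) (v i)) = 0" using c by (simp add: comb_def)
 finally have "comb s n v (%i. if i < k then c i else 0) = 0" .
 from assms(1)[unfolded indep_def, rule_format, OF this, of i] i assms(2) show "c i = 0" by simp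
qed

text \<open>A functional normalised on the part \<open>u\<close> of \<open>v n\<close> that the
  previous functionals do not see is corrected to \<open>b\<close>, which kills the earlier vectors.
  The earlier functionals are then corrected by multiples of \<open>b\<close> so as to kill
  \<open>v n\<close>.\<close>

lemma exists_dual: "indep s n v ==> \<exists>a. dual s n v a"
proof (induction n)
 case 0
 then show ?case by (simp add: dual_def)
next
 case (Suc n)
 have ind: "indep s n v" using Suc.prems indep_mono[of "Suc n" v n] by simp
 obtain a where "dual s n v a" using Suc.IH[OF ind] ..
 then have a: "\<And>i c x. i < n ==> a i (s c x) = c * a i x"
  "\<And>i j. i < n ==> j < n ==> a i (v j) = (if i = j then 1 else 0)"
  by (simp_all add: dual_def klin_def)
 define u where "u = v n - comb s n v (%i. a i (v n))"
 have "u \<noteq> 0"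
 proof
  assume "u = 0"
  have "comb s (Suc n) v (%i. if i < n then - a i (v n) else 1)
    = comb s n v (%i. if i < n then - a i (v n) else 1) + v n"
   by (simp add: comb_def)
  also have "comb s n v (%i. if i < n then - a i (v n) else 1)
    = comb s n v (%i. (-1) * (if i < n then a i (v n) else 1))"
   by (intro comb_cong) auto
  also have "\<dots> = - comb s n v (%i. if i < n then a i (v n) else 1)"
   by (simp only: comb_scale) simp
  also have "comb s n v (%i. if i < n then a i (v n) else 1) = comb s n v (%i. a i (v n))"
   by (intro comb_cong) auto
  finally have "comb s (Suc n) v (%i. if i < n then - a i (v n) else 1) = 0" using \<open>u = 0\<close> by (simp add: u_def)
  from Suc.prems[unfolded indep_def, rule_format, OF this, of n] show False by simp
 qed
 then obtain f :: "'m \<Rightarrow>\<^sub>L 'k" where "klin s (*) f \<and> f u = 1"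
  using scalar_functional by blast
 then have f: "\<And>c x. f (s c x) = c * f x" "f u = 1" by (simp_all add: klin_def)
 have bl: "bounded_linear (%x. f (v i) * a i x)" for i
  by (intro bounded_linear_const_mult blinfun.bounded_linear_right)
 define b where "b = f - (\<Sum>i<n. Blinfun (%x. f (v i) * a i x))"
 have b: "b x = f x - (\<Sum>i<n. f (v i) * a i x)" for x
  by (simp add: b_def blinfun.diff_left blinfun.sum_left bounded_linear_Blinfun_apply[OF bl])
 have bk: "b (s c x) = c * b x" for c x
  by (simp add: b f a(1) sum_distrib_left right_diff_distrib mult_ac)
 have bv: "b (v j) = 0" if "j < n" for j
 proof -
  have "(\<Sum>i<n. f (v i) * a i (v j)) = (\<Sum>i<n. if i = j then f (v j) else 0)"
   using a(2) that by (intro sum.cong) auto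
  then show ?thesis using that by (simp add: b)
 qed
 have bn: "b (v n) = 1"
 using f(2) by (simp add: u_def comb_def blinfun.diff_right blinfun.sum_right f(1) b mult.commute)
 have bl2: "bounded_linear (%x. a i (v n) * b x)" for i
  by (intro bounded_linear_const_mult blinfun.bounded_linear_right)
 define a' where "a' i = (if i < n then a i - Blinfun (%x. a i (v n) * b x) else b)" for i
 have a': "a' i x = (if i < n then a i x - a i (v n) * b x else b x)" for i x
  by (simp add: a'_def blinfun.diff_left bounded_linear_Blinfun_apply[OF bl2])
 have "dual s (Suc n) v a'"
  unfolding dual_def klin_def
 by (simp add: a' a(1) bk algebra_simps less_Suc_eq bv bn a(2))
 then show ?case by blast
qed

definition dual_projection :: "nat => (nat => 'm) => (nat => 'm \<Rightarrow>\<^sub>L 'k) => 'm \<Rightarrow>\<^sub>L 'm" where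
 "dual_projection n v a = (\<Sum>i<n. rank_one s (a i) (v i))"

lemma dual_projection_apply: "dual_projection n v a x = comb s n v (%i. a i x)"
 by (simp add: dual_projection_def blinfun.sum_left rank_one_apply comb_def)

lemma dual_comb:
 assumes "dual s n v a" "i < n"
 shows "a i (comb s n v c) = c i"
proof -
 have "a i (comb s n v c) = (\<Sum>j<n. c j * a i (v j))"
  using assms by (simp add: comb_def blinfun.sum_right dual_def klin_def)
 also have "\<dots> = (\<Sum>j<n. if j = i then c i else 0)"
  using assms unfolding dual_def by (intro sum.cong) auto
 also have "\<dots> = c i" using assms(2) by simp
 finally show ?thesis .
qed

lemma finite_dim_projection:
 assumes "finite_dim s S"
 obtains p :: "'m \<Rightarrow>\<^sub>L 'm" where "klin s s p" "\<And>x. p x \<in> S" "\<And>x. x \<in> S ==> p x = x"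
proof -
 obtain n v where v: "indep s n v" "range (comb s n v) = S"
  using assms unfolding finite_dim_frame frame_def by blast
 obtain a where a: "dual s n v a" using exists_dual[OF v(1)] by blast
 let ?p = "dual_projection n v a"
 have "klin s s ?p"
  unfolding klin_def
 proof (intro allI)
  fix c x
  have "comb s n v (%i. a i (s c x)) = comb s n v (%i. c * a i x)"
   using a by (intro comb_cong) (auto simp: dual_def klin_def)
  then show "?p (s c x) = s c (?p x)" by (simp add: dual_projection_apply comb_scale)
 qed
 moreover have "?p x \<in> S" for x using v(2) by (auto simp: dual_projection_apply)
 moreover have "?p x = x" if x: "x \<in> S" for x
 using v(2) x by (auto intro: comb_cong dual_comb[OF a] simp: dual_projection_apply)
 ultimately show thesis using that by blast
qed

lemma compact_comb_ball: "compact {comb s n v c |c. \<forall>i<n. norm (c i) \<le> r}"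
proof (induction n)
 case 0
 then show ?case by (simp add: comb_def)
next
 case (Suc n)
 have "compact ((%c. s c (v n)) ` {c. norm c \<le> r})"
  by (intro compact_continuous_image compact_scalar_ball
    bounded_linear.continuous_on[OF bounded_bilinear.bounded_linear_left[OF bounded_bilinear_scale]] continuous_on_id)
 from compact_sums[OF Suc this]
 have "compact {x + y |x y. x \<in> {comb s n v c |c. \<forall>i<n. norm (c i) \<le> r} \<and> y \<in> (%c. s c (v n)) ` {c. norm c \<le> r}}" .
 also have "{x + y |x y. x \<in> {comb s n v c |c. \<forall>i<n. norm (c i) \<le> r} \<and> y \<in> (%c. s c (v n)) ` {c. norm c \<le> r}}
   = {comb s (Suc n) v c |c. \<forall>i<Suc n. norm (c i) \<le> r}" (is "?A = ?B")
 proof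
  show "?A \<subseteq> ?B"
  proof
   fix z assume "z \<in> ?A"
   then obtain c k where ck: "z = comb s n v c + s k (v n)" "\<forall>i<n. norm (c i) \<le> r" "norm k \<le> r" by blast
   have "comb s (Suc n) v (%i. if i < n then c i else k) = comb s n v (%i. if i < n then c i else k) + s k (v n)"
    by (simp add: comb_def)
   also have "comb s n v (%i. if i < n then c i else k) = comb s n v c" by (intro comb_cong) auto
   finally have "z = comb s (Suc n) v (%i. if i < n then c i else k)" using ck(1) by simp
   then show "z \<in> ?B" using ck by (intro CollectI exI[of _ "%i. if i < n then c i else k"]) auto
  qed
  show "?B \<subseteq> ?A"
  by (force simp: comb_def)
 qed
 finally show ?case .
qed

text \<open>By \<open>indep_bound\<close> a bounded set in \<open>S\<close> has bounded coefficients
  with respect to a frame, hence lies in a compact set of combinations.\<close>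

lemma finite_rank_compact:
 fixes T :: "'z::real_normed_vector => 'm"
 assumes T: "bounded_linear T" and S: "finite_dim s S" "range T \<subseteq> S"
 shows "compact_operator T"
 unfolding compact_operator_def
proof (intro conjI allI impI T)
 fix B :: "'z set" assume "bounded B"
 then obtain r where r: "\<forall>y\<in>T ` B. norm y \<le> r"
  using bounded_linear_image[OF _ T] bounded_iff by blast
 obtain n v where v: "indep s n v" "range (comb s n v) = S"
  using S(1) unfolding finite_dim_frame frame_def by blast
 obtain \<eta> where \<eta>: "\<eta> > 0" "\<And>c. \<eta> * (\<Sum>i<n. norm (c i)) \<le> norm (comb s n v c)"
  using indep_bound[OF v(1)] by blast
 have "T ` B \<subseteq> {comb s n v c |c. \<forall>i<n. norm (c i) \<le> r / \<eta>}"
 proof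
  fix y assume y: "y \<in> T ` B"
  then have "y \<in> S" using S(2) by blast
  then obtain c where c: "y = comb s n v c" using v(2) by blast
  have "norm (c i) \<le> r / \<eta>" if "i < n" for i
  proof -
   have "norm (c i) \<le> (\<Sum>i<n. norm (c i))" using that by (intro member_le_sum) auto
   then have "\<eta> * norm (c i) \<le> \<eta> * (\<Sum>i<n. norm (c i))" using \<eta>(1) by simp
   also have "\<dots> \<le> r" using \<eta>(2)[of c] r y c by force
   finally show ?thesis using \<eta>(1) by (simp add: field_simps)
  qed
  then show "y \<in> {comb s n v c |c. \<forall>i<n. norm (c i) \<le> r / \<eta>}" using c by blast
 qed
 then have "closure (T ` B) \<subseteq> {comb s n v c |c. \<forall>i<n. norm (c i) \<le> r / \<eta>}"
  by (intro closure_minimal compact_imp_closed compact_comb_ball)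
 then have "{comb s n v c |c. \<forall>i<n. norm (c i) \<le> r / \<eta>} \<inter> closure (T ` B) = closure (T ` B)"
  by (rule inf.absorb2)
 then show "compact (closure (T ` B))"
  using compact_Int_closed[OF compact_comb_ball closed_closure, of n v "r / \<eta>" "T ` B"] by simp
qed

section \<open>Compact perturbations of the identity\<close>

lemma compact_net:
 assumes "compact (closure A)" "e > 0"
 shows "\<exists>D. finite D \<and> D \<subseteq> A \<and> (\<forall>a\<in>A. \<exists>b\<in>D. norm (a - b) < e)"
proof -
 have cov: "closure A \<subseteq> (\<Union>b\<in>A. ball b e)"
  using assms(2) unfolding closure_approachable by (auto simp: closure_approachable)
 obtain D where "D \<subseteq> A" "finite D" "closure A \<subseteq> (\<Union>b\<in>D. ball b e)"
  by (rule compactE_image[OF assms(1) _ cov]) auto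
 then have "\<forall>a\<in>A. \<exists>b\<in>D. norm (a - b) < e"
  using closure_subset[of A] by (fastforce simp: dist_norm norm_minus_commute)
 then show ?thesis using \<open>D \<subseteq> A\<close> \<open>finite D\<close> by blast
qed

text \<open>If the net did not span \<open>N\<close>, Riesz's lemma would give a unit vector of
  \<open>N\<close> at distance at least 1/2 from the span of the net.\<close>

lemma finite_dim_if_net:
 assumes N: "subspace N" and D: "finite D" "D \<subseteq> N"
  and net: "\<And>u. u \<in> N ==> norm u = 1 ==> \<exists>d\<in>D. norm (u - d) < 1 / 2"
 shows "finite_dim s N"
proof -
 have fd: "finite_dim s (span D)" by (rule finite_dim_span[OF D(1)])
 have sub: "span D \<subseteq> N" by (rule span_minimal[OF D(2) N])
 have "u \<in> span D" if u: "u \<in> N" for u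
 using riesz_unit_vector[OF finite_dim_closed[OF fd] subspace_real[OF subspace_span] subspace_real[OF N] sub u] net span_base by (smt (verit, ccfv_threshold))
 then have "N = span D" using sub by blast
 then show ?thesis using fd by simp
qed

text \<open>On the kernel \<open>T\<close> is minus the identity, so the unit sphere of the kernel
  lies in the image of a bounded set under \<open>T\<close>. The net is taken in the image of the
  unit ball of the kernel, so that its points belong to the kernel.\<close>

lemma compact_perturbation_kernel:
 assumes T: "compact_operator T" and k: "klin s s T"
 shows "finite_dim s {u. u + T u = 0}"
proof -
 interpret T: bounded_linear T using T compact_operator_def by blast
 let ?N = "{u. u + T u = 0}"
 have N: "subspace ?N"
 proof (rule subspaceI)
  fix x y assume "x \<in> ?N" "y \<in> ?N"
  then show "x + y \<in> ?N" by (simp add: T.add algebra_simps)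
 next
  fix c x assume "x \<in> ?N"
  then have "s c (x + T x) = 0" by simp
  then show "s c x \<in> ?N" using k by (simp add: klin_def scale_right_distrib)
 qed (simp add: T.zero)
 have "compact (closure (T ` {u\<in>?N. norm u \<le> 1}))"
 proof -
  have "bounded {u\<in>?N. norm u \<le> 1}" by (rule boundedI[of _ 1]) simp
  then show ?thesis using T unfolding compact_operator_def by blast
 qed
 then obtain D where D: "finite D" "D \<subseteq> T ` {u\<in>?N. norm u \<le> 1}"
  "\<forall>a\<in>T ` {u\<in>?N. norm u \<le> 1}. \<exists>b\<in>D. norm (a - b) < 1 / 2"
  using compact_net[of "T ` {u\<in>?N. norm u \<le> 1}" "1 / 2"] by auto
 have Tm: "T u = - u" if "u \<in> ?N" for u using that by (simp add: add_eq_0_iff)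
 have "D \<subseteq> ?N"
 proof
  fix d assume "d \<in> D"
  then obtain u where u: "u \<in> ?N" "d = T u" using D(2) by blast
  have "d = s (-1) u" unfolding u(2) Tm[OF u(1)] by simp
  then show "d \<in> ?N" by (simp only:) (rule subspace_scale[OF N u(1)])
 qed
 show ?thesis
 proof (rule finite_dim_if_net[OF N D(1) \<open>D \<subseteq> ?N\<close>])
  fix u assume u: "u \<in> ?N" "norm u = 1"
  have mu: "- u \<in> ?N" using subspace_scale[OF N u(1), of "-1"] by (simp only: scale_minus_left scale_one)
  then have "u \<in> T ` {u\<in>?N. norm u \<le> 1}" using Tm[OF mu] u by (intro image_eqI[of _ _ "- u"]) auto
  then show "\<exists>d\<in>D. norm (u - d) < 1 / 2" using D(3) by blast
 qed
qed

text \<open>A finite net of the image of the unit ball spans a \<open>D\<close> that approximates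
  \<open>T u\<close> up to \<open>norm u / 2\<close>. With \<open>d\<close> in \<open>D\<close>
  close to \<open>T y\<close>, the pair \<open>(y, - d)\<close> is an approximate preimage of
  \<open>y\<close> under \<open>(u, d) |-> u + T u + d\<close>, and the series argument makes it
  exact.\<close>

lemma compact_perturbation_cokernel:
 assumes T: "compact_operator T"
 shows "\<exists>D. finite_dim s D \<and> (\<forall>y. \<exists>u. \<exists>d\<in>D. y = u + T u + d)"
proof -
 interpret T: bounded_linear T using T compact_operator_def by blast
 have "compact (closure (T ` cball 0 1))"
  using T bounded_cball unfolding compact_operator_def by blast
 then obtain B where B: "finite B" "\<forall>a\<in>T ` cball 0 1. \<exists>b\<in>B. norm (a - b) < 1 / 2"
  using compact_net[of "T ` cball 0 1" "1 / 2"] by auto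
 define D where "D = span B"
 have D: "finite_dim s D" unfolding D_def by (rule finite_dim_span[OF B(1)])
 have near: "\<exists>d\<in>D. norm (T u - d) \<le> norm u / 2" for u
 proof (cases "u = 0")
  case True
  then show ?thesis unfolding D_def by (intro bexI[of _ 0]) (auto simp: T.zero span_zero)
 next
  case False
  have "T (u /\<^sub>R norm u) \<in> T ` cball 0 1" using False by (intro imageI) simp
  then obtain b where b: "b \<in> B" "norm (T (u /\<^sub>R norm u) - b) < 1 / 2" using B(2) by blast
  have "T u - norm u *\<^sub>R b = norm u *\<^sub>R (T (u /\<^sub>R norm u) - b)"
   using False by (simp add: T.scaleR algebra_simps)
  then have "norm (T u - norm u *\<^sub>R b) = norm u * norm (T (u /\<^sub>R norm u) - b)" by simp
  also have "\<dots> \<le> norm u * (1 / 2)" using b(2) by (intro mult_left_mono) auto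
  finally have "norm (T u - norm u *\<^sub>R b) \<le> norm u / 2" by simp
  moreover have "norm u *\<^sub>R b \<in> D"
   unfolding D_def using b(1) by (simp add: span_base span_scale flip: scale_of_real)
  ultimately show ?thesis by blast
 qed
 obtain c where c: "\<And>u. norm (T u) \<le> norm u * c" "c > 0" using T.pos_bounded by auto
 let ?f = "%(u, d). u + T u + d"
 let ?S = "UNIV \<times> D"
 have bl: "bounded_linear ?f"
  unfolding case_prod_beta
  by (intro bounded_linear_add bounded_linear_fst bounded_linear_snd bounded_linear_compose[OF T.bounded_linear])
 have cl: "closed ?S" by (intro closed_Times closed_UNIV finite_dim_closed[OF D])
 have sub: "Real_Vector_Spaces.subspace ?S"
  using subspace_real[OF finite_dim_subspace[OF D]] by (simp add: Real_Vector_Spaces.subspace_def zero_prod_def)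
 have "\<exists>x\<in>?S. norm x \<le> (2 + c + 1 / 2) * norm y \<and> norm (y - ?f x) \<le> norm y / 2" for y
 proof -
  obtain d where d: "d \<in> D" "norm (T y - d) \<le> norm y / 2" using near by blast
  have "- d \<in> D" using d(1) subspace_neg[OF finite_dim_subspace[OF D]] by blast
  have "norm d \<le> (c + 1 / 2) * norm y"
   using norm_triangle_sub[of d "T y"] c(1)[of y] d(2) by (simp add: norm_minus_commute algebra_simps)
  moreover have "norm (y, - d) \<le> norm y + norm d" using norm_Pair_le[of y "- d"] by simp
  ultimately have "norm (y, - d) \<le> (2 + c + 1 / 2) * norm y"
   using norm_ge_zero[of y] by (simp only: algebra_simps)
  moreover have "norm (y - ?f (y, - d)) \<le> norm y / 2" using d(2) by (simp add: norm_minus_commute)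
  ultimately show ?thesis using \<open>- d \<in> D\<close> by (intro bexI[of _ "(y, - d)"]) auto
 qed
 then have "\<forall>y. \<exists>x\<in>?S. ?f x = y"
  using approximate_preimage_series[OF bl cl sub, of "2 + c + 1 / 2"] c(2) by force
 then have "\<exists>u. \<exists>d\<in>D. y = u + T u + d" for y
  by (metis (no_types, lifting) SigmaE case_prod_conv)
 then show ?thesis using D by blast
qed

end

text \<open>The range of \<open>T\<close> is the kernel of \<open>p\<close>. Let \<open>q\<close>
  project onto the kernel of \<open>T\<close>. Exactly one lift of \<open>y - p y\<close> is killed
  by \<open>q\<close>: uniqueness makes it linear in \<open>y\<close>, and the open mapping theorem,
  applied to \<open>(u, w) |-> T u + w\<close> on the kernel of \<open>q\<close> times the range of
  \<open>p\<close>, makes it bounded.\<close>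

lemma right_inverse_mod_projection:
 fixes T :: "'m::banach \<Rightarrow>\<^sub>L 'n::banach" and s :: "'k::real_or_complex => 'm => 'm"
 assumes "banach_scale s" "banach_scale t" and T: "klin s t T" and ker: "finite_dim s {u. T u = 0}"
  and p: "klin t t (blinfun_apply p)" "\<And>y. p (p y) = p y" "\<And>u. p (T u) = 0"
  and onto: "\<And>y. \<exists>u. T u = y - p y"
 obtains R :: "'n \<Rightarrow>\<^sub>L 'm" where "klin t s R" "\<And>y. T (R y) = y - p y"
proof -
 interpret s: kbanach s by unfold_locales fact
 interpret t: kbanach t by unfold_locales fact
 obtain q :: "'m \<Rightarrow>\<^sub>L 'm" where q: "klin s s q" "\<And>x. q x \<in> {u. T u = 0}" "\<And>x. x \<in> {u. T u = 0} ==> q x = x"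
  by (rule s.finite_dim_projection[OF ker]) (rule that)
 have uniq: "u = v" if "q u = 0" "q v = 0" "T u = T v" for u v
  using q(3)[of "u - v"] that by (simp add: blinfun.diff_right)
 let ?S = "{x. q (fst x) = 0 \<and> p (snd x) = snd x}" and ?f = "%x. T (fst x) + snd x"
 have bl: "bounded_linear ?f"
  by (intro bounded_linear_add bounded_linear_snd bounded_linear_compose[OF blinfun.bounded_linear_right bounded_linear_fst])
 have cl: "closed ?S"
  by (intro closed_Collect_conj closed_Collect_eq continuous_intros)
 have sub: "Real_Vector_Spaces.subspace ?S"
  by (auto simp: Real_Vector_Spaces.subspace_def blinfun.add_right blinfun.scaleR_right)
 have dec: "\<exists>u. q u = 0 \<and> T u = y - p y" for y
 proof -
  obtain u where u: "T u = y - p y" using onto by blast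
  have "q (u - q u) = 0" "T (u - q u) = T u"
   using q(2)[of u] q(3)[of "q u"] by (simp_all add: blinfun.diff_right)
  then show ?thesis using u by metis
 qed
 have "?f ` ?S = UNIV"
 proof -
  have "y \<in> ?f ` ?S" for y
  proof -
   obtain u where "q u = 0" "T u = y - p y" using dec by blast
   then show ?thesis using p(2) by (intro image_eqI[of _ _ "(u, p y)"]) auto
  qed
  then show ?thesis by blast
 qed
 then obtain c where c: "\<And>y. \<exists>x\<in>?S. ?f x = y \<and> norm x \<le> c * norm y"
  using open_mapping[OF bl cl sub] by blast
 obtain g where g: "\<And>y. q (g y) = 0" "\<And>y. T (g y) = y - p y" by (metis dec)
 have "bounded_linear g"
 proof (rule bounded_linear_intro)
  show "g (x + y) = g x + g y" for x y
   by (rule uniq) (simp_all add: g blinfun.add_right)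
  show "g (r *\<^sub>R x) = r *\<^sub>R g x" for r x
   by (rule uniq) (simp_all add: g blinfun.scaleR_right scaleR_right_diff_distrib)
  show "norm (g y) \<le> norm y * c" for y
  proof -
   obtain x where x: "q (fst x) = 0" "p (snd x) = snd x" "T (fst x) + snd x = y" "norm x \<le> c * norm y"
    using c[of y] by auto
   have "T (fst x) = y - p y" by (metis x(2,3) p(3)[of "fst x"] add_0 blinfun.add_right add_diff_cancel_right')
   then have "g y = fst x" using uniq g x(1) by simp
   then show ?thesis using norm_fst_le[of "fst x" "snd x"] x(4) by (simp add: mult.commute)
  qed
 qed
 then have eq: "blinfun_apply (Blinfun g) = g" by (rule bounded_linear_Blinfun_apply)
 show thesis
 proof (rule that[of "Blinfun g"])
  show "klin t s (Blinfun g)"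
   unfolding eq klin_def
  proof (intro allI)
   show "g (t c x) = s c (g x)" for c x
    by (rule uniq) (use T p(1) q(1) in \<open>simp_all add: g klin_def t.scale_right_diff_distrib\<close>)
  qed
 qed (simp add: eq g)
qed

text \<open>The vectors \<open>b\<close> may be dependent, so a basis \<open>v\<close> of their span
  is used to project the span away, and \<open>right_inverse_mod_projection\<close> inverts the
  rest. The conclusion is an identity in \<open>T\<close> and \<open>b\<close> because an identity
  of this kind can be perturbed.\<close>

lemma right_inverse_transversal:
 fixes T :: "'m::banach \<Rightarrow>\<^sub>L 'n::banach" and s :: "'k::real_or_complex => 'm => 'm"
 assumes "banach_scale s" "banach_scale t" and T: "klin s t T" and ker: "finite_dim s {u. T u = 0}"
  and onto: "\<And>y. \<exists>u c. y = T u + comb t N b c"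
 obtains R :: "'n \<Rightarrow>\<^sub>L 'm" and a :: "nat => 'n \<Rightarrow>\<^sub>L 'k" where
  "\<And>y. T (R y) + comb t N b (%i. a i y) = y"
proof -
 interpret s: kbanach s by unfold_locales fact
 interpret t: kbanach t by unfold_locales fact
 let ?C = "range (comb t N b)"
 have C: "finite_dim t ?C" by (rule t.finite_dim_comb)
 then obtain n v where "frame t n v ?C"
  unfolding t.finite_dim_frame by blast
 then have v: "indep t n v" "range (comb t n v) = ?C" by (simp_all add: frame_def)
 obtain a where a: "dual t n v a" using t.exists_dual[OF v(1)] ..
 let ?p = "t.dual_projection n v a"
 have pC: "?p y \<in> ?C" for y using v(2) t.dual_projection_apply by auto
 have pid: "?p y = y" if y: "y \<in> ?C" for y
 proof -
  have "y \<in> range (comb t n v)" using y by (simp only: v(2))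
  then obtain c where c: "y = comb t n v c" by (rule rangeE)
  have "comb t n v (%i. a i y) = comb t n v c"
   unfolding c by (intro comb_cong t.dual_comb[OF a]) auto
  then show ?thesis by (simp add: t.dual_projection_apply c)
 qed
 have pk: "?p (t c x) = t c (?p x)" for c x
 proof -
  have "comb t n v (%i. a i (t c x)) = comb t n v (%i. c * a i x)"
   using a by (intro comb_cong) (auto simp: dual_def klin_def)
  then show ?thesis by (simp add: t.dual_projection_apply t.comb_scale)
 qed
 define T' where "T' = T - (?p o\<^sub>L T)"
 have T': "T' u = T u - ?p (T u)" for u by (simp add: T'_def blinfun.diff_left)
 have kerT': "finite_dim s {u. T' u = 0}"
 proof -
  have "finite_dim s {u \<in> UNIV. T u \<in> ?C}"
   by (rule finite_dim_preimage[OF s.vector_space_axioms t.vector_space_axioms s.subspace_UNIV C])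
    (use T ker in \<open>auto simp: blinfun.add_right klin_def\<close>)
  moreover have "{u. T' u = 0} = {u \<in> UNIV. T u \<in> ?C}"
  proof -
   have "T' u = 0 \<longleftrightarrow> T u \<in> ?C" for u
    by (metis pC[of "T u"] pid[of "T u"] T' eq_iff_diff_eq_0)
   then show ?thesis by blast
  qed
  ultimately show ?thesis by simp
 qed
 obtain R :: "'n \<Rightarrow>\<^sub>L 'm" where R: "klin t s R" "\<And>y. T' (R y) = y - ?p y"
 proof (rule right_inverse_mod_projection[OF assms(1,2) _ kerT', of ?p])
  show "klin s t T'" using T pk by (simp add: klin_def T' t.scale_right_diff_distrib)
  show "klin t t ?p" using pk by (simp add: klin_def)
  show pp: "?p (?p y) = ?p y" for y by (rule pid[OF pC])
  show "?p (T' u) = 0" for u by (simp add: T' blinfun.diff_right pp)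
  show "\<exists>u. T' u = y - ?p y" for y
  using onto[of y] pid[OF rangeI] by (auto simp: T' blinfun.add_right)
 qed (rule that)
 have "\<forall>j<n. \<exists>l. v j = comb t N b l"
 proof (intro allI impI)
  fix j assume "j < n"
  then have "v j = comb t n v (%i. if i = j then 1 else 0)" by (simp only: t.comb_delta)
  then have "v j \<in> range (comb t n v)" by simp
  then have "v j \<in> ?C" by (simp only: v(2))
  then show "\<exists>l. v j = comb t N b l" by (rule rangeE) (rule exI)
 qed
 \<comment> \<open>The basis is expressed in the given vectors, which converts coefficients along
   \<open>v\<close> into coefficients along \<open>b\<close>.\<close>
 then obtain l where l: "\<And>j. j < n ==> v j = comb t N b (l j)" by metis
 have bl: "bounded_linear (%y. \<Sum>j<n. a j (y - T (R y)) * l j i)" for i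
  by (intro bounded_linear_sum bounded_linear_mult_const
    bounded_linear_compose[OF blinfun.bounded_linear_right] bounded_linear_sub bounded_linear_ident
    blinfun.bounded_linear_right)
 show thesis
 proof (rule that[of R "%i. Blinfun (%y. \<Sum>j<n. a j (y - T (R y)) * l j i)"])
  fix y
  have "?p (y - T (R y)) = comb t n v (%j. a j (y - T (R y)))" by (rule t.dual_projection_apply)
  also have "\<dots> = (\<Sum>j<n. t (a j (y - T (R y))) (comb t N b (l j)))"
   unfolding comb_def[of t n] using l by (intro sum.cong) auto
  also have "\<dots> = (\<Sum>j<n. \<Sum>i<N. t (a j (y - T (R y)) * l j i) (b i))"
   by (simp add: comb_def t.scale_sum_right)
  also have "\<dots> = comb t N b (%i. \<Sum>j<n. a j (y - T (R y)) * l j i)"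
   unfolding comb_def by (subst sum.swap) (simp add: t.scale_sum_left)
  finally have "comb t N b (%i. \<Sum>j<n. a j (y - T (R y)) * l j i) = ?p (y - T (R y))" by simp
  moreover have "T (R y) + ?p (y - T (R y)) = y"
   using R(2)[of y] by (simp add: T' blinfun.diff_right algebra_simps)
  ultimately show "T (R y) + comb t N b (%i. Blinfun (%y. \<Sum>j<n. a j (y - T (R y)) * l j i) y) = y"
   by (simp add: bounded_linear_Blinfun_apply[OF bl])
 qed
qed

section \<open>Compact Hausdorff spaces\<close>

text \<open>These neighbourhoods contain the point itself, so what holds near a point of the space
  holds at it. The germ definitions below quantify over this filter instead of naming open
  sets.\<close>

abbreviation near :: "'x topology => 'x => ('x => bool) => bool" where
 "near X x P \<equiv> eventually P (nhdsin X x)"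

lemma eventually_nhdsin_self: "x \<in> topspace X ==> eventually P (nhdsin X x) ==> P x"
 by (auto simp: eventually_nhdsin)

lemma eventually_in_openin: "openin X U ==> x \<in> U ==> near X x (%y. y \<in> U)"
 unfolding eventually_nhdsin by blast

lemma eventually_openin: "x \<in> topspace X ==> eventually P (nhdsin X x) ==> \<exists>U. openin X U \<and> x \<in> U \<and> (\<forall>y\<in>U. P y)"
 by (auto simp: eventually_nhdsin)

lemma eventually_eventually_nhdsin:
 "eventually P (nhdsin X x) ==> near X x (%y. eventually P (nhdsin X y))"
 unfolding eventually_nhdsin by blast

lemma openin_topspace_mem: "openin X U ==> x \<in> U ==> x \<in> topspace X"
 using openin_subset by blast

text \<open>Reduces continuity on an open set to convergence at each of its points, the form in
  which later continuity claims are checked.\<close>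

lemma continuous_map_nhdsin:
 assumes U: "openin X U"
 shows "continuous_map (subtopology X U) euclidean f \<longleftrightarrow> (\<forall>x\<in>U. (f \<longlongrightarrow> f x) (nhdsin X x))"
proof
 assume cont: "continuous_map (subtopology X U) euclidean f"
 show "\<forall>x\<in>U. (f \<longlongrightarrow> f x) (nhdsin X x)"
 proof (intro ballI topological_tendstoI)
  fix x S assume x: "x \<in> U" "open S" "f x \<in> S"
  have "openin (subtopology X U) {y \<in> topspace (subtopology X U). f y \<in> S}"
   using cont x(2) by (intro openin_continuous_map_preimage) auto
  then have "openin X {y \<in> topspace (subtopology X U). f y \<in> S}" using U by (meson openin_trans_full)
  moreover have "x \<in> {y \<in> topspace (subtopology X U). f y \<in> S}"
   using x openin_topspace_mem[OF U] by simp
  ultimately show "near X x (%y. f y \<in> S)"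
   unfolding eventually_nhdsin by blast
 qed
next
 assume lim: "\<forall>x\<in>U. (f \<longlongrightarrow> f x) (nhdsin X x)"
 show "continuous_map (subtopology X U) euclidean f"
  unfolding continuous_map_def
 proof (intro conjI allI impI)
  fix S :: "'b set" assume "openin euclidean S"
  then have S: "open S" by simp
  show "openin (subtopology X U) {x \<in> topspace (subtopology X U). f x \<in> S}"
  proof (subst openin_subopen, intro ballI)
   fix x assume "x \<in> {x \<in> topspace (subtopology X U). f x \<in> S}"
   then have x: "x \<in> topspace X" "x \<in> U" "f x \<in> S" by auto
   have "near X x (%y. f y \<in> S)" using lim x S by (blast intro: topological_tendstoD)
   then obtain T where T: "openin X T" "x \<in> T" "\<forall>y\<in>T. f y \<in> S" using eventually_openin[OF x(1)] by metis
   show "\<exists>T. openin (subtopology X U) T \<and> x \<in> T \<and> T \<subseteq> {x \<in> topspace (subtopology X U). f x \<in> S}"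
    using T x openin_subset[OF T(1)] by (auto simp: openin_subtopology)
  qed
 qed simp
qed

lemma bump_function:
 assumes X: "compact_space X" "Hausdorff_space X" and U: "openin X U" "x \<in> U"
 obtains rho :: "'x => real" where "\<And>y. y \<in> topspace X ==> (rho \<longlongrightarrow> rho y) (nhdsin X y)"
  "\<And>y. 0 \<le> rho y" "\<And>y. rho y \<le> 1" "near X x (%y. rho y = 1)"
  "\<And>y. y \<in> topspace X ==> y \<notin> U ==> near X y (%z. rho z = 0)"
proof -
 have xt: "x \<in> topspace X" by (rule openin_topspace_mem[OF U])
 have "normal_space X" by (rule compact_Hausdorff_or_regular_imp_normal_space[OF X(1)]) (simp add: X)
 moreover have "closedin X (topspace X - U)" by (rule closedin_diff[OF closedin_topspace U(1)])
 moreover have "closedin X {x}" using X(2) xt by (simp add: closedin_Hausdorff_singleton)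
 moreover have "disjnt (topspace X - U) {x}" using U(2) by (simp add: disjnt_def)
 ultimately obtain f :: "'x => real" where f: "continuous_map X euclideanreal f" "f ` (topspace X - U) \<subseteq> {0}" "f ` {x} \<subseteq> {1}"
  by (rule Urysohn_lemma_alt[where a = 0 and b = 1])
 have lim: "(f \<longlongrightarrow> f y) (nhdsin X y)" if "y \<in> topspace X" for y
  using f(1) continuous_map_nhdsin[OF openin_topspace, of X f] that by simp
 \<comment> \<open>Urysohn's function is steepened: the result is 1 where
   \<open>f \<ge> 2 / 3\<close> and 0 where \<open>f \<le> 1 / 3\<close>. This upgrades values at
   points to values in neighbourhoods.\<close>
 define rho where "rho y = min 1 (max 0 (3 * f y - 1))" for y
 show thesis
 proof (rule that[of rho])
  show "(rho \<longlongrightarrow> rho y) (nhdsin X y)" if "y \<in> topspace X" for y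
   unfolding rho_def by (intro tendsto_intros tendsto_min tendsto_max lim that)
  show "0 \<le> rho y" "rho y \<le> 1" for y by (auto simp: rho_def)
  have "near X x (%y. f y > 2 / 3)" using f(3) by (intro order_tendstoD(1)[OF lim[OF xt]]) simp
  then show "near X x (%y. rho y = 1)" by eventually_elim (simp add: rho_def)
  show "near X y (%z. rho z = 0)" if "y \<in> topspace X" "y \<notin> U" for y
  proof -
   have "near X y (%z. f z < 1 / 3)" using f(2) that by (intro order_tendstoD(2)[OF lim]) auto
   then show ?thesis by eventually_elim (simp add: rho_def)
  qed
 qed
qed

lemma compact_nhds_cover:
 assumes X: "compact_space X" and P: "\<And>x. x \<in> topspace X ==> eventually (P x) (nhdsin X x)"
 obtains I where "finite I" "I \<subseteq> topspace X" "\<And>y. y \<in> topspace X ==> \<exists>x\<in>I. P x y"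
proof -
 have "\<forall>x\<in>topspace X. \<exists>U. openin X U \<and> x \<in> U \<and> (\<forall>y\<in>U. P x y)"
  by (intro ballI eventually_openin P)
 then obtain U where U: "\<And>x. x \<in> topspace X ==> openin X (U x) \<and> x \<in> U x \<and> (\<forall>y\<in>U x. P x y)"
  by metis
 have "(\<forall>V\<in>U ` topspace X. openin X V) \<and> topspace X \<subseteq> \<Union>(U ` topspace X)" using U by blast
 then have "\<exists>\<F>. finite \<F> \<and> \<F> \<subseteq> U ` topspace X \<and> topspace X \<subseteq> \<Union>\<F>"
  using X unfolding compact_space_alt by simp
 then obtain I where "finite I" "I \<subseteq> topspace X" "topspace X \<subseteq> \<Union>(U ` I)"
  by (metis finite_subset_image)
 then show thesis using U by (intro that[of I]) blast+
qed

text \<open>The support condition is stated for germs: each \<open>rho i\<close> vanishes near every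
  point outside \<open>U i\<close>. A product with something that makes sense only over
  \<open>U i\<close> is then continuous everywhere.\<close>

lemma partition_of_unity:
 assumes X: "compact_space X" "Hausdorff_space X"
  and U: "\<And>x. x \<in> topspace X ==> openin X (U x) \<and> x \<in> U x"
 obtains I and rho :: "'x => 'x => real" where "finite I" "I \<subseteq> topspace X"
  "\<And>i y. i \<in> I ==> y \<in> topspace X ==> (rho i \<longlongrightarrow> rho i y) (nhdsin X y)"
  "\<And>i y. i \<in> I ==> 0 \<le> rho i y" "\<And>y. y \<in> topspace X ==> (\<Sum>i\<in>I. rho i y) = 1"
  "\<And>i y. i \<in> I ==> y \<in> topspace X ==> y \<notin> U i ==> near X y (%z. rho i z = 0)"
proof -
 have "\<forall>x\<in>topspace X. \<exists>rho :: 'x => real. (\<forall>y\<in>topspace X. (rho \<longlongrightarrow> rho y) (nhdsin X y)) \<and> (\<forall>y. 0 \<le> rho y) \<and>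
   (near X x (%y. rho y = 1)) \<and> (\<forall>y\<in>topspace X. y \<notin> U x --> (near X y (%z. rho z = 0)))"
 by (metis U bump_function[OF X])
 from this[unfolded bchoice_iff] obtain rho :: "'x => 'x => real" where
  "\<forall>x\<in>topspace X. (\<forall>y\<in>topspace X. (rho x \<longlongrightarrow> rho x y) (nhdsin X y)) \<and> (\<forall>y. 0 \<le> rho x y) \<and>
   (near X x (%y. rho x y = 1)) \<and> (\<forall>y\<in>topspace X. y \<notin> U x --> (near X y (%z. rho x z = 0)))" ..
 then have rho: "\<And>x y. x \<in> topspace X ==> y \<in> topspace X ==> (rho x \<longlongrightarrow> rho x y) (nhdsin X y)"
  "\<And>x y. x \<in> topspace X ==> 0 \<le> rho x y" "\<And>x. x \<in> topspace X ==> near X x (%y. rho x y = 1)"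
  "\<And>x y. x \<in> topspace X ==> y \<in> topspace X ==> y \<notin> U x ==> near X y (%z. rho x z = 0)"
  by blast+
 obtain I where I: "finite I" "I \<subseteq> topspace X" "\<And>y. y \<in> topspace X ==> \<exists>x\<in>I. rho x y = 1"
  by (rule compact_nhds_cover[OF X(1) rho(3)]) auto
 define S where "S y = (\<Sum>i\<in>I. rho i y)" for y
 have Spos: "S y > 0" if y: "y \<in> topspace X" for y
 proof -
  obtain i where i: "i \<in> I" "rho i y = 1" using I(3)[OF y] by blast
  have "rho i y \<le> S y" unfolding S_def using I rho(2) i by (intro member_le_sum) auto
  then show ?thesis using i by simp
 qed
 show thesis
 proof (rule that[of I "%i y. rho i y / S y"])
  fix i y assume i: "i \<in> I"
  then have it: "i \<in> topspace X" using I by blast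
  show "0 \<le> rho i y / S y"
   unfolding S_def using I(2) rho(2) it by (intro divide_nonneg_nonneg sum_nonneg) auto
  assume y: "y \<in> topspace X"
  show "((%y. rho i y / S y) \<longlongrightarrow> rho i y / S y) (nhdsin X y)"
   unfolding S_def using I(2) y Spos[OF y] it
   by (intro tendsto_divide tendsto_sum rho(1)) (auto simp: S_def)
  show "near X y (%z. rho i z / S z = 0)" if "y \<notin> U i"
   using rho(4)[OF it y that] by eventually_elim simp
 next
  fix y assume y: "y \<in> topspace X"
  show "(\<Sum>i\<in>I. rho i y / S y) = 1"
   using Spos[OF y] by (simp add: S_def flip: sum_divide_distrib)
 qed (use I in auto)
qed

text \<open>Compactness of \<open>X \<times> [0,1]\<close>, for a statement that becomes weaker as its parameter grows.\<close>

lemma compact_directed_unit: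
 fixes G :: "'x => real => 'p => bool"
 assumes X: "compact_space X"
  and dir: "\<And>p q. \<exists>r. (\<forall>x t. G x t p --> G x t r) \<and> (\<forall>x t. G x t q --> G x t r)"
  and loc: "\<And>x t. x \<in> topspace X ==> 0 \<le> t ==> t \<le> 1 ==>
   \<exists>p e. e > 0 \<and> (near X x (%y. \<forall>r. \<bar>r - t\<bar> < e --> G y r p))"
 shows "\<exists>p. \<forall>x\<in>topspace X. \<forall>t\<in>{0..1}. G x t p"
proof -
 \<comment> \<open>Directedness yields a common parameter for finitely many; it is used once for the
   interval and once for \<open>X\<close>.\<close>
 have fin: "\<exists>r. \<forall>i\<in>I. \<forall>x t. G x t (p i) --> G x t r" if "finite I" for I :: "'i set" and p
  using that
 proof induction
  case (insert i I)
  then obtain r where r: "\<forall>i\<in>I. \<forall>x t. G x t (p i) --> G x t r" by blast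
  obtain r' where "\<forall>x t. G x t (p i) --> G x t r'" "\<forall>x t. G x t r --> G x t r'"
   using dir by blast
  then show ?case using r by (intro exI[of _ r']) blast
 qed simp
 have "\<forall>x\<in>topspace X. \<exists>p. near X x (%y. \<forall>t\<in>{0..1}. G y t p)"
 proof
  fix x assume x: "x \<in> topspace X"
  have "\<forall>t\<in>{0..1}. \<exists>p e. e > 0 \<and> (near X x (%y. \<forall>r. \<bar>r - t\<bar> < e --> G y r p))"
   using loc[OF x] by simp
  from this[unfolded bchoice_iff] obtain p e where "\<forall>t\<in>{0..1}. e t > 0 \<and>
    (near X x (%y. \<forall>r. \<bar>r - t\<bar> < e t --> G y r (p t)))"
   by (elim exE)
  then have pe: "\<And>t. t \<in> {0..1} ==> e t > 0"
   "\<And>t. t \<in> {0..1} ==> near X x (%y. \<forall>r. \<bar>r - t\<bar> < e t --> G y r (p t))"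
   by simp_all
  have cov: "{0..1::real} \<subseteq> (\<Union>t\<in>{0..1}. ball t (e t))" using pe(1) by fastforce
  obtain J where J: "J \<subseteq> {0..1}" "finite J" "{0..1} \<subseteq> (\<Union>t\<in>J. ball t (e t))"
   by (rule compactE_image[OF compact_Icc _ cov]) auto
  obtain q where q: "\<forall>i\<in>J. \<forall>x t. G x t (p i) --> G x t q" using fin[OF J(2), of p] by blast
  have "near X x (%y. \<forall>t\<in>J. \<forall>r. \<bar>r - t\<bar> < e t --> G y r (p t))"
   using pe(2) J by (intro eventually_ball_finite) auto
  then have "near X x (%y. \<forall>t\<in>{0..1}. G y t q)"
  proof (eventually_elim, intro ballI)
   fix y r assume y: "\<forall>t\<in>J. \<forall>r. \<bar>r - t\<bar> < e t --> G y r (p t)" and r: "r \<in> {0..1::real}"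
   then obtain t where "t \<in> J" "\<bar>r - t\<bar> < e t" using J(3) by (auto simp: dist_real_def)
   then show "G y r q" using y q by blast
  qed
  then show "\<exists>p. near X x (%y. \<forall>t\<in>{0..1}. G y t p)" ..
 qed
 from bchoice[OF this] obtain p where p: "\<forall>x\<in>topspace X. near X x (%y. \<forall>t\<in>{0..1}. G y t (p x))" ..
 obtain I where I: "finite I" "\<And>y. y \<in> topspace X ==> \<exists>x\<in>I. \<forall>t\<in>{0..1}. G y t (p x)"
  by (rule compact_nhds_cover[OF X bspec[OF p]]) auto
 obtain q where "\<forall>i\<in>I. \<forall>x t. G x t (p i) --> G x t q" using fin[OF I(1), of p] by blast
 then show ?thesis using I(2) by blast
qed

section \<open>Germs of morphisms and sections\<close>

text \<open>Membership in the maximal atlas. Charts that straighten a subbundle belong to it without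
  being in the given atlas.\<close>

definition admissible :: "'x topology => ('k, 'x, 'e::ab_group_add, 'm::banach) banach_bundle =>
  'x set => ('x => 'e => 'm) => bool" where
 "admissible X E U phi \<longleftrightarrow> bundle_chart X E U phi \<and> (\<forall>(U', psi)\<in>atlas E. charts_compatible X E U phi U' psi)"

text \<open>\<open>B\<close> is the operator family of \<open>T\<close> in two charts near
  \<open>x\<close>, with continuity demanded at \<open>x\<close> alone. A morphism has such a family
  at every point, each point with its own \<open>B\<close>.\<close>

definition rep :: "'x topology => ('k, 'x, 'e, 'm::real_normed_vector) banach_bundle => 'x => ('x => 'e => 'm) =>
  ('x => 'f => 'n::real_normed_vector) => ('x => 'e => 'f) => ('x => 'm \<Rightarrow>\<^sub>L 'n) => bool" where
 "rep X E x phi psi T B \<longleftrightarrow> (B \<longlongrightarrow> B x) (nhdsin X x) \<and>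
   (near X x (%y. \<forall>u\<in>fibre E y. psi y (T y u) = B y (phi y u)))"

definition mor_at :: "'x topology => ('k, 'x, 'e::ab_group_add, 'm::banach) banach_bundle =>
  ('k, 'x, 'f::ab_group_add, 'n::banach) banach_bundle => ('x => 'e => 'f) => 'x => bool" where
 "mor_at X E F T x \<longleftrightarrow>
   (near X x (%y. lin_on (scale E) (scale F) (fibre E y) (T y) \<and> T y ` fibre E y \<subseteq> fibre F y)) \<and>
   (\<forall>(U, phi)\<in>atlas E. \<forall>(V, psi)\<in>atlas F. x \<in> U --> x \<in> V --> (\<exists>B. rep X E x phi psi T B))"

definition sec_at :: "'x topology => ('k, 'x, 'e::ab_group_add, 'm::banach) banach_bundle => ('x => 'e) => 'x => bool" where
 "sec_at X E s x \<longleftrightarrow> (near X x (%y. s y \<in> fibre E y)) \<and>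
   (\<forall>(U, phi)\<in>atlas E. x \<in> U --> ((%y. phi y (s y)) \<longlongrightarrow> phi x (s x)) (nhdsin X x))"

lemma banach_bundle_model: "banach_bundle X E ==> kbanach (mscale E)"
 unfolding banach_bundle_def kbanach_def by blast

lemma banach_bundle_space: "banach_bundle X E ==> vector_space (scale E)"
 unfolding banach_bundle_def by blast

lemma banach_bundle_subspace: "banach_bundle X E ==> x \<in> topspace X ==> module.subspace (scale E) (fibre E x)"
 unfolding banach_bundle_def by blast

lemma admissible_atlas: "banach_bundle X E ==> (U, phi) \<in> atlas E ==> admissible X E U phi"
 by (auto simp: banach_bundle_def admissible_def)

lemma exists_chart: "banach_bundle X E ==> x \<in> topspace X ==> \<exists>(U, phi)\<in>atlas E. x \<in> U"
 unfolding banach_bundle_def by blast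

lemma exists_admissible: "banach_bundle X E ==> x \<in> topspace X ==> \<exists>U phi. admissible X E U phi \<and> x \<in> U"
 using exists_chart[of X E x] admissible_atlas[of X E] by blast

lemma admissible_openin: "admissible X E U phi ==> openin X U"
 unfolding admissible_def bundle_chart_def by blast

lemma admissible_eventually: "admissible X E U phi ==> x \<in> U ==> near X x (%y. y \<in> U)"
 by (metis admissible_openin eventually_in_openin)

lemma admissible_topspace: "admissible X E U phi ==> x \<in> U ==> x \<in> topspace X"
 by (metis admissible_openin openin_topspace_mem)

context
 fixes X E U phi x
 assumes adm: "admissible X E U phi" and x: "x \<in> U"
begin

lemma chart_lin: "lin_on (scale E) (mscale E) (fibre E x) (phi x)"
 and chart_bij: "bij_betw (phi x) (fibre E x) UNIV"
 using adm x unfolding admissible_def bundle_chart_def by auto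

lemma chart_add: "u \<in> fibre E x ==> v \<in> fibre E x ==> phi x (u + v) = phi x u + phi x v"
 and chart_scale: "u \<in> fibre E x ==> phi x (scale E c u) = mscale E c (phi x u)"
 using chart_lin unfolding lin_on_def by auto

lemma chart_inj: "u \<in> fibre E x ==> v \<in> fibre E x ==> phi x u = phi x v ==> u = v"
 using chart_bij unfolding bij_betw_def inj_on_def by blast

lemma chart_inv: "inv_into (fibre E x) (phi x) v \<in> fibre E x" "phi x (inv_into (fibre E x) (phi x) v) = v"
 using chart_bij by (simp_all add: bij_betw_def inv_into_into f_inv_into_f)

lemma chart_inv_left: "u \<in> fibre E x ==> inv_into (fibre E x) (phi x) (phi x u) = u"
 using chart_bij by (simp add: bij_betw_def)

end

lemma chart_zero:
 assumes "banach_bundle X E" "admissible X E U phi" "x \<in> U"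
 shows "phi x 0 = 0"
proof -
 interpret V: vector_space "scale E" by (rule banach_bundle_space[OF assms(1)])
 show ?thesis
  using V.subspace_0 banach_bundle_subspace[OF assms(1) admissible_topspace[OF assms(2,3)]] chart_add[OF assms(2,3), of 0 0] by simp
qed

lemma norm_continuous_rep:
 assumes "openin X W" "norm_continuous X W (in_charts (fibre E) phi psi T)" "x \<in> W"
  and inj: "\<And>y. y \<in> W ==> inj_on (phi y) (fibre E y)"
 shows "\<exists>B. rep X E x phi psi T B"
proof -
 obtain B where B: "continuous_map (subtopology X W) euclidean B"
  "\<And>y. y \<in> W ==> in_charts (fibre E) phi psi T y = blinfun_apply (B y)"
  using assms(2) unfolding norm_continuous_def by blast
 have "(B \<longlongrightarrow> B x) (nhdsin X x)" using B(1) continuous_map_nhdsin[OF assms(1)] assms(3) by blast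
 moreover have "near X x (%y. \<forall>u\<in>fibre E y. psi y (T y u) = B y (phi y u))"
  using eventually_in_openin[OF assms(1,3)]
 proof eventually_elim
  case (elim y)
  show ?case using B(2)[OF elim, symmetric] inj[OF elim] by (simp add: in_charts_def)
 qed
 ultimately show ?thesis unfolding rep_def by blast
qed

text \<open>The representatives at different points are unrelated a priori. Since the chart is
  bijective on fibres, all of them coincide with the canonical family \<open>A\<close> wherever they
  represent \<open>T\<close>, so their limits combine into continuity of \<open>A\<close>.\<close>

lemma rep_norm_continuous:
 assumes "openin X W" and rep: "\<And>x. x \<in> W ==> \<exists>B. rep X E x phi psi T B"
  and bij: "\<And>y. y \<in> W ==> bij_betw (phi y) (fibre E y) UNIV"
 shows "norm_continuous X W (in_charts (fibre E) phi psi T)"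
proof -
 define A where "A y = Blinfun (in_charts (fibre E) phi psi T y)" for y
 have eq: "in_charts (fibre E) phi psi T y = blinfun_apply C"
  if "y \<in> W" "\<forall>u\<in>fibre E y. psi y (T y u) = blinfun_apply C (phi y u)" for y C
 using bij[OF that(1)] that(2) by (auto simp: bij_betw_def inv_into_into f_inv_into_f in_charts_def)
 have A: "A y = C" if "y \<in> W" "\<forall>u\<in>fibre E y. psi y (T y u) = blinfun_apply C (phi y u)" for y C
  unfolding A_def eq[OF that] by (rule blinfun_apply_inverse)
 have "(A \<longlongrightarrow> A x) (nhdsin X x) \<and> in_charts (fibre E) phi psi T x = blinfun_apply (A x)" if x: "x \<in> W" for x
 proof -
  obtain B where "rep X E x phi psi T B" using rep[OF x] ..
  then have B: "(B \<longlongrightarrow> B x) (nhdsin X x)"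
   "near X x (%y. \<forall>u\<in>fibre E y. psi y (T y u) = B y (phi y u))"
   by (simp_all add: rep_def)
  have ev: "near X x (%y. A y = B y)"
   using B(2) eventually_in_openin[OF assms(1) x] by eventually_elim (rule A)
  have Bx: "\<forall>u\<in>fibre E x. psi x (T x u) = B x (phi x u)"
   using eventually_nhdsin_self[OF openin_topspace_mem[OF assms(1) x] B(2)] .
  have "A x = B x" using A[OF x Bx] .
  then show ?thesis using B(1) tendsto_cong[OF ev] eq[OF x Bx] by simp
 qed
 then show ?thesis
  unfolding norm_continuous_def using continuous_map_nhdsin[OF assms(1)] by blast
qed

section \<open>Local representatives in admissible charts\<close>

lemma rep_comp:
 assumes "rep X E x phi psi T B" "rep X F x psi \<theta> S C" "near X x (%y. T y ` fibre E y \<subseteq> fibre F y)"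
 shows "rep X E x phi \<theta> (%y u. S y (T y u)) (%y. C y o\<^sub>L B y)"
 unfolding rep_def
proof
 show "((%y. C y o\<^sub>L B y) \<longlongrightarrow> C x o\<^sub>L B x) (nhdsin X x)"
  using assms unfolding rep_def
  by (intro bounded_bilinear.tendsto[OF bounded_bilinear_blinfun_compose]) auto
 have "near X x (%y. \<forall>u\<in>fibre E y. psi y (T y u) = B y (phi y u))"
  "near X x (%y. \<forall>u\<in>fibre F y. \<theta> y (S y u) = C y (psi y u))"
  using assms unfolding rep_def by auto
 then show "near X x (%y. \<forall>u\<in>fibre E y. \<theta> y (S y (T y u)) = (C y o\<^sub>L B y) (phi y u))"
  using assms(3) by eventually_elim auto
qed

lemma rep_id_atlas:
 assumes E: "banach_bundle X E" and adm: "admissible X E U phi" and at: "(V, psi) \<in> atlas E" and x: "x \<in> U" "x \<in> V"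
 shows "\<exists>B. rep X E x phi psi (%y u. u) B" "\<exists>B. rep X E x psi phi (%y u. u) B"
proof -
 have op: "openin X (U \<inter> V)" using admissible_openin adm admissible_atlas[OF E at] by blast
 have c: "charts_compatible X E U phi V psi" using adm at unfolding admissible_def by blast
 show "\<exists>B. rep X E x phi psi (%y u. u) B"
  using c chart_bij[OF adm] x unfolding charts_compatible_def
  by (intro norm_continuous_rep[OF op]) (auto simp: bij_betw_def)
 show "\<exists>B. rep X E x psi phi (%y u. u) B"
  using c chart_bij[OF admissible_atlas[OF E at]] x unfolding charts_compatible_def
  by (intro norm_continuous_rep[OF op]) (auto simp: bij_betw_def)
qed

lemma rep_id:
 assumes E: "banach_bundle X E" and adm: "admissible X E U phi" "admissible X E V psi" and x: "x \<in> U" "x \<in> V"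
 shows "\<exists>B. rep X E x phi psi (%y u. u) B"
proof -
 obtain W \<theta> where W: "(W, \<theta>) \<in> atlas E" "x \<in> W"
  using exists_chart[OF E admissible_topspace[OF adm(1) x(1)]] by blast
 obtain B C where "rep X E x phi \<theta> (%y u. u) B" "rep X E x \<theta> psi (%y u. u) C"
  using rep_id_atlas[OF E adm(1) W(1) x(1) W(2)] rep_id_atlas[OF E adm(2) W(1) x(2) W(2)] by blast
 from rep_comp[OF this] show ?thesis by auto
qed

lemma mor_at_lin: "mor_at X E F T x ==>
  near X x (%y. lin_on (scale E) (scale F) (fibre E y) (T y) \<and> T y ` fibre E y \<subseteq> fibre F y)"
 unfolding mor_at_def by blast

lemma mor_at_rep:
 assumes E: "banach_bundle X E" and F: "banach_bundle X F" and T: "mor_at X E F T x"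
  and adm: "admissible X E U phi" "admissible X F V psi" and x: "x \<in> U" "x \<in> V"
 shows "\<exists>B. rep X E x phi psi T B"
proof -
 have xt: "x \<in> topspace X" by (rule admissible_topspace[OF adm(1) x(1)])
 obtain U' phi' V' psi' where c: "(U', phi') \<in> atlas E" "x \<in> U'" "(V', psi') \<in> atlas F" "x \<in> V'"
  using exists_chart[OF E xt] exists_chart[OF F xt] by blast
 obtain B where B: "rep X E x phi' psi' T B" using T c unfolding mor_at_def by blast
 obtain C where C: "rep X E x phi phi' (%y u. u) C" using rep_id_atlas(1)[OF E adm(1) c(1) x(1) c(2)] by blast
 obtain D where D: "rep X F x psi' psi (%y u. u) D" using rep_id_atlas(2)[OF F adm(2) c(3) x(2) c(4)] by blast
 have ev: "near X x (%y. T y ` fibre E y \<subseteq> fibre F y)"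
  using mor_at_lin[OF T] by eventually_elim blast
 have "rep X E x phi psi' (%y u. T y u) (%y. B y o\<^sub>L C y)" by (rule rep_comp[OF C B]) auto
 from rep_comp[OF this D ev] show ?thesis by auto
qed

text \<open>Together with \<open>mor_at_rep\<close> this frees the notion from the atlas: a
  representative in one pair of admissible charts yields one in every other pair by composition with
  transition maps.\<close>

lemma mor_atI:
 assumes E: "banach_bundle X E" and F: "banach_bundle X F"
  and lin: "near X x (%y. lin_on (scale E) (scale F) (fibre E y) (T y) \<and> T y ` fibre E y \<subseteq> fibre F y)"
  and adm: "admissible X E U phi" "admissible X F V psi" and x: "x \<in> U" "x \<in> V"
  and B: "rep X E x phi psi T B"
 shows "mor_at X E F T x"
 unfolding mor_at_def
proof (intro conjI lin ballI, clarify)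
 fix U' phi' V' psi' assume c: "(U', phi') \<in> atlas E" "x \<in> U'" "(V', psi') \<in> atlas F" "x \<in> V'"
 obtain C where C: "rep X E x phi' phi (%y u. u) C" using rep_id_atlas(2)[OF E adm(1) c(1) x(1) c(2)] by blast
 obtain D where D: "rep X F x psi psi' (%y u. u) D" using rep_id_atlas(1)[OF F adm(2) c(3) x(2) c(4)] by blast
 have ev: "near X x (%y. T y ` fibre E y \<subseteq> fibre F y)"
  using lin by eventually_elim blast
 have "rep X E x phi' psi (%y u. T y u) (%y. B y o\<^sub>L C y)" by (rule rep_comp[OF C B]) auto
 from rep_comp[OF this D ev] show "\<exists>B. rep X E x phi' psi' T B" by auto
qed

lemma bundle_morphisms_iff:
 assumes E: "banach_bundle X E" and F: "banach_bundle X F"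
 shows "T \<in> bundle_morphisms X E F \<longleftrightarrow> (\<forall>x\<in>topspace X. mor_at X E F T x)"
proof
 assume T: "T \<in> bundle_morphisms X E F"
 show "\<forall>x\<in>topspace X. mor_at X E F T x"
 proof
  fix x assume x: "x \<in> topspace X"
  have lin: "near X x (%y. lin_on (scale E) (scale F) (fibre E y) (T y) \<and> T y ` fibre E y \<subseteq> fibre F y)"
   using eventually_in_openin[OF openin_topspace x]
   by (rule eventually_mono) (use T in \<open>simp add: bundle_morphisms_def\<close>)
  obtain U phi V psi where c: "(U, phi) \<in> atlas E" "x \<in> U" "(V, psi) \<in> atlas F" "x \<in> V"
   using exists_chart[OF E x] exists_chart[OF F x] by blast
  have adm: "admissible X E U phi" "admissible X F V psi" using c admissible_atlas[OF E] admissible_atlas[OF F] by auto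
  have "norm_continuous X (U \<inter> V) (in_charts (fibre E) phi psi T)"
   using T c unfolding bundle_morphisms_def by blast
  then obtain B where "rep X E x phi psi T B"
   using norm_continuous_rep[of X "U \<inter> V" E phi psi T x] c admissible_openin[OF adm(1)] admissible_openin[OF adm(2)]
    chart_bij[OF adm(1)] by (auto simp: bij_betw_def openin_Int)
  then show "mor_at X E F T x" by (rule mor_atI[OF E F lin adm c(2,4)])
 qed
next
 assume T: "\<forall>x\<in>topspace X. mor_at X E F T x"
 show "T \<in> bundle_morphisms X E F"
  unfolding bundle_morphisms_def
 proof (intro CollectI conjI ballI, goal_cases)
  case (1 x)
  from eventually_nhdsin_self[OF 1 mor_at_lin[OF bspec[OF T 1]]] show ?case ..
 next
  case (2 x)
  from eventually_nhdsin_self[OF 2 mor_at_lin[OF bspec[OF T 2]]] show ?case ..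
 next
  case (3 p)
  obtain U phi where p: "p = (U, phi)" by force
  show ?case
   unfolding p split
  proof (intro ballI, goal_cases)
   case (1 q)
   obtain V psi where q: "q = (V, psi)" by force
   have adm: "admissible X E U phi" "admissible X F V psi"
    using 3 1 p q admissible_atlas[OF E] admissible_atlas[OF F] by auto
   show ?case
    unfolding q split
   proof (rule rep_norm_continuous)
    show "openin X (U \<inter> V)" by (intro openin_Int admissible_openin[OF adm(1)] admissible_openin[OF adm(2)])
    show "\<exists>B. rep X E x phi psi T B" if "x \<in> U \<inter> V" for x
     using that T admissible_topspace[OF adm(1)] by (intro mor_at_rep[OF E F _ adm]) auto
    show "bij_betw (phi y) (fibre E y) UNIV" if "y \<in> U \<inter> V" for y
     using that chart_bij[OF adm(1)] by blast
   qed
  qed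
 qed
qed

lemma rep_tendsto: "rep X E x phi psi T B ==> (B \<longlongrightarrow> B x) (nhdsin X x)"
 and rep_eventually: "rep X E x phi psi T B ==> near X x (%y. \<forall>u\<in>fibre E y. psi y (T y u) = B y (phi y u))"
 by (simp_all add: rep_def)

lemma rep_klin:
 assumes adm: "admissible X E U phi" "admissible X F V psi" and y: "y \<in> U" "y \<in> V"
  and T: "lin_on (scale E) (scale F) (fibre E y) (T y)" "T y ` fibre E y \<subseteq> fibre F y"
  and sub: "module.subspace (scale E) (fibre E y)" "vector_space (scale E)"
  and B: "\<forall>u\<in>fibre E y. psi y (T y u) = B (phi y u)"
 shows "klin (mscale E) (mscale F) B"
 unfolding klin_def
proof (intro allI)
 interpret V: vector_space "scale E" by fact
 fix c v
 let ?u = "inv_into (fibre E y) (phi y) v"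
 note u = chart_inv[OF adm(1) y(1), of v]
 have "B (mscale E c v) = B (phi y (scale E c ?u))"
  using chart_scale[OF adm(1) y(1) u(1)] u(2) by simp
 also have "\<dots> = psi y (T y (scale E c ?u))" using B V.subspace_scale[OF sub(1) u(1)] by simp
 also have "\<dots> = psi y (scale F c (T y ?u))" using T(1) u(1) by (simp add: lin_on_def)
 also have "\<dots> = mscale F c (psi y (T y ?u))"
  using T(2) u(1) by (intro chart_scale[OF adm(2) y(2)]) blast
 also have "\<dots> = mscale F c (B v)" using B u by simp
 finally show "B (mscale E c v) = mscale F c (B v)" .
qed

lemma mor_at_cong:
 assumes T: "mor_at X E F T x" and x: "x \<in> topspace X"
  and eq: "near X x (%y. \<forall>u\<in>fibre E y. T' y u = T y u)"
  and sub: "\<And>y. y \<in> topspace X ==> module.subspace (scale E) (fibre E y)" "vector_space (scale E)"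
 shows "mor_at X E F T' x"
 unfolding mor_at_def
proof (intro conjI ballI, goal_cases)
 case 1
 interpret V: vector_space "scale E" by fact
 show ?case
  using mor_at_lin[OF T] eq eventually_in_openin[OF openin_topspace x]
 proof eventually_elim
  case (elim y)
  then show ?case using V.subspace_add[OF sub(1)[OF elim(3)]] V.subspace_scale[OF sub(1)[OF elim(3)]]
   by (auto simp: lin_on_def)
 qed
next
 case (2 p)
 obtain U phi where p: "p = (U, phi)" by force
 show ?case unfolding p split
 proof (intro ballI, goal_cases)
  case (1 q)
  obtain V psi where q: "q = (V, psi)" by force
  have "\<exists>B. rep X E x phi psi T' B" if xu: "x \<in> U" "x \<in> V"
  proof -
   have "\<exists>B. rep X E x phi psi T B" using T 2 1 xu unfolding mor_at_def p q by fastforce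
   then obtain B where B: "rep X E x phi psi T B" ..
   have "near X x (%y. \<forall>u\<in>fibre E y. psi y (T' y u) = B y (phi y u))"
    using eq rep_eventually[OF B] by eventually_elim simp
   then show ?thesis using rep_tendsto[OF B] unfolding rep_def by blast
  qed
  then show ?case by (simp add: q)
 qed
qed

section \<open>Algebra of morphism germs between two bundles\<close>

locale bpair =
 fixes X :: "'x topology"
  and E :: "('k::real_or_complex, 'x, 'e::ab_group_add, 'm::banach) banach_bundle"
  and F :: "('k, 'x, 'f::ab_group_add, 'n::banach) banach_bundle"
 assumes E: "banach_bundle X E" and F: "banach_bundle X F"
begin

sublocale VE: vector_space "scale E" by (rule banach_bundle_space[OF E])
sublocale VF: vector_space "scale F" by (rule banach_bundle_space[OF F])
sublocale ME: kbanach "mscale E" by (rule banach_bundle_model[OF E])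
sublocale MF: kbanach "mscale F" by (rule banach_bundle_model[OF F])

lemma subE: "y \<in> topspace X ==> VE.subspace (fibre E y)" by (rule banach_bundle_subspace[OF E])
lemma subF: "y \<in> topspace X ==> VF.subspace (fibre F y)" by (rule banach_bundle_subspace[OF F])

lemma obtain_charts:
 assumes "x \<in> topspace X"
 obtains U phi V psi where "admissible X E U phi" "x \<in> U" "admissible X F V psi" "x \<in> V"
 using exists_admissible[OF E assms] exists_admissible[OF F assms] by blast

lemma mor_at_cong':
 "mor_at X E F T x ==> x \<in> topspace X ==> near X x (%y. \<forall>u\<in>fibre E y. T' y u = T y u) ==> mor_at X E F T' x"
 by (rule mor_at_cong) (auto intro: subE VE.vector_space_axioms)

lemma mor_at_fibre: "mor_at X E F T x ==> x \<in> topspace X ==> u \<in> fibre E x ==> T x u \<in> fibre F x"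
 and mor_at_add_arg: "mor_at X E F T x ==> x \<in> topspace X ==> u \<in> fibre E x ==> v \<in> fibre E x ==> T x (u + v) = T x u + T x v"
 and mor_at_scale_arg: "mor_at X E F T x ==> x \<in> topspace X ==> u \<in> fibre E x ==> T x (scale E c u) = scale F c (T x u)"
 using eventually_nhdsin_self[of x X, OF _ mor_at_lin[of X E F T x]] by (auto simp: lin_on_def)

lemma mor_at_diff_arg:
 assumes "mor_at X E F T x" "x \<in> topspace X" "u \<in> fibre E x" "v \<in> fibre E x"
 shows "T x (u - v) = T x u - T x v"
using VE.subspace_diff[OF subE[OF assms(2)] assms(3,4)] mor_at_add_arg[OF assms(1,2)] assms(4) by force

lemma mor_at_zero_arg: assumes "mor_at X E F T x" "x \<in> topspace X" shows "T x 0 = 0"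
 using mor_at_add_arg[OF assms VE.subspace_0[OF subE[OF assms(2)]] VE.subspace_0[OF subE[OF assms(2)]]] by simp

lemma mor_at_zero:
 assumes x: "x \<in> topspace X" shows "mor_at X E F (%y u. 0) x"
proof -
 obtain U phi V psi where c: "admissible X E U phi" "x \<in> U" "admissible X F V psi" "x \<in> V" by (rule obtain_charts[OF x])
 show ?thesis
 proof (rule mor_atI[OF E F _ c(1,3,2,4)])
  show "near X x (%y. lin_on (scale E) (scale F) (fibre E y) (%u. 0) \<and> (%u. 0) ` fibre E y \<subseteq> fibre F y)"
   using eventually_in_openin[OF openin_topspace x]
   by eventually_elim (auto simp: lin_on_def VF.subspace_0[OF subF])
  show "rep X E x phi psi (%y u. 0) (%y. 0)"
   unfolding rep_def
    using admissible_eventually[OF c(3,4)] by (auto elim!: eventually_mono simp: chart_zero[OF F c(3)])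
 qed
qed

lemma mor_at_add:
 assumes T: "mor_at X E F T x" and S: "mor_at X E F S x" and x: "x \<in> topspace X"
 shows "mor_at X E F (%y u. T y u + S y u) x"
proof -
 obtain U phi V psi where c: "admissible X E U phi" "x \<in> U" "admissible X F V psi" "x \<in> V" by (rule obtain_charts[OF x])
 obtain B where B: "rep X E x phi psi T B" using mor_at_rep[OF E F T c(1,3,2,4)] ..
 obtain C where C: "rep X E x phi psi S C" using mor_at_rep[OF E F S c(1,3,2,4)] ..
 have ev: "near X x (%y. y \<in> topspace X)" by (rule eventually_in_openin[OF openin_topspace x])
 show ?thesis
 proof (rule mor_atI[OF E F _ c(1,3,2,4)])
  show "near X x (%y. lin_on (scale E) (scale F) (fibre E y) (%u. T y u + S y u) \<and> (%u. T y u + S y u) ` fibre E y \<subseteq> fibre F y)"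
   using mor_at_lin[OF T] mor_at_lin[OF S] ev
   by eventually_elim (auto simp: lin_on_def VF.scale_right_distrib intro!: VF.subspace_add[OF subF])
  show "rep X E x phi psi (%y u. T y u + S y u) (%y. B y + C y)"
   unfolding rep_def
  proof (intro conjI tendsto_add rep_tendsto[OF B] rep_tendsto[OF C])
   show "near X x (%y. \<forall>u\<in>fibre E y. psi y (T y u + S y u) = (B y + C y) (phi y u))"
    using rep_eventually[OF B] rep_eventually[OF C] mor_at_lin[OF T] mor_at_lin[OF S] admissible_eventually[OF c(3,4)]
   proof eventually_elim
    case (elim y)
    have "psi y (T y u + S y u) = psi y (T y u) + psi y (S y u)" if "u \<in> fibre E y" for u
     using elim(3,4) that by (intro chart_add[OF c(3) elim(5)]) auto
    then show ?case using elim(1,2) by (simp add: blinfun.add_left)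
   qed
  qed
 qed
qed

lemma mor_at_scale:
 fixes r :: "'x => real"
 assumes T: "mor_at X E F T x" and r: "(r \<longlongrightarrow> r x) (nhdsin X x)" and x: "x \<in> topspace X"
 shows "mor_at X E F (%y u. scale F (of_real (r y)) (T y u)) x"
proof -
 obtain U phi V psi where c: "admissible X E U phi" "x \<in> U" "admissible X F V psi" "x \<in> V" by (rule obtain_charts[OF x])
 obtain B where B: "rep X E x phi psi T B" using mor_at_rep[OF E F T c(1,3,2,4)] ..
 have ev: "near X x (%y. y \<in> topspace X)" by (rule eventually_in_openin[OF openin_topspace x])
 show ?thesis
 proof (rule mor_atI[OF E F _ c(1,3,2,4)])
  show "near X x (%y. lin_on (scale E) (scale F) (fibre E y) (%u. scale F (of_real (r y)) (T y u)) \<and>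
    (%u. scale F (of_real (r y)) (T y u)) ` fibre E y \<subseteq> fibre F y)"
   using mor_at_lin[OF T] ev
   by eventually_elim (auto simp: lin_on_def VF.scale_right_distrib mult.commute intro!: VF.subspace_scale[OF subF])
  show "rep X E x phi psi (%y u. scale F (of_real (r y)) (T y u)) (%y. r y *\<^sub>R B y)"
   unfolding rep_def
  proof (intro conjI tendsto_scaleR r rep_tendsto[OF B])
   show "near X x (%y. \<forall>u\<in>fibre E y. psi y (scale F (of_real (r y)) (T y u)) = (r y *\<^sub>R B y) (phi y u))"
    using rep_eventually[OF B] mor_at_lin[OF T] admissible_eventually[OF c(3,4)]
   proof eventually_elim
    case (elim y)
    have "psi y (scale F (of_real (r y)) (T y u)) = mscale F (of_real (r y)) (psi y (T y u))" if "u \<in> fibre E y" for u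
     using elim(2) that by (intro chart_scale[OF c(3) elim(3)]) auto
    then show ?case using elim(1) by (simp add: blinfun.scaleR_left MF.scale_of_real)
   qed
  qed
 qed
qed

lemma mor_at_diff:
 assumes T: "mor_at X E F T x" and S: "mor_at X E F S x" and x: "x \<in> topspace X"
 shows "mor_at X E F (%y u. T y u - S y u) x"
proof -
 have "mor_at X E F (%y u. T y u + scale F (of_real (- 1)) (S y u)) x"
  by (intro mor_at_add T x mor_at_scale S tendsto_const)
 then show ?thesis by simp
qed

lemma mor_at_sum:
 assumes "finite I" "\<And>i. i \<in> I ==> mor_at X E F (T i) x" and x: "x \<in> topspace X"
 shows "mor_at X E F (%y u. \<Sum>i\<in>I. T i y u) x"
 using assms(1,2)
proof induction
 case empty then show ?case using mor_at_zero[OF x] by simp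
next
 case (insert i I)
 then have "mor_at X E F (%y u. T i y u + (\<Sum>i\<in>I. T i y u)) x" using x by (intro mor_at_add) auto
 then show ?case using insert.hyps by simp
qed

lemma mor_at_chartI:
 assumes adm: "admissible X E U phi" "admissible X F V psi" and x: "x \<in> U" "x \<in> V"
  and B: "(B \<longlongrightarrow> B x) (nhdsin X x)" "near X x (%y. klin (mscale E) (mscale F) (blinfun_apply (B y)))"
 shows "mor_at X E F (%y u. inv_into (fibre F y) (psi y) (B y (phi y u))) x"
proof (rule mor_atI[OF E F _ adm x])
 show "near X x (%y. lin_on (scale E) (scale F) (fibre E y) (%u. inv_into (fibre F y) (psi y) (B y (phi y u))) \<and>
   (%u. inv_into (fibre F y) (psi y) (B y (phi y u))) ` fibre E y \<subseteq> fibre F y)"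
  using B(2) admissible_eventually[OF adm(1) x(1)] admissible_eventually[OF adm(2) x(2)]
 proof eventually_elim
  case (elim y)
  have yt: "y \<in> topspace X" by (rule admissible_topspace[OF adm(1) elim(2)])
  note g = chart_inv[OF adm(2) elim(3)]
  show ?case
   unfolding lin_on_def
  proof (intro conjI ballI allI)
   fix u v assume uv: "u \<in> fibre E y" "v \<in> fibre E y"
   show "inv_into (fibre F y) (psi y) (B y (phi y (u + v))) = inv_into (fibre F y) (psi y) (B y (phi y u)) + inv_into (fibre F y) (psi y) (B y (phi y v))"
    by (rule chart_inj[OF adm(2) elim(3)])
     (simp_all add: g VF.subspace_add[OF subF[OF yt]] chart_add[OF adm(2) elim(3)] chart_add[OF adm(1) elim(2) uv] blinfun.add_right)
  next
   fix c u assume u: "u \<in> fibre E y"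
   show "inv_into (fibre F y) (psi y) (B y (phi y (scale E c u))) = scale F c (inv_into (fibre F y) (psi y) (B y (phi y u)))"
    by (rule chart_inj[OF adm(2) elim(3)])
     (use elim(1) in \<open>simp_all add: g VF.subspace_scale[OF subF[OF yt]] chart_scale[OF adm(2) elim(3)] chart_scale[OF adm(1) elim(2) u] klin_def\<close>)
  qed (use g in auto)
 qed
 show "rep X E x phi psi (%y u. inv_into (fibre F y) (psi y) (B y (phi y u))) B"
  unfolding rep_def
   using B(1) admissible_eventually[OF adm(2) x(2)] by (auto elim!: eventually_mono simp: chart_inv[OF adm(2)])
qed

lemma mor_rep_klin:
 assumes T: "mor_at X E F T x" and adm: "admissible X E U phi" "admissible X F V psi" and x: "x \<in> U" "x \<in> V"
  and B: "rep X E x phi psi T B"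
 shows "near X x (%y. klin (mscale E) (mscale F) (blinfun_apply (B y)))"
 using mor_at_lin[OF T] rep_eventually[OF B] admissible_eventually[OF adm(1) x(1)] admissible_eventually[OF adm(2) x(2)]
proof eventually_elim
 case (elim y)
 show ?case
  using elim by (intro rep_klin[OF adm elim(3,4), of T]) (auto simp: subE[OF admissible_topspace[OF adm(1) elim(3)]] VE.vector_space_axioms)
qed

text \<open>\<open>Q y\<close> has to be closed under convex combinations, as being a projection
  onto a given subspace or a right inverse is. It is asked of \<open>T i\<close> only where the
  weight is nonzero, since a local solution may be meaningless elsewhere.\<close>

lemma mor_glue:
 assumes X: "compact_space X" "Hausdorff_space X"
  and loc: "\<And>x. x \<in> topspace X ==> \<exists>T. near X x (%y. mor_at X E F T y \<and> Q y (T y))"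
  and convex: "\<And>y (I::'x set) (rho::'x => real) T. y \<in> topspace X ==> finite I ==> (\<And>i. i \<in> I ==> 0 \<le> rho i) ==> sum rho I = 1 ==>
   (\<And>i. i \<in> I ==> rho i \<noteq> 0 ==> Q y (T i)) ==> Q y (%u. \<Sum>i\<in>I. scale F (of_real (rho i)) (T i u))"
 shows "\<exists>T. (\<forall>x\<in>topspace X. mor_at X E F T x) \<and> (\<forall>y\<in>topspace X. Q y (T y))"
proof -
 have "\<forall>x\<in>topspace X. \<exists>TU. openin X (snd TU) \<and> x \<in> snd TU \<and> (\<forall>y\<in>snd TU. mor_at X E F (fst TU) y \<and> Q y (fst TU y))"
 proof
  fix x assume x: "x \<in> topspace X"
  obtain T where "near X x (%y. mor_at X E F T y \<and> Q y (T y))" using loc[OF x] ..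
  then obtain U where "openin X U" "x \<in> U" "\<forall>y\<in>U. mor_at X E F T y \<and> Q y (T y)"
   using eventually_openin[OF x, of "%y. mor_at X E F T y \<and> Q y (T y)"] by blast
  then show "\<exists>TU. openin X (snd TU) \<and> x \<in> snd TU \<and> (\<forall>y\<in>snd TU. mor_at X E F (fst TU) y \<and> Q y (fst TU y))"
   by (intro exI[of _ "(T, U)"]) auto
 qed
 from this[unfolded bchoice_iff] obtain TU where
  TU: "\<forall>x\<in>topspace X. openin X (snd (TU x)) \<and> x \<in> snd (TU x) \<and> (\<forall>y\<in>snd (TU x). mor_at X E F (fst (TU x)) y \<and> Q y (fst (TU x) y))" ..
 define T where "T x = fst (TU x)" for x
 define U where "U x = snd (TU x)" for x
 have U: "\<And>x. x \<in> topspace X ==> openin X (U x) \<and> x \<in> U x"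
  and TQ: "\<And>x y. x \<in> topspace X ==> y \<in> U x ==> mor_at X E F (T x) y \<and> Q y (T x y)"
  using TU by (auto simp: T_def U_def)
 obtain I and rho :: "'x => 'x => real" where I: "finite I" "I \<subseteq> topspace X"
  and rho: "\<And>i y. i \<in> I ==> y \<in> topspace X ==> (rho i \<longlongrightarrow> rho i y) (nhdsin X y)"
  "\<And>i y. i \<in> I ==> 0 \<le> rho i y" "\<And>y. y \<in> topspace X ==> (\<Sum>i\<in>I. rho i y) = 1"
  "\<And>i y. i \<in> I ==> y \<in> topspace X ==> y \<notin> U i ==> near X y (%z. rho i z = 0)"
  by (rule partition_of_unity[OF X U]) (assumption, (rule that; assumption))
 let ?T = "%y u. \<Sum>i\<in>I. scale F (of_real (rho i y)) (T i y u)"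
 have "mor_at X E F ?T y" if y: "y \<in> topspace X" for y
 proof (rule mor_at_sum[OF I(1) _ y])
  fix i assume i: "i \<in> I"
  show "mor_at X E F (%y u. scale F (of_real (rho i y)) (T i y u)) y"
  proof (cases "y \<in> U i")
   case True
   then show ?thesis using TQ[of i y] i I(2) by (intro mor_at_scale rho(1) y) auto
  next
   \<comment> \<open>Nothing is known of \<open>T i\<close> here, but its weight vanishes near
     \<open>y\<close>, so the product agrees with the zero morphism there.\<close>
   case False
   show ?thesis
    by (rule mor_at_cong'[OF mor_at_zero[OF y] y]) (use rho(4)[OF i y False] in \<open>auto elim!: eventually_mono\<close>)
  qed
 qed
 moreover have "Q y (?T y)" if y: "y \<in> topspace X" for y
 proof (rule convex[OF y I(1)])
  fix i assume i: "i \<in> I" "rho i y \<noteq> 0"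
  show "Q y (T i y)" using rho(4)[OF i(1) y] eventually_nhdsin_self[OF y] TQ[of i y] i I(2) by blast
 qed (use rho y in auto)
 ultimately show ?thesis by blast
qed

section \<open>Germs of continuous sections\<close>

lemma sec_at_fibre: "sec_at X E s x ==> x \<in> topspace X ==> s x \<in> fibre E x"
 unfolding sec_at_def using eventually_nhdsin_self[of x X "%y. s y \<in> fibre E y"] by blast

lemma sec_at_adm:
 assumes s: "sec_at X E s x" and adm: "admissible X E U phi" "x \<in> U"
 shows "((%y. phi y (s y)) \<longlongrightarrow> phi x (s x)) (nhdsin X x)"
proof -
 have xt: "x \<in> topspace X" by (rule admissible_topspace[OF adm])
 obtain W \<theta> where W: "(W, \<theta>) \<in> atlas E" "x \<in> W" using exists_chart[OF E xt] by blast
 obtain B where B: "rep X E x \<theta> phi (%y u. u) B" using rep_id_atlas(2)[OF E adm(1) W(1) adm(2) W(2)] ..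
 have sf: "near X x (%y. s y \<in> fibre E y)" using s unfolding sec_at_def by blast
 have ev: "near X x (%y. phi y (s y) = B y (\<theta> y (s y)))"
  using rep_eventually[OF B] sf by eventually_elim simp
 have "((%y. B y (\<theta> y (s y))) \<longlongrightarrow> B x (\<theta> x (s x))) (nhdsin X x)"
  using bounded_bilinear.tendsto[OF bounded_bilinear_blinfun_apply] rep_tendsto[OF B] s W by (force simp: sec_at_def)
 then show ?thesis using tendsto_cong[OF ev] eventually_nhdsin_self[OF xt ev] by simp
qed

lemma sec_atI:
 assumes s: "near X x (%y. s y \<in> fibre E y)" and adm: "admissible X E U phi" "x \<in> U"
  and lim: "((%y. phi y (s y)) \<longlongrightarrow> phi x (s x)) (nhdsin X x)"
 shows "sec_at X E s x"
 unfolding sec_at_def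
proof (intro conjI s ballI, clarify)
 fix W \<theta> assume W: "(W, \<theta>) \<in> atlas E" "x \<in> W"
 have xt: "x \<in> topspace X" by (rule admissible_topspace[OF adm])
 obtain B where B: "rep X E x phi \<theta> (%y u. u) B" using rep_id_atlas(1)[OF E adm(1) W(1) adm(2) W(2)] ..
 have ev: "near X x (%y. \<theta> y (s y) = B y (phi y (s y)))"
  using rep_eventually[OF B] s by eventually_elim simp
 have "((%y. B y (phi y (s y))) \<longlongrightarrow> B x (phi x (s x))) (nhdsin X x)"
  by (intro bounded_bilinear.tendsto[OF bounded_bilinear_blinfun_apply] rep_tendsto[OF B] lim)
 then show "((%y. \<theta> y (s y)) \<longlongrightarrow> \<theta> x (s x)) (nhdsin X x)"
  using tendsto_cong[OF ev] eventually_nhdsin_self[OF xt ev] by simp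
qed

lemma sec_at_chart:
 assumes adm: "admissible X E U phi" "x \<in> U"
 shows "sec_at X E (%y. inv_into (fibre E y) (phi y) v) x"
proof (rule sec_atI[OF _ adm])
 show "near X x (%y. inv_into (fibre E y) (phi y) v \<in> fibre E y)"
  using admissible_eventually[OF adm] by eventually_elim (rule chart_inv[OF adm(1)])
 have ev: "near X x (%y. phi y (inv_into (fibre E y) (phi y) v) = v)"
  using admissible_eventually[OF adm] by eventually_elim (rule chart_inv[OF adm(1)])
 show "((%y. phi y (inv_into (fibre E y) (phi y) v)) \<longlongrightarrow> phi x (inv_into (fibre E x) (phi x) v)) (nhdsin X x)"
  using tendsto_cong[OF ev] chart_inv(2)[OF adm] by simp
qed

lemma sec_at_cong:
 assumes s: "sec_at X E s x" and x: "x \<in> topspace X" and eq: "near X x (%y. s' y = s y)"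
 shows "sec_at X E s' x"
proof -
 obtain U phi where adm: "admissible X E U phi" "x \<in> U" using exists_admissible[OF E x] by blast
 show ?thesis
 proof (rule sec_atI[OF _ adm])
  have "near X x (%y. s y \<in> fibre E y)" using s by (simp add: sec_at_def)
  then show "near X x (%y. s' y \<in> fibre E y)" using eq by eventually_elim simp
  have "near X x (%y. phi y (s' y) = phi y (s y))" using eq by eventually_elim simp
  then show "((%y. phi y (s' y)) \<longlongrightarrow> phi x (s' x)) (nhdsin X x)"
   using sec_at_adm[OF s adm] tendsto_cong eventually_nhdsin_self[OF x eq] by fastforce
 qed
qed

lemma sec_at_zero: assumes x: "x \<in> topspace X" shows "sec_at X E (%y. 0) x"
proof -
 obtain U phi where adm: "admissible X E U phi" "x \<in> U" using exists_admissible[OF E x] by blast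
 have ev: "near X x (%y. phi y 0 = 0)"
  using admissible_eventually[OF adm] by eventually_elim (rule chart_zero[OF E adm(1)])
 show ?thesis
 proof (rule sec_atI[OF _ adm])
  show "near X x (%y. 0 \<in> fibre E y)"
   using eventually_in_openin[OF openin_topspace x] by eventually_elim (rule VE.subspace_0[OF subE])
  show "((%y. phi y 0) \<longlongrightarrow> phi x 0) (nhdsin X x)"
   using tendsto_cong[OF ev] eventually_nhdsin_self[OF x ev] by simp
 qed
qed

lemma sec_at_add:
 assumes s: "sec_at X E s x" and t: "sec_at X E t x" and x: "x \<in> topspace X"
 shows "sec_at X E (%y. s y + t y) x"
proof -
 obtain U phi where adm: "admissible X E U phi" "x \<in> U" using exists_admissible[OF E x] by blast
 have st: "near X x (%y. s y \<in> fibre E y)" "near X x (%y. t y \<in> fibre E y)"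
  using s t by (simp_all add: sec_at_def)
 have ev: "near X x (%y. phi y (s y + t y) = phi y (s y) + phi y (t y))"
  using st admissible_eventually[OF adm] by eventually_elim (rule chart_add[OF adm(1)])
 show ?thesis
 proof (rule sec_atI[OF _ adm])
  show "near X x (%y. s y + t y \<in> fibre E y)"
   using st eventually_in_openin[OF openin_topspace x] by eventually_elim (rule VE.subspace_add[OF subE])
  show "((%y. phi y (s y + t y)) \<longlongrightarrow> phi x (s x + t x)) (nhdsin X x)"
   using tendsto_add[OF sec_at_adm[OF s adm] sec_at_adm[OF t adm]] tendsto_cong[OF ev] eventually_nhdsin_self[OF x ev] by simp
 qed
qed

lemma sec_at_scale:
 assumes s: "sec_at X E s x" and c: "(c \<longlongrightarrow> c x) (nhdsin X x)" and x: "x \<in> topspace X"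
 shows "sec_at X E (%y. scale E (c y) (s y)) x"
proof -
 obtain U phi where adm: "admissible X E U phi" "x \<in> U" using exists_admissible[OF E x] by blast
 have st: "near X x (%y. s y \<in> fibre E y)"
  using s by (simp_all add: sec_at_def)
 have ev: "near X x (%y. phi y (scale E (c y) (s y)) = mscale E (c y) (phi y (s y)))"
  using st admissible_eventually[OF adm] by eventually_elim (rule chart_scale[OF adm(1)])
 show ?thesis
 proof (rule sec_atI[OF _ adm])
  show "near X x (%y. scale E (c y) (s y) \<in> fibre E y)"
   using st eventually_in_openin[OF openin_topspace x] by eventually_elim (rule VE.subspace_scale[OF subE])
  show "((%y. phi y (scale E (c y) (s y))) \<longlongrightarrow> phi x (scale E (c x) (s x))) (nhdsin X x)"
   using bounded_bilinear.tendsto[OF ME.bounded_bilinear_scale c sec_at_adm[OF s adm]] tendsto_cong[OF ev] eventually_nhdsin_self[OF x ev] by simp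
 qed
qed

lemma sec_at_comb:
 assumes s: "\<And>i. i < n ==> sec_at X E (%y. s y i) x" and c: "\<And>i. i < n ==> ((%y. c y i) \<longlongrightarrow> c x i) (nhdsin X x)"
  and x: "x \<in> topspace X"
 shows "sec_at X E (%y. comb (scale E) n (s y) (c y)) x"
 using s c
proof (induction n)
 case 0
 then show ?case using sec_at_zero[OF x] by (simp add: comb_def)
next
 case (Suc n)
 show ?case using Suc sec_at_add sec_at_scale x by (simp add: comb_def)
qed

end

lemma (in bpair) sec_at_mor:
 assumes T: "mor_at X E F T x" and s: "sec_at X E s x" and x: "x \<in> topspace X"
 shows "sec_at X F (%y. T y (s y)) x"
proof -
 interpret FE: bpair X F E by unfold_locales (rule F, rule E)
 obtain U phi V psi where c: "admissible X E U phi" "x \<in> U" "admissible X F V psi" "x \<in> V" by (rule obtain_charts[OF x])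
 obtain B where B: "rep X E x phi psi T B" using mor_at_rep[OF E F T c(1,3,2,4)] ..
 have sf: "near X x (%y. s y \<in> fibre E y)" using s unfolding sec_at_def by blast
 have ev: "near X x (%y. psi y (T y (s y)) = B y (phi y (s y)))"
  using rep_eventually[OF B] sf by eventually_elim simp
 show ?thesis
 proof (rule FE.sec_atI[OF _ c(3,4)])
  show "near X x (%y. T y (s y) \<in> fibre F y)"
   using mor_at_lin[OF T] sf by eventually_elim auto
  have "((%y. B y (phi y (s y))) \<longlongrightarrow> B x (phi x (s x))) (nhdsin X x)"
   by (intro bounded_bilinear.tendsto[OF bounded_bilinear_blinfun_apply] rep_tendsto[OF B] sec_at_adm[OF s c(1,2)])
  then show "((%y. psi y (T y (s y))) \<longlongrightarrow> psi x (T x (s x))) (nhdsin X x)"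
   using tendsto_cong[OF ev] eventually_nhdsin_self[OF x ev] by simp
 qed
qed

lemma mor_at_id: assumes E: "banach_bundle X E" and x: "x \<in> topspace X" shows "mor_at X E E (%y u. u) x"
using exists_admissible[OF E x] rep_id[OF E] mor_atI[OF E E] by (force simp: lin_on_def)

lemma mor_at_comp:
 assumes E: "banach_bundle X E" and F: "banach_bundle X F" and G: "banach_bundle X G"
  and T: "mor_at X E F T x" and S: "mor_at X F G S x" and x: "x \<in> topspace X"
 shows "mor_at X E G (%y u. S y (T y u)) x"
proof -
 obtain U phi where c: "admissible X E U phi" "x \<in> U" using exists_admissible[OF E x] by blast
 obtain V psi where d: "admissible X F V psi" "x \<in> V" using exists_admissible[OF F x] by blast
 obtain W \<theta> where e: "admissible X G W \<theta>" "x \<in> W" using exists_admissible[OF G x] by blast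
 obtain B where B: "rep X E x phi psi T B" using mor_at_rep[OF E F T c(1) d(1) c(2) d(2)] ..
 obtain C where C: "rep X F x psi \<theta> S C" using mor_at_rep[OF F G S d(1) e(1) d(2) e(2)] ..
 have ev: "near X x (%y. T y ` fibre E y \<subseteq> fibre F y)" using mor_at_lin[OF T] by eventually_elim blast
 show ?thesis
 proof (rule mor_atI[OF E G _ c(1) e(1) c(2) e(2) rep_comp[OF B C ev]])
  show "near X x (%y. lin_on (scale E) (scale G) (fibre E y) (%u. S y (T y u)) \<and> (%u. S y (T y u)) ` fibre E y \<subseteq> fibre G y)"
   using mor_at_lin[OF T] mor_at_lin[OF S] by eventually_elim (auto simp: lin_on_def image_subset_iff)
 qed
qed

section \<open>Finite dimensional subbundles\<close>

lemma blinv_klin: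
 fixes s :: "'k::real_or_complex => 'm::banach => 'm"
  and B :: "'m \<Rightarrow>\<^sub>L 'm"
 assumes "klin s s B" "norm (B - id_blinfun) \<le> 1 / 2"
 shows "klin s s (blinv B)"
 unfolding klin_def
by (metis assms(1) klin_def blinv_near_id(4)[OF assms(2)] blinv_near_id(5)[OF assms(2)])

lemma eventually_near_id:
 fixes A :: "'x => 'm::banach \<Rightarrow>\<^sub>L 'm"
 assumes "(A \<longlongrightarrow> A x) G" "A x = id_blinfun"
 shows "\<forall>\<^sub>F y in G. norm (A y - id_blinfun) \<le> 1 / 2"
proof -
 have "\<forall>\<^sub>F y in G. dist (A y) (A x) < 1 / 2" using assms(1) by (rule tendstoD) simp
 then show ?thesis by eventually_elim (simp add: dist_norm assms(2))
qed

text \<open>\<open>mor_at_rep\<close> gives a separate \<open>B\<close> for each point. Norm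
  continuity on a whole neighbourhood provides one family that represents \<open>T\<close> at all
  nearby points, as the construction of new charts requires.\<close>

lemma mor_rep_on:
 assumes E: "banach_bundle X E" and F: "banach_bundle X F"
  and adm: "admissible X E U phi" "admissible X F V psi" and x: "x \<in> U" "x \<in> V"
  and T: "near X x (%y. mor_at X E F T y)"
 obtains B where "near X x (%y. rep X E y phi psi T B)"
proof -
 have xt: "x \<in> topspace X" by (rule admissible_topspace[OF adm(1) x(1)])
 obtain W where W: "openin X W" "x \<in> W" "\<forall>y\<in>W. mor_at X E F T y"
  using eventually_openin[OF xt T] by blast
 let ?W = "W \<inter> (U \<inter> V)"
 have op: "openin X ?W"
  by (intro openin_Int W(1) admissible_openin[OF adm(1)] admissible_openin[OF adm(2)])
 have "norm_continuous X ?W (in_charts (fibre E) phi psi T)"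
 using rep_norm_continuous[OF op] W(3) mor_at_rep[OF E F _ adm] chart_bij[OF adm(1)] by blast
 then obtain B where B: "continuous_map (subtopology X ?W) euclidean B"
  "\<And>y. y \<in> ?W ==> in_charts (fibre E) phi psi T y = blinfun_apply (B y)"
  unfolding norm_continuous_def by blast
 have eq: "\<forall>u\<in>fibre E y. psi y (T y u) = B y (phi y u)" if "y \<in> ?W" for y
  using B(2)[OF that, symmetric] that by (auto simp: in_charts_def chart_inv_left[OF adm(1)])
 have "rep X E y phi psi T B" if y: "y \<in> ?W" for y
  unfolding rep_def
 proof
  show "(B \<longlongrightarrow> B y) (nhdsin X y)" using B(1) y unfolding continuous_map_nhdsin[OF op] by blast
  show "near X y (%z. \<forall>u\<in>fibre E z. psi z (T z u) = B z (phi z u))"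
   using eventually_in_openin[OF op y] by eventually_elim (rule eq)
 qed
 moreover have "near X x (%y. y \<in> ?W)" by (rule eventually_in_openin[OF op]) (use W x in simp)
 ultimately show thesis using that eventually_mono by smt
qed

locale bbundle =
 fixes X :: "'x topology"
  and E :: "('k::real_or_complex, 'x, 'e::ab_group_add, 'm::banach) banach_bundle"
 assumes EB: "banach_bundle X E"
begin

sublocale bpair X E E by unfold_locales (rule EB)

lemma finite_dim_chart:
 assumes adm: "admissible X E U phi" "x \<in> U" and S: "S \<subseteq> fibre E x"
 shows "finite_dim (mscale E) (phi x ` S) \<longleftrightarrow> finite_dim (scale E) S"
proof
 assume "finite_dim (scale E) S"
 then show "finite_dim (mscale E) (phi x ` S)"
  using S chart_add[OF adm] chart_scale[OF adm]
  by (intro finite_dim_image[OF VE.vector_space_axioms ME.vector_space_axioms]) (auto simp: subset_iff)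
next
 have xt: "x \<in> topspace X" by (rule admissible_topspace[OF adm])
 assume M: "finite_dim (mscale E) (phi x ` S)"
 have "finite_dim (scale E) (inv_into (fibre E x) (phi x) ` phi x ` S)"
 using finite_dim_image[OF ME.vector_space_axioms VE.vector_space_axioms M] chart_inj[OF adm] by (simp add: chart_inv[OF adm] VE.subspace_add[OF subE[OF xt]] chart_add[OF adm] VE.subspace_scale[OF subE[OF xt]] chart_scale[OF adm])
 also have "inv_into (fibre E x) (phi x) ` phi x ` S = S"
  using S by (force simp: chart_inv_left[OF adm])
 finally show "finite_dim (scale E) S" .
qed

lemma chart_comb:
 assumes adm: "admissible X E U phi" "x \<in> U" and v: "\<And>i. i < n ==> v i \<in> fibre E x"
 shows "phi x (comb (scale E) n v c) = comb (mscale E) n (%i. phi x (v i)) c"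
 using v
proof (induction n)
 case 0
 show ?case using chart_zero[OF E adm] by (simp add: comb_def)
next
 case (Suc n)
 have S: "VE.subspace (fibre E x)" by (rule subE[OF admissible_topspace[OF adm]])
 show ?case
  using VE.comb_in S Suc chart_add[OF adm, of "comb (scale E) n v c" "scale E (c n) (v n)"] VE.subspace_scale[OF S] by (simp add: comb_def chart_scale[OF adm])
qed

lemma indep_chart:
 assumes adm: "admissible X E U phi" "x \<in> U" and v: "\<And>i. i < n ==> v i \<in> fibre E x"
 shows "indep (mscale E) n (%i. phi x (v i)) \<longleftrightarrow> indep (scale E) n v"
proof -
 have S: "VE.subspace (fibre E x)" by (rule subE[OF admissible_topspace[OF adm]])
 have "comb (mscale E) n (%i. phi x (v i)) c = 0 \<longleftrightarrow> comb (scale E) n v c = 0" for c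
 proof -
  have "phi x (comb (scale E) n v c) = phi x 0 \<longleftrightarrow> comb (scale E) n v c = 0"
   using v VE.comb_in S chart_inj[OF adm _ VE.subspace_0[OF S]] by auto
  moreover have "phi x (comb (scale E) n v c) = comb (mscale E) n (%i. phi x (v i)) c"
   by (rule chart_comb[OF adm v])
  ultimately show ?thesis by (simp add: chart_zero[OF E adm])
 qed
 then show ?thesis by (simp add: indep_def)
qed

text \<open>The common source of adapted charts: straighten \<open>V\<close> by operators \<open>A\<close> close to the identity.\<close>

lemma adapted_chart_if_straightened:
 assumes adm: "admissible X E U psi" "x \<in> U"
  and A: "near X x (%y. (A \<longlongrightarrow> A y) (nhdsin X y))" "A x = id_blinfun"
   "near X x (%y. klin (mscale E) (mscale E) (blinfun_apply (A y)))"
  and V: "near X x (%y. psi y ` V y = A y ` M)"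
 shows "\<exists>W phi. x \<in> W \<and> adapted_chart X E V W phi M"
proof -
 have xt: "x \<in> topspace X" by (rule admissible_topspace[OF adm])
 have "(A \<longlongrightarrow> A x) (nhdsin X x)" using eventually_nhdsin_self[OF xt A(1)] .
 then have near: "near X x (%y. norm (A y - id_blinfun) \<le> 1 / 2)"
  by (rule eventually_near_id) (rule A(2))
 define G where "G y \<longleftrightarrow> y \<in> U \<and> (A \<longlongrightarrow> A y) (nhdsin X y) \<and> klin (mscale E) (mscale E) (blinfun_apply (A y))
   \<and> psi y ` V y = A y ` M \<and> norm (A y - id_blinfun) \<le> 1 / 2" for y
 have "eventually G (nhdsin X x)"
  using A(1,3) V near admissible_eventually[OF adm] unfolding G_def by eventually_elim simp
 then obtain W where W: "openin X W" "x \<in> W" and "\<forall>y\<in>W. G y"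
  using eventually_openin[OF xt] by blast
 then have WA: "\<And>y. y \<in> W ==> y \<in> U \<and> (A \<longlongrightarrow> A y) (nhdsin X y) \<and>
   klin (mscale E) (mscale E) (blinfun_apply (A y)) \<and> psi y ` V y = A y ` M \<and> norm (A y - id_blinfun) \<le> 1 / 2"
  unfolding G_def by blast
 have WN: "norm (A y - id_blinfun) \<le> 1 / 2" if "y \<in> W" for y using WA[OF that] by blast
 \<comment> \<open>Composing with the inverse of \<open>A y\<close> sends the image of
   \<open>V y\<close> to the fixed subspace \<open>M\<close>. The transitions to and from
   \<open>psi\<close> are continuous because \<open>A\<close> and its inverse are.\<close>
 define phi where "phi y u = blinv (A y) (psi y u)" for y u
 have bc: "bundle_chart X E W phi"
  unfolding bundle_chart_def
 proof (intro conjI ballI W(1))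
  fix y assume y: "y \<in> W"
  note w = WA[OF y]
  have nr: "norm (A y - id_blinfun) \<le> 1 / 2" and yU: "y \<in> U" using w by auto
  have kl: "klin (mscale E) (mscale E) (blinv (A y))" using w by (intro blinv_klin) auto
  show "lin_on (scale E) (mscale E) (fibre E y) (phi y)"
   using kl by (auto simp: lin_on_def phi_def chart_add[OF adm(1) yU] chart_scale[OF adm(1) yU] blinfun.add_right klin_def)
  have "bij_betw (blinfun_apply (blinv (A y)) \<circ> psi y) (fibre E y) UNIV"
   using blinv_near_id(1)[OF nr] bij_imp_bij_inv bij_betw_trans[OF chart_bij[OF adm(1) yU]] by (auto simp: blinv_near_id(2)[OF nr])
  moreover have "phi y = blinfun_apply (blinv (A y)) \<circ> psi y" by (simp add: phi_def fun_eq_iff)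
  ultimately show "bij_betw (phi y) (fibre E y) UNIV" by simp
 qed
 have evW: "near X y (%z. z \<in> W)" if "y \<in> W" for y by (rule eventually_in_openin[OF W(1) that])
 have r1: "rep X E y phi psi (%y u. u) A" if "y \<in> W" for y
  unfolding rep_def
 proof
  show "(A \<longlongrightarrow> A y) (nhdsin X y)" using WA[OF that] by blast
  show "near X y (%y. \<forall>u\<in>fibre E y. psi y u = A y (phi y u))"
   using evW[OF that] by eventually_elim (simp add: phi_def blinv_near_id(4)[OF WN])
 qed
 have r2: "rep X E y psi phi (%y u. u) (%y. blinv (A y))" if "y \<in> W" for y
  unfolding rep_def
 proof
  show "((%y. blinv (A y)) \<longlongrightarrow> blinv (A y)) (nhdsin X y)"
  proof (rule tendsto_blinv)
   show "(A \<longlongrightarrow> A y) (nhdsin X y)" using WA[OF that] by blast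
   show "norm (A y - id_blinfun) \<le> 1 / 2" by (rule WN[OF that])
   show "near X y (%y. norm (A y - id_blinfun) \<le> 1 / 2)"
    using evW[OF that] by eventually_elim (rule WN)
  qed
  show "near X y (%y. \<forall>u\<in>fibre E y. phi y u = (blinv (A y)) (psi y u))" by (simp add: phi_def)
 qed
 have compat: "charts_compatible X E W phi W' \<theta>" if c: "(W', \<theta>) \<in> atlas E" for W' \<theta>
 proof -
  have admc: "admissible X E W' \<theta>" by (rule admissible_atlas[OF E c])
  have op: "openin X (W \<inter> W')" by (intro openin_Int W(1) admissible_openin[OF admc])
  show ?thesis
   unfolding charts_compatible_def
  proof (intro conjI rep_norm_continuous[OF op])
   fix y assume y: "y \<in> W \<inter> W'"
   then have yW: "y \<in> W" "y \<in> W'" and yU: "y \<in> U" using WA by auto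
   obtain B where B: "rep X E y psi \<theta> (%y u. u) B" using rep_id[OF E adm(1) admc yU yW(2)] ..
   obtain C where C: "rep X E y \<theta> psi (%y u. u) C" using rep_id[OF E admc adm(1) yW(2) yU] ..
   show "\<exists>B. rep X E y phi \<theta> (%y u. u) B" using rep_comp[OF r1[OF yW(1)] B] by auto
   show "\<exists>B. rep X E y \<theta> phi (%y u. u) B" using rep_comp[OF C r2[OF yW(1)]] by auto
   show "bij_betw (phi y) (fibre E y) UNIV" using bc yW(1) unfolding bundle_chart_def by blast
   show "bij_betw (\<theta> y) (fibre E y) UNIV" by (rule chart_bij[OF admc yW(2)])
  qed
 qed
 have "phi y ` V y = M" if "y \<in> W" for y
 proof -
  have "phi y ` V y = blinv (A y) ` (psi y ` V y)" by (simp add: phi_def image_image)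
  also have "\<dots> = M" using WA[OF that] by (simp add: image_image blinv_near_id(5))
  finally show ?thesis .
 qed
 then have "adapted_chart X E V W phi M"
  unfolding adapted_chart_def using bc compat by auto
 then show ?thesis using W(2) by blast
qed

definition local_frame :: "('x => 'e set) => 'x => nat => ('x => nat => 'e) => bool" where
 "local_frame V x n b \<longleftrightarrow>
   (near X x (%y. (\<forall>i<n. sec_at X E (%z. b z i) y) \<and> frame (scale E) n (b y) (V y)))"

lemma adapted_admissible: "adapted_chart X E V U phi M ==> admissible X E U phi"
 and adapted_image: "adapted_chart X E V U phi M ==> y \<in> U ==> phi y ` V y = M"
 by (auto simp: adapted_chart_def admissible_def)

lemma subbundle_subset: "findim_subbundle X E V ==> x \<in> topspace X ==> V x \<subseteq> fibre E x"
 unfolding findim_subbundle_def by blast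

lemma subbundle_chart:
 assumes "findim_subbundle X E V" "x \<in> topspace X"
 obtains U phi M where "x \<in> U" "adapted_chart X E V U phi M" "finite_dim (mscale E) M"
 using assms unfolding findim_subbundle_def by blast

lemma subbundle_finite_dim:
 assumes V: "findim_subbundle X E V" and x: "x \<in> topspace X"
 shows "finite_dim (scale E) (V x)"
by (metis subbundle_chart[OF V x] finite_dim_chart[OF adapted_admissible _ subbundle_subset[OF V x]] adapted_image)

lemma subbundle_subspace: "findim_subbundle X E V ==> x \<in> topspace X ==> VE.subspace (V x)"
 using subbundle_finite_dim VE.finite_dim_subspace by blast

lemma adapted_frame:
 assumes c: "adapted_chart X E V U phi M" and sub: "\<And>y. y \<in> U ==> V y \<subseteq> fibre E y"
  and M: "frame (mscale E) n e M" and y: "y \<in> U"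
 shows "frame (scale E) n (%i. inv_into (fibre E y) (phi y) (e i)) (V y)"
proof -
 note adm = adapted_admissible[OF c]
 let ?b = "%i. inv_into (fibre E y) (phi y) (e i)"
 have b: "?b i \<in> fibre E y" "phi y (?b i) = e i" for i using chart_inv[OF adm y] by auto
 have "indep (scale E) n ?b"
  using indep_chart[OF adm y, of n ?b] b M by (simp add: frame_def)
 moreover have "range (comb (scale E) n ?b) = V y"
 proof -
  have cf: "comb (scale E) n ?b c \<in> fibre E y" for c
   using b VE.comb_in subE[OF admissible_topspace[OF adm y]] by simp
  have ch: "phi y (comb (scale E) n ?b c) = comb (mscale E) n e c" for c
   using chart_comb[OF adm y, of n ?b c] b by simp
  have im: "phi y ` range (comb (scale E) n ?b) = phi y ` V y"
   unfolding adapted_image[OF c y] using M by (simp add: image_image ch frame_def)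
  show ?thesis
  proof (rule inj_on_image_eq_iff[THEN iffD1, OF _ _ _ im])
   show "inj_on (phi y) (fibre E y)" using chart_bij[OF adm y] by (rule bij_betw_imp_inj_on)
  qed (use cf sub[OF y] in auto)
 qed
 ultimately show ?thesis by (simp add: frame_def)
qed

lemma subbundle_frame:
 assumes V: "findim_subbundle X E V" and x: "x \<in> topspace X"
 obtains n b where "local_frame V x n b"
proof -
 obtain U phi M where c: "x \<in> U" "adapted_chart X E V U phi M" "finite_dim (mscale E) M"
  by (rule subbundle_chart[OF V x])
 note adm = adapted_admissible[OF c(2)]
 obtain n e where e: "frame (mscale E) n e M" using c(3) unfolding ME.finite_dim_frame by blast
 have "local_frame V x n (%y i. inv_into (fibre E y) (phi y) (e i))"
  unfolding local_frame_def using admissible_eventually[OF adm c(1)]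
 proof eventually_elim
  case (elim y)
  show ?case
   using sec_at_chart[OF adm elim] adapted_frame[OF c(2) subbundle_subset[OF V admissible_topspace[OF adm]] e elim] by blast
 qed
 then show thesis by (rule that)
qed

text \<open>The frame at \<open>x\<close>, read in a chart, has biorthogonal functionals
  \<open>a i\<close>. Adding rank one corrections to the identity gives operators near the identity
  that send the frame at \<open>x\<close> to the frame at \<open>y\<close>, as
  \<open>adapted_chart_if_straightened\<close> requires.\<close>

lemma frame_subbundle:
 assumes fr: "\<And>x. x \<in> topspace X ==> \<exists>n b. local_frame V x n b"
 shows "findim_subbundle X E V"
 unfolding findim_subbundle_def
proof (intro conjI ballI)
 fix x assume x: "x \<in> topspace X"
 obtain n b where nb: "local_frame V x n b" using fr[OF x] by blast
 have fx: "frame (scale E) n (b x) (V x)" and bx: "\<And>i. i < n ==> sec_at X E (%z. b z i) x"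
  using eventually_nhdsin_self[OF x nb[unfolded local_frame_def]] by auto
 have bf: "b x i \<in> fibre E x" if "i < n" for i using sec_at_fibre[OF bx[OF that] x] .
 show "V x \<subseteq> fibre E x"
 using fx VE.comb_in[OF subE[OF x] bf] by (force simp: frame_def)
 obtain U psi where adm: "admissible X E U psi" "x \<in> U" using exists_admissible[OF E x] by blast
 let ?e = "%i. psi x (b x i)"
 have ind: "indep (mscale E) n ?e" using indep_chart[OF adm bf] fx by (simp add: frame_def)
 obtain a where a: "dual (mscale E) n ?e a" using ME.exists_dual[OF ind] ..
 define A where "A y = id_blinfun + (\<Sum>i<n. rank_one (mscale E) (a i) (psi y (b y i) - ?e i))" for y
 have Av: "A y v = v + (\<Sum>i<n. mscale E (a i v) (psi y (b y i) - ?e i))" for y v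
  by (simp add: A_def blinfun.add_left blinfun.sum_left ME.rank_one_apply)
 have Ae: "A y (comb (mscale E) n ?e c) = comb (mscale E) n (%i. psi y (b y i)) c" for y c
 proof -
  have "(\<Sum>i<n. mscale E (a i (comb (mscale E) n ?e c)) (psi y (b y i) - ?e i))
    = (\<Sum>i<n. mscale E (c i) (psi y (b y i) - ?e i))"
   by (intro sum.cong) (auto simp: ME.dual_comb[OF a])
  then show ?thesis
   by (simp add: Av ME.scale_right_diff_distrib sum_subtractf comb_def)
 qed
 let ?M = "range (comb (mscale E) n ?e)"
 have "\<exists>W phi. x \<in> W \<and> adapted_chart X E V W phi ?M"
 proof (rule adapted_chart_if_straightened[OF adm])
  show "near X x (%y. (A \<longlongrightarrow> A y) (nhdsin X y))"
   using nb[unfolded local_frame_def] admissible_eventually[OF adm]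
  proof eventually_elim
   case (elim y)
   show ?case unfolding A_def
    using sec_at_adm[OF _ adm(1) elim(2)] elim(1)
    by (intro tendsto_intros ME.tendsto_rank_one) blast
  qed
  show "A x = id_blinfun" by (rule blinfun_eqI) (simp add: Av)
  show "near X x (%y. klin (mscale E) (mscale E) (blinfun_apply (A y)))"
  using a by (simp add: klin_def ME.scale_sum_right dual_def Av ME.scale_right_distrib)
  show "near X x (%y. psi y ` V y = A y ` ?M)"
   using nb[unfolded local_frame_def] admissible_eventually[OF adm]
  proof eventually_elim
   case (elim y)
   have yt: "y \<in> topspace X" by (rule admissible_topspace[OF adm(1) elim(2)])
   have "b y i \<in> fibre E y" if "i < n" for i using sec_at_fibre[of "%z. b z i" y] elim(1) that yt by simp
   then have "psi y ` range (comb (scale E) n (b y)) = A y ` ?M"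
    by (simp add: image_image Ae chart_comb[OF adm(1) elim(2)])
   then show ?case using elim(1) by (simp add: frame_def)
  qed
 qed
 then show "\<exists>U phi M. x \<in> U \<and> adapted_chart X E V U phi M \<and> finite_dim (mscale E) M"
  using ME.finite_dim_comb by blast
qed

text \<open>A continuous family of projections is straightened by
  \<open>B y B x + (1 - B y) (1 - B x)\<close>, which is the identity at \<open>y = x\<close> and
  intertwines \<open>B x\<close> with \<open>B y\<close>.\<close>

lemma idempotent_subbundle:
 assumes Q: "\<And>x. x \<in> topspace X ==> mor_at X E E Q x"
  and V: "\<And>x u. x \<in> topspace X ==> u \<in> fibre E x ==> Q x u \<in> V x"
   "\<And>x u. x \<in> topspace X ==> u \<in> V x ==> u \<in> fibre E x \<and> Q x u = u"
  and fd: "\<And>x. x \<in> topspace X ==> finite_dim (scale E) (V x)"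
 shows "findim_subbundle X E V"
 unfolding findim_subbundle_def
proof (intro conjI ballI)
 fix x assume x: "x \<in> topspace X"
 show Vx: "V x \<subseteq> fibre E x" using V(2)[OF x] by blast
 obtain U psi where adm: "admissible X E U psi" "x \<in> U" using exists_admissible[OF E x] by blast
 have top: "near X x (%y. y \<in> topspace X)" by (rule eventually_in_openin[OF openin_topspace x])
 have "near X x (%y. mor_at X E E Q y)" using top by eventually_elim (rule Q)
 then obtain B where B: "near X x (%y. rep X E y psi psi Q B)"
  by (rule mor_rep_on[OF E E adm(1,1) adm(2,2)])
 have Bx: "near X x (%y. \<forall>u\<in>fibre E y. psi y (Q y u) = B y (psi y u))"
  by (rule rep_eventually[OF eventually_nhdsin_self[OF x B]])
 have imB: "psi y ` V y = range (B y) \<and> (\<forall>v. B y (B y v) = B y v)"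
  if y: "y \<in> U" and eq: "\<forall>u\<in>fibre E y. psi y (Q y u) = B y (psi y u)" for y
 proof -
  have yt: "y \<in> topspace X" by (rule admissible_topspace[OF adm(1) y])
  have Bv: "\<exists>w\<in>V y. B y v = psi y w" for v
  using chart_inv[OF adm(1) y, of v] eq V(1)[OF yt] by force
  have BV: "B y (psi y w) = psi y w" if "w \<in> V y" for w
   using V(2)[OF yt that] eq by (metis)
  show ?thesis
  proof (intro conjI allI)
   show "psi y ` V y = range (B y)"
   proof
    show "psi y ` V y \<subseteq> range (B y)" by (metis BV image_subsetI rangeI)
    show "range (B y) \<subseteq> psi y ` V y" using Bv by blast
   qed
   fix v
   obtain w where "w \<in> V y" "B y v = psi y w" using Bv by blast
   then show "B y (B y v) = B y v" using BV by simp
  qed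
 qed
 have evB: "near X x (%y. psi y ` V y = range (B y) \<and> (\<forall>v. B y (B y v) = B y v))"
  using Bx admissible_eventually[OF adm] by eventually_elim (rule imB)
 have B0: "psi x ` V x = range (B x)" "\<And>v. B x (B x v) = B x v"
  using eventually_nhdsin_self[OF x evB] by auto
 define A where "A y = (B y o\<^sub>L B x) + ((id_blinfun - B y) o\<^sub>L (id_blinfun - B x))" for y
 have Av: "A y v = B y (B x v) + ((v - B x v) - B y (v - B x v))" for y v
  by (simp add: A_def blinfun.add_left blinfun.diff_left)
 have Acont: "near X x (%y. (A \<longlongrightarrow> A y) (nhdsin X y))"
  using B
 proof eventually_elim
  case (elim y)
  show ?case unfolding A_def using rep_tendsto[OF elim]
   by (intro tendsto_add tendsto_diff tendsto_const bounded_bilinear.tendsto[OF bounded_bilinear_blinfun_compose])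
 qed
 have Aid: "A x = id_blinfun" by (rule blinfun_eqI) (simp add: Av B0(2) blinfun.diff_right)
 have Bk: "near X x (%y. klin (mscale E) (mscale E) (B y))"
  by (rule mor_rep_klin[OF Q[OF x] adm(1,1) adm(2,2) eventually_nhdsin_self[OF x B]])
 have Bkx: "klin (mscale E) (mscale E) (B x)" by (rule eventually_nhdsin_self[OF x Bk])
 have "\<exists>W phi. x \<in> W \<and> adapted_chart X E V W phi (range (B x))"
 proof (rule adapted_chart_if_straightened[OF adm Acont Aid])
  show "near X x (%y. klin (mscale E) (mscale E) (A y))"
   using Bk
  proof eventually_elim
   case (elim y)
   then show ?case using Bkx
    by (simp add: klin_def Av ME.scale_right_distrib ME.scale_right_diff_distrib blinfun.diff_right)
  qed
  have near: "near X x (%y. norm (A y - id_blinfun) \<le> 1 / 2)"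
   by (rule eventually_near_id[OF eventually_nhdsin_self[OF x Acont] Aid])
  show "near X x (%y. psi y ` V y = A y ` range (B x))"
   using evB near
  proof eventually_elim
   case (elim y)
   \<comment> \<open>The intertwining relation \<open>A y B x = B y A y\<close>. As
     \<open>A y\<close> is invertible, it maps the range of \<open>B x\<close> onto the range of
     \<open>B y\<close>.\<close>
   have comm: "A y (B x v) = B y (A y v)" for v
    using elim(1) B0(2) by (simp add: Av blinfun.add_right blinfun.diff_right)
   have "range (B y) = A y ` range (B x)"
   proof
    show "range (B y) \<subseteq> A y ` range (B x)"
    proof
     fix w assume "w \<in> range (B y)"
     then have "B y w = w" using elim(1) by auto
     then have "w = A y (B x (blinv (A y) w))" by (simp add: comm blinv_near_id(4)[OF elim(2)])
     then show "w \<in> A y ` range (B x)" by blast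
    qed
    show "A y ` range (B x) \<subseteq> range (B y)" by (auto simp: comm)
   qed
   then show ?case using elim(1) by simp
  qed
 qed
 moreover have "finite_dim (mscale E) (range (B x))"
  using finite_dim_chart[OF adm Vx] fd[OF x] B0(1) by simp
 ultimately show "\<exists>U phi M. x \<in> U \<and> adapted_chart X E V U phi M \<and> finite_dim (mscale E) M" by blast
qed

text \<open>A projection exists locally in an adapted chart, and the projections onto a fixed
  subspace form a convex set, so they glue.\<close>

lemma subbundle_projection:
 assumes X: "compact_space X" "Hausdorff_space X" and V: "findim_subbundle X E V"
 obtains P where "\<And>x. x \<in> topspace X ==> mor_at X E E P x"
  "\<And>x u. x \<in> topspace X ==> u \<in> fibre E x ==> P x u \<in> V x"
  "\<And>x u. x \<in> topspace X ==> u \<in> V x ==> P x u = u"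
proof -
 let ?Q = "%y T. (\<forall>u\<in>fibre E y. T u \<in> V y) \<and> (\<forall>u\<in>V y. T u = u)"
 have "\<exists>P. (\<forall>x\<in>topspace X. mor_at X E E P x) \<and> (\<forall>y\<in>topspace X. ?Q y (P y))"
 proof (rule mor_glue[OF X])
  fix x assume x: "x \<in> topspace X"
  obtain U phi M where c: "x \<in> U" "adapted_chart X E V U phi M" "finite_dim (mscale E) M"
   by (rule subbundle_chart[OF V x])
  note adm = adapted_admissible[OF c(2)]
  obtain p where p: "klin (mscale E) (mscale E) (blinfun_apply p)" "\<And>v. p v \<in> M" "\<And>v. v \<in> M ==> p v = v"
   by (rule ME.finite_dim_projection[OF c(3)]) (rule that; assumption)
  let ?T = "%y u. inv_into (fibre E y) (phi y) (p (phi y u))"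
  have "near X x (%y. mor_at X E E ?T y \<and> ?Q y (?T y))"
   using admissible_eventually[OF adm c(1)]
  proof eventually_elim
   case (elim y)
   have yt: "y \<in> topspace X" by (rule admissible_topspace[OF adm elim])
   have VM: "phi y u \<in> M \<longleftrightarrow> u \<in> V y" if "u \<in> fibre E y" for u
    using adapted_image[OF c(2) elim] chart_inj[OF adm elim that] subbundle_subset[OF V yt] by blast
   note i = chart_inv[OF adm elim]
   have "mor_at X E E ?T y"
    using mor_at_chartI[OF adm adm elim elim, of "%y. p"] p(1) by simp
   moreover have "?T y u \<in> V y" if "u \<in> fibre E y" for u
    using VM[OF i(1)] i(2) p(2) by simp
   moreover have "?T y u = u" if u: "u \<in> V y" for u
   proof -
    have uf: "u \<in> fibre E y" using subbundle_subset[OF V yt] u by blast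
    show ?thesis using p(3) VM[OF uf] u chart_inv_left[OF adm elim uf] by simp
   qed
   ultimately show ?case by blast
  qed
  then show "\<exists>T. near X x (%y. mor_at X E E T y \<and> ?Q y (T y))" by (rule exI[of _ ?T])
 next
  fix y :: 'x and I :: "'x set" and rho :: "'x => real" and T :: "'x => 'e => 'e"
  assume y: "y \<in> topspace X" and I: "finite I" "sum rho I = 1" and T: "\<And>i. i \<in> I ==> rho i \<noteq> 0 ==> ?Q y (T i)"
  have VS: "VE.subspace (V y)" by (rule subbundle_subspace[OF V y])
  show "?Q y (%u. \<Sum>i\<in>I. scale E (of_real (rho i)) (T i u))"
  proof (intro conjI ballI)
   fix u assume u: "u \<in> fibre E y"
   have "scale E (of_real (rho i)) (T i u) \<in> V y" if "i \<in> I" for i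
    using T[OF that] u VE.subspace_0[OF VS] VE.subspace_scale[OF VS] by (cases "rho i = 0") auto
   then show "(\<Sum>i\<in>I. scale E (of_real (rho i)) (T i u)) \<in> V y" by (rule VE.subspace_sum[OF VS])
  next
   fix u assume u: "u \<in> V y"
   have "scale E (of_real (rho i)) (T i u) = scale E (of_real (rho i)) u" if "i \<in> I" for i
    using T[OF that] u by (cases "rho i = 0") auto
   then have "(\<Sum>i\<in>I. scale E (of_real (rho i)) (T i u)) = (\<Sum>i\<in>I. scale E (of_real (rho i)) u)"
    by (intro sum.cong) auto
   also have "\<dots> = scale E (of_real (sum rho I)) u" by (simp add: VE.scale_sum_left)
   finally show "(\<Sum>i\<in>I. scale E (of_real (rho i)) (T i u)) = u" using I(2) by simp
  qed
 qed
 then show thesis using that by blast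
qed

end

section \<open>Right inverses and the index bundle\<close>

context bpair
begin

text \<open>Put \<open>T = (1 - P) L\<close>; fibrewise its range is the kernel of \<open>P\<close>.
  A right inverse at one point becomes one at nearby points after correction by the inverse of an
  operator close to the identity. The solutions \<open>S\<close> of \<open>T S = 1 - P\<close> form
  an affine space, so they glue.\<close>

lemma transversal_right_inverse:
 assumes X: "compact_space X" "Hausdorff_space X"
  and L: "\<And>x. x \<in> topspace X ==> mor_at X E F L x"
  and ker: "\<And>x. x \<in> topspace X ==> finite_dim (scale E) {u \<in> fibre E x. L x u = 0}"
  and V: "findim_subbundle X F V"
  and P: "\<And>x. x \<in> topspace X ==> mor_at X F F P x"
   "\<And>x u. x \<in> topspace X ==> u \<in> fibre F x ==> P x u \<in> V x"
   "\<And>x u. x \<in> topspace X ==> u \<in> V x ==> P x u = u"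
  and trans: "transversal X E F L V"
 obtains R where "\<And>x. x \<in> topspace X ==> mor_at X F E R x"
  "\<And>x w. x \<in> topspace X ==> w \<in> fibre F x ==> L x (R x w) - P x (L x (R x w)) = w - P x w"
  "\<And>x v. x \<in> topspace X ==> v \<in> V x ==> R x v = 0"
proof -
 interpret FE: bpair X F E by unfold_locales (rule F, rule E)
 interpret EE: bbundle X E by unfold_locales (rule E)
 interpret FF: bbundle X F by unfold_locales (rule F)
 define T where "T y u = L y u - P y (L y u)" for y u
 have VF: "V x \<subseteq> fibre F x" if "x \<in> topspace X" for x by (rule FF.subbundle_subset[OF V that])
 have VS: "VF.subspace (V x)" if "x \<in> topspace X" for x by (rule FF.subbundle_subspace[OF V that])
 have T: "mor_at X E F T x" if "x \<in> topspace X" for x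
  unfolding T_def using that by (intro mor_at_diff L mor_at_comp[OF E F F L P(1)])
 have Lf: "L x u \<in> fibre F x" if "x \<in> topspace X" "u \<in> fibre E x" for x u
  by (rule mor_at_fibre[OF L[OF that(1)] that])
 have PT: "P x (T x u) = 0" if "x \<in> topspace X" "u \<in> fibre E x" for x u
 using that Lf[OF that] P(2)[OF that(1) Lf[OF that]] VF[OF that(1)] FF.mor_at_diff_arg P(1) P(3)[OF that(1) P(2)[OF that(1) Lf[OF that]]] by (fastforce simp: T_def)
 let ?Q = "%y S. (\<forall>w\<in>fibre F y. S w \<in> fibre E y) \<and> (\<forall>w\<in>fibre F y. T y (S w) = w - P y w)"
 have "\<exists>S. (\<forall>x\<in>topspace X. mor_at X F E S x) \<and> (\<forall>y\<in>topspace X. ?Q y (S y))"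
 proof (rule FE.mor_glue[OF X])
  fix x assume x: "x \<in> topspace X"
  obtain U phi W psi where c: "admissible X E U phi" "x \<in> U" "admissible X F W psi" "x \<in> W" by (rule obtain_charts[OF x])
  have top: "near X x (%y. y \<in> topspace X)" by (rule eventually_in_openin[OF openin_topspace x])
  have "near X x (%y. mor_at X E F T y)" using top by eventually_elim (rule T)
  then obtain B where B: "near X x (%y. rep X E y phi psi T B)"
   by (rule mor_rep_on[OF E F c(1,3,2,4)])
  have "near X x (%y. mor_at X F F P y)" using top by eventually_elim (rule P(1))
  then obtain p where p: "near X x (%y. rep X F y psi psi P p)"
   by (rule mor_rep_on[OF F F c(3,3,4,4)])
  note Bx = eventually_nhdsin_self[OF x B] and px = eventually_nhdsin_self[OF x p]
  have fact: "(\<forall>v. p y (p y v) = p y v) \<and> (\<forall>v. p y (B y v) = 0)"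
   if y: "y \<in> U" "y \<in> W" "\<forall>u\<in>fibre E y. psi y (T y u) = B y (phi y u)" "\<forall>w\<in>fibre F y. psi y (P y w) = p y (psi y w)" for y
  proof (intro conjI allI)
   have yt: "y \<in> topspace X" by (rule admissible_topspace[OF c(1) y(1)])
   fix v
   note i = chart_inv[OF c(3) y(2), of v]
   have Pf: "P y (inv_into (fibre F y) (psi y) v) \<in> V y" by (rule P(2)[OF yt i(1)])
   have "p y v = psi y (P y (inv_into (fibre F y) (psi y) v))" using y(4) i by simp
   moreover have "p y (psi y (P y (inv_into (fibre F y) (psi y) v))) = psi y (P y (P y (inv_into (fibre F y) (psi y) v)))"
    using y(4) Pf VF[OF yt] by auto
   ultimately show "p y (p y v) = p y v" using P(3)[OF yt Pf] by simp
  next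
   have yt: "y \<in> topspace X" by (rule admissible_topspace[OF c(1) y(1)])
   fix v
   note i = chart_inv[OF c(1) y(1), of v]
   have "p y (B y v) = p y (psi y (T y (inv_into (fibre E y) (phi y) v)))" using y(3) i by simp
   also have "\<dots> = psi y (P y (T y (inv_into (fibre E y) (phi y) v)))"
    using y(4) mor_at_fibre[OF T[OF yt] yt i(1)] by simp
   also have "\<dots> = 0" using PT[OF yt i(1)] chart_zero[OF F c(3) y(2)] by simp
   finally show "p y (B y v) = 0" .
  qed
  have evB: "near X x (%y. \<forall>u\<in>fibre E y. psi y (T y u) = B y (phi y u))" by (rule rep_eventually[OF Bx])
  have evp: "near X x (%y. \<forall>w\<in>fibre F y. psi y (P y w) = p y (psi y w))" by (rule rep_eventually[OF px])
  note eB = eventually_nhdsin_self[OF x evB] and ep = eventually_nhdsin_self[OF x evp]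
  note f0 = fact[OF c(2,4) eB ep]
  have Bk: "klin (mscale E) (mscale F) (B x)"
   by (rule eventually_nhdsin_self[OF x mor_rep_klin[OF T[OF x] c(1,3,2,4) Bx]])
  have pk: "near X x (%y. klin (mscale F) (mscale F) (p y))"
   by (rule FF.mor_rep_klin[OF P(1)[OF x] c(3,3,4,4) px])
  have kerB: "finite_dim (mscale E) {v. B x v = 0}"
  proof -
   have "finite_dim (scale E) {u \<in> fibre E x. L x u \<in> V x}"
    using mor_at_add_arg[OF L[OF x] x] mor_at_scale_arg[OF L[OF x] x]
    by (intro finite_dim_preimage[OF VE.vector_space_axioms VF.vector_space_axioms subE[OF x] FF.subbundle_finite_dim[OF V x]] ker x)
   moreover have "{u \<in> fibre E x. L x u \<in> V x} = {u \<in> fibre E x. T x u = 0}"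
    using P(2,3)[OF x] Lf[OF x] unfolding T_def by force
   ultimately have "finite_dim (mscale E) (phi x ` {u \<in> fibre E x. T x u = 0})"
    by (simp add: EE.finite_dim_chart[OF c(1,2)])
   moreover have "phi x ` {u \<in> fibre E x. T x u = 0} = {v. B x v = 0}"
   proof
    show "phi x ` {u \<in> fibre E x. T x u = 0} \<subseteq> {v. B x v = 0}"
     using eB chart_zero[OF F c(3,4)] by force
    show "{v. B x v = 0} \<subseteq> phi x ` {u \<in> fibre E x. T x u = 0}"
    proof
     fix v assume "v \<in> {v. B x v = 0}"
     note i = chart_inv[OF c(1,2), of v]
     have "psi x (T x (inv_into (fibre E x) (phi x) v)) = psi x 0"
      using eB i \<open>v \<in> _\<close> chart_zero[OF F c(3,4)] by simp
     then have "T x (inv_into (fibre E x) (phi x) v) = 0"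
      by (rule chart_inj[OF c(3,4) mor_at_fibre[OF T[OF x] x i(1)] VF.subspace_0[OF subF[OF x]]])
     then show "v \<in> phi x ` {u \<in> fibre E x. T x u = 0}"
      using i by (intro image_eqI[of _ _ "inv_into (fibre E x) (phi x) v"]) auto
    qed
   qed
   ultimately show ?thesis by simp
  qed
  have onto: "\<exists>u. B x u = w - p x w" for w
  proof -
   note i = chart_inv[OF c(3,4), of w]
   let ?w = "inv_into (fibre F x) (psi x) w"
   obtain u v where uv: "u \<in> fibre E x" "v \<in> V x" "?w = L x u + v"
    using trans x i(1) unfolding transversal_def by blast
   have vf: "v \<in> fibre F x" using VF[OF x] uv(2) by blast
   have "T x u = ?w - P x ?w"
    using FF.mor_at_add_arg[OF P(1)[OF x] x Lf[OF x uv(1)] vf] P(3)[OF x uv(2)] by (simp add: uv(3) T_def)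
   moreover have "?w = (?w - P x ?w) + P x ?w" by simp
   moreover have Pw: "P x ?w \<in> fibre F x" using P(2)[OF x i(1)] VF[OF x] by blast
   ultimately have "psi x ?w = psi x (T x u) + psi x (P x ?w)"
    using chart_add[OF c(3,4) mor_at_fibre[OF T[OF x] x uv(1)] Pw] by simp
   then have "B x (phi x u) = w - p x w" using i eB ep uv(1) by (simp add: algebra_simps)
   then show ?thesis ..
  qed
  obtain R0 :: "'n \<Rightarrow>\<^sub>L 'm" where R0: "klin (mscale F) (mscale E) (blinfun_apply R0)" "\<And>w. B x (R0 w) = w - p x w"
   by (rule right_inverse_mod_projection[OF ME.banach_scale MF.banach_scale Bk kerB
      eventually_nhdsin_self[OF x pk] _ _ onto]) (use f0 that in auto)
  \<comment> \<open>\<open>C\<close> is the identity at \<open>x\<close>, hence invertible nearby.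
    The summand \<open>p\<close> supplies the directions missed by \<open>B R0\<close>, which
    reaches only the kernel of \<open>p\<close>.\<close>
  define C where "C y = (B y o\<^sub>L R0) + p y" for y
  have Cid: "C x = id_blinfun" by (rule blinfun_eqI) (simp add: C_def blinfun.add_left R0(2))
  have Ccont: "near X x (%y. (C \<longlongrightarrow> C y) (nhdsin X y))"
   using B p
  proof eventually_elim
   case (elim y)
   show ?case unfolding C_def using rep_tendsto[OF elim(1)] rep_tendsto[OF elim(2)]
    by (intro tendsto_add tendsto_const bounded_bilinear.tendsto[OF bounded_bilinear_blinfun_compose])
  qed
  have near: "near X x (%y. norm (C y - id_blinfun) \<le> 1 / 2)"
   by (rule eventually_near_id[OF eventually_nhdsin_self[OF x Ccont] Cid])
  have Bky: "near X x (%y. klin (mscale E) (mscale F) (B y))"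
   by (rule mor_rep_klin[OF T[OF x] c(1,3,2,4) Bx])
  \<comment> \<open>Correcting \<open>R0\<close> by the inverse of \<open>C\<close> makes
    \<open>B y (D y w) = w - p y w\<close> hold near \<open>x\<close> and not only at
    \<open>x\<close>.\<close>
  define D where "D y = R0 o\<^sub>L blinv (C y) o\<^sub>L (id_blinfun - p y)" for y
  have Dk: "near X x (%y. klin (mscale F) (mscale E) (D y))"
   using Bky pk near
  proof eventually_elim
   case (elim y)
   have "klin (mscale F) (mscale F) (C y)"
    using elim(1,2) R0(1) by (simp add: C_def klin_def blinfun.add_left MF.scale_right_distrib)
   then have "klin (mscale F) (mscale F) (blinv (C y))" using elim(3) by (rule blinv_klin)
   then show ?case using elim(2) R0(1)
    by (simp add: D_def klin_def blinfun.diff_left flip: MF.scale_right_diff_distrib)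
  qed
  have Dcont: "near X x (%y. (D \<longlongrightarrow> D y) (nhdsin X y))"
   using Ccont near eventually_eventually_nhdsin[OF near] p
  proof eventually_elim
   case (elim y)
   show ?case unfolding D_def using rep_tendsto[OF elim(4)]
    by (intro tendsto_diff tendsto_const bounded_bilinear.tendsto[OF bounded_bilinear_blinfun_compose] tendsto_blinv elim)
  qed
  let ?S = "%y w. inv_into (fibre E y) (phi y) (D y (psi y w))"
  have "near X x (%y. mor_at X F E ?S y \<and> ?Q y (?S y))"
   using Dcont eventually_eventually_nhdsin[OF Dk] admissible_eventually[OF c(1,2)] admissible_eventually[OF c(3,4)] evB evp near
  proof eventually_elim
   case (elim y)
   have yt: "y \<in> topspace X" by (rule admissible_topspace[OF c(1) elim(3)])
   note f = fact[OF elim(3,4,5,6)]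
   have m: "mor_at X F E ?S y" by (rule FE.mor_at_chartI[OF c(3,1) elim(4,3,1,2)])
   have "T y (?S y w) = w - P y w" if w: "w \<in> fibre F y" for w
   proof (rule chart_inj[OF c(3) elim(4)])
    note i = chart_inv[OF c(1) elim(3), of "D y (psi y w)"]
    have Pw: "P y w \<in> fibre F y" using P(2)[OF yt w] VF[OF yt] by blast
    show wf: "w - P y w \<in> fibre F y" by (rule VF.subspace_diff[OF subF[OF yt] w Pw])
    show "T y (?S y w) \<in> fibre F y" by (rule mor_at_fibre[OF T[OF yt] yt i(1)])
    define r where "r = psi y w - p y (psi y w)"
    define z where "z = blinv (C y) r"
    have Cz: "B y (R0 z) + p y z = r"
     using blinv_near_id(4)[OF elim(7)] by (simp add: z_def C_def blinfun.add_left)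
    \<comment> \<open>Applying \<open>p y\<close> separates the summands: it kills the range of
      \<open>B y\<close> and the vector \<open>r\<close>, which leaves
      \<open>p y z = 0\<close>.\<close>
    then have "p y (B y (R0 z)) + p y (p y z) = p y r" by (metis blinfun.add_right)
    then have "p y z = 0" using f by (simp add: r_def blinfun.diff_right)
    then have "B y (R0 z) = r" using Cz by simp
    moreover have "D y (psi y w) = R0 z" by (simp add: D_def z_def r_def blinfun.diff_left)
    ultimately have "psi y (T y (?S y w)) = r" using elim(5) i by simp
    moreover have "psi y (w - P y w) = r"
     using chart_add[OF c(3) elim(4) wf Pw] elim(6) w by (simp add: r_def eq_diff_eq)
    ultimately show "psi y (T y (?S y w)) = psi y (w - P y w)" by simp
   qed
   then show ?case using m chart_inv(1)[OF c(1) elim(3)] by blast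
  qed
  then show "\<exists>S. near X x (%y. mor_at X F E S y \<and> ?Q y (S y))" by (rule exI[of _ ?S])
 next
  fix y :: 'x and I :: "'x set" and rho :: "'x => real" and S :: "'x => 'f => 'e"
  assume y: "y \<in> topspace X" and I: "finite I" "sum rho I = 1" and S: "\<And>i. i \<in> I ==> rho i \<noteq> 0 ==> ?Q y (S i)"
  have Sf: "scale E (of_real (rho i)) (S i w) \<in> fibre E y" if "i \<in> I" "w \<in> fibre F y" for i w
   using S[OF that(1)] that VE.subspace_0[OF subE[OF y]] VE.subspace_scale[OF subE[OF y]] by (cases "rho i = 0") auto
  have TS: "T y (scale E (of_real (rho i)) (S i w)) = scale F (of_real (rho i)) (w - P y w)" if "i \<in> I" "w \<in> fibre F y" for i w
   using S[OF that(1)] that mor_at_scale_arg[OF T[OF y] y] mor_at_zero_arg[OF T[OF y] y] by (cases "rho i = 0") auto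
  have Tsum: "T y (\<Sum>i\<in>J. g i) = (\<Sum>i\<in>J. T y (g i))" if "finite J" "\<And>i. i \<in> J ==> g i \<in> fibre E y" for J :: "'x set" and g
   using that
  proof induction
   case (insert j J)
   then have "(\<Sum>i\<in>J. g i) \<in> fibre E y" by (intro VE.subspace_sum[OF subE[OF y]]) auto
   then show ?case using insert mor_at_add_arg[OF T[OF y] y, of "g j" "\<Sum>i\<in>J. g i"] by simp
  qed (simp add: mor_at_zero_arg[OF T[OF y] y])
  show "?Q y (%w. \<Sum>i\<in>I. scale E (of_real (rho i)) (S i w))"
  proof (intro conjI ballI)
   fix w assume w: "w \<in> fibre F y"
   show "(\<Sum>i\<in>I. scale E (of_real (rho i)) (S i w)) \<in> fibre E y"
    using Sf w by (intro VE.subspace_sum[OF subE[OF y]]) auto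
   have "T y (\<Sum>i\<in>I. scale E (of_real (rho i)) (S i w)) = (\<Sum>i\<in>I. scale F (of_real (rho i)) (w - P y w))"
    using Tsum[OF I(1), of "%i. scale E (of_real (rho i)) (S i w)"] Sf TS w by simp
   also have "\<dots> = scale F (of_real (sum rho I)) (w - P y w)" by (simp add: VF.scale_sum_left)
   finally show "T y (\<Sum>i\<in>I. scale E (of_real (rho i)) (S i w)) = w - P y w" using I(2) by simp
  qed
 qed
 then obtain S where Sm: "\<And>x. x \<in> topspace X ==> mor_at X F E S x"
  and ST: "\<And>x w. x \<in> topspace X ==> w \<in> fibre F x ==> T x (S x w) = w - P x w" by blast
 \<comment> \<open>Precomposition with the idempotent \<open>1 - P\<close> preserves the equation
   and makes \<open>R\<close> vanish on \<open>V\<close>.\<close>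
 define R where "R y w = S y (w - P y w)" for y w
 show thesis
 proof (rule that[of R])
  show "mor_at X F E R x" if "x \<in> topspace X" for x
   unfolding R_def using that
   by (intro mor_at_comp[OF F F E _ Sm, of "%y w. w - P y w"] FF.mor_at_diff mor_at_id[OF F] P(1))
  show "R x v = 0" if "x \<in> topspace X" "v \<in> V x" for x v
   using P(3)[OF that] FE.mor_at_zero_arg[OF Sm[OF that(1)] that(1)] by (simp add: R_def)
  show "L x (R x w) - P x (L x (R x w)) = w - P x w" if x: "x \<in> topspace X" and w: "w \<in> fibre F x" for x w
  using P(2)[OF x w] VF[OF x] VF.subspace_diff[OF subF[OF x] w] FF.mor_at_diff_arg[OF P(1)[OF x] x w] P(3)[OF x] ST[OF x] by (auto simp: T_def R_def)
 qed
qed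

lemma index_domain_mem: "u \<in> index_domain E L V x \<longleftrightarrow> u \<in> fibre E x \<and> L x u \<in> V x"
 by (simp add: index_domain_def)

text \<open>\<open>1 - R L\<close> is a projection onto the index domain: it fixes the domain
  because \<open>R\<close> kills \<open>V\<close>, and \<open>L\<close> maps its values into
  \<open>V\<close> by the equation for \<open>R\<close>. So \<open>idempotent_subbundle\<close>
  applies.\<close>

lemma index_domain_subbundle:
 assumes L: "\<And>x. x \<in> topspace X ==> mor_at X E F L x"
  and ker: "\<And>x. x \<in> topspace X ==> finite_dim (scale E) {u \<in> fibre E x. L x u = 0}"
  and V: "findim_subbundle X F V"
  and P: "\<And>x. x \<in> topspace X ==> mor_at X F F P x"
   "\<And>x u. x \<in> topspace X ==> u \<in> fibre F x ==> P x u \<in> V x"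
   "\<And>x u. x \<in> topspace X ==> u \<in> V x ==> P x u = u"
  and R: "\<And>x. x \<in> topspace X ==> mor_at X F E R x"
   "\<And>x w. x \<in> topspace X ==> w \<in> fibre F x ==> L x (R x w) - P x (L x (R x w)) = w - P x w"
   "\<And>x v. x \<in> topspace X ==> v \<in> V x ==> R x v = 0"
 shows "findim_subbundle X E (index_domain E L V)"
  "\<And>x. x \<in> topspace X ==> mor_at X E E (%x u. u - R x (L x u)) x"
  "\<And>x u. x \<in> topspace X ==> u \<in> fibre E x ==> u - R x (L x u) \<in> index_domain E L V x"
  "\<And>x u. x \<in> topspace X ==> u \<in> index_domain E L V x ==> R x (L x u) = 0"
proof -
 interpret FE: bpair X F E by unfold_locales (rule F, rule E)
 interpret EE: bbundle X E by unfold_locales (rule E)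
 interpret FF: bbundle X F by unfold_locales (rule F)
 have VS: "VF.subspace (V x)" if "x \<in> topspace X" for x by (rule FF.subbundle_subspace[OF V that])
 show m: "mor_at X E E (%x u. u - R x (L x u)) x" if "x \<in> topspace X" for x
  using that by (intro EE.mor_at_diff mor_at_id[OF E] mor_at_comp[OF E F E L R(1)])
 show z: "R x (L x u) = 0" if "x \<in> topspace X" "u \<in> index_domain E L V x" for x u
  using R(3)[OF that(1)] that(2) unfolding index_domain_mem by blast
 show i: "u - R x (L x u) \<in> index_domain E L V x" if x: "x \<in> topspace X" and u: "u \<in> fibre E x" for x u
  unfolding index_domain_mem
 proof
  have Lu: "L x u \<in> fibre F x" by (rule mor_at_fibre[OF L[OF x] x u])
  have RL: "R x (L x u) \<in> fibre E x" by (rule FE.mor_at_fibre[OF R(1)[OF x] x Lu])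
  show "u - R x (L x u) \<in> fibre E x" by (rule VE.subspace_diff[OF subE[OF x] u RL])
  have "L x (u - R x (L x u)) = L x u - L x (R x (L x u))" by (rule mor_at_diff_arg[OF L[OF x] x u RL])
  also have "\<dots> = P x (L x u) - P x (L x (R x (L x u)))"
   using R(2)[OF x Lu] by (simp add: algebra_simps)
  also have "\<dots> \<in> V x"
   using VF.subspace_diff[OF VS[OF x]] P(2)[OF x] Lu mor_at_fibre[OF L[OF x] x RL] by blast
  finally show "L x (u - R x (L x u)) \<in> V x" .
 qed
 show "findim_subbundle X E (index_domain E L V)"
 using EE.idempotent_subbundle[OF m i] mor_at_add_arg[OF L] mor_at_scale_arg[OF L] finite_dim_preimage[OF VE.vector_space_axioms VF.vector_space_axioms subE FF.subbundle_finite_dim[OF V]] ker z by (fastforce simp: index_domain_def)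
qed

text \<open>\<open>A\<close> lives only on \<open>Z\<close> and is known only to preserve continuous
  sections. Expanding \<open>Q\<close> in a local frame of \<open>Z\<close> gives a finite sum of
  rank one operators, for which pointwise continuity implies norm continuity.\<close>

lemma finite_rank_mor:
 assumes Z: "findim_subbundle X E Z" and x: "x \<in> topspace X"
  and Q: "\<And>x. x \<in> topspace X ==> mor_at X E E Q x" "\<And>x u. x \<in> topspace X ==> u \<in> fibre E x ==> Q x u \<in> Z x"
  and A: "\<And>x. x \<in> topspace X ==> lin_on (scale E) (scale F) (Z x) (A x)"
   "\<And>x u. x \<in> topspace X ==> u \<in> Z x ==> A x u \<in> fibre F x"
   "\<And>x s. x \<in> topspace X ==> sec_at X E s x ==> near X x (%y. s y \<in> Z y) ==> sec_at X F (%y. A y (s y)) x"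
 shows "mor_at X E F (%y u. A y (Q y u)) x"
proof -
 interpret FE: bpair X F E by unfold_locales (rule F, rule E)
 interpret EE: bbundle X E by unfold_locales (rule E)
 obtain U phi M where c: "x \<in> U" "adapted_chart X E Z U phi M" "finite_dim (mscale E) M"
  by (rule EE.subbundle_chart[OF Z x])
 note adm = EE.adapted_admissible[OF c(2)]
 obtain n e where e: "frame (mscale E) n e M" using c(3) unfolding ME.finite_dim_frame by blast
 then have ei: "indep (mscale E) n e" by (simp add: frame_def)
 obtain a where a: "dual (mscale E) n e a" using ME.exists_dual[OF ei] ..
 let ?b = "%y i. inv_into (fibre E y) (phi y) (e i)"
 have Zsub: "Z y \<subseteq> fibre E y" if "y \<in> topspace X" for y by (rule EE.subbundle_subset[OF Z that])
 have fr: "frame (scale E) n (?b y) (Z y)" if "y \<in> U" for y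
  by (rule EE.adapted_frame[OF c(2) Zsub e that]) (rule admissible_topspace[OF adm])
 have bZ: "?b y i \<in> Z y" if "i < n" "y \<in> U" for i y by (rule VE.frame_mem[OF fr[OF that(2)] that(1)])
 obtain V psi where d: "admissible X F V psi" "x \<in> V" using exists_admissible[OF F x] by blast
 obtain B where B: "rep X E x phi phi Q B" using mor_at_rep[OF E E Q(1)[OF x] adm adm c(1,1)] ..
 define S where "S y = (\<Sum>i<n. rank_one (mscale F) (a i) (psi y (A y (?b y i))))" for y
 have top: "near X x (%y. y \<in> topspace X)" by (rule eventually_in_openin[OF openin_topspace x])
 show ?thesis
 proof (rule mor_atI[OF E F _ adm d(1) c(1) d(2)])
  show "near X x (%y. lin_on (scale E) (scale F) (fibre E y) (%u. A y (Q y u)) \<and> (%u. A y (Q y u)) ` fibre E y \<subseteq> fibre F y)"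
   using mor_at_lin[OF Q(1)[OF x]] top
  proof eventually_elim
   case (elim y)
   then show ?case using A(1,2)[OF elim(2)] Q(2)[OF elim(2)] by (auto simp: lin_on_def)
  qed
  show "rep X E x phi psi (%y u. A y (Q y u)) (%y. S y o\<^sub>L B y)"
   unfolding rep_def
  proof
   have "((%y. psi y (A y (?b y i))) \<longlongrightarrow> psi x (A x (?b x i))) (nhdsin X x)" if "i < n" for i
   proof (rule FE.sec_at_adm[OF A(3)[OF x EE.sec_at_chart[OF adm c(1)]] d])
    show "near X x (%y. ?b y i \<in> Z y)"
     using admissible_eventually[OF adm c(1)] by eventually_elim (rule bZ[OF that])
   qed
   then show "((%y. S y o\<^sub>L B y) \<longlongrightarrow> S x o\<^sub>L B x) (nhdsin X x)"
    unfolding S_def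
    by (intro bounded_bilinear.tendsto[OF bounded_bilinear_blinfun_compose] rep_tendsto[OF B] tendsto_sum MF.tendsto_rank_one) simp
   show "near X x (%y. \<forall>u\<in>fibre E y. psi y (A y (Q y u)) = (S y o\<^sub>L B y) (phi y u))"
    using rep_eventually[OF B] admissible_eventually[OF adm c(1)] admissible_eventually[OF d]
   proof (eventually_elim, intro ballI)
    fix y u assume el: "\<forall>u\<in>fibre E y. phi y (Q y u) = B y (phi y u)" "y \<in> U" "y \<in> V" and u: "u \<in> fibre E y"
    have yt: "y \<in> topspace X" by (rule admissible_topspace[OF adm el(2)])
    obtain k where k: "Q y u = comb (scale E) n (?b y) k"
     using Q(2)[OF yt u] fr[OF el(2)] by (auto simp: frame_def)
    have Bu: "B y (phi y u) = comb (mscale E) n e k"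
     using EE.chart_comb[OF adm el(2)] chart_inv[OF adm el(2)] el(1) u by (auto simp: k)
    have "A y (comb (scale E) m (?b y) k) = comb (scale F) m (%i. A y (?b y i)) k \<and>
      psi y (comb (scale F) m (%i. A y (?b y i)) k) = comb (mscale F) m (%i. psi y (A y (?b y i))) k" if "m \<le> n" for m
     using that
    proof (induction m)
     case 0
     show ?case
      using A(1)[OF yt] VE.subspace_0[OF EE.subbundle_subspace[OF Z yt]] chart_zero[OF F d(1) el(3)] by (force simp: lin_on_def comb_def)
    next
     case (Suc m)
     have ZS: "VE.subspace (Z y)" by (rule EE.subbundle_subspace[OF Z yt])
     have bm: "?b y i \<in> Z y" if "i \<le> m" for i using bZ[OF _ el(2), of i] that Suc.prems by simp
     have cm: "comb (scale E) m (?b y) k \<in> Z y" using bm by (intro VE.comb_in ZS) auto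
     have Am: "A y (?b y i) \<in> fibre F y" if "i \<le> m" for i using A(2)[OF yt bm[OF that]] .
     have cF: "comb (scale F) m (%i. A y (?b y i)) k \<in> fibre F y" using Am by (intro VF.comb_in subF[OF yt]) auto
     have "A y (comb (scale E) (Suc m) (?b y) k) = A y (comb (scale E) m (?b y) k) + A y (scale E (k m) (?b y m))"
      using A(1)[OF yt] cm VE.subspace_scale[OF ZS bm[of m]] unfolding lin_on_def comb_def by simp
     moreover have "A y (scale E (k m) (?b y m)) = scale F (k m) (A y (?b y m))"
      using A(1)[OF yt] bm[of m] unfolding lin_on_def by simp
     ultimately have 1: "A y (comb (scale E) (Suc m) (?b y) k) = comb (scale F) (Suc m) (%i. A y (?b y i)) k"
      using Suc by (simp add: comb_def)
     have "psi y (comb (scale F) (Suc m) (%i. A y (?b y i)) k) = psi y (comb (scale F) m (%i. A y (?b y i)) k) + psi y (scale F (k m) (A y (?b y m)))"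
      using chart_add[OF d(1) el(3) cF VF.subspace_scale[OF subF[OF yt] Am[of m], of "k m"]] by (simp add: comb_def)
     also have "psi y (scale F (k m) (A y (?b y m))) = mscale F (k m) (psi y (A y (?b y m)))"
      by (rule chart_scale[OF d(1) el(3) Am]) simp
     finally show ?case using 1 Suc by (simp add: comb_def)
    qed
    then have "psi y (A y (Q y u)) = comb (mscale F) n (%i. psi y (A y (?b y i))) k" unfolding k by simp
    also have "\<dots> = S y (comb (mscale E) n e k)"
     by (simp add: S_def blinfun.sum_left MF.rank_one_apply ME.dual_comb[OF a] comb_def[of "mscale F"])
    finally show "psi y (A y (Q y u)) = (S y o\<^sub>L B y) (phi y u)" by (simp add: Bu)
   qed
  qed
 qed
qed

end

section \<open>Perturbing sections into general position\<close>

lemma comb_append: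
 "comb s (n + m) (%i. if i < n then v i else w (i - n)) (%i. if i < n then c i else d (i - n))
  = comb s n v c + comb s m w d"
proof -
 let ?f = "%i. s (if i < n then c i else d (i - n)) (if i < n then v i else w (i - n))"
 have "sum ?f {..<n + m} = sum ?f {..<n} + sum ?f {n..<n + m}"
  by (subst sum.union_disjoint[symmetric]) (auto intro: sum.cong)
 also have "sum ?f {..<n} = comb s n v c" by (simp add: comb_def)
 also have "sum ?f {n..<n + m} = (\<Sum>i<m. ?f (i + n))"
  using sum.shift_bounds_nat_ivl[of ?f 0 n m] by (simp add: atLeast0LessThan add.commute)
 also have "\<dots> = comb s m w d" by (simp add: comb_def)
 finally show ?thesis by (simp add: comb_def)
qed

lemma comb_split: "comb s (n + m) v c = comb s n v c + comb s m (%i. v (i + n)) (%i. c (i + n))"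
proof -
 have "comb s (n + m) v c = comb s (n + m) (%i. if i < n then v i else v (i - n + n)) (%i. if i < n then c i else c (i - n + n))"
  by (intro comb_cong) auto
 from trans[OF this comb_append[of s n m v "%i. v (i + n)" c "%i. c (i + n)"]] show ?thesis .
qed

context bbundle
begin

definition global_section :: "('x => 'e) => bool" where
 "global_section s \<longleftrightarrow> (\<forall>x\<in>topspace X. sec_at X E s x)"

lemma zero_subbundle: "findim_subbundle X E (%x. {0})"
proof (rule frame_subbundle)
 fix x
 have "frame (scale E) 0 b {0}" for b by (auto simp: frame_def indep_def comb_def)
 then have "local_frame (%x. {0}) x 0 (%_ _. 0)" by (simp add: local_frame_def)
 then show "\<exists>n b. local_frame (%x. {0}) x n b" by blast
qed

lemma frame_append:
 assumes f: "frame (scale E) n v S" "frame (scale E) m w T" and ST: "S \<inter> T \<subseteq> {0}"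
 shows "frame (scale E) (n + m) (%i. if i < n then v i else w (i - n)) {x + y |x y. x \<in> S \<and> y \<in> T}"
proof -
 let ?b = "%i. if i < n then v i else w (i - n)"
 have cb: "comb (scale E) (n + m) ?b c = comb (scale E) n v c + comb (scale E) m w (%i. c (i + n))" for c
 proof -
  have "comb (scale E) n ?b c = comb (scale E) n v c" by (intro comb_cong) auto
  then show ?thesis by (simp add: comb_split)
 qed
 have "indep (scale E) (n + m) ?b"
  unfolding indep_def
 proof (intro allI impI)
  fix c i assume c: "comb (scale E) (n + m) ?b c = 0" and i: "i < n + m"
  let ?p = "comb (scale E) n v c" and ?q = "comb (scale E) m w (%i. c (i + n))"
  have pq: "?p = - ?q" using c unfolding cb by (simp add: add_eq_0_iff)
  have "?p \<in> S" "?q \<in> T" using f by (auto simp: frame_def)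
  moreover have "- ?q \<in> T" using \<open>?q \<in> T\<close> VE.subspace_neg[OF VE.frame_subspace[OF f(2)]] by blast
  ultimately have "?p = 0" using ST pq by auto
  then have "?q = 0" using pq by simp
  show "c i = 0"
  proof (cases "i < n")
   case True then show ?thesis using f(1) \<open>?p = 0\<close> by (simp add: frame_def indep_def)
  next
   case False
   have "\<forall>j<m. c (j + n) = 0" using f(2) \<open>?q = 0\<close> unfolding frame_def indep_def by blast
   then show ?thesis using i False by (metis add.commute add_diff_inverse_nat nat_add_left_cancel_less)
  qed
 qed
 moreover have "range (comb (scale E) (n + m) ?b) = {x + y |x y. x \<in> S \<and> y \<in> T}"
 proof
  show "range (comb (scale E) (n + m) ?b) \<subseteq> {x + y |x y. x \<in> S \<and> y \<in> T}"
   using f unfolding frame_def cb by blast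
  show "{x + y |x y. x \<in> S \<and> y \<in> T} \<subseteq> range (comb (scale E) (n + m) ?b)"
  proof
   fix z assume "z \<in> {x + y |x y. x \<in> S \<and> y \<in> T}"
   then obtain x y where z: "z = x + y" "x \<in> S" "y \<in> T" by blast
   obtain c d where "x = comb (scale E) n v c" "y = comb (scale E) m w d"
    using z f unfolding frame_def by blast
   then have "z = comb (scale E) (n + m) ?b (%i. if i < n then c i else d (i - n))"
    using z(1) by (simp only: comb_append)
   then show "z \<in> range (comb (scale E) (n + m) ?b)" by blast
  qed
 qed
 ultimately show ?thesis by (simp add: frame_def)
qed

lemma sum_subbundle:
 assumes V: "findim_subbundle X E V" and W: "findim_subbundle X E W"
  and VW: "\<And>x. x \<in> topspace X ==> V x \<inter> W x \<subseteq> {0}"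
 shows "findim_subbundle X E (%x. {v + w |v w. v \<in> V x \<and> w \<in> W x})"
proof (rule frame_subbundle)
 fix x assume x: "x \<in> topspace X"
 obtain n v where v: "local_frame V x n v" by (rule subbundle_frame[OF V x])
 obtain m w where w: "local_frame W x m w" by (rule subbundle_frame[OF W x])
 have "local_frame (%x. {v + w |v w. v \<in> V x \<and> w \<in> W x}) x (n + m) (%y i. if i < n then v y i else w y (i - n))"
  unfolding local_frame_def
  using v[unfolded local_frame_def] w[unfolded local_frame_def] eventually_in_openin[OF openin_topspace x]
 proof eventually_elim
  case (elim y)
  have "sec_at X E (%z. if i < n then v z i else w z (i - n)) y" if "i < n + m" for i
   using elim(1,2) that by (cases "i < n") auto
  moreover have "frame (scale E) (n + m) (%i. if i < n then v y i else w y (i - n)) {v + w |v w. v \<in> V y \<and> w \<in> W y}"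
   using elim(1,2) VW[OF elim(3)] by (intro frame_append) auto
  ultimately show ?case by blast
 qed
 then show "\<exists>n b. local_frame (%x. {v + w |v w. v \<in> V x \<and> w \<in> W x}) x n b" by blast
qed

lemma line_subbundle:
 assumes s: "global_section s" and nz: "\<And>x. x \<in> topspace X ==> s x \<noteq> 0"
 shows "findim_subbundle X E (%x. range (%c. scale E c (s x)))"
proof (rule frame_subbundle)
 fix x assume x: "x \<in> topspace X"
 have "local_frame (%x. range (%c. scale E c (s x))) x 1 (%y i. s y)"
  unfolding local_frame_def using eventually_in_openin[OF openin_topspace x]
 proof eventually_elim
  case (elim y)
  have cb: "comb (scale E) 1 (%i. s y) c = scale E (c 0) (s y)" for c by (simp add: comb_def)
  have "frame (scale E) 1 (%i. s y) (range (%c. scale E c (s y)))"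
   unfolding frame_def indep_def cb using nz[OF elim] by auto
  then show ?case using s elim by (simp add: global_section_def)
 qed
 then show "\<exists>n b. local_frame (%x. range (%c. scale E c (s x))) x n b" by blast
qed

section \<open>Bump sections and conditions stable under small perturbation\<close>

definition cutoff :: "'x set => ('x => real) => bool" where
 "cutoff U rho \<longleftrightarrow> (\<forall>y\<in>topspace X. (rho \<longlongrightarrow> rho y) (nhdsin X y)) \<and> (\<forall>y. 0 \<le> rho y \<and> rho y \<le> 1) \<and>
   (\<forall>y\<in>topspace X. y \<notin> U --> (near X y (%z. rho z = 0)))"

text \<open>Outside the chart domain the inverse of the chart has no meaning, but a cutoff
  \<open>rho\<close> vanishes near every such point.\<close>

definition bump_section :: "('x => 'e => 'm) => ('x => real) => 'm => 'x => 'e" where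
 "bump_section psi rho w y = scale E (of_real (rho y)) (inv_into (fibre E y) (psi y) w)"

lemma global_bump_section:
 assumes adm: "admissible X E U psi" and rho: "cutoff U rho"
 shows "global_section (bump_section psi rho w)"
 unfolding global_section_def
proof
 fix x assume x: "x \<in> topspace X"
 show "sec_at X E (bump_section psi rho w) x"
 proof (cases "x \<in> U")
  case True
  have "((%y. of_real (rho y) :: 'k) \<longlongrightarrow> of_real (rho x)) (nhdsin X x)"
   using rho x unfolding cutoff_def by (intro tendsto_of_real) blast
  then show ?thesis unfolding bump_section_def by (intro sec_at_scale sec_at_chart[OF adm True] x)
 next
  case False
  then have "near X x (%z. rho z = 0)" using rho x unfolding cutoff_def by blast
  then have "near X x (%z. bump_section psi rho w z = 0)" by eventually_elim (simp add: bump_section_def)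
  then show ?thesis by (rule sec_at_cong[OF sec_at_zero[OF x] x])
 qed
qed

lemma bump_section_bound:
 assumes adm: "admissible X E U psi" and rho: "cutoff U rho" and th: "admissible X E W \<theta>" "x \<in> W"
 obtains c where "c > 0" "near X x (%y. \<forall>w. norm (\<theta> y (bump_section psi rho w y)) \<le> c * norm w)"
proof (cases "x \<in> U")
 case True
 obtain B where B: "rep X E x psi \<theta> (%y u. u) B" using rep_id[OF E adm th(1) True th(2)] ..
 have "near X x (%y. dist (B y) (B x) < 1)" using rep_tendsto[OF B] by (rule tendstoD) simp
 then have "near X x (%y. \<forall>w. norm (\<theta> y (bump_section psi rho w y)) \<le> (norm (B x) + 1) * norm w)"
  using rep_eventually[OF B] admissible_eventually[OF adm True] admissible_eventually[OF th]
 proof (eventually_elim, intro allI)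
  fix y w assume el: "dist (B y) (B x) < 1" "\<forall>u\<in>fibre E y. \<theta> y u = B y (psi y u)" "y \<in> U" "y \<in> W"
  note i = chart_inv[OF adm el(3), of w]
  have r: "0 \<le> rho y" "rho y \<le> 1" using rho unfolding cutoff_def by auto
  have "norm (\<theta> y (bump_section psi rho w y)) = rho y * norm (B y w)"
   using chart_scale[OF th(1) el(4) i(1)] el(2) i r by (simp add: bump_section_def ME.scale_of_real)
  also have "\<dots> \<le> 1 * norm (B y w)" using r by (intro mult_right_mono) auto
  also have "norm (B y w) \<le> norm (B y) * norm w" by (rule norm_blinfun)
  also have "norm (B y) \<le> norm (B x) + 1"
   using el(1) norm_triangle_ineq2[of "B y" "B x"] by (simp add: dist_norm)
  finally show "norm (\<theta> y (bump_section psi rho w y)) \<le> (norm (B x) + 1) * norm w" by (simp add: mult_right_mono)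
 qed
 then show thesis using norm_ge_zero[of "B x"] by (intro that[of "norm (B x) + 1"]) linarith
next
 case False
 have x: "x \<in> topspace X" by (rule admissible_topspace[OF th])
 then have "near X x (%z. rho z = 0)" using rho False unfolding cutoff_def by blast
 then have "near X x (%y. \<forall>w. norm (\<theta> y (bump_section psi rho w y)) \<le> 1 * norm w)"
  using admissible_eventually[OF th]
  by eventually_elim (simp add: bump_section_def chart_zero[OF E th(1)])
 then show thesis by (intro that[of 1]) auto
qed

text \<open>Closeness is measured in a chart against the moving value \<open>s y\<close>, so that
  the condition can be tested along a perturbed section. The real parameter is there so that one
  perturbation can serve all members of a pencil.\<close>

definition open_condition :: "('x => real => 'e => bool) => bool" where
 "open_condition C \<longleftrightarrow> (\<forall>s x t U \<theta>. global_section s --> x \<in> topspace X --> t \<in> {0..1} --> C x t (s x) -->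
   admissible X E U \<theta> --> x \<in> U -->
   (\<exists>e>0. near X x (%y. \<forall>r. \<bar>r - t\<bar> < e -->
    (\<forall>v\<in>fibre E y. norm (\<theta> y v - \<theta> y (s y)) < e --> C y r v))))"

lemma open_condition_conj:
 assumes "open_condition C" "open_condition D"
 shows "open_condition (%x t v. C x t v \<and> D x t v)"
 unfolding open_condition_def
proof (intro allI impI)
 fix s x t U \<theta>
 assume h: "global_section s" "x \<in> topspace X" "t \<in> {0..1::real}" "C x t (s x) \<and> D x t (s x)" "admissible X E U \<theta>" "x \<in> U"
 obtain e where e: "e > 0" "near X x (%y. \<forall>r. \<bar>r - t\<bar> < e -->
    (\<forall>v\<in>fibre E y. norm (\<theta> y v - \<theta> y (s y)) < e --> C y r v))"
  using assms(1)[unfolded open_condition_def, rule_format, OF h(1,2,3) conjunct1[OF h(4)] h(5,6)] by blast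
 obtain d where d: "d > 0" "near X x (%y. \<forall>r. \<bar>r - t\<bar> < d -->
    (\<forall>v\<in>fibre E y. norm (\<theta> y v - \<theta> y (s y)) < d --> D y r v))"
  using assms(2)[unfolded open_condition_def, rule_format, OF h(1,2,3) conjunct2[OF h(4)] h(5,6)] by blast
 show "\<exists>e>0. near X x (%y. \<forall>r. \<bar>r - t\<bar> < e -->
    (\<forall>v\<in>fibre E y. norm (\<theta> y v - \<theta> y (s y)) < e --> C y r v \<and> D y r v))"
  using e d by (intro exI[of _ "min e d"] conjI) (auto elim: eventually_elim2)
qed

text \<open>Compactness of \<open>X\<close> times the unit interval makes the local tolerances
  uniform. The directed parameter is a natural number \<open>p\<close>, which stands for the
  tolerance \<open>1 / (p + 1)\<close>.\<close>

lemma open_condition_stable: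
 assumes X: "compact_space X" and C: "open_condition C" and s: "global_section s"
  and Cs: "\<And>x t. x \<in> topspace X ==> t \<in> {0..1} ==> C x t (s x)"
  and adm: "admissible X E U psi" and rho: "cutoff U rho"
 obtains \<delta> where "\<delta> > 0" "\<And>x t w. x \<in> topspace X ==> t \<in> {0..1} ==> norm w < \<delta> ==> C x t (s x + bump_section psi rho w x)"
proof -
 have "\<exists>p. \<forall>x\<in>topspace X. \<forall>t\<in>{0..1}. \<forall>w. norm w * Suc p < 1 --> C x t (s x + bump_section psi rho w x)"
 proof (rule compact_directed_unit[OF X])
  fix p q :: nat
  have mono: "norm w * Suc p < 1" if "norm w * Suc (max p q) < 1" for w :: 'm and p q :: nat
  proof -
   have "norm w * Suc p \<le> norm w * Suc (max p q)" by (intro mult_left_mono) auto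
   then show ?thesis using that by linarith
  qed
  show "\<exists>r. (\<forall>x t. (\<forall>w. norm w * real (Suc p) < 1 --> C x t (s x + bump_section psi rho w x)) -->
      (\<forall>w. norm w * real (Suc r) < 1 --> C x t (s x + bump_section psi rho w x))) \<and>
     (\<forall>x t. (\<forall>w. norm w * real (Suc q) < 1 --> C x t (s x + bump_section psi rho w x)) -->
      (\<forall>w. norm w * real (Suc r) < 1 --> C x t (s x + bump_section psi rho w x)))"
   using mono[of _ p q] mono[of _ q p] by (intro exI[of _ "max p q"]) (auto simp: max.commute)
 next
  fix x and t :: real assume x: "x \<in> topspace X" and t: "0 \<le> t" "t \<le> 1"
  obtain W \<theta> where th: "admissible X E W \<theta>" "x \<in> W" using exists_admissible[OF E x] by blast
  have t01: "t \<in> {0..1}" using t by simp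
  obtain e where e: "e > 0" "near X x (%y. \<forall>r. \<bar>r - t\<bar> < e -->
    (\<forall>v\<in>fibre E y. norm (\<theta> y v - \<theta> y (s y)) < e --> C y r v))"
   using C[unfolded open_condition_def, rule_format, OF s x t01 Cs[OF x t01] th] by blast
  obtain c where c: "c > 0" "near X x (%y. \<forall>w. norm (\<theta> y (bump_section psi rho w y)) \<le> c * norm w)"
   by (rule bump_section_bound[OF adm rho th])
  obtain p :: nat where p: "c / e < real p" using reals_Archimedean2 by blast
  have "near X x (%y. \<forall>r. \<bar>r - t\<bar> < e --> (\<forall>w. norm w * Suc p < 1 --> C y r (s y + bump_section psi rho w y)))"
   using e(2) c(2) admissible_eventually[OF th]
  proof (eventually_elim, intro allI impI)
   fix y r and w :: 'm
   assume el: "\<forall>r. \<bar>r - t\<bar> < e --> (\<forall>v\<in>fibre E y. norm (\<theta> y v - \<theta> y (s y)) < e --> C y r v)"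
    "\<forall>w. norm (\<theta> y (bump_section psi rho w y)) \<le> c * norm w" "y \<in> W"
    and r: "\<bar>r - t\<bar> < e" and w: "norm w * Suc p < 1"
   have yt: "y \<in> topspace X" by (rule admissible_topspace[OF th(1) el(3)])
   have sf: "s y \<in> fibre E y" using s yt unfolding global_section_def by (blast intro: sec_at_fibre)
   have bf: "bump_section psi rho w y \<in> fibre E y"
    using global_bump_section[OF adm rho] yt unfolding global_section_def by (blast intro: sec_at_fibre)
   have "norm (\<theta> y (s y + bump_section psi rho w y) - \<theta> y (s y)) = norm (\<theta> y (bump_section psi rho w y))"
    using chart_add[OF th(1) el(3) sf bf] by simp
   also have "\<dots> \<le> c * norm w" using el(2) by blast
   also have "\<dots> < e"
   proof -
    have "c * norm w \<le> (e * Suc p) * norm w"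
     using p e(1) by (intro mult_right_mono) (auto simp: field_simps)
    also have "\<dots> = e * (norm w * Suc p)" by simp
    also have "\<dots> < e" using w e(1) by simp
    finally show ?thesis .
   qed
   finally show "C y r (s y + bump_section psi rho w y)"
    using el(1) r VE.subspace_add[OF subE[OF yt] sf bf] by blast
  qed
  then show "\<exists>p e. 0 < e \<and> (near X x (%y. \<forall>r. \<bar>r - t\<bar> < e -->
    (\<forall>w. norm w * real (Suc p) < 1 --> C y r (s y + bump_section psi rho w y))))" using e(1) by blast
 qed
 then obtain p where p: "\<forall>x\<in>topspace X. \<forall>t\<in>{0..1}. \<forall>w. norm w * Suc p < 1 --> C x t (s x + bump_section psi rho w x)" ..
 show thesis
 proof (rule that[of "1 / Suc p"])
  show "C x t (s x + bump_section psi rho w x)" if "x \<in> topspace X" "t \<in> {0..1}" "norm w < 1 / Suc p" for x t w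
   using p that by (simp add: field_simps)
 qed simp
qed

text \<open>Avoidance of \<open>Z\<close> is open since finite dimensional subspaces of the model
  are closed. It is demanded only on the closed set \<open>rho = 1\<close>, and is vacuous near
  every other point.\<close>

lemma open_condition_nonvanishing:
 assumes Z: "findim_subbundle X E Z" and rho: "\<And>x. x \<in> topspace X ==> (rho \<longlongrightarrow> rho x) (nhdsin X x)"
 shows "open_condition (%x t v. rho x = (1::real) --> v \<notin> Z x)"
 unfolding open_condition_def
proof (intro allI impI)
 fix s x and t :: real and U \<theta>
 assume h: "global_section s" "x \<in> topspace X" "t \<in> {0..1}" "rho x = 1 --> s x \<notin> Z x" "admissible X E U \<theta>" "x \<in> U"
 show "\<exists>e>0. near X x (%y. \<forall>r. \<bar>r - t\<bar> < e -->
   (\<forall>v\<in>fibre E y. norm (\<theta> y v - \<theta> y (s y)) < e --> rho y = 1 --> v \<notin> Z y))"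
 proof (cases "rho x = 1")
  case False
  have "near X x (%y. rho y \<noteq> 1)"
   using rho[OF h(2)] False by (rule tendsto_imp_eventually_ne)
  then show ?thesis by (intro exI[of _ 1]) (auto elim: eventually_mono)
 next
  case True
  obtain W phi M where c: "x \<in> W" "adapted_chart X E Z W phi M" "finite_dim (mscale E) M"
   by (rule subbundle_chart[OF Z h(2)])
  note adm = adapted_admissible[OF c(2)]
  have sf: "s x \<in> fibre E x" using h(1,2) unfolding global_section_def by (blast intro: sec_at_fibre)
  have Zm: "phi y u \<in> M \<longleftrightarrow> u \<in> Z y" if "y \<in> W" "u \<in> fibre E y" for y u
   using adapted_image[OF c(2) that(1)] chart_inj[OF adm that(1) that(2)] subbundle_subset[OF Z admissible_topspace[OF adm that(1)]] by blast
  have "phi x (s x) \<in> - M" "open (- M)"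
   using Zm[OF c(1) sf] h(4) True ME.finite_dim_closed[OF c(3)] by auto
  then obtain d where d: "d > 0" "ball (phi x (s x)) d \<subseteq> - M" by (meson open_contains_ball)
  obtain B where B: "rep X E x \<theta> phi (%y u. u) B" using rep_id[OF E h(5) adm h(6) c(1)] ..
  have e1: "near X x (%y. dist (B y) (B x) < 1)" using rep_tendsto[OF B] by (rule tendstoD) simp
  have "sec_at X E s x" using h(1,2) by (simp add: global_section_def)
  then have e2: "near X x (%y. dist (phi y (s y)) (phi x (s x)) < d / 2)"
   using d(1) by (intro tendstoD[OF sec_at_adm[OF _ adm c(1)]]) auto
  \<comment> \<open>Bounds the transition from \<open>\<theta>\<close> to the adapted chart near
    \<open>x\<close>: a tolerance \<open>d / (2 * k)\<close> before the transition is
    \<open>d / 2\<close> after it, and the other \<open>d / 2\<close> pays for the variation of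
    \<open>s\<close>.\<close>
  define k where "k = norm (B x) + 1"
  have k: "k > 0" unfolding k_def using norm_ge_zero[of "B x"] by linarith
  have "near X x (%y. \<forall>r. \<bar>r - t\<bar> < d / (2 * k) -->
   (\<forall>v\<in>fibre E y. norm (\<theta> y v - \<theta> y (s y)) < d / (2 * k) --> rho y = 1 --> v \<notin> Z y))"
   using e1 e2 rep_eventually[OF B] admissible_eventually[OF adm c(1)]
  proof (eventually_elim, intro allI impI ballI)
   fix y r v
   assume el: "dist (B y) (B x) < 1" "dist (phi y (s y)) (phi x (s x)) < d / 2"
    "\<forall>u\<in>fibre E y. phi y u = B y (\<theta> y u)" "y \<in> W" and v: "v \<in> fibre E y" "norm (\<theta> y v - \<theta> y (s y)) < d / (2 * k)"
   have sfy: "s y \<in> fibre E y"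
    using h(1) sec_at_fibre admissible_topspace[OF adm el(4)] by (simp add: global_section_def)
   have "norm (phi y v - phi y (s y)) = norm (B y (\<theta> y v - \<theta> y (s y)))"
    using el(3) v(1) sfy by (simp add: blinfun.diff_right)
   also have "\<dots> \<le> norm (B y) * norm (\<theta> y v - \<theta> y (s y))" by (rule norm_blinfun)
   also have "\<dots> \<le> k * norm (\<theta> y v - \<theta> y (s y))"
    using el(1) norm_triangle_ineq2[of "B y" "B x"] unfolding k_def
    by (intro mult_right_mono) (auto simp: dist_norm)
   also have "\<dots> < k * (d / (2 * k))" using v(2) k by (intro mult_strict_left_mono)
   also have "\<dots> = d / 2" using k by simp
   finally have "dist (phi y v) (phi x (s x)) < d"
    using el(2) dist_triangle[of "phi y v" "phi x (s x)" "phi y (s y)"] by (simp add: dist_norm)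
   then have "phi y v \<notin> M" using d(2) by (auto simp: dist_commute)
   then show "v \<notin> Z y" using Zm[OF el(4) v(1)] by blast
  qed
  then show ?thesis using d(1) k by (intro exI[of _ "d / (2 * k)"]) simp
 qed
qed

lemma open_condition_True: "open_condition (%x t v. True)"
 by (auto simp: open_condition_def intro: exI[of _ 1])

lemma open_condition_ball:
 assumes "finite J" "\<And>j. j \<in> J ==> open_condition (C j)"
 shows "open_condition (%x t v. \<forall>j\<in>J. C j x t v)"
 using assms
proof induction
 case empty then show ?case using open_condition_True by simp
next
 case (insert j J)
 show ?case using insert open_condition_conj by simp
qed

text \<open>On \<open>K\<close> the values of \<open>f\<close> are within \<open>d / 8\<close> of
  finitely many vectors, which together with \<open>M\<close> span a finite dimensional
  \<open>M'\<close>. Riesz's lemma gives a unit vector at distance at least 1/2 from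
  \<open>M'\<close>; its multiple by \<open>d / 2\<close> is at distance at least
  \<open>d / 4\<close>, more than the error \<open>d / 8\<close>.\<close>

lemma avoid_compact_plus_findim:
 fixes f :: "'x => 'm"
 assumes X: "compact_space X" and inf: "\<not> finite_dim (mscale E) UNIV" and M: "finite_dim (mscale E) M" and d: "d > 0"
  and near: "\<And>x. x \<in> topspace X ==> near X x (%y. y \<in> K --> norm (f y - f x) < d / 8)"
 obtains w where "norm w < d" "\<And>y. y \<in> topspace X ==> y \<in> K ==> f y + w \<notin> M"
proof -
 obtain I where I: "finite I" "I \<subseteq> topspace X" "\<And>y. y \<in> topspace X ==> \<exists>x\<in>I. y \<in> K --> norm (f y - f x) < d / 8"
  by (rule compact_nhds_cover[OF X near]) auto
 define M' where "M' = {m + n |m n. m \<in> M \<and> n \<in> ME.span (f ` I)}"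
 have M': "finite_dim (mscale E) M'"
  unfolding M'_def using I(1) by (intro ME.finite_dim_sums[OF M] ME.finite_dim_span) auto
 have "M' \<noteq> UNIV" using M' inf by auto
 then obtain u where u: "u \<notin> M'" by blast
 obtain w where w: "norm w = 1" "\<forall>m\<in>M'. 1 / 2 \<le> norm (w - m)"
  using riesz_unit_vector[OF ME.finite_dim_closed[OF M'] ME.subspace_real[OF ME.finite_dim_subspace[OF M']] Real_Vector_Spaces.subspace_UNIV subset_UNIV UNIV_I u] by blast
 show thesis
 proof (rule that[of "(d / 2) *\<^sub>R w"])
  show "norm ((d / 2) *\<^sub>R w) < d" using w(1) d by simp
  fix y assume y: "y \<in> topspace X" "y \<in> K"
  show "f y + (d / 2) *\<^sub>R w \<notin> M"
  proof
   assume m: "f y + (d / 2) *\<^sub>R w \<in> M"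
   obtain x where x: "x \<in> I" "norm (f y - f x) < d / 8" using I(3)[OF y(1)] y(2) by blast
   have "- f x \<in> ME.span (f ` I)" using x(1) by (intro ME.span_neg ME.span_base) blast
   then have "(f y + (d / 2) *\<^sub>R w) + (- f x) \<in> M'" unfolding M'_def using m by blast
   then have "mscale E (of_real (2 / d)) ((f y + (d / 2) *\<^sub>R w) + (- f x)) \<in> M'"
    by (rule ME.subspace_scale[OF ME.finite_dim_subspace[OF M']])
   then have "(2 / d) *\<^sub>R ((f y + (d / 2) *\<^sub>R w) + (- f x)) \<in> M'"
    by (simp only: ME.scale_of_real)
   then have "1 / 2 \<le> norm (w - (2 / d) *\<^sub>R ((f y + (d / 2) *\<^sub>R w) + (- f x)))" using w(2) by blast
   also have "w - (2 / d) *\<^sub>R ((f y + (d / 2) *\<^sub>R w) + (- f x)) = (2 / d) *\<^sub>R (f x - f y)"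
    using d by (simp add: algebra_simps)
   also have "norm \<dots> = (2 / d) * norm (f y - f x)" using d by (simp add: norm_minus_commute)
   also have "\<dots> < (2 / d) * (d / 8)" using x(2) d by (intro mult_strict_left_mono) auto
   finally show False using d by simp
  qed
 qed
qed

text \<open>Finitely many closed sets \<open>rho j = 1\<close> cover \<open>X\<close>; on each in
  turn the section is moved off \<open>Z\<close> by a bump in one chart. Avoidance on the earlier
  sets is made part of the open condition, so a sufficiently small bump preserves it.\<close>

proposition generic_section:
 assumes X: "compact_space X" "Hausdorff_space X" and inf: "\<not> finite_dim (mscale E) UNIV"
  and Z: "findim_subbundle X E Z" and C: "open_condition C" and s: "global_section s"
  and Cs: "\<And>x t. x \<in> topspace X ==> t \<in> {0..1} ==> C x t (s x)"
 obtains s' where "global_section s'" "\<And>x t. x \<in> topspace X ==> t \<in> {0..1} ==> C x t (s' x)"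
  "\<And>x. x \<in> topspace X ==> s' x \<notin> Z x"
proof -
 have "\<forall>x\<in>topspace X. \<exists>q. x \<in> fst q \<and> cutoff (fst q) (snd (snd (snd q))) \<and> adapted_chart X E Z (fst q) (fst (snd q)) (fst (snd (snd q))) \<and>
   finite_dim (mscale E) (fst (snd (snd q))) \<and> (near X x (%y. snd (snd (snd q)) y = 1))"
 proof
  fix x assume x: "x \<in> topspace X"
  obtain U phi M where c: "x \<in> U" "adapted_chart X E Z U phi M" "finite_dim (mscale E) M"
   by (rule subbundle_chart[OF Z x])
  have op: "openin X U" by (rule admissible_openin[OF adapted_admissible[OF c(2)]])
  obtain rho :: "'x => real" where "\<And>y. y \<in> topspace X ==> (rho \<longlongrightarrow> rho y) (nhdsin X y)"
   "\<And>y. 0 \<le> rho y" "\<And>y. rho y \<le> 1" "near X x (%y. rho y = 1)"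
   "\<And>y. y \<in> topspace X ==> y \<notin> U ==> near X y (%z. rho z = 0)"
   by (rule bump_function[OF X op c(1)]) (rule that; assumption)
  then have "cutoff U rho" "near X x (%y. rho y = 1)" by (auto simp: cutoff_def)
  then show "\<exists>q. x \<in> fst q \<and> cutoff (fst q) (snd (snd (snd q))) \<and> adapted_chart X E Z (fst q) (fst (snd q)) (fst (snd (snd q))) \<and>
   finite_dim (mscale E) (fst (snd (snd q))) \<and> (near X x (%y. snd (snd (snd q)) y = 1))"
   using c by (intro exI[of _ "(U, phi, M, rho)"]) simp
 qed
 from this[unfolded bchoice_iff] obtain q where q: "\<forall>x\<in>topspace X. x \<in> fst (q x) \<and> cutoff (fst (q x)) (snd (snd (snd (q x)))) \<and>
   adapted_chart X E Z (fst (q x)) (fst (snd (q x))) (fst (snd (snd (q x)))) \<and>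
   finite_dim (mscale E) (fst (snd (snd (q x)))) \<and> (near X x (%y. snd (snd (snd (q x))) y = 1))" ..
 define U where "U x = fst (q x)" for x
 define psi where "psi x = fst (snd (q x))" for x
 define M where "M x = fst (snd (snd (q x)))" for x
 define rho where "rho x = snd (snd (snd (q x)))" for x
 have c: "cutoff (U x) (rho x)" "adapted_chart X E Z (U x) (psi x) (M x)" "finite_dim (mscale E) (M x)"
  "near X x (%y. rho x y = 1)" if "x \<in> topspace X" for x
  using q that by (auto simp: U_def psi_def M_def rho_def)
 obtain I where I: "finite I" "I \<subseteq> topspace X" "\<And>y. y \<in> topspace X ==> \<exists>x\<in>I. rho x y = 1"
  by (rule compact_nhds_cover[OF X(1) c(4)]) auto
 have "\<exists>s'. global_section s' \<and> (\<forall>x\<in>topspace X. \<forall>t\<in>{0..1}. C x t (s' x)) \<and>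
   (\<forall>x\<in>topspace X. \<forall>j\<in>I. rho j x = 1 --> s' x \<notin> Z x)"
  using I(1,2)
 proof (induction rule: finite_induct)
  case empty
  then show ?case using s Cs by blast
 next
  case (insert j J)
  then obtain s' where s': "global_section s'" "\<And>x t. x \<in> topspace X ==> t \<in> {0..1} ==> C x t (s' x)"
   "\<And>x j. x \<in> topspace X ==> j \<in> J ==> rho j x = 1 ==> s' x \<notin> Z x" by blast
  have j: "j \<in> topspace X" using insert.prems by blast
  note adm = adapted_admissible[OF c(2)[OF j]]
  have "open_condition (%x t v. C x t v \<and> (\<forall>j\<in>J. rho j x = 1 --> v \<notin> Z x))"
  proof (intro open_condition_conj C open_condition_ball insert.hyps open_condition_nonvanishing Z)
   fix j x assume "j \<in> J" "x \<in> topspace X"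
   then show "(rho j \<longlongrightarrow> rho j x) (nhdsin X x)" using c(1)[of j] insert.prems unfolding cutoff_def by blast
  qed
  from open_condition_stable[OF X(1) this s'(1) _ adm c(1)[OF j]] s'(2,3)
  obtain \<delta> where \<delta>: "\<delta> > 0" "\<And>x t w. x \<in> topspace X ==> t \<in> {0..1} ==> norm w < \<delta> ==>
    C x t (s' x + bump_section (psi j) (rho j) w x) \<and> (\<forall>i\<in>J. rho i x = 1 --> s' x + bump_section (psi j) (rho j) w x \<notin> Z x)"
   by auto
  have supp: "y \<in> U j" if "y \<in> topspace X" "rho j y = 1" for y
  using c(1)[OF j] eventually_nhdsin_self[OF that(1)] that(2) by (force simp: cutoff_def)
  have near: "near X x (%y. y \<in> {y. rho j y = 1} --> norm (psi j y (s' y) - psi j x (s' x)) < \<delta> / 8)" if x: "x \<in> topspace X" for x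
  proof (cases "rho j x = 1")
   case True
   have "sec_at X E s' x" using s'(1) x by (simp add: global_section_def)
   then have "near X x (%y. dist (psi j y (s' y)) (psi j x (s' x)) < \<delta> / 8)"
    using \<delta>(1) by (intro tendstoD[OF sec_at_adm[OF _ adm supp[OF x True]]]) auto
   then show ?thesis by eventually_elim (simp add: dist_norm)
  next
   case False
   have "(rho j \<longlongrightarrow> rho j x) (nhdsin X x)" using c(1)[OF j] x unfolding cutoff_def by blast
   from tendsto_imp_eventually_ne[OF this False] show ?thesis by eventually_elim simp
  qed
  obtain w where w: "norm w < \<delta>" "\<And>y. y \<in> topspace X ==> y \<in> {y. rho j y = 1} ==> psi j y (s' y) + w \<notin> M j"
   by (rule avoid_compact_plus_findim[OF X(1) inf c(3)[OF j] \<delta>(1) near]) (assumption, (rule that; assumption))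
  let ?s = "%y. s' y + bump_section (psi j) (rho j) w y"
  have "global_section ?s"
   using s'(1) global_bump_section[OF adm c(1)[OF j], of w] unfolding global_section_def by (blast intro: sec_at_add)
  moreover have "?s y \<notin> Z y" if y: "y \<in> topspace X" "rho j y = 1" for y
  proof
   assume z: "?s y \<in> Z y"
   note i = chart_inv[OF adm supp[OF y], of w]
   have sf: "s' y \<in> fibre E y" using s'(1) y(1) unfolding global_section_def by (blast intro: sec_at_fibre)
   have "psi j y (?s y) = psi j y (s' y) + w"
    using chart_add[OF adm supp[OF y] sf i(1)] i(2) y(2) by (simp add: bump_section_def)
   moreover have "psi j y (?s y) \<in> M j" using z adapted_image[OF c(2)[OF j] supp[OF y]] by blast
   ultimately show False using w(2) y by simp
  qed
  moreover have "?s y \<notin> Z y" if "y \<in> topspace X" "i \<in> J" "rho i y = 1" for y i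
   using \<delta>(2)[OF that(1) _ w(1), of 0] that by auto
  ultimately have "global_section ?s \<and> (\<forall>x\<in>topspace X. \<forall>t\<in>{0..1}. C x t (?s x)) \<and>
   (\<forall>x\<in>topspace X. \<forall>i\<in>insert j J. rho i x = 1 --> ?s x \<notin> Z x)"
   using \<delta>(2)[OF _ _ w(1)] by blast
  then show ?case by (rule exI[of _ ?s])
 qed
 then show thesis using that I(3) by blast
qed

end

section \<open>Transversal subbundles\<close>

context bpair
begin

section \<open>Pencils of morphisms and openness of transversality\<close>

definition pencil :: "('x => 'e => 'f) => ('x => 'e => 'f) => real => 'x => 'e => 'f" where
 "pencil L0 L1 t x u = L0 x u + scale F (of_real t) (L1 x u)"

text \<open>Stated with the span of a set, so that finitely many sections and whole subspaces can be
  mixed while the former are gradually replaced by the latter.\<close>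

definition spans_cokernel :: "('x => 'e => 'f) => 'x => 'f set => bool" where
 "spans_cokernel L x S \<longleftrightarrow> (\<forall>w\<in>fibre F x. \<exists>u\<in>fibre E x. \<exists>d\<in>VF.span S. w = L x u + d)"

lemma spans_cokernel_mono: "spans_cokernel L x S ==> S \<subseteq> VF.span T ==> spans_cokernel L x T"
 unfolding spans_cokernel_def using VF.span_minimal[of S "VF.span T"] by blast

lemma mor_at_pencil:
 "mor_at X E F L0 x ==> mor_at X E F L1 x ==> x \<in> topspace X ==> mor_at X E F (pencil L0 L1 t) x"
 unfolding pencil_def by (intro mor_at_add mor_at_scale tendsto_const)

lemma finite_dim_chart_kernel:
 assumes T: "mor_at X E F T x" and c: "admissible X E U phi" "x \<in> U" "admissible X F V psi" "x \<in> V"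
  and B: "\<forall>u\<in>fibre E x. psi x (T x u) = B (phi x u)"
 shows "finite_dim (mscale E) {v. B v = 0} \<longleftrightarrow> finite_dim (scale E) {u \<in> fibre E x. T x u = 0}"
proof -
 interpret EE: bbundle X E by unfold_locales (rule E)
 have x: "x \<in> topspace X" by (rule admissible_topspace[OF c(1,2)])
 have "phi x ` {u \<in> fibre E x. T x u = 0} = {v. B v = 0}"
 proof
  show "phi x ` {u \<in> fibre E x. T x u = 0} \<subseteq> {v. B v = 0}"
   using B chart_zero[OF F c(3,4)] by force
  show "{v. B v = 0} \<subseteq> phi x ` {u \<in> fibre E x. T x u = 0}"
  proof
   fix v assume "v \<in> {v. B v = 0}"
   note i = chart_inv[OF c(1,2), of v]
   have "psi x (T x (inv_into (fibre E x) (phi x) v)) = psi x 0"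
    using B i \<open>v \<in> _\<close> chart_zero[OF F c(3,4)] by simp
   then have "T x (inv_into (fibre E x) (phi x) v) = 0"
    by (rule chart_inj[OF c(3,4) mor_at_fibre[OF T x i(1)] VF.subspace_0[OF subF[OF x]]])
   then show "v \<in> phi x ` {u \<in> fibre E x. T x u = 0}"
    using i by (intro image_eqI[of _ _ "inv_into (fibre E x) (phi x) v"]) auto
  qed
 qed
 then show ?thesis using EE.finite_dim_chart[OF c(1,2), of "{u \<in> fibre E x. T x u = 0}"] by auto
qed

text \<open>At \<open>(x, t)\<close> transversality is witnessed by \<open>R\<close> and functionals
  \<open>a i\<close> through the identity of \<open>right_inverse_transversal\<close>. Inserting
  nearby operators and vectors into it gives a map within 1/2 of the identity, hence onto, and
  surjectivity is transversality at the nearby point.\<close>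

lemma open_transversality:
 fixes N :: nat
 assumes x: "x \<in> topspace X" and L: "mor_at X E F L0 x" "mor_at X E F L1 x"
  and ker: "finite_dim (scale E) {u \<in> fibre E x. pencil L0 L1 t x u = 0}"
  and b: "\<And>i. i < N ==> sec_at X F (%y. b y i) x"
  and tr: "spans_cokernel (pencil L0 L1 t) x (b x ` {..<N})"
  and d: "admissible X F V psi" "x \<in> V"
 obtains e where "e > 0" "near X x (%y. \<forall>r. \<bar>r - t\<bar> < e -->
  (\<forall>b'. (\<forall>i<N. b' i \<in> fibre F y \<and> norm (psi y (b' i) - psi y (b y i)) < e) -->
   spans_cokernel (pencil L0 L1 r) y (b' ` {..<N})))"
proof -
 interpret FF: bbundle X F by unfold_locales (rule F)
 obtain U phi where c: "admissible X E U phi" "x \<in> U" using exists_admissible[OF E x] by blast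
 obtain B0 where B0: "rep X E x phi psi L0 B0" using mor_at_rep[OF E F L(1) c(1) d(1) c(2) d(2)] ..
 obtain B1 where B1: "rep X E x phi psi L1 B1" using mor_at_rep[OF E F L(2) c(1) d(1) c(2) d(2)] ..
 define T where "T = B0 x + t *\<^sub>R B1 x"
 have chart_pencil: "psi y (pencil L0 L1 r y u) = (B0 y + r *\<^sub>R B1 y) (phi y u)"
  if "y \<in> V" "u \<in> fibre E y" "L0 y u \<in> fibre F y" "L1 y u \<in> fibre F y"
   "psi y (L0 y u) = B0 y (phi y u)" "psi y (L1 y u) = B1 y (phi y u)" for r y u
 using VF.subspace_scale[OF subF[OF admissible_topspace[OF d(1) that(1)]] that(4)] that by (simp add: pencil_def chart_add[OF d(1) that(1)] chart_scale[OF d(1) that(1)] MF.scale_of_real blinfun.add_left blinfun.scaleR_left)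
 have mp: "mor_at X E F (pencil L0 L1 t) x" by (rule mor_at_pencil[OF L x])
 have Tx: "\<forall>u\<in>fibre E x. psi x (pencil L0 L1 t x u) = T (phi x u)"
  unfolding T_def
  using eventually_nhdsin_self[OF x rep_eventually[OF B0]] eventually_nhdsin_self[OF x rep_eventually[OF B1]]
   mor_at_fibre[OF L(1) x] mor_at_fibre[OF L(2) x] by (intro ballI chart_pencil d) auto
 have Tk: "klin (mscale E) (mscale F) T"
  using eventually_nhdsin_self[OF x mor_at_lin[OF mp]] Tx
  by (intro rep_klin[OF c(1) d(1) c(2) d(2), of "pencil L0 L1 t"]) (auto simp: subE[OF x] VE.vector_space_axioms)
 have kerT: "finite_dim (mscale E) {v. T v = 0}"
  using finite_dim_chart_kernel[OF mp c d Tx] ker by blast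
 have bf: "b x i \<in> fibre F x" if "i < N" for i using FF.sec_at_fibre[OF b[OF that] x] .
 have onto: "\<exists>u c. w = T u + comb (mscale F) N (%i. psi x (b x i)) c" for w
 proof -
  note i = chart_inv[OF d, of w]
  let ?w = "inv_into (fibre F x) (psi x) w"
  obtain u g where u: "u \<in> fibre E x" "g \<in> VF.span (b x ` {..<N})" "?w = pencil L0 L1 t x u + g"
   using tr i(1) unfolding spans_cokernel_def by blast
  then obtain k where k: "g = comb (scale F) N (b x) k" using VF.range_comb_span[of N "b x"] by blast
  have gf: "g \<in> fibre F x" unfolding k using bf by (intro VF.comb_in subF[OF x])
  have "w = psi x (pencil L0 L1 t x u) + psi x g"
   using chart_add[OF d mor_at_fibre[OF mp x u(1)] gf] u(3) i(2) by simp
  also have "\<dots> = T (phi x u) + comb (mscale F) N (%i. psi x (b x i)) k"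
   using Tx u(1) FF.chart_comb[OF d bf] k by simp
  finally show ?thesis by blast
 qed
 obtain R :: "'n \<Rightarrow>\<^sub>L 'm" and a :: "nat => 'n \<Rightarrow>\<^sub>L 'k" where
  Ra: "\<And>w. T (R w) + comb (mscale F) N (%i. psi x (b x i)) (%i. a i w) = w"
  by (rule right_inverse_transversal[OF ME.banach_scale MF.banach_scale Tk kerT onto]) (rule that)
 \<comment> \<open>At \<open>(y, r, e)\<close> this bounds the distance of the perturbed map from
   the identity when the vectors move by less than \<open>e\<close>. It tends to 0 jointly in the
   three arguments, which yields one common tolerance.\<close>
 define h where "h z = norm (B0 (fst z) - B0 x) * norm R + norm (fst (snd z) *\<^sub>R B1 (fst z) - t *\<^sub>R B1 x) * norm R +
  (\<Sum>i<N. norm (a i) * (snd (snd z) + norm (psi (fst z) (b (fst z) i) - psi x (b x i))))" for z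
 let ?G = "nhdsin X x \<times>\<^sub>F (nhds t \<times>\<^sub>F nhds (0::real))"
 have f1: "((%z. g (fst z)) \<longlongrightarrow> l) ?G" if "(g \<longlongrightarrow> l) (nhdsin X x)" for g :: "'x => 'z::topological_space" and l
  by (rule filterlim_compose[OF that filterlim_fst])
 have f2: "((%z. fst (snd z)) \<longlongrightarrow> t) ?G" by (rule filterlim_compose[OF filterlim_fst filterlim_snd])
 have f3: "((%z. snd (snd z)) \<longlongrightarrow> 0) ?G" by (rule filterlim_compose[OF filterlim_snd filterlim_snd])
 have "(h \<longlongrightarrow> norm (B0 x - B0 x) * norm R + norm (t *\<^sub>R B1 x - t *\<^sub>R B1 x) * norm R +
   (\<Sum>i<N. norm (a i) * (0 + norm (psi x (b x i) - psi x (b x i))))) ?G"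
  unfolding h_def using FF.sec_at_adm[OF b d]
  by (intro tendsto_add tendsto_mult tendsto_sum tendsto_norm tendsto_diff tendsto_scaleR tendsto_const f2 f3
    f1[OF rep_tendsto[OF B0]] f1[OF rep_tendsto[OF B1]] f1) auto
 then have "(h \<longlongrightarrow> 0) ?G" by simp
 then have "\<forall>\<^sub>F z in ?G. h z < 1 / 2" by (rule order_tendstoD) simp
 then obtain Pf Pg where Pf: "eventually Pf (nhdsin X x)" and Pg: "eventually Pg (nhds t \<times>\<^sub>F nhds 0)"
  and PP: "\<And>y z. Pf y ==> Pg z ==> h (y, z) < 1 / 2" unfolding eventually_prod_filter by blast
 obtain Q1 Q2 where Q: "eventually Q1 (nhds t)" "eventually Q2 (nhds 0)" "\<And>r e. Q1 r ==> Q2 e ==> Pg (r, e)"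
  using Pg unfolding eventually_prod_filter by blast
 obtain e1 where e1: "e1 > 0" "\<And>r. dist r t < e1 ==> Q1 r" using Q(1) unfolding eventually_nhds_metric by blast
 obtain e2 where e2: "e2 > 0" "\<And>r. dist r 0 < e2 ==> Q2 r" using Q(2) unfolding eventually_nhds_metric by blast
 \<comment> \<open>Half of \<open>e2\<close>, because \<open>e\<close> is itself inserted as the
   third argument of \<open>h\<close> and must lie strictly within the tolerance.\<close>
 define e where "e = min e1 (e2 / 2)"
 have e: "e > 0" "e < e2" "e \<le> e1" using e1 e2 by (auto simp: e_def)
 have Q2e: "Q2 e" using e2(2)[of e] e by simp
 have "near X x (%y. \<forall>r. \<bar>r - t\<bar> < e -->
  (\<forall>b'. (\<forall>i<N. b' i \<in> fibre F y \<and> norm (psi y (b' i) - psi y (b y i)) < e) -->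
   spans_cokernel (pencil L0 L1 r) y (b' ` {..<N})))"
  using Pf rep_eventually[OF B0] rep_eventually[OF B1] mor_at_lin[OF L(1)] mor_at_lin[OF L(2)]
   admissible_eventually[OF c] admissible_eventually[OF d]
 proof (eventually_elim, intro allI impI)
  fix y r b'
  assume el: "Pf y" "\<forall>u\<in>fibre E y. psi y (L0 y u) = B0 y (phi y u)" "\<forall>u\<in>fibre E y. psi y (L1 y u) = B1 y (phi y u)"
   "lin_on (scale E) (scale F) (fibre E y) (L0 y) \<and> L0 y ` fibre E y \<subseteq> fibre F y"
   "lin_on (scale E) (scale F) (fibre E y) (L1 y) \<and> L1 y ` fibre E y \<subseteq> fibre F y" "y \<in> U" "y \<in> V"
   and r: "\<bar>r - t\<bar> < e" and b': "\<forall>i<N. b' i \<in> fibre F y \<and> norm (psi y (b' i) - psi y (b y i)) < e"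
  have yt: "y \<in> topspace X" by (rule admissible_topspace[OF c(1) el(6)])
  have hs: "h (y, r, e) < 1 / 2" using r e(3) e1(2) PP[OF el(1) Q(3)[OF _ Q2e]] by (simp add: dist_real_def)
  define G where "G v = B0 y (R v) + r *\<^sub>R B1 y (R v) + comb (mscale F) N (%i. psi y (b' i)) (%i. a i v)" for v
  have Gbl: "bounded_linear G"
   unfolding G_def comb_def
   by (intro bounded_linear_add bounded_linear_sum bounded_linear_const_scaleR
     bounded_linear_compose[OF blinfun.bounded_linear_right blinfun.bounded_linear_right]
     bounded_linear_compose[OF bounded_bilinear.bounded_linear_left[OF MF.bounded_bilinear_scale] blinfun.bounded_linear_right])
  have "norm (G v - v) \<le> norm v / 2" for v
  proof -
   \<comment> \<open>The subtracted \<open>v\<close> is rewritten by the identity at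
     \<open>x\<close>, so that only differences of operators and of vectors remain.\<close>
   have "G v - v = (B0 y - B0 x) (R v) + (r *\<^sub>R B1 y - t *\<^sub>R B1 x) (R v)
     + (\<Sum>i<N. mscale F (a i v) (psi y (b' i) - psi x (b x i)))"
    by (subst (2) Ra[of v, symmetric])
     (simp add: G_def T_def comb_def blinfun.add_left blinfun.diff_left blinfun.scaleR_left
      MF.scale_right_diff_distrib sum_subtractf algebra_simps)
   also have "norm \<dots> \<le> norm ((B0 y - B0 x) (R v)) + norm ((r *\<^sub>R B1 y - t *\<^sub>R B1 x) (R v))
     + norm (\<Sum>i<N. mscale F (a i v) (psi y (b' i) - psi x (b x i)))"
    by (intro norm_triangle_le add_mono norm_triangle_ineq order_refl)
   also have "norm ((B0 y - B0 x) (R v)) \<le> norm (B0 y - B0 x) * norm R * norm v"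
    using norm_blinfun[of "B0 y - B0 x" "R v"] mult_left_mono[OF norm_blinfun[of R v] norm_ge_zero[of "B0 y - B0 x"]] by (simp add: mult.assoc)
   also have "norm ((r *\<^sub>R B1 y - t *\<^sub>R B1 x) (R v)) \<le> norm (r *\<^sub>R B1 y - t *\<^sub>R B1 x) * norm R * norm v"
    using norm_blinfun[of "r *\<^sub>R B1 y - t *\<^sub>R B1 x" "R v"] mult_left_mono[OF norm_blinfun[of R v] norm_ge_zero[of "r *\<^sub>R B1 y - t *\<^sub>R B1 x"]] by (simp add: mult.assoc)
   also have "norm (\<Sum>i<N. mscale F (a i v) (psi y (b' i) - psi x (b x i)))
     \<le> (\<Sum>i<N. norm (a i) * (e + norm (psi y (b y i) - psi x (b x i)))) * norm v"
    unfolding sum_distrib_right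
   proof (intro order_trans[OF norm_sum] sum_mono)
    fix i assume i: "i \<in> {..<N}"
    have "norm (psi y (b' i) - psi x (b x i)) \<le> norm (psi y (b' i) - psi y (b y i)) + norm (psi y (b y i) - psi x (b x i))"
     using norm_triangle_ineq[of "psi y (b' i) - psi y (b y i)" "psi y (b y i) - psi x (b x i)"] by simp
    also have "\<dots> \<le> e + norm (psi y (b y i) - psi x (b x i))" using b' i by (intro add_right_mono less_imp_le) simp
    finally have "norm (a i v) * norm (psi y (b' i) - psi x (b x i)) \<le> (norm (a i) * norm v) * (e + norm (psi y (b y i) - psi x (b x i)))"
     using e(1) by (intro mult_mono norm_blinfun) auto
    then show "norm (mscale F (a i v) (psi y (b' i) - psi x (b x i))) \<le> norm (a i) * (e + norm (psi y (b y i) - psi x (b x i))) * norm v"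
     by (simp add: MF.norm_scale mult_ac)
   qed
   finally have "norm (G v - v) \<le> h (y, r, e) * norm v" by (simp add: h_def algebra_simps)
   also have "\<dots> \<le> 1 / 2 * norm v" using hs by (intro mult_right_mono) auto
   finally show ?thesis by simp
  qed
  from near_identity_surj(1)[OF Gbl this] have surj: "surj G" by (simp add: bij_is_surj)
  show "spans_cokernel (pencil L0 L1 r) y (b' ` {..<N})"
   unfolding spans_cokernel_def
  proof
   fix w assume w: "w \<in> fibre F y"
   obtain v where v: "G v = psi y w" by (metis surj surjD)
   note i = chart_inv[OF c(1) el(6), of "R v"]
   let ?u = "inv_into (fibre E y) (phi y) (R v)" and ?g = "comb (scale F) N b' (%i. a i v)"
   have Lf: "L0 y ?u \<in> fibre F y" "L1 y ?u \<in> fibre F y" using el(4,5) i(1) by auto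
   have gf: "?g \<in> fibre F y" using b' by (intro VF.comb_in subF[OF yt]) auto
   have pf: "pencil L0 L1 r y ?u \<in> fibre F y"
    unfolding pencil_def using Lf by (intro VF.subspace_add[OF subF[OF yt]] VF.subspace_scale[OF subF[OF yt]])
   have "psi y (pencil L0 L1 r y ?u + ?g) = psi y (pencil L0 L1 r y ?u) + psi y ?g"
    by (rule chart_add[OF d(1) el(7) pf gf])
   also have "psi y (pencil L0 L1 r y ?u) = (B0 y + r *\<^sub>R B1 y) (R v)"
    using chart_pencil[OF el(7) i(1) Lf] el(2,3) i by simp
   also have "psi y ?g = comb (mscale F) N (%i. psi y (b' i)) (%i. a i v)"
    using b' by (intro FF.chart_comb[OF d(1) el(7)]) auto
   finally have "psi y (pencil L0 L1 r y ?u + ?g) = psi y w"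
    unfolding v[symmetric] by (simp add: G_def blinfun.add_left blinfun.scaleR_left)
   then have "pencil L0 L1 r y ?u + ?g = w"
    by (rule chart_inj[OF d(1) el(7) VF.subspace_add[OF subF[OF yt] pf gf] w])
   moreover have "?g \<in> VF.span (b' ` {..<N})" using VF.range_comb_span[of N b'] by blast
   ultimately show "\<exists>u\<in>fibre E y. \<exists>d\<in>VF.span (b' ` {..<N}). w = pencil L0 L1 r y u + d" using i(1) by blast
  qed
 qed
 then show thesis using that e(1) by blast
qed

end

text \<open>Covers both uses: the constant pencil of one Fredholm morphism and the segment from an
  isomorphism to its compact perturbation.\<close>

locale fredholm_pencil = bpair X E F
 for X :: "'x topology"
  and E :: "('k::real_or_complex, 'x, 'e::ab_group_add, 'm::banach) banach_bundle"
  and F :: "('k, 'x, 'f::ab_group_add, 'n::banach) banach_bundle" +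
 fixes L0 L1 :: "'x => 'e => 'f"
 assumes X: "compact_space X" "Hausdorff_space X"
  and L0: "\<And>x. x \<in> topspace X ==> mor_at X E F L0 x"
  and L1: "\<And>x. x \<in> topspace X ==> mor_at X E F L1 x"
  and kernel: "\<And>x t. x \<in> topspace X ==> t \<in> {0..1} ==> finite_dim (scale E) {u \<in> fibre E x. pencil L0 L1 t x u = 0}"
  and cokernel: "\<And>x t. x \<in> topspace X ==> t \<in> {0..1} ==>
   \<exists>C. finite_dim (scale F) C \<and> C \<subseteq> fibre F x \<and> spans_cokernel (pencil L0 L1 t) x C"
begin

sublocale FF: bbundle X F by unfold_locales (rule F)

text \<open>At each \<open>(x, t)\<close> a basis of a finite dimensional supplement of the image is
  extended by bump sections. They still span nearby by \<open>open_transversality\<close>, and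
  compactness leaves finitely many; lists of sections form the directed parameter, joined by
  concatenation.\<close>

lemma finitely_many_spanning_sections:
 obtains ps where "\<And>p. p \<in> set ps ==> FF.global_section p"
  "\<And>x t. x \<in> topspace X ==> t \<in> {0..1} ==> spans_cokernel (pencil L0 L1 t) x ((%p. p x) ` set ps)"
proof -
 \<comment> \<open>The parameter ranges over arbitrary lists of functions, so the members that are
   not continuous sections are filtered out inside the condition.\<close>
 let ?G = "%x t ps. spans_cokernel (pencil L0 L1 t) x ((%p. p x) ` {p \<in> set ps. FF.global_section p})"
 have "\<exists>ps. \<forall>x\<in>topspace X. \<forall>t\<in>{0..1}. ?G x t ps"
 proof (rule compact_directed_unit[OF X(1)])
  fix p q :: "('x => 'f) list"
  have "?G x t r --> ?G x t (p @ q)" if "set r \<subseteq> set (p @ q)" for r x t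
   using that by (intro impI, elim spans_cokernel_mono) (auto intro!: VF.span_base)
  then show "\<exists>r. (\<forall>x t. ?G x t p --> ?G x t r) \<and> (\<forall>x t. ?G x t q --> ?G x t r)"
   by (intro exI[of _ "p @ q"]) auto
 next
  fix x and t :: real assume x: "x \<in> topspace X" and t: "0 \<le> t" "t \<le> 1"
  then have t': "t \<in> {0..1}" by simp
  obtain C where C: "finite_dim (scale F) C" "C \<subseteq> fibre F x" "spans_cokernel (pencil L0 L1 t) x C"
   using cokernel[OF x t'] by blast
  obtain n e where e: "frame (scale F) n e C" using C(1) unfolding VF.finite_dim_frame by blast
  have ef: "e i \<in> fibre F x" if "i < n" for i using VF.frame_mem[OF e that] C(2) by blast
  obtain V psi where d: "admissible X F V psi" "x \<in> V" using exists_admissible[OF F x] by blast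
  obtain rho :: "'x => real" where rho: "\<And>y. y \<in> topspace X ==> (rho \<longlongrightarrow> rho y) (nhdsin X y)"
   "\<And>y. 0 \<le> rho y" "\<And>y. rho y \<le> 1" "near X x (%y. rho y = 1)"
   "\<And>y. y \<in> topspace X ==> y \<notin> V ==> near X y (%z. rho z = 0)"
   by (rule bump_function[OF X admissible_openin[OF d(1)] d(2)]) (rule that; assumption)
  have cut: "FF.cutoff V rho" using rho by (simp add: FF.cutoff_def)
  define b where "b y i = FF.bump_section psi rho (psi x (e i)) y" for y i
  have gb: "FF.global_section (%y. b y i)" for i
   unfolding b_def using FF.global_bump_section[OF d(1) cut] by simp
  have bx: "b x i = e i" if "i < n" for i
   using eventually_nhdsin_self[OF x rho(4)] chart_inv_left[OF d ef[OF that]] by (simp add: b_def FF.bump_section_def)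
  have tr: "spans_cokernel (pencil L0 L1 t) x (b x ` {..<n})"
   using e bx C(3) spans_cokernel_mono by (simp add: frame_def VF.range_comb_span)
  have sb: "sec_at X F (%y. b y i) x" for i using gb x by (simp add: FF.global_section_def)
  obtain \<epsilon> where \<epsilon>: "\<epsilon> > 0" "near X x (%y. \<forall>r. \<bar>r - t\<bar> < \<epsilon> -->
    (\<forall>b'. (\<forall>i<n. b' i \<in> fibre F y \<and> norm (psi y (b' i) - psi y (b y i)) < \<epsilon>) -->
     spans_cokernel (pencil L0 L1 r) y (b' ` {..<n})))"
   by (rule open_transversality[OF x L0[OF x] L1[OF x] kernel[OF x t'] sb tr d])
  let ?ps = "map (%i y. b y i) [0..<n]"
  have "near X x (%y. \<forall>r. \<bar>r - t\<bar> < \<epsilon> --> ?G y r ?ps)"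
   using \<epsilon>(2) eventually_in_openin[OF openin_topspace x]
  proof (eventually_elim, intro allI impI)
   fix y r assume el: "\<forall>r. \<bar>r - t\<bar> < \<epsilon> -->
    (\<forall>b'. (\<forall>i<n. b' i \<in> fibre F y \<and> norm (psi y (b' i) - psi y (b y i)) < \<epsilon>) -->
     spans_cokernel (pencil L0 L1 r) y (b' ` {..<n}))" "y \<in> topspace X" and r: "\<bar>r - t\<bar> < \<epsilon>"
   have "sec_at X F (%y. b y i) y" for i using gb el(2) by (simp add: FF.global_section_def)
   from FF.sec_at_fibre[OF this el(2)] have "b y i \<in> fibre F y" for i .
   then have "spans_cokernel (pencil L0 L1 r) y (b y ` {..<n})" using el(1) r \<epsilon>(1) by simp
   moreover have "b y ` {..<n} = (%p. p y) ` {p \<in> set ?ps. FF.global_section p}"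
    using gb by (force simp: image_iff)
   ultimately show "?G y r ?ps" by simp
  qed
  then show "\<exists>p e. 0 < e \<and> (near X x (%y. \<forall>r. \<bar>r - t\<bar> < e --> ?G y r p))" using \<epsilon>(1) by blast
 qed
 then obtain ps where ps: "\<forall>x\<in>topspace X. \<forall>t\<in>{0..1}. ?G x t ps" ..
 show thesis
  by (rule that[of "filter FF.global_section ps"]) (use ps in auto)
qed

text \<open>A local frame of \<open>Z\<close>, the sections \<open>ps\<close> and the moving vector
  are listed as one family \<open>b\<close> of \<open>N + 1\<close> vectors, to which
  \<open>open_transversality\<close> applies; the last entry alone differs from the reference
  family.\<close>

lemma open_condition_spans_cokernel:
 assumes Z: "findim_subbundle X F Z" and ps: "\<And>p. p \<in> set ps ==> FF.global_section p"
 shows "FF.open_condition (%x t v. spans_cokernel (pencil L0 L1 t) x (insert v (Z x \<union> (%p. p x) ` set ps)))"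
 unfolding FF.open_condition_def
proof (intro allI impI)
 fix s x and t :: real and V psi
 assume h: "FF.global_section s" "x \<in> topspace X" "t \<in> {0..1}"
  "spans_cokernel (pencil L0 L1 t) x (insert (s x) (Z x \<union> (%p. p x) ` set ps))" "admissible X F V psi" "x \<in> V"
 obtain n z where z: "FF.local_frame Z x n z" by (rule FF.subbundle_frame[OF Z h(2)])
 define N where "N = n + length ps"
 define b where "b v y i = (if i < n then z y i else if i < N then (ps ! (i - n)) y else v)" for v y i
 have img: "b v y ` {..<Suc N} = insert v (z y ` {..<n} \<union> (%p. p y) ` set ps)" for v y
 proof -
  have "{..<Suc N} = {..<n} \<union> {n..<N} \<union> {N}" by (auto simp: N_def)
  moreover have "b v y ` {..<n} = z y ` {..<n}" by (intro image_cong) (auto simp: b_def)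
  moreover have "b v y ` {n..<N} = (%p. p y) ` set ps"
  proof -
   have "set ps = (%i. ps ! (i - n)) ` {n..<N}"
   proof
    show "set ps \<subseteq> (%i. ps ! (i - n)) ` {n..<N}"
    proof
     fix p assume "p \<in> set ps"
     then obtain i where "i < length ps" "p = ps ! i" by (metis in_set_conv_nth)
     then show "p \<in> (%i. ps ! (i - n)) ` {n..<N}" by (intro image_eqI[of _ _ "i + n"]) (auto simp: N_def)
    qed
    show "(%i. ps ! (i - n)) ` {n..<N} \<subseteq> set ps" by (auto simp: N_def)
   qed
   then show ?thesis by (simp add: image_image) (intro image_cong, auto simp: b_def)
  qed
  moreover have "b v y ` {N} = {v}" by (simp add: b_def N_def)
  ultimately show ?thesis by (simp only: image_Un) blast
 qed
 have fr: "near X x (%y. (\<forall>i<n. sec_at X F (%w. z w i) y) \<and> frame (scale F) n (z y) (Z y))"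
  using z by (simp add: FF.local_frame_def)
 have ext: "VF.span (insert v (z y ` {..<n} \<union> A)) = VF.span (insert v (Z y \<union> A))"
  if "frame (scale F) n (z y) (Z y)" for v y A
 proof -
  have Zs: "Z y = VF.span (z y ` {..<n})" using that by (simp add: frame_def VF.range_comb_span)
  have "VF.span (z y ` {..<n}) \<subseteq> VF.span (insert v (z y ` {..<n} \<union> A))" by (rule VF.span_mono) blast
  then have "insert v (Z y \<union> A) \<subseteq> VF.span (insert v (z y ` {..<n} \<union> A))"
   unfolding Zs using VF.span_superset[of "insert v (z y ` {..<n} \<union> A)"] by blast
  moreover have "insert v (z y ` {..<n} \<union> A) \<subseteq> VF.span (insert v (Z y \<union> A))"
   unfolding Zs using VF.span_superset[of "z y ` {..<n}"] VF.span_superset[of "insert v (VF.span (z y ` {..<n}) \<union> A)"] by blast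
  ultimately show ?thesis by (intro subset_antisym VF.span_minimal VF.subspace_span)
 qed
 have sb: "sec_at X F (%y. b (s y) y i) x" for i
 proof -
  have "sec_at X F (ps ! j) x" if "j < length ps" for j
   using ps[OF nth_mem[OF that]] h(2) by (simp add: FF.global_section_def)
  then show ?thesis
   using eventually_nhdsin_self[OF h(2) fr] h(1,2) unfolding b_def N_def FF.global_section_def
   by (cases "i < n"; cases "i < n + length ps") auto
 qed
 have tr: "spans_cokernel (pencil L0 L1 t) x (b (s x) x ` {..<Suc N})"
  using h(4) ext eventually_nhdsin_self[OF h(2) fr] unfolding img spans_cokernel_def by simp
 obtain e where e: "e > 0" "near X x (%y. \<forall>r. \<bar>r - t\<bar> < e -->
    (\<forall>b'. (\<forall>i<Suc N. b' i \<in> fibre F y \<and> norm (psi y (b' i) - psi y (b (s y) y i)) < e) -->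
     spans_cokernel (pencil L0 L1 r) y (b' ` {..<Suc N})))"
  by (rule open_transversality[OF h(2) L0[OF h(2)] L1[OF h(2)] kernel[OF h(2,3)] sb tr h(5,6)])
 have "near X x (%y. \<forall>r. \<bar>r - t\<bar> < e --> (\<forall>v\<in>fibre F y. norm (psi y v - psi y (s y)) < e -->
   spans_cokernel (pencil L0 L1 r) y (insert v (Z y \<union> (%p. p y) ` set ps))))"
  using e(2) fr eventually_in_openin[OF openin_topspace h(2)]
 proof (eventually_elim, intro allI impI ballI)
  fix y r v
  assume el: "\<forall>r. \<bar>r - t\<bar> < e -->
    (\<forall>b'. (\<forall>i<Suc N. b' i \<in> fibre F y \<and> norm (psi y (b' i) - psi y (b (s y) y i)) < e) -->
     spans_cokernel (pencil L0 L1 r) y (b' ` {..<Suc N}))"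
   "(\<forall>i<n. sec_at X F (%w. z w i) y) \<and> frame (scale F) n (z y) (Z y)" "y \<in> topspace X"
   and r: "\<bar>r - t\<bar> < e" and v: "v \<in> fibre F y" "norm (psi y v - psi y (s y)) < e"
  have "b v y i \<in> fibre F y \<and> norm (psi y (b v y i) - psi y (b (s y) y i)) < e" if "i < Suc N" for i
  using ps[OF nth_mem] el(3) FF.sec_at_fibre VF.frame_mem[of n "z y" "Z y" i] el(2) FF.subbundle_subset[OF Z el(3)] v e(1) by (auto simp: FF.global_section_def b_def N_def)
  then have "spans_cokernel (pencil L0 L1 r) y (b v y ` {..<Suc N})" using el(1) r by blast
  then show "spans_cokernel (pencil L0 L1 r) y (insert v (Z y \<union> (%p. p y) ` set ps))"
   using ext el(2) unfolding img spans_cokernel_def by simp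
 qed
 then show "\<exists>e>0. near X x (%y. \<forall>r. \<bar>r - t\<bar> < e --> (\<forall>v\<in>fibre F y. norm (psi y v - psi y (s y)) < e -->
   spans_cokernel (pencil L0 L1 r) y (insert v (Z y \<union> (%p. p y) ` set ps))))"
  using e(1) by blast
qed

text \<open>The spanning sections are traded one by one for lines. The next section \<open>p\<close>
  may meet \<open>V + W\<close>, so it is replaced by a section \<open>s\<close> that avoids
  \<open>V + W\<close> everywhere, while the spanning condition is retained because it is open. The
  line of \<open>s\<close> then joins \<open>W\<close>.\<close>

proposition exists_transversal_complement:
 assumes inf: "\<not> finite_dim (mscale F) UNIV" and V: "findim_subbundle X F V"
 obtains W where "findim_subbundle X F W" "\<And>x. x \<in> topspace X ==> V x \<inter> W x \<subseteq> {0}"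
  "\<And>x t. x \<in> topspace X ==> t \<in> {0..1} ==> spans_cokernel (pencil L0 L1 t) x (V x \<union> W x)"
proof -
 obtain ps where ps: "\<And>p. p \<in> set ps ==> FF.global_section p"
  "\<And>x t. x \<in> topspace X ==> t \<in> {0..1} ==> spans_cokernel (pencil L0 L1 t) x ((%p. p x) ` set ps)"
  by (rule finitely_many_spanning_sections) (rule that; assumption)
 let ?A = "%W ps. findim_subbundle X F W \<and> (\<forall>x\<in>topspace X. V x \<inter> W x \<subseteq> {0}) \<and>
  (\<forall>x\<in>topspace X. \<forall>t\<in>{0..1}. spans_cokernel (pencil L0 L1 t) x (V x \<union> W x \<union> (%p. p x) ` set ps))"
 have step: "\<exists>W'. ?A W' []" if "?A W ps" "\<forall>p\<in>set ps. FF.global_section p" for W ps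
  using that
 proof (induction ps arbitrary: W)
  case Nil
  show ?case using Nil.prems(1) by (rule exI[of _ W])
 next
  case (Cons p ps)
  note W = conjunct1[OF Cons.prems(1)]
  note VW = bspec[OF conjunct1[OF conjunct2[OF Cons.prems(1)]]]
  note WC = bspec[OF bspec[OF conjunct2[OF conjunct2[OF Cons.prems(1)]]]]
  define Z where "Z x = {v + w |v w. v \<in> V x \<and> w \<in> W x}" for x
  have Z: "findim_subbundle X F Z" unfolding Z_def by (rule FF.sum_subbundle[OF V W VW])
  have VS: "VF.subspace (V x)" "VF.subspace (W x)" "VF.subspace (Z x)" if "x \<in> topspace X" for x
   by (fact FF.subbundle_subspace[OF V that] FF.subbundle_subspace[OF W that] FF.subbundle_subspace[OF Z that])+
  have sub: "V x \<subseteq> Z x" "W x \<subseteq> Z x" if "x \<in> topspace X" for x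
   using VF.subspace_0[OF VS(1)[OF that]] VF.subspace_0[OF VS(2)[OF that]] unfolding Z_def by force+
  have C: "FF.open_condition (%x t v. spans_cokernel (pencil L0 L1 t) x (insert v (Z x \<union> (%p. p x) ` set ps)))"
   using Cons.prems by (intro open_condition_spans_cokernel Z) auto
  have gp: "FF.global_section p" using Cons.prems by simp
  have init: "spans_cokernel (pencil L0 L1 t) x (insert (p x) (Z x \<union> (%p. p x) ` set ps))"
   if x: "x \<in> topspace X" and t: "t \<in> {0..1}" for x t
  proof (rule spans_cokernel_mono)
   show "spans_cokernel (pencil L0 L1 t) x (V x \<union> W x \<union> (%p. p x) ` set (p # ps))"
    by (rule WC[OF x t])
   show "V x \<union> W x \<union> (%p. p x) ` set (p # ps) \<subseteq> VF.span (insert (p x) (Z x \<union> (%p. p x) ` set ps))"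
    using sub[OF x] by (intro order_trans[OF _ VF.span_superset]) auto
  qed
  obtain s where s: "FF.global_section s"
   "\<And>x t. x \<in> topspace X ==> t \<in> {0..1} ==> spans_cokernel (pencil L0 L1 t) x (insert (s x) (Z x \<union> (%p. p x) ` set ps))"
   "\<And>x. x \<in> topspace X ==> s x \<notin> Z x"
   by (rule FF.generic_section[OF X inf Z C gp init]) (assumption | (rule that; assumption))+
  have snz: "s x \<noteq> 0" if "x \<in> topspace X" for x using s(3)[OF that] VF.subspace_0[OF VS(3)[OF that]] by auto
  have line: "c = 0" if "x \<in> topspace X" "scale F c (s x) \<in> Z x" for x c
  proof (rule ccontr)
   assume "c \<noteq> 0"
   then have "scale F (inverse c) (scale F c (s x)) = s x" by simp
   then show False using VF.subspace_scale[OF VS(3)[OF that(1)] that(2), of "inverse c"] s(3)[OF that(1)] by simp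
  qed
  define W1 where "W1 x = {w + l |w l. w \<in> W x \<and> l \<in> range (%c. scale F c (s x))}" for x
  have "findim_subbundle X F W1"
   unfolding W1_def
  using FF.sum_subbundle W FF.line_subbundle[OF s(1) snz] line sub(2) by force
  moreover have "V x \<inter> W1 x \<subseteq> {0}" if x: "x \<in> topspace X" for x
  using sub[OF x] VF.subspace_diff[OF VS(3)[OF x]] line[OF x] VW[OF x] by (force simp: W1_def)
  moreover have "spans_cokernel (pencil L0 L1 t) x (V x \<union> W1 x \<union> (%p. p x) ` set ps)"
   if x: "x \<in> topspace X" and t: "t \<in> {0..1}" for x t
  proof (rule spans_cokernel_mono[OF s(2)[OF x t]])
   have "s x \<in> W1 x"
    unfolding W1_def using VF.subspace_0[OF VS(2)[OF x]]
    by (intro CollectI exI[of _ 0] exI[of _ "s x"]) (auto intro: range_eqI[of _ _ 1])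
   moreover have "W x \<subseteq> W1 x"
   proof
    fix w assume "w \<in> W x"
    then show "w \<in> W1 x"
     unfolding W1_def by (intro CollectI exI[of _ w] exI[of _ 0] conjI) (auto intro: range_eqI[of _ _ 0])
   qed
   then have "Z x \<subseteq> VF.span (V x \<union> W1 x \<union> (%p. p x) ` set ps)"
   proof (intro subsetI)
    fix z assume "z \<in> Z x"
    then obtain v w where z: "z = v + w" "v \<in> V x" "w \<in> W x" unfolding Z_def by blast
    show "z \<in> VF.span (V x \<union> W1 x \<union> (%p. p x) ` set ps)"
     unfolding z(1) using z(2,3) \<open>W x \<subseteq> W1 x\<close> by (intro VF.span_add VF.span_base) auto
   qed
   ultimately show "insert (s x) (Z x \<union> (%p. p x) ` set ps) \<subseteq> VF.span (V x \<union> W1 x \<union> (%p. p x) ` set ps)"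
    by (auto intro: VF.span_base)
  qed
  ultimately show ?case using Cons.prems(2) by (intro Cons.IH[of W1]) auto
 qed
 have "?A (%x. {0}) ps"
 proof (intro conjI ballI FF.zero_subbundle)
  fix x t assume "x \<in> topspace X" "t \<in> {0..1::real}"
  then show "spans_cokernel (pencil L0 L1 t) x (V x \<union> {0} \<union> (%p. p x) ` set ps)"
   by (rule spans_cokernel_mono[OF ps(2)]) (auto intro: VF.span_base)
 qed simp
 then have "\<exists>W'. ?A W' []" by (rule step) (simp add: ps(1))
 then obtain W where W: "?A W []" by (rule exE)
 show thesis
 proof (rule that[of W])
  show "spans_cokernel (pencil L0 L1 t) x (V x \<union> W x)" if "x \<in> topspace X" "t \<in> {0..1}" for x t
   using bspec[OF bspec[OF conjunct2[OF conjunct2[OF W]] that(1)] that(2)] by simp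
 qed (use W in auto)
qed

end

section \<open>Vector bundles\<close>

lemma tendsto_fun_iff:
 fixes f :: "'z => 'i => 'b::topological_space"
 shows "(f \<longlongrightarrow> l) G \<longleftrightarrow> (\<forall>i. ((%z. f z i) \<longlongrightarrow> l i) G)"
 using limitin_componentwise[of "%i. euclidean" UNIV f l G]
 by (simp add: euclidean_product_topology)

lemma vector_space_cscale: "vector_space (cscale :: 'k::field => (nat => 'k) => _)"
 by unfold_locales (simp_all add: cscale_def fun_eq_iff algebra_simps)

lemma subspace_coords: "module.subspace cscale (coords n :: (nat => 'k::field) set)"
proof -
 interpret vector_space "cscale :: 'k => _" by (rule vector_space_cscale)
 show ?thesis by (rule subspaceI) (auto simp: coords_def cscale_def)
qed

definition unit_coord :: "nat => nat => 'k::field" where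
 "unit_coord i = (%j. if j = i then 1 else 0)"

lemma unit_coord_coords: "i < n ==> unit_coord i \<in> coords n"
 by (auto simp: unit_coord_def coords_def)

lemma comb_unit_coord: "comb cscale n unit_coord c j = (if j < n then c j else (0::'k::field))"
proof -
 have "comb cscale n unit_coord c j = (\<Sum>i<n. c i * unit_coord i j)"
  by (induction n) (simp_all add: comb_def cscale_def)
 also have "\<dots> = (\<Sum>i<n. if i = j then c j else 0)" by (intro sum.cong) (auto simp: unit_coord_def)
 also have "\<dots> = (if j < n then c j else 0)" by simp
 finally show ?thesis .
qed

lemma coords_expand: "v \<in> coords n ==> comb cscale n unit_coord v = v"
 by (rule ext) (auto simp: comb_unit_coord coords_def)

lemma tendsto_comb_cscale:
 fixes c :: "'z => nat => 'k::real_normed_field"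
 assumes "\<And>i. i < n ==> ((%z. v z i) \<longlongrightarrow> v0 i) G" "\<And>i. i < n ==> ((%z. c z i) \<longlongrightarrow> c0 i) G"
 shows "((%z. comb cscale n (v z) (c z)) \<longlongrightarrow> comb cscale n v0 c0) G"
proof -
 have eq: "comb cscale n v c j = (\<Sum>i<n. c i * v i j)" for v and c :: "nat => 'k" and j
  by (induction n) (simp_all add: comb_def cscale_def)
 have "((%z. v z i j) \<longlongrightarrow> v0 i j) G" if "i < n" for i j using assms(1)[OF that] unfolding tendsto_fun_iff by blast
 then show ?thesis unfolding tendsto_fun_iff eq using assms(2) by (intro allI tendsto_sum tendsto_mult) auto
qed

lemma lin_on_zero:
 assumes "vector_space s" "vector_space t" "lin_on s t S f" "0 \<in> S"
 shows "f 0 = 0"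
using assms(3,4) by (force simp: lin_on_def)

lemma lin_on_comb:
 assumes s: "vector_space s" and t: "vector_space t" and f: "lin_on s t S f" and S: "module.subspace s S"
  and v: "\<And>i. i < n ==> v i \<in> S"
 shows "f (comb s n v c) = comb t n (%i. f (v i)) c"
proof -
 interpret s: vector_space s by fact
 interpret t: vector_space t by fact
 show ?thesis using v
 proof (induction n)
  case 0
  show ?case using lin_on_zero[OF s t f s.subspace_0[OF S]] by (simp add: comb_def)
 next
  case (Suc n)
  have "f (comb s n v c + s (c n) (v n)) = f (comb s n v c) + f (s (c n) (v n))"
   using f s.subspace_scale[OF S] Suc.prems s.comb_in S by (simp add: lin_on_def)
  moreover have "f (s (c n) (v n)) = t (c n) (f (v n))" using f Suc.prems unfolding lin_on_def by blast
  ultimately show ?case using Suc by (simp add: comb_def)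
 qed
qed

lemma lin_on_inverse:
 assumes s: "vector_space s" and f: "lin_on s t S f" and S: "module.subspace s S" and bij: "bij_betw f S S'"
 shows "lin_on t s S' (inv_into S f)"
proof -
 interpret s: vector_space s by fact
 have i: "inv_into S f w \<in> S" "f (inv_into S f w) = w" if "w \<in> S'" for w
  using that bij by (auto simp: bij_betw_def)
 have inj: "u = v" if "u \<in> S" "v \<in> S" "f u = f v" for u v using that bij by (auto simp: bij_betw_def inj_on_def)
 have im: "f u \<in> S'" if "u \<in> S" for u using that bij by (auto simp: bij_betw_def)
 show ?thesis
  unfolding lin_on_def
 proof (intro conjI ballI allI)
  fix u v assume u: "u \<in> S'" "v \<in> S'"
  have sum: "inv_into S f u + inv_into S f v \<in> S" by (intro s.subspace_add S i u)
  have e: "f (inv_into S f u + inv_into S f v) = u + v" using f i u unfolding lin_on_def by auto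
  then show "inv_into S f (u + v) = inv_into S f u + inv_into S f v" using im[OF sum] inj sum by (simp add: i e)
 next
  fix c u assume u: "u \<in> S'"
  have sc: "s c (inv_into S f u) \<in> S" by (intro s.subspace_scale S i u)
  have e: "f (s c (inv_into S f u)) = t c u" using f i u unfolding lin_on_def by auto
  then show "inv_into S f (t c u) = s c (inv_into S f u)" using im[OF sc] inj sc by (simp add: i e)
 qed
qed

definition vsec_at :: "'x topology => ('k::real_normed_field, 'x, 'v::ab_group_add) vbundle => ('x => 'v) => 'x => bool" where
 "vsec_at X V s x \<longleftrightarrow> (near X x (%y. s y \<in> vfibre V y)) \<and>
   (\<forall>(U, n, phi)\<in>vatlas V. x \<in> U --> ((%y. phi y (s y)) \<longlongrightarrow> phi x (s x)) (nhdsin X x))"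

definition preserves_sections where
 "preserves_sections X V W f \<longleftrightarrow> (\<forall>x\<in>topspace X. \<forall>s. vsec_at X V s x --> vsec_at X W (%y. f y (s y)) x)"

definition fibrewise_linear where
 "fibrewise_linear X V W f \<longleftrightarrow>
  (\<forall>x\<in>topspace X. lin_on (vscale V) (vscale W) (vfibre V x) (f x) \<and> f x ` vfibre V x \<subseteq> vfibre W x)"

locale vbundle_loc =
 fixes X :: "'x topology" and V :: "('k::real_normed_field, 'x, 'v::ab_group_add) vbundle"
 assumes V: "vector_bundle X V"
begin

sublocale vector_space "vscale V" using V unfolding vector_bundle_def by blast

lemma vsub: "x \<in> topspace X ==> subspace (vfibre V x)"
 using V unfolding vector_bundle_def by blast

lemma vchart:
 assumes "(U, n, phi) \<in> vatlas V"
 shows "openin X U" "x \<in> U ==> lin_on (vscale V) cscale (vfibre V x) (phi x)"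
  "x \<in> U ==> bij_betw (phi x) (vfibre V x) (coords n)" "x \<in> U ==> x \<in> topspace X"
proof -
 have *: "\<forall>(U, n, phi)\<in>vatlas V. openin X U \<and>
    (\<forall>x\<in>U. lin_on (vscale V) cscale (vfibre V x) (phi x) \<and> bij_betw (phi x) (vfibre V x) (coords n))"
  using V by (simp add: vector_bundle_def)
 show o: "openin X U" "x \<in> U ==> lin_on (vscale V) cscale (vfibre V x) (phi x)"
  "x \<in> U ==> bij_betw (phi x) (vfibre V x) (coords n)" using bspec[OF * assms] by auto
 show "x \<in> U ==> x \<in> topspace X" by (rule openin_topspace_mem[OF o(1)])
qed

lemma exists_vchart: "x \<in> topspace X ==> \<exists>(U, n, phi)\<in>vatlas V. x \<in> U"
using V by (fastforce simp: vector_bundle_def)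

lemma vchart_eventually: "(U, n, phi) \<in> vatlas V ==> x \<in> U ==> near X x (%y. y \<in> U)"
 by (rule eventually_in_openin[OF vchart(1)])

lemma vchart_inv:
 assumes "(U, n, phi) \<in> vatlas V" "x \<in> U" "v \<in> coords n"
 shows "inv_into (vfibre V x) (phi x) v \<in> vfibre V x" "phi x (inv_into (vfibre V x) (phi x) v) = v"
 using vchart(3)[OF assms(1,2)] assms(3) by (auto simp: bij_betw_def inv_into_into f_inv_into_f)

lemma vchart_inv_left:
 assumes "(U, n, phi) \<in> vatlas V" "x \<in> U" "u \<in> vfibre V x"
 shows "inv_into (vfibre V x) (phi x) (phi x u) = u"
 using vchart(3)[OF assms(1,2)] assms(3) by (simp add: bij_betw_def)

lemma vchart_coords:
 assumes "(U, n, phi) \<in> vatlas V" "x \<in> U" "u \<in> vfibre V x"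
 shows "phi x u \<in> coords n"
 using vchart(3)[OF assms(1,2)] assms(3) by (auto simp: bij_betw_def)

lemma vchart_expand:
 assumes c: "(U, n, phi) \<in> vatlas V" "x \<in> U" and u: "u \<in> vfibre V x"
 shows "u = comb (vscale V) n (%i. inv_into (vfibre V x) (phi x) (unit_coord i)) (phi x u)"
proof -
 let ?b = "%i. inv_into (vfibre V x) (phi x) (unit_coord i)"
 have x: "x \<in> topspace X" by (rule vchart(4)[OF c])
 have b: "?b i \<in> vfibre V x" "phi x (?b i) = unit_coord i" if "i < n" for i
  using vchart_inv[OF c unit_coord_coords[OF that]] by auto
 have cf: "comb (vscale V) n ?b (phi x u) \<in> vfibre V x" using b by (intro comb_in vsub x) auto
 have "phi x (comb (vscale V) n ?b (phi x u)) = comb cscale n (%i. phi x (?b i)) (phi x u)"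
  by (rule lin_on_comb[OF vector_space_axioms vector_space_cscale vchart(2)[OF c] vsub[OF x] b(1)])
 also have "\<dots> = comb cscale n unit_coord (phi x u)" using b by (intro comb_cong) auto
 also have "\<dots> = phi x u" by (rule coords_expand[OF vchart_coords[OF c u]])
 finally show ?thesis using vchart_inv_left[OF c u] vchart_inv_left[OF c cf] by simp
qed

lemma vsec_tendsto: "vsec_at X V s x ==> (U, n, phi) \<in> vatlas V ==> x \<in> U ==> ((%y. phi y (s y)) \<longlongrightarrow> phi x (s x)) (nhdsin X x)"
 unfolding vsec_at_def by blast

lemma vsec_vchart:
 assumes c: "(U, n, phi) \<in> vatlas V" "x \<in> U" and v: "v \<in> coords n"
 shows "vsec_at X V (%y. inv_into (vfibre V y) (phi y) v) x"
 unfolding vsec_at_def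
proof (intro conjI ballI, goal_cases)
 case 1
 show ?case using vchart_eventually[OF c] by eventually_elim (rule vchart_inv[OF c(1) _ v])
next
 case (2 p)
 obtain U' m psi where p: "p = (U', m, psi)" by (metis prod_cases3)
 have at: "(U', m, psi) \<in> vatlas V" using 2 p by simp
 have *: "\<forall>(U, n, phi)\<in>vatlas V. \<forall>(U', m, psi)\<in>vatlas V.
    coords_continuous X (U \<inter> U') n (in_charts (vfibre V) phi psi (%x u. u))"
  using V by (simp add: vector_bundle_def)
 have "coords_continuous X (U \<inter> U') n (in_charts (vfibre V) phi psi (%x u. u))"
  using bspec[OF * c(1)] bspec[OF _ at] by force
 then have "continuous_map (subtopology X (U \<inter> U')) euclidean (%y. psi y (inv_into (vfibre V y) (phi y) v))"
  using v unfolding coords_continuous_def in_charts_def by blast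
 then have "\<forall>y\<in>U \<inter> U'. ((%y. psi y (inv_into (vfibre V y) (phi y) v)) \<longlongrightarrow> psi y (inv_into (vfibre V y) (phi y) v)) (nhdsin X y)"
  unfolding continuous_map_nhdsin[OF openin_Int[OF vchart(1)[OF c(1)] vchart(1)[OF at]]] .
 then show ?case using p c(2) by simp
qed

lemma vsec_cong:
 assumes s: "vsec_at X V s x" and x: "x \<in> topspace X" and eq: "near X x (%y. s' y = s y)"
 shows "vsec_at X V s' x"
 unfolding vsec_at_def
proof (intro conjI ballI, goal_cases)
 case 1
 have "near X x (%y. s y \<in> vfibre V y)" using s by (simp add: vsec_at_def)
 then show ?case using eq by eventually_elim simp
next
 case (2 p)
 obtain U' m psi where p: "p = (U', m, psi)" by (metis prod_cases3)
 have "near X x (%y. psi y (s' y) = psi y (s y))" using eq by eventually_elim simp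
 then show ?case unfolding p split
  using vsec_tendsto[OF s] 2 p tendsto_cong eventually_nhdsin_self[OF x eq] by fastforce
qed

end

text \<open>In a chart a section is a combination of coordinate sections with continuous
  coefficients, so preserving sections amounts to pointwise continuity of the map in charts. With
  this criterion charts drop out of many isomorphism arguments.\<close>

lemma vb_morphism_iff:
 assumes V: "vector_bundle X V" and W: "vector_bundle X W"
 shows "f \<in> vb_morphisms X V W \<longleftrightarrow> fibrewise_linear X V W f \<and> preserves_sections X V W f"
proof
 interpret V: vbundle_loc X V by unfold_locales (rule V)
 interpret W: vbundle_loc X W by unfold_locales (rule W)
 {
  assume f: "f \<in> vb_morphisms X V W"
  then have lin: "fibrewise_linear X V W f" by (simp add: vb_morphisms_def fibrewise_linear_def)
  have "vsec_at X W (%y. f y (s y)) x" if x: "x \<in> topspace X" and s: "vsec_at X V s x" for x s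
   unfolding vsec_at_def
  proof (intro conjI ballI, goal_cases)
   have sf: "near X x (%y. s y \<in> vfibre V y)" using s by (simp add: vsec_at_def)
   have top: "near X x (%y. y \<in> topspace X)" by (rule eventually_in_openin[OF openin_topspace x])
   {
    case 1
    show ?case using sf top by eventually_elim (use lin in \<open>auto simp: fibrewise_linear_def\<close>)
   next
    case (2 p)
    obtain U' m psi where p: "p = (U', m, psi)" by (metis prod_cases3)
    have at: "(U', m, psi) \<in> vatlas W" using 2 p by simp
    obtain U n phi where c: "(U, n, phi) \<in> vatlas V" "x \<in> U" using V.exists_vchart[OF x] by blast
    have "((%y. psi y (f y (s y))) \<longlongrightarrow> psi x (f x (s x))) (nhdsin X x)" if xU': "x \<in> U'"
    proof -
     let ?b = "%y i. inv_into (vfibre V y) (phi y) (unit_coord i)"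
     have *: "\<forall>(U, n, phi)\<in>vatlas V. \<forall>(U', m, psi)\<in>vatlas W. coords_continuous X (U \<inter> U') n (in_charts (vfibre V) phi psi f)"
      using f by (simp add: vb_morphisms_def)
     have cc: "coords_continuous X (U \<inter> U') n (in_charts (vfibre V) phi psi f)"
      using bspec[OF * c(1)] bspec[OF _ at] by force
     have lb: "((%y. psi y (f y (?b y i))) \<longlongrightarrow> psi x (f x (?b x i))) (nhdsin X x)" if "i < n" for i
     using cc unit_coord_coords[OF that] c(2) xU' by (auto simp: coords_continuous_def in_charts_def continuous_map_nhdsin[OF openin_Int[OF V.vchart(1)[OF c(1)] W.vchart(1)[OF at]]])
     have ls: "((%y. phi y (s y) i) \<longlongrightarrow> phi x (s x) i) (nhdsin X x)" for i
      using V.vsec_tendsto[OF s c] unfolding tendsto_fun_iff by blast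
     have lim: "((%y. comb cscale n (%i. psi y (f y (?b y i))) (phi y (s y))) \<longlongrightarrow>
       comb cscale n (%i. psi x (f x (?b x i))) (phi x (s x))) (nhdsin X x)"
      by (intro tendsto_comb_cscale lb ls)
     have ev: "near X x (%y. psi y (f y (s y)) = comb cscale n (%i. psi y (f y (?b y i))) (phi y (s y)))"
      using sf top V.vchart_eventually[OF c] W.vchart_eventually[OF at xU']
     proof eventually_elim
      case (elim y)
      have b: "?b y i \<in> vfibre V y" if "i < n" for i by (rule V.vchart_inv[OF c(1) elim(3) unit_coord_coords[OF that]])
      have lf: "lin_on (vscale V) (vscale W) (vfibre V y) (f y)" "f y ` vfibre V y \<subseteq> vfibre W y"
       using lin elim(2) by (auto simp: fibrewise_linear_def)
      have "f y (s y) = f y (comb (vscale V) n (?b y) (phi y (s y)))"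
       using V.vchart_expand[OF c(1) elim(3,1)] by simp
      also have "\<dots> = comb (vscale W) n (%i. f y (?b y i)) (phi y (s y))"
       by (rule lin_on_comb[OF V.vector_space_axioms W.vector_space_axioms lf(1) V.vsub[OF elim(2)] b])
      also have "psi y \<dots> = comb cscale n (%i. psi y (f y (?b y i))) (phi y (s y))"
       by (rule lin_on_comb[OF W.vector_space_axioms vector_space_cscale W.vchart(2)[OF at elim(4)] W.vsub[OF elim(2)]])
        (use b lf in auto)
      finally show ?case .
     qed
     show ?thesis using lim tendsto_cong[OF ev] eventually_nhdsin_self[OF x ev] by simp
    qed
    then show ?case by (simp add: p)
   }
  qed
  then show "fibrewise_linear X V W f \<and> preserves_sections X V W f" using lin by (simp add: preserves_sections_def)
 }
 {
  assume f: "fibrewise_linear X V W f \<and> preserves_sections X V W f"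
  show "f \<in> vb_morphisms X V W"
   unfolding vb_morphisms_def
  proof (intro CollectI conjI, goal_cases)
   case 1 show ?case using f by (simp add: fibrewise_linear_def)
  next
   case 2
   have "coords_continuous X (U \<inter> U') n (in_charts (vfibre V) phi psi f)"
    if c: "(U, n, phi) \<in> vatlas V" and d: "(U', m, psi) \<in> vatlas W" for U n phi U' m psi
    unfolding coords_continuous_def
   using V.vsec_vchart[OF c] f W.vsec_tendsto[OF _ d] by (fastforce simp: continuous_map_nhdsin[OF openin_Int[OF V.vchart(1)[OF c] W.vchart(1)[OF d]]] in_charts_def preserves_sections_def)
   then show ?case by blast
  qed
 }
qed

definition section_iso where
 "section_iso X V W f g \<longleftrightarrow> fibrewise_linear X V W f \<and> preserves_sections X V W f \<and>
   fibrewise_linear X W V g \<and> preserves_sections X W V g \<and>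
   (\<forall>x\<in>topspace X. (\<forall>u\<in>vfibre V x. g x (f x u) = u) \<and> (\<forall>v\<in>vfibre W x. f x (g x v) = v))"

lemma vb_isomorphic_iff:
 assumes "vector_bundle X V" "vector_bundle X W"
 shows "vb_isomorphic X V W \<longleftrightarrow> (\<exists>f g. section_iso X V W f g)"
 unfolding vb_isomorphic_def section_iso_def Bex_def
 by (auto simp: vb_morphism_iff[OF assms] vb_morphism_iff[OF assms(2,1)])

lemma fibrewise_linear_comp:
 "fibrewise_linear X V W f ==> fibrewise_linear X W Z g ==> fibrewise_linear X V Z (%x u. g x (f x u))"
 unfolding fibrewise_linear_def lin_on_def by (auto simp: image_subset_iff)

lemma preserves_sections_comp:
 "preserves_sections X V W f ==> preserves_sections X W Z g ==> preserves_sections X V Z (%x u. g x (f x u))"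
 unfolding preserves_sections_def by blast

lemma section_iso_trans:
 assumes "section_iso X V W f g" "section_iso X W Z h k"
 shows "section_iso X V Z (%x u. h x (f x u)) (%x u. g x (k x u))"
 using assms fibrewise_linear_comp[of X V W f Z h] fibrewise_linear_comp[of X Z W k V g]
  preserves_sections_comp[of X V W f Z h] preserves_sections_comp[of X Z W k V g]
 unfolding section_iso_def by (auto simp: fibrewise_linear_def image_subset_iff)

lemma section_iso_refl: "section_iso X V V (%x u. u) (%x u. u)"
 by (simp add: section_iso_def fibrewise_linear_def preserves_sections_def lin_on_def)

lemma vb_isomorphic_refl: "vector_bundle X V ==> vb_isomorphic X V V"
 by (metis vb_isomorphic_iff section_iso_refl)

lemma vb_isomorphic_sym: "vb_isomorphic X V W ==> vb_isomorphic X W V"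
 unfolding vb_isomorphic_def by blast

lemma vb_isomorphic_trans:
 assumes "vector_bundle X V" "vector_bundle X W" "vector_bundle X Z" "vb_isomorphic X V W" "vb_isomorphic X W Z"
 shows "vb_isomorphic X V Z"
 using assms(4,5) section_iso_trans unfolding vb_isomorphic_iff[OF assms(1,2)] vb_isomorphic_iff[OF assms(2,3)] vb_isomorphic_iff[OF assms(1,3)]
 by blast

subsection \<open>Whitney sums\<close>

text \<open>The description of sections as pairs is what makes the monoid laws easy: with
  \<open>vb_morphism_iff\<close>, commutativity, associativity and the unit reduce to rearranging
  pairs.\<close>

lemma vector_bundle_whitney_sum:
 fixes V :: "('k::real_normed_field, 'x, 'v::ab_group_add) vbundle" and W :: "('k, 'x, 'w::ab_group_add) vbundle"
 assumes V: "vector_bundle X V" and W: "vector_bundle X W"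
 shows "vector_bundle X (whitney_sum V W)"
  and "x \<in> topspace X ==> vsec_at X (whitney_sum V W) s x \<longleftrightarrow> vsec_at X V (%y. fst (s y)) x \<and> vsec_at X W (%y. snd (s y)) x"
proof -
 interpret V: vbundle_loc X V by unfold_locales (rule V)
 interpret W: vbundle_loc X W by unfold_locales (rule W)
 let ?S = "whitney_sum V W"
 define j where "j n phi psi = (%x (v, w) i. if i < n then phi x v i else psi x w (i - n))" for n and phi :: "'x => 'v => nat => 'k" and psi :: "'x => 'w => nat => 'k"
 have fib: "vfibre ?S x = vfibre V x \<times> vfibre W x" and sca: "vscale ?S = (%c (v, w). (vscale V c v, vscale W c w))" for x
  by (simp_all add: whitney_sum_def)
 have atlas: "A \<in> vatlas ?S \<longleftrightarrow> (\<exists>U n phi U' m psi. A = (U \<inter> U', n + m, j n phi psi) \<and> (U, n, phi) \<in> vatlas V \<and> (U', m, psi) \<in> vatlas W)" for A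
  unfolding whitney_sum_def j_def by (simp) 
 have vs: "vector_space (vscale ?S)"
  unfolding sca by unfold_locales
   (auto simp: V.scale_right_distrib W.scale_right_distrib V.scale_left_distrib W.scale_left_distrib)
 interpret S: vector_space "vscale ?S" by (rule vs)
 have sub: "S.subspace (vfibre ?S x)" if "x \<in> topspace X" for x
  unfolding fib by (rule S.subspaceI)
   (use V.vsub[OF that] W.vsub[OF that] in \<open>auto simp: sca zero_prod_def V.subspace_0 W.subspace_0 V.subspace_add W.subspace_add V.subspace_scale W.subspace_scale\<close>)
 have jcoord: "j n phi psi x u \<in> coords (n + m)"
  if c: "(U, n, phi) \<in> vatlas V" "(U', m, psi) \<in> vatlas W" "x \<in> U" "x \<in> U'" "u \<in> vfibre ?S x" for U n phi U' m psi x u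
 using c(5) W.vchart_coords[OF c(2,4)] by (auto simp: fib j_def coords_def)
 have jbij: "bij_betw (j n phi psi x) (vfibre ?S x) (coords (n + m))"
  if c: "(U, n, phi) \<in> vatlas V" "(U', m, psi) \<in> vatlas W" "x \<in> U" "x \<in> U'" for U n phi U' m psi x
  unfolding bij_betw_def
 proof
  show "inj_on (j n phi psi x) (vfibre ?S x)"
  proof (rule inj_onI)
   fix u u' assume u: "u \<in> vfibre ?S x" "u' \<in> vfibre ?S x" "j n phi psi x u = j n phi psi x u'"
   obtain v w v' w' where e: "u = (v, w)" "v \<in> vfibre V x" "w \<in> vfibre W x" "u' = (v', w')" "v' \<in> vfibre V x" "w' \<in> vfibre W x"
    using u by (auto simp: fib)
   have "phi x v i = phi x v' i" for i
    using fun_cong[OF u(3), of i] V.vchart_coords[OF c(1,3) e(2)] V.vchart_coords[OF c(1,3) e(5)]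
    by (cases "i < n") (auto simp: j_def e coords_def)
   then have "v = v'" using V.vchart_inv_left[OF c(1,3) e(2)] V.vchart_inv_left[OF c(1,3) e(5)] by (metis ext)
   have "psi x w i = psi x w' i" for i
    using fun_cong[OF u(3), of "i + n"] by (simp add: j_def e)
   then have "w = w'" using W.vchart_inv_left[OF c(2,4) e(3)] W.vchart_inv_left[OF c(2,4) e(6)] by (metis ext)
   then show "u = u'" using \<open>v = v'\<close> e by simp
  qed
  show "j n phi psi x ` vfibre ?S x = coords (n + m)"
  proof
   show "j n phi psi x ` vfibre ?S x \<subseteq> coords (n + m)" using jcoord[OF c] by blast
   show "coords (n + m) \<subseteq> j n phi psi x ` vfibre ?S x"
   proof
    fix k :: "nat => 'k" assume k: "k \<in> coords (n + m)"
    let ?k1 = "%i. if i < n then k i else 0" and ?k2 = "%i. k (i + n)"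
    have k1: "?k1 \<in> coords n" and k2: "?k2 \<in> coords m" using k by (auto simp: coords_def)
    note i1 = V.vchart_inv[OF c(1,3) k1] and i2 = W.vchart_inv[OF c(2,4) k2]
    have "j n phi psi x (inv_into (vfibre V x) (phi x) ?k1, inv_into (vfibre W x) (psi x) ?k2) = k"
     using i1 i2 by (auto simp: j_def)
    then show "k \<in> j n phi psi x ` vfibre ?S x" using i1 i2 by (intro image_eqI) (auto simp: fib)
   qed
  qed
 qed
 have jlin: "lin_on (vscale ?S) cscale (vfibre ?S x) (j n phi psi x)"
  if c: "(U, n, phi) \<in> vatlas V" "(U', m, psi) \<in> vatlas W" "x \<in> U" "x \<in> U'" for U n phi U' m psi x
  using V.vchart(2)[OF c(1,3)] W.vchart(2)[OF c(2,4)] unfolding lin_on_def fib sca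
  by (auto simp: j_def cscale_def)
 have jtend: "((%y. j n phi psi y (s y)) \<longlongrightarrow> j n phi psi x (s x)) (nhdsin X x)"
  if "((%y. phi y (fst (s y))) \<longlongrightarrow> phi x (fst (s x))) (nhdsin X x)" "((%y. psi y (snd (s y))) \<longlongrightarrow> psi x (snd (s x))) (nhdsin X x)"
  for n phi psi s x
  using that unfolding tendsto_fun_iff j_def by (auto simp: case_prod_beta)
 have jdest: "((%y. phi y (fst (s y)) i) \<longlongrightarrow> phi x (fst (s x)) i) (nhdsin X x)" if "((%y. j n phi psi y (s y)) \<longlongrightarrow> j n phi psi x (s x)) (nhdsin X x)" "i < n"
  for n phi psi s x i
  using that unfolding tendsto_fun_iff j_def by (auto simp: case_prod_beta dest: spec[of _ i])
 have jdest2: "((%y. psi y (snd (s y)) i) \<longlongrightarrow> psi x (snd (s x)) i) (nhdsin X x)" if "((%y. j n phi psi y (s y)) \<longlongrightarrow> j n phi psi x (s x)) (nhdsin X x)"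
  for n phi psi s x i
  using that unfolding tendsto_fun_iff j_def by (auto simp: case_prod_beta dest: spec[of _ "i + n"])
 have fibev: "(near X x (%y. s y \<in> vfibre ?S y)) \<longleftrightarrow>
   (near X x (%y. fst (s y) \<in> vfibre V y)) \<and> (near X x (%y. snd (s y) \<in> vfibre W y))" for s x
  by (simp add: fib mem_Times_iff eventually_conj_iff)
 have toS: "vsec_at X ?S s x" if "vsec_at X V (%y. fst (s y)) x" "vsec_at X W (%y. snd (s y)) x" for s x
  unfolding vsec_at_def
 proof (intro conjI ballI, goal_cases)
  case 1 show ?case using that unfolding fibev vsec_at_def by blast
 next
  case (2 p)
  then obtain U n phi U' m psi where p: "p = (U \<inter> U', n + m, j n phi psi)" "(U, n, phi) \<in> vatlas V" "(U', m, psi) \<in> vatlas W"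
   unfolding atlas by blast
  show ?case unfolding p(1) split using V.vsec_tendsto[OF that(1) p(2)] W.vsec_tendsto[OF that(2) p(3)]
   by (intro impI jtend) auto
 qed
 show S: "vector_bundle X ?S"
  unfolding vector_bundle_def
 proof (intro conjI vs ballI, goal_cases)
  case (1 x) then show ?case by (rule sub)
 next
  case (2 p)
  then obtain U n phi U' m psi where p: "p = (U \<inter> U', n + m, j n phi psi)" "(U, n, phi) \<in> vatlas V" "(U', m, psi) \<in> vatlas W"
   unfolding atlas by blast
  show ?case unfolding p(1) split
   using jlin[OF p(2,3)] jbij[OF p(2,3)] by (auto intro!: openin_Int V.vchart(1)[OF p(2)] W.vchart(1)[OF p(3)])
 next
  case 3
  show ?case
  proof
   show "(\<Union>(U, n, phi)\<in>vatlas ?S. U) \<subseteq> topspace X"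
    using V.vchart(4) unfolding atlas by (auto simp: atlas)
   show "topspace X \<subseteq> (\<Union>(U, n, phi)\<in>vatlas ?S. U)"
   proof
    fix x assume x: "x \<in> topspace X"
    obtain U n phi U' m psi where c: "(U, n, phi) \<in> vatlas V" "x \<in> U" "(U', m, psi) \<in> vatlas W" "x \<in> U'"
     using V.exists_vchart[OF x] W.exists_vchart[OF x] by blast
    then have "(U \<inter> U', n + m, j n phi psi) \<in> vatlas ?S" unfolding atlas by blast
    then show "x \<in> (\<Union>(U, n, phi)\<in>vatlas ?S. U)" using c by blast
   qed
  qed
 next
  case (4 p)
  then obtain U n phi U' m psi where p: "p = (U \<inter> U', n + m, j n phi psi)" "(U, n, phi) \<in> vatlas V" "(U', m, psi) \<in> vatlas W"
   unfolding atlas by blast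
  show ?case
   unfolding p(1) split
  proof (intro ballI, goal_cases)
   case (1 q)
   then obtain T l \<theta> T' r \<eta> where q: "q = (T \<inter> T', l + r, j l \<theta> \<eta>)" "(T, l, \<theta>) \<in> vatlas V" "(T', r, \<eta>) \<in> vatlas W"
    unfolding atlas by blast
   have op: "openin X (U \<inter> U' \<inter> (T \<inter> T'))"
    by (intro openin_Int V.vchart(1)[OF p(2)] W.vchart(1)[OF p(3)] V.vchart(1)[OF q(2)] W.vchart(1)[OF q(3)])
   have "continuous_map (subtopology X (U \<inter> U' \<inter> (T \<inter> T'))) euclidean (%x. in_charts (vfibre ?S) (j n phi psi) (j l \<theta> \<eta>) (%x u. u) x k)"
    if k: "k \<in> coords (n + m)" for k
    unfolding continuous_map_nhdsin[OF op] in_charts_def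
   proof
    fix x assume x: "x \<in> U \<inter> U' \<inter> (T \<inter> T')"
    let ?k1 = "%i. if i < n then k i else 0" and ?k2 = "%i. k (i + n)"
    have k1: "?k1 \<in> coords n" and k2: "?k2 \<in> coords m" using k by (auto simp: coords_def)
    let ?s = "%y. (inv_into (vfibre V y) (phi y) ?k1, inv_into (vfibre W y) (psi y) ?k2)"
    have inv: "inv_into (vfibre ?S y) (j n phi psi y) k = ?s y" if "y \<in> U" "y \<in> U'" for y
    proof -
     note i1 = V.vchart_inv[OF p(2) that(1) k1] and i2 = W.vchart_inv[OF p(3) that(2) k2]
     have "j n phi psi y (?s y) = k" using i1 i2 by (auto simp: j_def)
     moreover have "?s y \<in> vfibre ?S y" using i1 i2 by (simp add: fib)
     ultimately show ?thesis using bij_betw_inv_into_left[OF jbij[OF p(2,3) that]] by metis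
    qed
    have "((%y. j l \<theta> \<eta> y (?s y)) \<longlongrightarrow> j l \<theta> \<eta> x (?s x)) (nhdsin X x)"
     using V.vsec_tendsto[OF V.vsec_vchart[OF p(2) _ k1] q(2)] W.vsec_tendsto[OF W.vsec_vchart[OF p(3) _ k2] q(3)] x
     by (intro jtend) auto
    moreover have ev: "near X x (%y. j l \<theta> \<eta> y (inv_into (vfibre ?S y) (j n phi psi y) k) = j l \<theta> \<eta> y (?s y))"
     using eventually_in_openin[OF op x] by eventually_elim (simp add: inv)
    ultimately show "((%x. j l \<theta> \<eta> x (inv_into (vfibre ?S x) (j n phi psi x) k)) \<longlongrightarrow> j l \<theta> \<eta> x (inv_into (vfibre ?S x) (j n phi psi x) k)) (nhdsin X x)"
     using tendsto_cong[OF ev] inv[of x] x by simp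
   qed
   then show ?case unfolding q(1) split coords_continuous_def by blast
  qed
 qed
 show "vsec_at X ?S s x \<longleftrightarrow> vsec_at X V (%y. fst (s y)) x \<and> vsec_at X W (%y. snd (s y)) x" if x: "x \<in> topspace X" for x s
 proof
  assume s: "vsec_at X ?S s x"
  interpret S': vbundle_loc X ?S by unfold_locales (rule S)
  have ev: "near X x (%y. fst (s y) \<in> vfibre V y)" "near X x (%y. snd (s y) \<in> vfibre W y)"
   using s fibev[of s x] by (simp_all add: vsec_at_def)
  obtain U0 n0 phi0 U1 n1 psi1 where c0: "(U0, n0, phi0) \<in> vatlas V" "x \<in> U0" "(U1, n1, psi1) \<in> vatlas W" "x \<in> U1"
   using V.exists_vchart[OF x] W.exists_vchart[OF x] by blast
  have "((%y. phi y (fst (s y))) \<longlongrightarrow> phi x (fst (s x))) (nhdsin X x)" if c: "(U, n, phi) \<in> vatlas V" "x \<in> U" for U n phi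
   unfolding tendsto_fun_iff
  proof
   fix i
   have "(U \<inter> U1, n + n1, j n phi psi1) \<in> vatlas ?S" unfolding atlas using c c0 by blast
   from S'.vsec_tendsto[OF s this] c c0 have l: "((%y. j n phi psi1 y (s y)) \<longlongrightarrow> j n phi psi1 x (s x)) (nhdsin X x)" by blast
   show "((%y. phi y (fst (s y)) i) \<longlongrightarrow> phi x (fst (s x)) i) (nhdsin X x)"
   proof (cases "i < n")
    case True then show ?thesis by (rule jdest[OF l])
   next
    \<comment> \<open>In the chart of the sum the coordinates from index \<open>n\<close> on belong
      to the second summand and say nothing about the first; but in a chart of rank \<open>n\<close>
      these coordinates vanish.\<close>
    case False
    have e: "near X x (%y. phi y (fst (s y)) i = 0)"
     using ev(1) V.vchart_eventually[OF c]
    proof eventually_elim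
     case (elim y)
     then show ?case using V.vchart_coords[OF c(1) elim(2,1)] False by (simp add: coords_def)
    qed
    then show ?thesis using tendsto_cong[OF e] eventually_nhdsin_self[OF x e] by simp
   qed
  qed
  moreover have "((%y. psi y (snd (s y))) \<longlongrightarrow> psi x (snd (s x))) (nhdsin X x)" if c: "(U, n, psi) \<in> vatlas W" "x \<in> U" for U n psi
  proof -
   have "(U0 \<inter> U, n0 + n, j n0 phi0 psi) \<in> vatlas ?S" unfolding atlas using c c0 by blast
   from S'.vsec_tendsto[OF s this] c c0 have "((%y. j n0 phi0 psi y (s y)) \<longlongrightarrow> j n0 phi0 psi x (s x)) (nhdsin X x)" by blast
   from jdest2[OF this] show ?thesis unfolding tendsto_fun_iff by blast
  qed
  ultimately show "vsec_at X V (%y. fst (s y)) x \<and> vsec_at X W (%y. snd (s y)) x"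
   using ev by (auto simp: vsec_at_def)
 qed (blast intro: toS)
qed

lemma whitney_sum_fibre: "vfibre (whitney_sum V W) x = vfibre V x \<times> vfibre W x"
 and whitney_sum_scale: "vscale (whitney_sum V W) c (v, w) = (vscale V c v, vscale W c w)"
 by (simp_all add: whitney_sum_def)

lemma section_iso_whitney:
 fixes V :: "('k::real_normed_field, 'x, 'v::ab_group_add) vbundle" and W :: "('k, 'x, 'w::ab_group_add) vbundle"
  and V' :: "('k, 'x, 'a::ab_group_add) vbundle" and W' :: "('k, 'x, 'b::ab_group_add) vbundle"
 assumes V: "vector_bundle X V" "vector_bundle X V'" "section_iso X V V' f g"
  and W: "vector_bundle X W" "vector_bundle X W'" "section_iso X W W' h k"
 shows "section_iso X (whitney_sum V W) (whitney_sum V' W')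
  (%x u. (f x (fst u), h x (snd u))) (%x u. (g x (fst u), k x (snd u)))"
proof -
 have fl: "fibrewise_linear X (whitney_sum V W) (whitney_sum V' W') (%x u. (f x (fst u), h x (snd u)))"
  if "fibrewise_linear X V V' f" "fibrewise_linear X W W' h"
  for V :: "('k, 'x, 'c::ab_group_add) vbundle" and W :: "('k, 'x, 'd::ab_group_add) vbundle"
   and V' :: "('k, 'x, 'a'::ab_group_add) vbundle" and W' :: "('k, 'x, 'b'::ab_group_add) vbundle" and f h
  using that unfolding fibrewise_linear_def lin_on_def by (auto simp: whitney_sum_fibre whitney_sum_scale image_subset_iff)
 have ps: "preserves_sections X (whitney_sum V W) (whitney_sum V' W') (%x u. (f x (fst u), h x (snd u)))"
  if "preserves_sections X V V' f" "preserves_sections X W W' h" "vector_bundle X V" "vector_bundle X V'" "vector_bundle X W" "vector_bundle X W'"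
  for V :: "('k, 'x, 'c::ab_group_add) vbundle" and W :: "('k, 'x, 'd::ab_group_add) vbundle"
   and V' :: "('k, 'x, 'a'::ab_group_add) vbundle" and W' :: "('k, 'x, 'b'::ab_group_add) vbundle" and f h
  using that(1,2) unfolding preserves_sections_def
  by (auto simp: vector_bundle_whitney_sum(2)[OF that(3,5)] vector_bundle_whitney_sum(2)[OF that(4,6)])
 have f: "fibrewise_linear X V V' f" "preserves_sections X V V' f" "fibrewise_linear X V' V g" "preserves_sections X V' V g"
  and h: "fibrewise_linear X W W' h" "preserves_sections X W W' h" "fibrewise_linear X W' W k" "preserves_sections X W' W k"
  using V(3) W(3) by (simp_all add: section_iso_def)
 show ?thesis
  unfolding section_iso_def
  using fl[OF f(1) h(1)] fl[OF f(3) h(3)] ps[OF f(2) h(2) V(1,2) W(1,2)] ps[OF f(4) h(4) V(2,1) W(2,1)] V(3) W(3) by (auto simp: section_iso_def whitney_sum_fibre)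
qed

lemma whitney_sum_cong:
 assumes "vector_bundle X V" "vector_bundle X V'" "vb_isomorphic X V V'"
  and "vector_bundle X W" "vector_bundle X W'" "vb_isomorphic X W W'"
 shows "vb_isomorphic X (whitney_sum V W) (whitney_sum V' W')"
using assms(3,6) section_iso_whitney[OF assms(1,2) _ assms(4,5)] by (force simp: vb_isomorphic_iff[OF assms(1,2)] vb_isomorphic_iff[OF assms(4,5)] vb_isomorphic_iff[OF vector_bundle_whitney_sum(1)[OF assms(1,4)] vector_bundle_whitney_sum(1)[OF assms(2,5)]])

lemma whitney_sum_comm:
 assumes V: "vector_bundle X V" and W: "vector_bundle X W"
 shows "vb_isomorphic X (whitney_sum V W) (whitney_sum W V)"
proof -
 have "section_iso X (whitney_sum V W) (whitney_sum W V) (%x u. (snd u, fst u)) (%x u. (snd u, fst u))"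
  unfolding section_iso_def fibrewise_linear_def lin_on_def preserves_sections_def
  by (auto simp: whitney_sum_fibre whitney_sum_scale vector_bundle_whitney_sum(2)[OF V W] vector_bundle_whitney_sum(2)[OF W V])
 then show ?thesis
  unfolding vb_isomorphic_iff[OF vector_bundle_whitney_sum(1)[OF V W] vector_bundle_whitney_sum(1)[OF W V]] by blast
qed

lemma whitney_sum_assoc:
 assumes V: "vector_bundle X V" and W: "vector_bundle X W" and Z: "vector_bundle X Z"
 shows "vb_isomorphic X (whitney_sum (whitney_sum V W) Z) (whitney_sum V (whitney_sum W Z))"
proof -
 note VW = vector_bundle_whitney_sum[OF V W] and WZ = vector_bundle_whitney_sum[OF W Z]
 note VW_Z = vector_bundle_whitney_sum[OF VW(1) Z] and V_WZ = vector_bundle_whitney_sum[OF V WZ(1)]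
 have "section_iso X (whitney_sum (whitney_sum V W) Z) (whitney_sum V (whitney_sum W Z))
   (%x u. (fst (fst u), (snd (fst u), snd u))) (%x u. ((fst u, fst (snd u)), snd (snd u)))"
  unfolding section_iso_def fibrewise_linear_def lin_on_def preserves_sections_def
  by (auto simp: whitney_sum_fibre whitney_sum_scale VW_Z(2) V_WZ(2) VW(2) WZ(2))
 then show ?thesis unfolding vb_isomorphic_iff[OF VW_Z(1) V_WZ(1)] by blast
qed

lemma vector_bundle_zero: "vector_bundle X (zero_vbundle X :: ('k::real_normed_field, 'x, nat => 'k) vbundle)"
proof -
 interpret vector_space "cscale :: 'k => _" by (rule vector_space_cscale)
 have inv: "inv_into {0} (%v. v) 0 = (0 :: nat => 'k)" by (metis inv_into_into image_ident singletonD singletonI)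
 show ?thesis
  using vector_space_axioms by (auto simp: vector_bundle_def zero_vbundle_def bij_betw_def lin_on_def coords_continuous_def in_charts_def coords_def)
qed

lemma vsec_zero_vbundle: "vsec_at X (zero_vbundle X :: ('k::real_normed_field, 'x, nat => 'k) vbundle) (%y. 0) x"
 by (auto simp: vsec_at_def zero_vbundle_def)

lemma whitney_sum_zero:
 fixes V :: "('k::real_normed_field, 'x, 'v::ab_group_add) vbundle"
 assumes V: "vector_bundle X V"
 shows "vb_isomorphic X (whitney_sum (zero_vbundle X) V) V"
proof -
 note Z = vector_bundle_zero[where ?'k = 'k, of X]
 note ZV = vector_bundle_whitney_sum[OF Z V]
 have fz: "vfibre (zero_vbundle X :: ('k, 'x, nat => 'k) vbundle) x = {0}" "vscale (zero_vbundle X :: ('k, 'x, nat => 'k) vbundle) = cscale" for x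
  by (simp_all add: zero_vbundle_def)
 have "section_iso X (whitney_sum (zero_vbundle X) V) V (%x u. snd u) (%x u. (0, u))"
  unfolding section_iso_def fibrewise_linear_def lin_on_def preserves_sections_def
  by (auto simp: whitney_sum_fibre whitney_sum_scale ZV(2) fz vsec_zero_vbundle) (auto simp: cscale_def fun_eq_iff)
 then show ?thesis unfolding vb_isomorphic_iff[OF ZV(1) V] by blast
qed

text \<open>Each fibre is identified with \<open>K\<^sup>n\<close> by one chart, chosen for each point without continuity.\<close>

lemma exists_standard_representative:
 fixes V :: "('k::real_normed_field, 'x, 'v::ab_group_add) vbundle"
 assumes V: "vector_bundle X V"
 shows "\<exists>W :: ('k, 'x, nat => 'k) vbundle. vector_bundle X W \<and> vb_isomorphic X W V"
proof -
 interpret V: vbundle_loc X V by unfold_locales (rule V)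
 interpret C: vector_space "cscale :: 'k => _" by (rule vector_space_cscale)
 have "\<forall>x\<in>topspace X. \<exists>p. p \<in> vatlas V \<and> x \<in> fst p" using V.exists_vchart by fastforce
 from this[unfolded bchoice_iff] obtain p where p: "\<forall>x\<in>topspace X. p x \<in> vatlas V \<and> x \<in> fst (p x)" ..
 define n where "n x = fst (snd (p x))" for x
 define \<theta> where "\<theta> x = snd (snd (p x)) x" for x
 have pc: "(fst (p x), n x, snd (snd (p x))) \<in> vatlas V" "x \<in> fst (p x)" if "x \<in> topspace X" for x
  using p that by (auto simp: n_def)
 have lin: "lin_on (vscale V) cscale (vfibre V x) (\<theta> x)" and bij: "bij_betw (\<theta> x) (vfibre V x) (coords (n x))" if "x \<in> topspace X" for x
  using V.vchart(2,3)[OF pc[OF that]] by (simp_all add: \<theta>_def)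
 define i where "i x = inv_into (vfibre V x) (\<theta> x)" for x
 have i: "i x v \<in> vfibre V x" "\<theta> x (i x v) = v" if "x \<in> topspace X" "v \<in> coords (n x)" for x v
  using bij[OF that(1)] that(2) by (auto simp: i_def bij_betw_def inv_into_into f_inv_into_f)
 have i': "i x (\<theta> x u) = u" if "x \<in> topspace X" "u \<in> vfibre V x" for x u
  using bij[OF that(1)] that(2) by (simp add: i_def bij_betw_def)
 have ilin: "lin_on cscale (vscale V) (coords (n x)) (i x)" if "x \<in> topspace X" for x
  unfolding i_def by (rule lin_on_inverse[OF V.vector_space_axioms lin[OF that] V.vsub[OF that] bij[OF that]])
 have ibij: "bij_betw (i x) (coords (n x)) (vfibre V x)" if "x \<in> topspace X" for x
  unfolding i_def by (rule bij_betw_inv_into[OF bij[OF that]])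
 define W :: "('k, 'x, nat => 'k) vbundle" where
  "W = \<lparr>vfibre = (%x. coords (n x)), vscale = cscale, vatlas = (%(U, m, phi). (U, m, %x w. phi x (i x w))) ` vatlas V\<rparr>"
 have Wf: "vfibre W x = coords (n x)" "vscale W = cscale" "vatlas W = (%(U, m, phi). (U, m, %x w. phi x (i x w))) ` vatlas V" for x
  by (simp_all add: W_def)
 have bijW: "bij_betw (%w. phi x (i x w)) (coords (n x)) (coords m)" if "(U, m, phi) \<in> vatlas V" "x \<in> U" for U m phi x
  using bij_betw_trans[OF ibij[OF V.vchart(4)[OF that]] V.vchart(3)[OF that]] by (simp add: comp_def)
 have vsecW: "vsec_at X W s x \<longleftrightarrow> vsec_at X V (%y. i y (s y)) x"
  if x: "x \<in> topspace X" and ev: "(near X x (%y. s y \<in> coords (n y)))" for s x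
 proof -
  have "near X x (%y. i y (s y) \<in> vfibre V y)"
   using ev eventually_in_openin[OF openin_topspace x] by eventually_elim (rule i)
  then show ?thesis using ev by (force simp: vsec_at_def Wf)
 qed
 have Wb: "vector_bundle X W"
  unfolding vector_bundle_def
 proof (intro conjI ballI, goal_cases)
  case 1 show ?case unfolding Wf by (rule vector_space_cscale)
 next
  case (2 x) show ?case unfolding Wf by (rule subspace_coords)
 next
  case (3 q)
  then obtain U m phi where q: "q = (U, m, %x w. phi x (i x w))" "(U, m, phi) \<in> vatlas V" unfolding Wf by auto
  have "lin_on cscale cscale (coords (n x)) (%w. phi x (i x w))" if "x \<in> U" for x
   using ilin[OF V.vchart(4)[OF q(2) that]] V.vchart(2)[OF q(2) that] i(1)[OF V.vchart(4)[OF q(2) that]]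
   unfolding lin_on_def by auto
  then show ?case unfolding q(1) split Wf using V.vchart(1)[OF q(2)] bijW[OF q(2)] by blast
 next
  case 4
  show ?case using V by (auto simp: Wf vector_bundle_def)
 next
  case (5 q)
  then obtain U m phi where q: "q = (U, m, %x w. phi x (i x w))" "(U, m, phi) \<in> vatlas V" unfolding Wf by auto
  show ?case unfolding q(1) split
  proof (intro ballI, goal_cases)
   case (1 r)
   then obtain U' m' psi where r: "r = (U', m', %x w. psi x (i x w))" "(U', m', psi) \<in> vatlas V" unfolding Wf by auto
   have op: "openin X (U \<inter> U')" by (intro openin_Int V.vchart(1)[OF q(2)] V.vchart(1)[OF r(2)])
   have "continuous_map (subtopology X (U \<inter> U')) euclidean
     (%x. in_charts (vfibre W) (%x w. phi x (i x w)) (%x w. psi x (i x w)) (%x u. u) x v)" if v: "v \<in> coords m" for v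
    unfolding continuous_map_nhdsin[OF op] in_charts_def
   proof
    fix x assume x: "x \<in> U \<inter> U'"
    have e: "i y (inv_into (vfibre W y) (%w. phi y (i y w)) v) = inv_into (vfibre V y) (phi y) v" if y: "y \<in> U" for y
    using V.vchart(4)[OF q(2) y] bijW[OF q(2) y] v inv_into_into[of v "%w. phi y (i y w)" "coords (n y)"] f_inv_into_f[of v "%w. phi y (i y w)" "coords (n y)"] V.vchart_inv_left[OF q(2) y i(1)] by (force simp: Wf bij_betw_def)
    have ev: "near X x (%y. psi y (i y (inv_into (vfibre W y) (%w. phi y (i y w)) v)) = psi y (inv_into (vfibre V y) (phi y) v))"
     using eventually_in_openin[OF op x] by eventually_elim (simp add: e)
    show "((%y. psi y (i y (inv_into (vfibre W y) (%w. phi y (i y w)) v))) \<longlongrightarrow>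
      psi x (i x (inv_into (vfibre W x) (%w. phi x (i x w)) v))) (nhdsin X x)" using V.vsec_tendsto[OF V.vsec_vchart[OF q(2) _ v] r(2)] x tendsto_cong[OF ev] e[of x] by simp
   qed
   then show ?case unfolding r(1) split coords_continuous_def by blast
  qed
 qed
 have "section_iso X W V i \<theta>"
  unfolding section_iso_def
 proof (intro conjI)
  show "fibrewise_linear X W V i" unfolding fibrewise_linear_def Wf using ilin i(1) by blast
  show "fibrewise_linear X V W \<theta>" unfolding fibrewise_linear_def Wf using lin bij by (auto simp: bij_betw_def)
  show "preserves_sections X W V i"
   unfolding preserves_sections_def using vsecW by (auto simp: vsec_at_def Wf)
  show "preserves_sections X V W \<theta>"
   unfolding preserves_sections_def
  proof (intro ballI allI impI)
   fix x s assume x: "x \<in> topspace X" and s: "vsec_at X V s x"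
   have ev: "near X x (%y. s y \<in> vfibre V y \<and> y \<in> topspace X)"
    using s eventually_in_openin[OF openin_topspace x] by (simp add: vsec_at_def eventually_conj_iff)
   then have 1: "near X x (%y. \<theta> y (s y) \<in> coords (n y))"
    by eventually_elim (use bij in \<open>auto simp: bij_betw_def\<close>)
   have 2: "near X x (%y. i y (\<theta> y (s y)) = s y)" using ev by eventually_elim (simp add: i')
   show "vsec_at X W (%y. \<theta> y (s y)) x" unfolding vsecW[OF x 1] by (rule V.vsec_cong[OF s x 2])
  qed
  show "\<forall>x\<in>topspace X. (\<forall>u\<in>vfibre W x. \<theta> x (i x u) = u) \<and> (\<forall>v\<in>vfibre V x. i x (\<theta> x v) = v)"
   unfolding Wf using i i' by blast
 qed
 then show ?thesis using Wb vb_isomorphic_iff[OF Wb V] by blast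
qed

subsection \<open>The monoid of isomorphism classes\<close>

text \<open>A class lists only bundles of the standard fibre type, so equality of classes is
  exploited through a standard representative of \<open>V\<close>, which then lies in both.\<close>

lemma vb_class_eq_iff:
 assumes V: "vector_bundle X V" and W: "vector_bundle X W"
 shows "vb_class X V = vb_class X W \<longleftrightarrow> vb_isomorphic X V W"
using exists_standard_representative[OF V] vb_isomorphic_trans[OF V _ W vb_isomorphic_sym] vb_isomorphic_trans[OF _ V W] vb_isomorphic_trans[OF _ W V _ vb_isomorphic_sym] by (auto simp: vb_class_def)

lemma vb_class_Vect:
 assumes V: "vector_bundle X V"
 shows "vb_class X V \<in> carrier (Vect X)"
using exists_standard_representative[OF V] vb_class_eq_iff[OF _ V] by (auto simp: Vect_def)

lemma Vect_carrierE:
 fixes a :: "('k::real_normed_field, 'x) vb_class"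
 assumes "a \<in> carrier (Vect X)"
 obtains V :: "('k, 'x, nat => 'k) vbundle" where "vector_bundle X V" "a = vb_class X V"
 using assms by (auto simp: Vect_def)

text \<open>The union in the definition of the product runs over nonempty sets, and by
  \<open>whitney_sum_cong\<close> all its members are equal.\<close>

lemma Vect_mult:
 assumes V: "vector_bundle X V" and W: "vector_bundle X W"
 shows "vb_class X V \<otimes>\<^bsub>Vect X\<^esub> vb_class X W = vb_class X (whitney_sum V W)"
proof -
 have e: "vb_class X (whitney_sum A B) = vb_class X (whitney_sum V W)" if "A \<in> vb_class X V" "B \<in> vb_class X W" for A B
 using that vb_class_eq_iff[OF vector_bundle_whitney_sum(1) vector_bundle_whitney_sum(1)[OF V W]] whitney_sum_cong[OF _ V _ _ W] by (auto simp: vb_class_def)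
 have ne: "vb_class X V \<noteq> {}" "vb_class X W \<noteq> {}"
  using exists_standard_representative[OF V] exists_standard_representative[OF W] by (auto simp: vb_class_def)
 show ?thesis using ne e by (simp add: Vect_def)
qed

lemma Vect_one: "\<one>\<^bsub>Vect X\<^esub> = vb_class X (zero_vbundle X)"
 by (simp add: Vect_def)

lemma comm_monoid_Vect: "comm_monoid (Vect X :: ('k::real_normed_field, 'x) vb_class monoid)"
proof (rule comm_monoidI)
 fix a b c :: "('k, 'x) vb_class"
 assume a: "a \<in> carrier (Vect X)"
 obtain A :: "('k, 'x, nat => 'k) vbundle" where A: "vector_bundle X A" "a = vb_class X A" using Vect_carrierE[OF a] .
 note Z = vector_bundle_zero[where ?'k = 'k, of X]
 show "\<one>\<^bsub>Vect X\<^esub> \<otimes>\<^bsub>Vect X\<^esub> a = a"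
  unfolding A(2) Vect_one Vect_mult[OF Z A(1)]
  using vb_class_eq_iff[OF vector_bundle_whitney_sum(1)[OF Z A(1)] A(1)] whitney_sum_zero[OF A(1)] by simp
 assume b: "b \<in> carrier (Vect X)"
 obtain B :: "('k, 'x, nat => 'k) vbundle" where B: "vector_bundle X B" "b = vb_class X B" using Vect_carrierE[OF b] .
 note AB = vector_bundle_whitney_sum(1)[OF A(1) B(1)] and BA = vector_bundle_whitney_sum(1)[OF B(1) A(1)]
 show "a \<otimes>\<^bsub>Vect X\<^esub> b \<in> carrier (Vect X)"
  unfolding A(2) B(2) Vect_mult[OF A(1) B(1)] by (rule vb_class_Vect[OF AB])
 show "a \<otimes>\<^bsub>Vect X\<^esub> b = b \<otimes>\<^bsub>Vect X\<^esub> a"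
  unfolding A(2) B(2) Vect_mult[OF A(1) B(1)] Vect_mult[OF B(1) A(1)]
  using vb_class_eq_iff[OF AB BA] whitney_sum_comm[OF A(1) B(1)] by simp
 assume c: "c \<in> carrier (Vect X)"
 obtain C :: "('k, 'x, nat => 'k) vbundle" where C: "vector_bundle X C" "c = vb_class X C" using Vect_carrierE[OF c] .
 note BC = vector_bundle_whitney_sum(1)[OF B(1) C(1)]
 show "a \<otimes>\<^bsub>Vect X\<^esub> b \<otimes>\<^bsub>Vect X\<^esub> c = a \<otimes>\<^bsub>Vect X\<^esub> (b \<otimes>\<^bsub>Vect X\<^esub> c)"
  unfolding A(2) B(2) C(2) Vect_mult[OF A(1) B(1)] Vect_mult[OF AB C(1)] Vect_mult[OF B(1) C(1)] Vect_mult[OF A(1) BC]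
  using vb_class_eq_iff[OF vector_bundle_whitney_sum(1)[OF AB C(1)] vector_bundle_whitney_sum(1)[OF A(1) BC]] whitney_sum_assoc[OF A(1) B(1) C(1)] by simp
next
 show "\<one>\<^bsub>Vect X\<^esub> \<in> carrier (Vect X :: ('k, 'x) vb_class monoid)"
  unfolding Vect_one by (rule vb_class_Vect[OF vector_bundle_zero])
qed

subsection \<open>The Grothendieck group\<close>

context comm_monoid
begin

abbreviation gcl :: "'a => 'a => ('a \<times> 'a) set" where
 "gcl a b \<equiv> grothendieck_rel G `` {(a, b)}"

lemma grothendieck_rel_iff:
 "((a, b), (c, d)) \<in> grothendieck_rel G \<longleftrightarrow> a \<in> carrier G \<and> b \<in> carrier G \<and> c \<in> carrier G \<and> d \<in> carrier G \<and>
   (\<exists>e\<in>carrier G. a \<otimes> d \<otimes> e = c \<otimes> b \<otimes> e)"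
 by (simp add: grothendieck_rel_def)

lemma equiv_grothendieck_rel: "equiv (carrier G \<times> carrier G) (grothendieck_rel G)"
proof (rule equivI)
 show "grothendieck_rel G \<subseteq> (carrier G \<times> carrier G) \<times> (carrier G \<times> carrier G)"
  by (auto simp: grothendieck_rel_def)
 show "refl_on (carrier G \<times> carrier G) (grothendieck_rel G)"
  by (auto simp: refl_on_def grothendieck_rel_def)
 show "sym (grothendieck_rel G)"
 by (metis symI surj_pair grothendieck_rel_iff)
 show "trans (grothendieck_rel G)"
 proof (rule transI)
  fix x y z assume xy: "(x, y) \<in> grothendieck_rel G" and yz: "(y, z) \<in> grothendieck_rel G"
  obtain a b c d h f where p: "x = (a, b)" "y = (c, d)" "z = (h, f)" by (metis surj_pair)
  obtain e g where C: "a \<in> carrier G" "b \<in> carrier G" "c \<in> carrier G" "d \<in> carrier G" "h \<in> carrier G" "f \<in> carrier G"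
   "e \<in> carrier G" "g \<in> carrier G" and 1: "a \<otimes> d \<otimes> e = c \<otimes> b \<otimes> e" and 2: "c \<otimes> f \<otimes> g = h \<otimes> d \<otimes> g"
   using xy yz unfolding p grothendieck_rel_iff by blast
  \<comment> \<open>The monoid allows no cancellation; multiplying by \<open>d\<close>,
    \<open>e\<close> and \<open>g\<close> makes both given relations applicable after
    reordering.\<close>
  have "a \<otimes> f \<otimes> (d \<otimes> e \<otimes> g) = (a \<otimes> d \<otimes> e) \<otimes> (f \<otimes> g)" using C by (simp add: m_ac)
  also have "\<dots> = (c \<otimes> f \<otimes> g) \<otimes> (b \<otimes> e)" unfolding 1 using C by (simp add: m_ac)
  also have "\<dots> = h \<otimes> b \<otimes> (d \<otimes> e \<otimes> g)" unfolding 2 using C by (simp add: m_ac)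
  finally show "(x, z) \<in> grothendieck_rel G" unfolding p grothendieck_rel_iff using C by blast
 qed
qed

lemma gcl_eq_iff:
 assumes "a \<in> carrier G" "b \<in> carrier G" "c \<in> carrier G" "d \<in> carrier G"
 shows "gcl a b = gcl c d \<longleftrightarrow> (\<exists>e\<in>carrier G. a \<otimes> d \<otimes> e = c \<otimes> b \<otimes> e)"
 using eq_equiv_class_iff[OF equiv_grothendieck_rel, of "(a, b)" "(c, d)"] assms by (simp add: grothendieck_rel_iff)

lemma grothendieck_carrierE:
 assumes "p \<in> carrier (grothendieck_group G)"
 obtains a b where "a \<in> carrier G" "b \<in> carrier G" "p = gcl a b"
 using assms by (auto simp: grothendieck_group_def elim!: quotientE)

lemma gcl_carrier: "a \<in> carrier G ==> b \<in> carrier G ==> gcl a b \<in> carrier (grothendieck_group G)"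
 by (auto simp: grothendieck_group_def intro: quotientI)

lemma gcl_mult:
 assumes C: "a \<in> carrier G" "b \<in> carrier G" "c \<in> carrier G" "d \<in> carrier G"
 shows "gcl a b \<otimes>\<^bsub>grothendieck_group G\<^esub> gcl c d = gcl (a \<otimes> c) (b \<otimes> d)"
proof -
 have e: "gcl (a' \<otimes> c') (b' \<otimes> d') = gcl (a \<otimes> c) (b \<otimes> d)" if h: "(a', b') \<in> gcl a b" "(c', d') \<in> gcl c d" for a' b' c' d'
 proof -
  obtain e g where D: "a' \<in> carrier G" "b' \<in> carrier G" "c' \<in> carrier G" "d' \<in> carrier G" "e \<in> carrier G" "g \<in> carrier G"
   and 1: "a \<otimes> b' \<otimes> e = a' \<otimes> b \<otimes> e" and 2: "c \<otimes> d' \<otimes> g = c' \<otimes> d \<otimes> g"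
   using h unfolding Image_singleton_iff grothendieck_rel_iff by blast
  have "(a' \<otimes> c') \<otimes> (b \<otimes> d) \<otimes> (e \<otimes> g) = (a' \<otimes> b \<otimes> e) \<otimes> (c' \<otimes> d \<otimes> g)" using C D by (simp add: m_ac)
  also have "\<dots> = (a \<otimes> c) \<otimes> (b' \<otimes> d') \<otimes> (e \<otimes> g)" unfolding 1[symmetric] 2[symmetric] using C D by (simp add: m_ac)
  finally show ?thesis using C D by (subst gcl_eq_iff) auto
 qed
 have ne: "(a, b) \<in> gcl a b" "(c, d) \<in> gcl c d"
  using C equiv_class_self[OF equiv_grothendieck_rel] by auto
 have "(\<Union>(a', b')\<in>gcl a b. \<Union>(c', d')\<in>gcl c d. gcl (a' \<otimes> c') (b' \<otimes> d')) = gcl (a \<otimes> c) (b \<otimes> d)"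
 proof (rule SUP_eq_const)
  fix p assume p: "p \<in> gcl a b"
  obtain a' b' where p': "p = (a', b')" by force
  show "(case p of (a', b') => \<Union>(c', d')\<in>gcl c d. gcl (a' \<otimes> c') (b' \<otimes> d')) = gcl (a \<otimes> c) (b \<otimes> d)"
   using e p ne by blast
 qed (use ne in blast)
 then show ?thesis by (simp add: grothendieck_group_def)
qed

lemma grothendieck_one: "\<one>\<^bsub>grothendieck_group G\<^esub> = gcl \<one> \<one>"
 by (simp add: grothendieck_group_def)

lemma gcl_diag: "a \<in> carrier G ==> gcl a a = gcl \<one> \<one>"
 by (subst gcl_eq_iff) auto

lemma group_grothendieck: "group (grothendieck_group G)"
proof (rule groupI)
 fix p q r assume p: "p \<in> carrier (grothendieck_group G)"
 obtain a b where a: "a \<in> carrier G" "b \<in> carrier G" "p = gcl a b" using grothendieck_carrierE[OF p] .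
 show "\<one>\<^bsub>grothendieck_group G\<^esub> \<otimes>\<^bsub>grothendieck_group G\<^esub> p = p"
  unfolding a(3) grothendieck_one using a(1,2) by (simp add: gcl_mult)
 show "\<exists>q\<in>carrier (grothendieck_group G). q \<otimes>\<^bsub>grothendieck_group G\<^esub> p = \<one>\<^bsub>grothendieck_group G\<^esub>"
  unfolding a(3) grothendieck_one using a(1,2) gcl_diag[of "a \<otimes> b"]
  by (intro bexI[of _ "gcl b a"] gcl_carrier) (auto simp: gcl_mult m_comm)
 assume q: "q \<in> carrier (grothendieck_group G)"
 obtain c d where c: "c \<in> carrier G" "d \<in> carrier G" "q = gcl c d" using grothendieck_carrierE[OF q] .
 show "p \<otimes>\<^bsub>grothendieck_group G\<^esub> q \<in> carrier (grothendieck_group G)"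
  unfolding a(3) c(3) using a(1,2) c(1,2) by (simp add: gcl_mult gcl_carrier)
 assume r: "r \<in> carrier (grothendieck_group G)"
 obtain e f where e: "e \<in> carrier G" "f \<in> carrier G" "r = gcl e f" using grothendieck_carrierE[OF r] .
 show "p \<otimes>\<^bsub>grothendieck_group G\<^esub> q \<otimes>\<^bsub>grothendieck_group G\<^esub> r = p \<otimes>\<^bsub>grothendieck_group G\<^esub> (q \<otimes>\<^bsub>grothendieck_group G\<^esub> r)"
  unfolding a(3) c(3) e(3) using a(1,2) c(1,2) e(1,2) by (simp add: gcl_mult m_assoc)
next
 show "\<one>\<^bsub>grothendieck_group G\<^esub> \<in> carrier (grothendieck_group G)" unfolding grothendieck_one by (simp add: gcl_carrier)
qed

text \<open>The inverse of the class of \<open>(b, 1)\<close> is the class of \<open>(1, b)\<close>,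
  so the difference is represented by \<open>(a, b)\<close>.\<close>

lemma grothendieck_difference_eq_one:
 assumes "a \<in> carrier G" "b \<in> carrier G"
 shows "gcl a \<one> \<otimes>\<^bsub>grothendieck_group G\<^esub> inv\<^bsub>grothendieck_group G\<^esub> gcl b \<one> = \<one>\<^bsub>grothendieck_group G\<^esub> \<longleftrightarrow>
  (\<exists>e\<in>carrier G. a \<otimes> e = b \<otimes> e)"
proof -
 interpret K: group "grothendieck_group G" by (rule group_grothendieck)
 have "inv\<^bsub>grothendieck_group G\<^esub> gcl b \<one> = gcl \<one> b"
  using assms gcl_diag[of b] by (intro K.inv_equality) (auto simp: gcl_mult gcl_carrier grothendieck_one)
 then show ?thesis using assms by (simp add: gcl_mult grothendieck_one gcl_eq_iff)
qed

end

lemma K_difference_eq_one: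
 fixes V :: "('k::real_normed_field, 'x, 'v::ab_group_add) vbundle" and W :: "('k, 'x, 'w::ab_group_add) vbundle"
 assumes V: "vector_bundle X V" and W: "vector_bundle X W"
 shows "K_class X V \<otimes>\<^bsub>K_group X\<^esub> inv\<^bsub>K_group X\<^esub> K_class X W = \<one>\<^bsub>K_group X\<^esub> \<longleftrightarrow>
  (\<exists>Z :: ('k, 'x, nat => 'k) vbundle. vector_bundle X Z \<and> vb_isomorphic X (whitney_sum V Z) (whitney_sum W Z))"
proof -
 interpret comm_monoid "Vect X :: ('k, 'x) vb_class monoid" by (rule comm_monoid_Vect)
 have "K_class X V \<otimes>\<^bsub>K_group X\<^esub> inv\<^bsub>K_group X\<^esub> K_class X W = \<one>\<^bsub>K_group X\<^esub> \<longleftrightarrow>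
   (\<exists>e\<in>carrier (Vect X). vb_class X V \<otimes>\<^bsub>Vect X\<^esub> e = vb_class X W \<otimes>\<^bsub>Vect X\<^esub> e)"
  unfolding K_class_def K_group_def by (intro grothendieck_difference_eq_one vb_class_Vect V W)
 also have "\<dots> \<longleftrightarrow> (\<exists>Z :: ('k, 'x, nat => 'k) vbundle. vector_bundle X Z \<and> vb_isomorphic X (whitney_sum V Z) (whitney_sum W Z))"
 proof -
  have "vb_class X V \<otimes>\<^bsub>Vect X\<^esub> vb_class X Z = vb_class X W \<otimes>\<^bsub>Vect X\<^esub> vb_class X Z \<longleftrightarrow> vb_isomorphic X (whitney_sum V Z) (whitney_sum W Z)"
   if Z: "vector_bundle X Z" for Z :: "('k, 'x, nat => 'k) vbundle"
   unfolding Vect_mult[OF V Z] Vect_mult[OF W Z]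
   by (rule vb_class_eq_iff[OF vector_bundle_whitney_sum(1)[OF V Z] vector_bundle_whitney_sum(1)[OF W Z]])
  then show ?thesis using vb_class_Vect by (metis Vect_carrierE)
 qed
 finally show ?thesis .
qed

text \<open>Allows a stabilising bundle of any fibre type, such as a subbundle of \<open>F\<close>,
  by passing to a standard representative.\<close>

lemma K_difference_eq_oneI:
 fixes V :: "('k::real_normed_field, 'x, 'v::ab_group_add) vbundle" and W :: "('k, 'x, 'w::ab_group_add) vbundle"
  and Z :: "('k, 'x, 'z::ab_group_add) vbundle"
 assumes V: "vector_bundle X V" and W: "vector_bundle X W" and Z: "vector_bundle X Z"
  and iso: "vb_isomorphic X (whitney_sum V Z) (whitney_sum W Z)"
 shows "K_class X V \<otimes>\<^bsub>K_group X\<^esub> inv\<^bsub>K_group X\<^esub> K_class X W = \<one>\<^bsub>K_group X\<^esub>"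
proof -
 obtain R :: "('k, 'x, nat => 'k) vbundle" where R: "vector_bundle X R" "vb_isomorphic X R Z"
  using exists_standard_representative[OF Z] by blast
 note VR = vector_bundle_whitney_sum(1)[OF V R(1)] and VZ = vector_bundle_whitney_sum(1)[OF V Z]
 note WR = vector_bundle_whitney_sum(1)[OF W R(1)] and WZ = vector_bundle_whitney_sum(1)[OF W Z]
 have "vb_isomorphic X (whitney_sum V R) (whitney_sum V Z)"
  by (rule whitney_sum_cong[OF V V vb_isomorphic_refl[OF V] R(1) Z R(2)])
 from vb_isomorphic_trans[OF VR VZ WZ this iso] have "vb_isomorphic X (whitney_sum V R) (whitney_sum W Z)" .
 moreover have "vb_isomorphic X (whitney_sum W Z) (whitney_sum W R)"
  by (rule whitney_sum_cong[OF W W vb_isomorphic_refl[OF W] Z R(1) vb_isomorphic_sym[OF R(2)]])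
 ultimately have "vb_isomorphic X (whitney_sum V R) (whitney_sum W R)" by (rule vb_isomorphic_trans[OF VR WZ WR])
 then show ?thesis unfolding K_difference_eq_one[OF V W] using R(1) by blast
qed

subsection \<open>Subbundles as vector bundles\<close>

lemma (in vector_space) exists_coordinate_map:
 assumes "finite_dim scale M"
 obtains n c where "lin_on scale cscale M c" "bij_betw c M (coords n)"
proof -
 obtain n e where e: "frame scale n e M" using assms finite_dim_frame by blast
 obtain c where c: "\<And>x. x \<in> M ==> comb scale n e (c x) = x"
  "\<And>x y i. x \<in> M ==> y \<in> M ==> i < n ==> c (x + y) i = c x i + c y i"
  "\<And>k x i. x \<in> M ==> i < n ==> c (scale k x) i = k * c x i"
  "\<And>x i. i \<ge> n ==> c x i = 0" by (rule frame_coord[OF e]) blast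
 show thesis
 proof (rule that[of c n])
  have "c (x + y) i = c x i + c y i" if "x \<in> M" "y \<in> M" for x y i
   using c(2)[OF that, of i] c(4)[of i] by (cases "i < n") auto
  moreover have "c (scale k x) i = k * c x i" if "x \<in> M" for k x i
   using c(3)[OF that, of i] c(4)[of i] by (cases "i < n") auto
  ultimately show "lin_on scale cscale M c" by (auto simp: lin_on_def cscale_def)
  show "bij_betw c M (coords n)"
   unfolding bij_betw_def
  proof
   show "inj_on c M" by (metis c(1) inj_onI)
   show "c ` M = coords n"
   proof
    show "c ` M \<subseteq> coords n" using c(4) by (auto simp: coords_def)
    show "coords n \<subseteq> c ` M"
    proof
     fix k :: "nat => 'a" assume k: "k \<in> coords n"
     have M: "comb scale n e k \<in> M" using e by (auto simp: frame_def)
     have "c (comb scale n e k) i = k i" for i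
      using indep_eq[of n e "c (comb scale n e k)" k i] c(1)[OF M] c(4)[of i] e k
      by (cases "i < n") (auto simp: frame_def coords_def)
     then show "k \<in> c ` M" using M by (intro image_eqI[of _ _ "comb scale n e k"]) auto
    qed
   qed
  qed
 qed
qed

lemma (in vbundle_loc) vsec_atI:
 assumes c: "(U, n, phi) \<in> vatlas V" "x \<in> U" and s: "near X x (%y. s y \<in> vfibre V y)"
  and lim: "\<And>i. i < n ==> ((%y. phi y (s y) i) \<longlongrightarrow> phi x (s x) i) (nhdsin X x)"
 shows "vsec_at X V s x"
 unfolding vsec_at_def
proof (intro conjI s ballI, goal_cases)
 case (1 p)
 obtain U' m psi where p: "p = (U', m, psi)" by (metis prod_cases3)
 have d: "(U', m, psi) \<in> vatlas V" using 1 p by simp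
 have x: "x \<in> topspace X" by (rule vchart(4)[OF c])
 let ?b = "%y i. inv_into (vfibre V y) (phi y) (unit_coord i)"
 have "((%y. psi y (s y)) \<longlongrightarrow> psi x (s x)) (nhdsin X x)" if xU: "x \<in> U'"
 proof -
  have "((%y. comb cscale n (%i. psi y (?b y i)) (phi y (s y))) \<longlongrightarrow> comb cscale n (%i. psi x (?b x i)) (phi x (s x))) (nhdsin X x)"
   by (intro tendsto_comb_cscale lim vsec_tendsto[OF vsec_vchart[OF c unit_coord_coords] d xU])
  moreover have ev: "near X x (%y. psi y (s y) = comb cscale n (%i. psi y (?b y i)) (phi y (s y)))"
   using s vchart_eventually[OF c] vchart_eventually[OF d xU]
  proof eventually_elim
   case (elim y)
   have "psi y (s y) = psi y (comb (vscale V) n (?b y) (phi y (s y)))"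
    using vchart_expand[OF c(1) elim(2,1)] by simp
   also have "\<dots> = comb cscale n (%i. psi y (?b y i)) (phi y (s y))"
    by (rule lin_on_comb[OF vector_space_axioms vector_space_cscale vchart(2)[OF d elim(3)] vsub[OF vchart(4)[OF d elim(3)]]])
     (rule vchart_inv[OF c(1) elim(2) unit_coord_coords])
   finally show ?case .
  qed
  ultimately show ?thesis using tendsto_cong[OF ev] eventually_nhdsin_self[OF x ev] by simp
 qed
 then show ?case by (simp add: p)
qed

context bbundle
begin

lemma coordinate_map_frame:
 assumes M: "ME.subspace M" and c: "lin_on (mscale E) cscale M c" "bij_betw c M (coords n)"
 defines "e \<equiv> %i. inv_into M c (unit_coord i)"
 shows "frame (mscale E) n e M" "v \<in> M ==> comb (mscale E) n e (c v) = v"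
proof -
 have eM: "e i \<in> M" "c (e i) = unit_coord i" if "i < n" for i
  using c(2) unit_coord_coords[OF that, where ?'a = 'k] by (auto simp: e_def bij_betw_def inv_into_into f_inv_into_f)
 have inM: "comb (mscale E) n e k \<in> M" for k using eM by (intro ME.comb_in M) auto
 have cc: "c (comb (mscale E) n e k) = comb cscale n unit_coord k" for k
 proof -
  have "c (comb (mscale E) n e k) = comb cscale n (%i. c (e i)) k"
   by (rule lin_on_comb[OF ME.vector_space_axioms vector_space_cscale c(1) M eM(1)])
  also have "\<dots> = comb cscale n unit_coord k" using eM by (intro comb_cong) auto
  finally show ?thesis .
 qed
 have inj: "u = v" if "u \<in> M" "v \<in> M" "c u = c v" for u v using that c(2) by (auto simp: bij_betw_def inj_on_def)
 show ex: "comb (mscale E) n e (c v) = v" if "v \<in> M" for v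
 using inj[OF inM that] c(2) that coords_expand by (force simp: bij_betw_def cc)
 have "indep (mscale E) n e"
  unfolding indep_def
 proof (intro allI impI)
  fix k i assume k: "comb (mscale E) n e k = 0" and i: "i < n"
  have "comb cscale n unit_coord k i = (0 :: nat => 'k) i"
   using lin_on_zero[OF ME.vector_space_axioms vector_space_cscale c(1) ME.subspace_0[OF M]] cc[of k] k by simp
  then show "k i = 0" using i by (simp add: comb_unit_coord)
 qed
 moreover have "range (comb (mscale E) n e) = M" by (metis inM ex image_subset_iff subset_antisym subsetI rangeI)
 ultimately show "frame (mscale E) n e M" by (simp add: frame_def)
qed

text \<open>By \<open>tendsto_comb\<close> and \<open>tendsto_coefficients\<close>, vectors and
  coefficients determine each other continuously. So a finite dimensional subspace has the same
  topology in the Banach model as in a vector bundle chart.\<close>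

lemma coordinate_map_tendsto:
 assumes M: "ME.subspace M" and c: "lin_on (mscale E) cscale M c" "bij_betw c M (coords n)"
  and v: "\<forall>\<^sub>F z in G. v z \<in> M" "v0 \<in> M"
 shows "((%z. c (v z)) \<longlongrightarrow> c v0) G \<longleftrightarrow> (v \<longlongrightarrow> v0) G"
proof -
 let ?e = "%i. inv_into M c (unit_coord i)"
 note fr = coordinate_map_frame[OF M c]
 have ev: "\<forall>\<^sub>F z in G. v z = comb (mscale E) n ?e (c (v z))" using v(1) by eventually_elim (simp add: fr(2))
 have v0: "v0 = comb (mscale E) n ?e (c v0)" using fr(2)[OF v(2)] by simp
 show ?thesis
 proof
  assume "((%z. c (v z)) \<longlongrightarrow> c v0) G"
  then have "((%z. comb (mscale E) n ?e (c (v z))) \<longlongrightarrow> comb (mscale E) n ?e (c v0)) G"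
   unfolding tendsto_fun_iff by (intro ME.tendsto_comb tendsto_const) blast
  then show "(v \<longlongrightarrow> v0) G" using tendsto_cong[OF ev] v0 by simp
 next
  assume "(v \<longlongrightarrow> v0) G"
  then have lim: "((%z. comb (mscale E) n ?e (c (v z))) \<longlongrightarrow> comb (mscale E) n ?e (c v0)) G"
   using tendsto_cong[OF ev] v0 by simp
  show "((%z. c (v z)) \<longlongrightarrow> c v0) G"
   unfolding tendsto_fun_iff
  proof
   fix i
   show "((%z. c (v z) i) \<longlongrightarrow> c v0 i) G"
   proof (cases "i < n")
    case True
    have "indep (mscale E) n ?e" using fr(1) by (simp add: frame_def)
    from ME.tendsto_coefficients[OF this tendsto_const lim True] show ?thesis .
   next
    case False
    have z: "c w i = 0" if "w \<in> M" for w
    proof -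
     have "c w \<in> coords n" using c(2) that by (auto simp: bij_betw_def)
     then show ?thesis using False by (simp add: coords_def)
    qed
    have e: "\<forall>\<^sub>F z in G. c (v z) i = 0" using v(1) by eventually_elim (rule z)
    show ?thesis using tendsto_cong[OF e] z[OF v(2)] by simp
   qed
  qed
 qed
qed

lemma subbundle_atlas:
 "A \<in> vatlas (subbundle_vb X E Z) \<longleftrightarrow> (\<exists>U n phi c M. A = (U, n, %x v. c (phi x v)) \<and> adapted_chart X E Z U phi M \<and>
   lin_on (mscale E) cscale M c \<and> bij_betw c M (coords n))"
 by (auto simp: subbundle_vb_def)

lemma subbundle_vb_simps: "vfibre (subbundle_vb X E Z) = Z" "vscale (subbundle_vb X E Z) = scale E"
 by (simp_all add: subbundle_vb_def)

lemma adapted_subspace: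
 assumes Z: "findim_subbundle X E Z" and c: "adapted_chart X E Z U phi M" "x \<in> U"
 shows "ME.subspace M"
using adapted_admissible[OF c(1)] admissible_topspace[OF _ c(2)] finite_dim_chart[OF _ c(2) subbundle_subset[OF Z]] subbundle_finite_dim[OF Z] ME.finite_dim_subspace by (force simp: adapted_image[OF c])

lemma subbundle_sec_tendsto:
 assumes Z: "findim_subbundle X E Z" and s: "sec_at X E s x" "near X x (%y. s y \<in> Z y)"
  and c: "adapted_chart X E Z U phi M" "lin_on (mscale E) cscale M c" "bij_betw c M (coords n)" "x \<in> U"
 shows "((%y. c (phi y (s y))) \<longlongrightarrow> c (phi x (s x))) (nhdsin X x)"
proof -
 note adm = adapted_admissible[OF c(1)]
 have x: "x \<in> topspace X" by (rule admissible_topspace[OF adm c(4)])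
 have ev: "near X x (%y. phi y (s y) \<in> M)"
  using s(2) admissible_eventually[OF adm c(4)]
 proof eventually_elim
  case (elim y) then show ?case using adapted_image[OF c(1) elim(2)] by blast
 qed
 show ?thesis
  using coordinate_map_tendsto[OF adapted_subspace[OF Z c(1,4)] c(2,3) ev eventually_nhdsin_self[OF x ev]] sec_at_adm[OF s(1) adm c(4)] by simp
qed

text \<open>The bridge between the two presentations: continuity in vector bundle charts can be
  checked in the ambient Banach bundle.\<close>

lemma subbundle_vb_sec:
 assumes Z: "findim_subbundle X E Z" and x: "x \<in> topspace X"
 shows "vsec_at X (subbundle_vb X E Z) s x \<longleftrightarrow> sec_at X E s x \<and> (near X x (%y. s y \<in> Z y))"
proof
 assume s: "sec_at X E s x \<and> (near X x (%y. s y \<in> Z y))"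
 show "vsec_at X (subbundle_vb X E Z) s x"
  unfolding vsec_at_def
 using s subbundle_sec_tendsto[OF Z] by (auto simp: subbundle_vb_simps subbundle_atlas)
next
 assume s: "vsec_at X (subbundle_vb X E Z) s x"
 have ev: "near X x (%y. s y \<in> Z y)" using s by (simp add: vsec_at_def subbundle_vb_simps)
 obtain U phi M where c: "x \<in> U" "adapted_chart X E Z U phi M" "finite_dim (mscale E) M"
  by (rule subbundle_chart[OF Z x])
 note adm = adapted_admissible[OF c(2)]
 obtain n c where cc: "lin_on (mscale E) cscale M c" "bij_betw c M (coords n)"
  by (rule ME.exists_coordinate_map[OF c(3)]) (rule that)
 have "(U, n, %x v. c (phi x v)) \<in> vatlas (subbundle_vb X E Z)"
     unfolding subbundle_atlas by (intro exI[of _ U] exI[of _ n] exI[of _ phi] exI[of _ c] exI[of _ M] conjI refl c cc)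
 then have lim: "((%y. c (phi y (s y))) \<longlongrightarrow> c (phi x (s x))) (nhdsin X x)"
  using bspec[OF conjunct2[OF s[unfolded vsec_at_def]]] c(1) by fastforce
 have evM: "near X x (%y. phi y (s y) \<in> M)"
  using ev admissible_eventually[OF adm c(1)]
 proof eventually_elim
  case (elim y) then show ?case using adapted_image[OF c(2) elim(2)] by blast
 qed
 have "((%y. phi y (s y)) \<longlongrightarrow> phi x (s x)) (nhdsin X x)"
  using coordinate_map_tendsto[OF ME.finite_dim_subspace[OF c(3)] cc evM eventually_nhdsin_self[OF x evM]] lim by simp
 moreover have "near X x (%y. s y \<in> fibre E y)"
  using ev eventually_in_openin[OF openin_topspace x]
  by eventually_elim (use subbundle_subset[OF Z] in blast)
 ultimately show "sec_at X E s x \<and> (near X x (%y. s y \<in> Z y))" using ev sec_atI[OF _ adm c(1)] by blast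
qed

lemma vector_bundle_subbundle:
 assumes Z: "findim_subbundle X E Z"
 shows "vector_bundle X (subbundle_vb X E Z)"
proof -
 have bij: "bij_betw (%v. c (phi x v)) (Z x) (coords n)"
  if c: "adapted_chart X E Z U phi M" "bij_betw c M (coords n)" "x \<in> U" for U phi M c and n x
 proof -
  note adm = adapted_admissible[OF c(1)]
  have "bij_betw (phi x) (Z x) M"
   unfolding bij_betw_def adapted_image[OF c(1,3)]
   using chart_bij[OF adm c(3)] subbundle_subset[OF Z admissible_topspace[OF adm c(3)]] by (auto simp: bij_betw_def intro: inj_on_subset)
  from bij_betw_trans[OF this c(2)] show ?thesis by (simp add: comp_def)
 qed
 show ?thesis
  unfolding vector_bundle_def
 proof (intro conjI ballI, goal_cases)
  case 1 show ?case unfolding subbundle_vb_simps by (rule VE.vector_space_axioms)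
 next
  case (2 x) then show ?case unfolding subbundle_vb_simps by (rule subbundle_subspace[OF Z])
 next
  case (3 p)
  then obtain U n phi c M where p: "p = (U, n, %x v. c (phi x v))" "adapted_chart X E Z U phi M"
   "lin_on (mscale E) cscale M c" "bij_betw c M (coords n)" unfolding subbundle_atlas by blast
  note adm = adapted_admissible[OF p(2)]
  have "lin_on (scale E) cscale (Z x) (%v. c (phi x v))" if x: "x \<in> U" for x
  proof -
   have f: "u \<in> fibre E x" "phi x u \<in> M" if "u \<in> Z x" for u
    using that subbundle_subset[OF Z admissible_topspace[OF adm x]] adapted_image[OF p(2) x] by auto
   show ?thesis using p(3) f unfolding lin_on_def
    by (simp add: chart_add[OF adm x] chart_scale[OF adm x])
  qed
  then show ?case unfolding p(1) split subbundle_vb_simps using admissible_openin[OF adm] bij[OF p(2,4)] by blast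
 next
  case 4
  show ?case
  proof
   show "(\<Union>(U, n, phi)\<in>vatlas (subbundle_vb X E Z). U) \<subseteq> topspace X"
   using admissible_topspace[OF adapted_admissible] by (auto simp: subbundle_atlas)
   show "topspace X \<subseteq> (\<Union>(U, n, phi)\<in>vatlas (subbundle_vb X E Z). U)"
   proof
    fix x assume x: "x \<in> topspace X"
    obtain U phi M where c: "x \<in> U" "adapted_chart X E Z U phi M" "finite_dim (mscale E) M"
     by (rule subbundle_chart[OF Z x])
    obtain n c where cc: "lin_on (mscale E) cscale M c" "bij_betw c M (coords n)"
     by (rule ME.exists_coordinate_map[OF c(3)]) (rule that)
    have "(U, n, %x v. c (phi x v)) \<in> vatlas (subbundle_vb X E Z)"
     unfolding subbundle_atlas by (intro exI[of _ U] exI[of _ n] exI[of _ phi] exI[of _ c] exI[of _ M] conjI refl c cc)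
    then show "x \<in> (\<Union>(U, n, phi)\<in>vatlas (subbundle_vb X E Z). U)" using c(1) by blast
   qed
  qed
 next
  case (5 p)
  then obtain U n phi c M where p: "p = (U, n, %x v. c (phi x v))" "adapted_chart X E Z U phi M"
   "lin_on (mscale E) cscale M c" "bij_betw c M (coords n)" unfolding subbundle_atlas by blast
  note adm = adapted_admissible[OF p(2)]
  show ?case unfolding p(1) split
  proof (intro ballI, goal_cases)
   case (1 q)
   then obtain T m psi d N where q: "q = (T, m, %x v. d (psi x v))" "adapted_chart X E Z T psi N"
    "lin_on (mscale E) cscale N d" "bij_betw d N (coords m)" unfolding subbundle_atlas by blast
   note adm' = adapted_admissible[OF q(2)]
   have op: "openin X (U \<inter> T)" by (intro openin_Int admissible_openin[OF adm] admissible_openin[OF adm'])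
   have "continuous_map (subtopology X (U \<inter> T)) euclidean
     (%x. in_charts Z (%x v. c (phi x v)) (%x v. d (psi x v)) (%x u. u) x k)" if k: "k \<in> coords n" for k
    unfolding continuous_map_nhdsin[OF op] in_charts_def
   proof
    fix x assume x: "x \<in> U \<inter> T"
    have xt: "x \<in> topspace X" using x admissible_topspace[OF adm] by blast
    let ?m = "inv_into M c k"
    let ?s = "%y. inv_into (fibre E y) (phi y) ?m"
    have m: "?m \<in> M" "c ?m = k" using p(4) k by (auto simp: bij_betw_def inv_into_into f_inv_into_f)
    have e: "?s y \<in> Z y \<and> inv_into (Z y) (%v. c (phi y v)) k = ?s y" if y: "y \<in> U" for y
    using adapted_image[OF p(2) y] m(1) subbundle_subset[OF Z admissible_topspace[OF adm y]] chart_inv_left[OF adm y] bij_betw_inv_into_left[OF bij[OF p(2,4) y]] m(2) by force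
    have sZ: "near X x (%y. ?s y \<in> Z y)" using eventually_in_openin[OF op x] by eventually_elim (use e in blast)
    have xU: "x \<in> U" "x \<in> T" using x by auto
    have "((%y. d (psi y (?s y))) \<longlongrightarrow> d (psi x (?s x))) (nhdsin X x)"
     by (rule subbundle_sec_tendsto[OF Z sec_at_chart[OF adm xU(1)] sZ q(2,3,4) xU(2)])
    moreover have ev: "near X x (%y. d (psi y (inv_into (Z y) (%v. c (phi y v)) k)) = d (psi y (?s y)))"
     using eventually_in_openin[OF op x] by eventually_elim (use e in simp)
    ultimately show "((%x. d (psi x (inv_into (Z x) (%v. c (phi x v)) k))) \<longlongrightarrow> d (psi x (inv_into (Z x) (%v. c (phi x v)) k))) (nhdsin X x)"
     using tendsto_cong[OF ev] e[OF xU(1)] by simp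
   qed
   then show ?case unfolding q(1) split coords_continuous_def subbundle_vb_simps by blast
  qed
 qed
qed

text \<open>The point is continuity of the inverse. The images of a local frame stay independent,
  and coefficients with respect to a continuously varying frame are continuous by
  \<open>tendsto_coefficients\<close>.\<close>

lemma bijective_morphism_iso:
 fixes V :: "('k, 'x, 'v::ab_group_add) vbundle"
 assumes V: "vector_bundle X V" and Z: "findim_subbundle X E Z"
  and f: "fibrewise_linear X V (subbundle_vb X E Z) f" "preserves_sections X V (subbundle_vb X E Z) f"
  and bij: "\<And>x. x \<in> topspace X ==> bij_betw (f x) (vfibre V x) (Z x)"
 shows "vb_isomorphic X V (subbundle_vb X E Z)"
proof -
 interpret V: vbundle_loc X V by unfold_locales (rule V)
 note ZV = vector_bundle_subbundle[OF Z]
 define g where "g x = inv_into (vfibre V x) (f x)" for x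
 have flin: "lin_on (vscale V) (scale E) (vfibre V x) (f x)" if "x \<in> topspace X" for x
  using f(1) that by (simp add: fibrewise_linear_def subbundle_vb_simps)
 have g: "g x v \<in> vfibre V x" "f x (g x v) = v" if "x \<in> topspace X" "v \<in> Z x" for x v
  using bij[OF that(1)] that(2) by (auto simp: g_def bij_betw_def inv_into_into f_inv_into_f)
 have g': "g x (f x u) = u" if "x \<in> topspace X" "u \<in> vfibre V x" for x u
  using bij[OF that(1)] that(2) by (simp add: g_def bij_betw_def)
 have fsec: "sec_at X E (%y. f y (s y)) x" if "x \<in> topspace X" "vsec_at X V s x" for x s
  using f(2) that subbundle_vb_sec[OF Z that(1)] unfolding preserves_sections_def by blast
 have "vsec_at X V (%y. g y (t y)) x" if x: "x \<in> topspace X" and t: "vsec_at X (subbundle_vb X E Z) t x" for x t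
 proof -
  have tE: "sec_at X E t x" and tZ: "near X x (%y. t y \<in> Z y)" using t subbundle_vb_sec[OF Z x] by auto
  have top: "near X x (%y. y \<in> topspace X)" by (rule eventually_in_openin[OF openin_topspace x])
  obtain U n phi where c: "(U, n, phi) \<in> vatlas V" "x \<in> U" using V.exists_vchart[OF x] by blast
  obtain T psi where d: "admissible X E T psi" "x \<in> T" using exists_admissible[OF E x] by blast
  let ?b = "%y i. inv_into (vfibre V y) (phi y) (unit_coord i)"
  let ?s = "%y. g y (t y)"
  have sf: "near X x (%y. ?s y \<in> vfibre V y)" using tZ top by eventually_elim (rule g)
  have bV: "?b y i \<in> vfibre V y" if "y \<in> U" "i < n" for y i by (rule V.vchart_inv[OF c(1) that(1) unit_coord_coords[OF that(2)]])
  have fb: "f y (?b y i) \<in> fibre E y" if "y \<in> U" "i < n" for y i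
   using bij[OF V.vchart(4)[OF c(1) that(1)]] bV[OF that] subbundle_subset[OF Z V.vchart(4)[OF c(1) that(1)]] by (auto simp: bij_betw_def)
  have comb_f: "f y (comb (vscale V) n (?b y) k) = comb (scale E) n (%i. f y (?b y i)) k" if "y \<in> U" for y k
   using V.vchart(4)[OF c(1) that] bV[OF that]
   by (intro lin_on_comb[OF V.vector_space_axioms VE.vector_space_axioms flin V.vsub])
  have ev: "near X x (%y. psi y (t y) = comb (mscale E) n (%i. psi y (f y (?b y i))) (phi y (?s y)))"
   using tZ top sf V.vchart_eventually[OF c] admissible_eventually[OF d]
  proof eventually_elim
   case (elim y)
   have "t y = f y (?s y)" using g(2)[OF elim(2,1)] by simp
   also have "\<dots> = f y (comb (vscale V) n (?b y) (phi y (?s y)))" using V.vchart_expand[OF c(1) elim(4,3)] by simp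
   also have "\<dots> = comb (scale E) n (%i. f y (?b y i)) (phi y (?s y))" by (rule comb_f[OF elim(4)])
   finally have "psi y (t y) = psi y (comb (scale E) n (%i. f y (?b y i)) (phi y (?s y)))" by simp
   also have "\<dots> = comb (mscale E) n (%i. psi y (f y (?b y i))) (phi y (?s y))" by (rule chart_comb[OF d(1) elim(5) fb[OF elim(4)]])
   finally show ?case .
  qed
  have lim: "((%y. comb (mscale E) n (%i. psi y (f y (?b y i))) (phi y (?s y))) \<longlongrightarrow>
    comb (mscale E) n (%i. psi x (f x (?b x i))) (phi x (?s x))) (nhdsin X x)"
   using sec_at_adm[OF tE d] tendsto_cong[OF ev] eventually_nhdsin_self[OF x ev] by simp
  have ind: "indep (mscale E) n (%i. psi x (f x (?b x i)))"
  proof -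
   have "indep (scale E) n (%i. f x (?b x i))"
    unfolding indep_def
   proof (intro allI impI)
    fix k i assume k: "comb (scale E) n (%i. f x (?b x i)) k = 0" and i: "i < n"
    have cV: "comb (vscale V) n (?b x) k \<in> vfibre V x" using bV[OF c(2)] by (intro V.comb_in V.vsub x) auto
    have z: "0 \<in> vfibre V x" by (rule V.subspace_0[OF V.vsub[OF x]])
    have "comb (vscale V) n (?b x) k = 0"
     using k comb_f[OF c(2)] lin_on_zero[OF V.vector_space_axioms VE.vector_space_axioms flin[OF x] z] bij[OF x] cV z by (simp add: bij_betw_def inj_on_def)
    then have "phi x (comb (vscale V) n (?b x) k) = 0"
     using lin_on_zero[OF V.vector_space_axioms vector_space_cscale V.vchart(2)[OF c] z] by simp
    moreover have "phi x (comb (vscale V) n (?b x) k) = comb cscale n (%i. phi x (?b x i)) k"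
     by (rule lin_on_comb[OF V.vector_space_axioms vector_space_cscale V.vchart(2)[OF c] V.vsub[OF x] bV[OF c(2)]])
    moreover have "comb cscale n (%i. phi x (?b x i)) k = comb cscale n unit_coord k"
     using V.vchart_inv[OF c unit_coord_coords] by (intro comb_cong) auto
    ultimately have "comb cscale n unit_coord k i = (0 :: nat => 'k) i" by simp
    then show "k i = 0" using i by (simp add: comb_unit_coord)
   qed
   then show ?thesis using indep_chart[OF d fb[OF c(2)]] by simp
  qed
  have lb: "((%y. psi y (f y (?b y i))) \<longlongrightarrow> psi x (f x (?b x i))) (nhdsin X x)" if "i < n" for i
   by (rule sec_at_adm[OF fsec[OF x V.vsec_vchart[OF c unit_coord_coords[OF that]]] d])
  show ?thesis
   by (rule V.vsec_atI[OF c sf]) (rule ME.tendsto_coefficients[OF ind lb lim])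
 qed
 moreover have "lin_on (scale E) (vscale V) (Z x) (g x)" if "x \<in> topspace X" for x
  unfolding g_def by (rule lin_on_inverse[OF V.vector_space_axioms flin[OF that] V.vsub[OF that] bij[OF that]])
 ultimately have "section_iso X V (subbundle_vb X E Z) f g"
  using f g g' by (auto simp: section_iso_def fibrewise_linear_def preserves_sections_def subbundle_vb_simps)
 then show ?thesis unfolding vb_isomorphic_iff[OF V ZV] by blast
qed

end

section \<open>Comparing index bundles\<close>

lemma (in bbundle) vb_isomorphic_subbundleI:
 assumes V: "vector_bundle X V" and Z: "findim_subbundle X E Z"
  and lin: "\<And>x. x \<in> topspace X ==> lin_on (vscale V) (scale E) (vfibre V x) (f x)"
  and bij: "\<And>x. x \<in> topspace X ==> bij_betw (f x) (vfibre V x) (Z x)"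
  and sec: "\<And>x s. x \<in> topspace X ==> vsec_at X V s x ==> sec_at X E (%y. f y (s y)) x"
 shows "vb_isomorphic X V (subbundle_vb X E Z)"
proof (rule bijective_morphism_iso[OF V Z _ _ bij])
 show "fibrewise_linear X V (subbundle_vb X E Z) f"
  using lin bij by (auto simp: fibrewise_linear_def subbundle_vb_simps bij_betw_def)
 show "preserves_sections X V (subbundle_vb X E Z) f"
  unfolding preserves_sections_def
 proof (intro ballI allI impI)
  fix x s assume x: "x \<in> topspace X" and s: "vsec_at X V s x"
  have "near X x (%y. s y \<in> vfibre V y)" using s by (simp add: vsec_at_def)
  then have "near X x (%y. f y (s y) \<in> Z y)"
   using eventually_in_openin[OF openin_topspace x]
   by eventually_elim (use bij in \<open>auto simp: bij_betw_def\<close>)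
  then show "vsec_at X (subbundle_vb X E Z) (%y. f y (s y)) x"
   using subbundle_vb_sec[OF Z x] sec[OF x s] by blast
 qed
qed

text \<open>An injective map that preserves sections carries local frames to local frames, so
  \<open>frame_subbundle\<close> applies to the image.\<close>

lemma (in bbundle) image_subbundle:
 fixes W :: "('k, 'x, 'w::ab_group_add) vbundle"
 assumes W: "vector_bundle X W"
  and lin: "\<And>x. x \<in> topspace X ==> lin_on (vscale W) (scale E) (vfibre W x) (j x)"
  and inj: "\<And>x u. x \<in> topspace X ==> u \<in> vfibre W x ==> j x u = 0 ==> u = 0"
  and sec: "\<And>x s. x \<in> topspace X ==> vsec_at X W s x ==> sec_at X E (%y. j y (s y)) x"
 shows "findim_subbundle X E (%x. j x ` vfibre W x)" (is ?A)
  and "vb_isomorphic X W (subbundle_vb X E (%x. j x ` vfibre W x))"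
proof -
 interpret W: vbundle_loc X W by unfold_locales (rule W)
 have injc: "comb (vscale W) n v k = 0"
  if x: "x \<in> topspace X" and v: "\<And>i. i < n ==> v i \<in> vfibre W x" and k: "comb (scale E) n (%i. j x (v i)) k = 0"
  for x n v and k :: "nat => 'k"
 using inj[OF x] W.comb_in[OF W.vsub[OF x] v] lin_on_comb[OF W.vector_space_axioms VE.vector_space_axioms lin[OF x] W.vsub[OF x] v] k by simp
 show A: ?A
 proof (rule frame_subbundle)
  fix x assume x: "x \<in> topspace X"
  obtain U n phi where c: "(U, n, phi) \<in> vatlas W" "x \<in> U" using W.exists_vchart[OF x] by blast
  let ?b = "%y i. inv_into (vfibre W y) (phi y) (unit_coord i)"
  have "local_frame (%x. j x ` vfibre W x) x n (%y i. j y (?b y i))"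
   unfolding local_frame_def using W.vchart_eventually[OF c]
  proof (eventually_elim, intro conjI allI impI)
   fix y assume y: "y \<in> U"
   have yt: "y \<in> topspace X" by (rule W.vchart(4)[OF c(1) y])
   have b: "?b y i \<in> vfibre W y" "phi y (?b y i) = unit_coord i" if "i < n" for i
    using W.vchart_inv[OF c(1) y unit_coord_coords[OF that]] by auto
   show "sec_at X E (%z. j z (?b z i)) y" if "i < n" for i
    by (rule sec[OF yt W.vsec_vchart[OF c(1) y unit_coord_coords[OF that]]])
   have jc: "j y (comb (vscale W) n (?b y) k) = comb (scale E) n (%i. j y (?b y i)) k" for k
    by (rule lin_on_comb[OF W.vector_space_axioms VE.vector_space_axioms lin[OF yt] W.vsub[OF yt] b(1)])
   have "indep (scale E) n (%i. j y (?b y i))"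
    unfolding indep_def
   proof (intro allI impI)
    fix k i assume k: "comb (scale E) n (%i. j y (?b y i)) k = 0" and i: "i < n"
    have z: "comb (vscale W) n (?b y) k = 0" by (rule injc[OF yt b(1) k])
    have "comb cscale n unit_coord k = comb cscale n (%i. phi y (?b y i)) k" using b by (intro comb_cong) auto
    also have "\<dots> = phi y (comb (vscale W) n (?b y) k)"
     by (rule lin_on_comb[OF W.vector_space_axioms vector_space_cscale W.vchart(2)[OF c(1) y] W.vsub[OF yt] b(1), symmetric])
    also have "\<dots> = 0"
     unfolding z by (rule lin_on_zero[OF W.vector_space_axioms vector_space_cscale W.vchart(2)[OF c(1) y] W.subspace_0[OF W.vsub[OF yt]]])
    finally have "comb cscale n unit_coord k i = (0 :: nat => 'k) i" by simp
    then show "k i = 0" using i by (simp add: comb_unit_coord)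
   qed
   moreover have "range (comb (scale E) n (%i. j y (?b y i))) = j y ` vfibre W y"
   proof
    show "range (comb (scale E) n (%i. j y (?b y i))) \<subseteq> j y ` vfibre W y"
     using W.comb_in[OF W.vsub[OF yt] b(1)] by (auto simp flip: jc)
    show "j y ` vfibre W y \<subseteq> range (comb (scale E) n (%i. j y (?b y i)))"
    proof
     fix z assume "z \<in> j y ` vfibre W y"
     then obtain u where u: "u \<in> vfibre W y" "z = j y u" by blast
     have "z = j y (comb (vscale W) n (?b y) (phi y u))" using W.vchart_expand[OF c(1) y u(1)] u(2) by simp
     then show "z \<in> range (comb (scale E) n (%i. j y (?b y i)))" by (simp add: jc)
    qed
   qed
   ultimately show "frame (scale E) n (%i. j y (?b y i)) (j y ` vfibre W y)" by (simp add: frame_def)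
  qed
  then show "\<exists>n b. local_frame (%x. j x ` vfibre W x) x n b" by blast
 qed
 show "vb_isomorphic X W (subbundle_vb X E (%x. j x ` vfibre W x))"
 proof (rule vb_isomorphic_subbundleI[OF W A lin _ sec])
  fix x assume x: "x \<in> topspace X"
  have "inj_on (j x) (vfibre W x)"
  proof (rule inj_onI)
   fix u v assume uv: "u \<in> vfibre W x" "v \<in> vfibre W x" "j x u = j x v"
   have d: "u - v \<in> vfibre W x" by (rule W.subspace_diff[OF W.vsub[OF x] uv(1,2)])
   have "u - v = 0" using lin[OF x] d uv inj[OF x d] by (force simp: lin_on_def)
   then show "u = v" by simp
  qed
  then show "bij_betw (j x) (vfibre W x) (j x ` vfibre W x)" by (simp add: bij_betw_def)
 qed
qed

lemma (in bpair) subbundle_vb_isomorphic: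
 assumes Z: "findim_subbundle X E Z" and Z': "findim_subbundle X F Z'"
  and T: "\<And>x. x \<in> topspace X ==> mor_at X E F T x"
  and bij: "\<And>x. x \<in> topspace X ==> bij_betw (T x) (Z x) (Z' x)"
 shows "vb_isomorphic X (subbundle_vb X E Z) (subbundle_vb X F Z')"
proof -
 interpret EE: bbundle X E by unfold_locales (rule E)
 interpret FF: bbundle X F by unfold_locales (rule F)
 show ?thesis
 proof (rule FF.vb_isomorphic_subbundleI[OF EE.vector_bundle_subbundle[OF Z] Z'])
  fix x assume x: "x \<in> topspace X"
  show "lin_on (vscale (subbundle_vb X E Z)) (scale F) (vfibre (subbundle_vb X E Z) x) (T x)"
   unfolding EE.subbundle_vb_simps lin_on_def
   using mor_at_add_arg[OF T[OF x] x] mor_at_scale_arg[OF T[OF x] x] EE.subbundle_subset[OF Z x] by blast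
  show "bij_betw (T x) (vfibre (subbundle_vb X E Z) x) (Z' x)" using bij[OF x] by (simp add: EE.subbundle_vb_simps)
  show "sec_at X F (%y. T y (s y)) x" if "vsec_at X (subbundle_vb X E Z) s x" for s
   using that EE.subbundle_vb_sec[OF Z x] sec_at_mor[OF T[OF x] _ x] by blast
 qed
qed

text \<open>In charts \<open>1 + r G\<close> is within 1/2 of the identity for small
  \<open>r\<close>, locally uniformly; compactness gives one bound for all fibres.\<close>

lemma (in bbundle) small_perturbation_bij:
 assumes X: "compact_space X" and G: "\<And>x. x \<in> topspace X ==> mor_at X E E G x"
 obtains \<delta> where "\<delta> > 0" "\<And>x r. x \<in> topspace X ==> \<bar>r\<bar> < \<delta> ==>
  bij_betw (%u. u + scale E (of_real r) (G x u)) (fibre E x) (fibre E x)"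
proof -
 have loc: "\<forall>x\<in>topspace X. \<exists>k>0. near X x (%y. \<forall>r. \<bar>r\<bar> * k < 1 -->
   bij_betw (%u. u + scale E (of_real r) (G y u)) (fibre E y) (fibre E y))"
 proof
  fix x assume x: "x \<in> topspace X"
  obtain U phi where c: "admissible X E U phi" "x \<in> U" using exists_admissible[OF E x] by blast
  obtain B where B: "rep X E x phi phi G B" using mor_at_rep[OF E E G[OF x] c(1,1) c(2,2)] ..
  \<comment> \<open>The factor 2 keeps the norm of \<open>r B y\<close> at most 1/2, and the summand
    1 covers the variation of \<open>B\<close> near \<open>x\<close>.\<close>
  define k where "k = 2 * (norm (B x) + 1)"
  have k: "k > 0" unfolding k_def by (intro mult_pos_pos add_nonneg_pos norm_ge_zero) simp_all
  have "near X x (%y. dist (B y) (B x) < 1)" using rep_tendsto[OF B] by (rule tendstoD) simp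
  then have "near X x (%y. \<forall>r. \<bar>r\<bar> * k < 1 -->
    bij_betw (%u. u + scale E (of_real r) (G y u)) (fibre E y) (fibre E y))"
   using rep_eventually[OF B] mor_at_lin[OF G[OF x]] admissible_eventually[OF c]
  proof (eventually_elim, intro allI impI)
   fix y and r :: real
   assume el: "dist (B y) (B x) < 1" "\<forall>u\<in>fibre E y. phi y (G y u) = B y (phi y u)"
    "lin_on (scale E) (scale E) (fibre E y) (G y) \<and> G y ` fibre E y \<subseteq> fibre E y" "y \<in> U"
    and r: "\<bar>r\<bar> * k < 1"
   have S: "VE.subspace (fibre E y)" by (rule subE[OF admissible_topspace[OF c(1) el(4)]])
   let ?f = "%v. v + r *\<^sub>R B y v"
   have nB: "norm (B y) \<le> norm (B x) + 1"
    using el(1) norm_triangle_ineq2[of "B y" "B x"] by (simp add: dist_norm)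
   have bl: "bounded_linear ?f"
    by (intro bounded_linear_add bounded_linear_ident bounded_linear_const_scaleR blinfun.bounded_linear_right)
   have "norm (?f v - v) \<le> norm v / 2" for v
   proof -
    have "norm (?f v - v) = \<bar>r\<bar> * norm (B y v)" by simp
    also have "\<dots> \<le> \<bar>r\<bar> * ((norm (B x) + 1) * norm v)"
     by (intro mult_left_mono order_trans[OF norm_blinfun mult_right_mono[OF nB]]) auto
    also have "\<dots> = (\<bar>r\<bar> * k) * norm v / 2" by (simp add: k_def)
    also have "\<dots> \<le> 1 * norm v / 2" using r by (intro divide_right_mono mult_right_mono) auto
    finally show ?thesis by simp
   qed
   then have bf: "bij ?f" using near_identity_surj(1)[OF bl] by blast
   let ?g = "%u. u + scale E (of_real r) (G y u)"
   have gf: "?g u \<in> fibre E y" "phi y (?g u) = ?f (phi y u)" if "u \<in> fibre E y" for u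
   using el(3) that VE.subspace_scale[OF S] VE.subspace_add[OF S that] chart_add[OF c(1) el(4) that] chart_scale[OF c(1) el(4)] el(2) by (auto simp: ME.scale_of_real)
   show "bij_betw ?g (fibre E y) (fibre E y)"
    unfolding bij_betw_def
   proof
    show "inj_on ?g (fibre E y)"
    proof (rule inj_onI)
     fix u v assume uv: "u \<in> fibre E y" "v \<in> fibre E y" "?g u = ?g v"
     then have "?f (phi y u) = ?f (phi y v)" using gf by metis
     then have "phi y u = phi y v" using bf by (meson bij_is_inj injD)
     then show "u = v" by (rule chart_inj[OF c(1) el(4) uv(1,2)])
    qed
    show "?g ` fibre E y = fibre E y"
    proof
     show "?g ` fibre E y \<subseteq> fibre E y" using gf by blast
     show "fibre E y \<subseteq> ?g ` fibre E y"
     proof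
      fix w assume w: "w \<in> fibre E y"
      obtain v where v: "phi y w = ?f v" using bf by (meson bij_is_surj surjD)
      note i = chart_inv[OF c(1) el(4), of v]
      show "w \<in> ?g ` fibre E y" using gf[OF i(1)] i(2) v chart_inj[OF c(1) el(4) _ w] i(1) by simp
     qed
    qed
   qed
  qed
  then show "\<exists>k>0. near X x (%y. \<forall>r. \<bar>r\<bar> * k < 1 -->
    bij_betw (%u. u + scale E (of_real r) (G y u)) (fibre E y) (fibre E y))" using k by blast
 qed
 from this[unfolded bchoice_iff] obtain k where k: "\<forall>x\<in>topspace X. k x > 0 \<and> (near X x (%y. \<forall>r. \<bar>r\<bar> * k x < 1 -->
   bij_betw (%u. u + scale E (of_real r) (G y u)) (fibre E y) (fibre E y)))" ..
 let ?P = "%x y. \<forall>r. \<bar>r\<bar> * k x < 1 --> bij_betw (%u. u + scale E (of_real r) (G y u)) (fibre E y) (fibre E y)"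
 obtain I where I: "finite I" "I \<subseteq> topspace X" "\<And>y. y \<in> topspace X ==> \<exists>x\<in>I. ?P x y"
  by (rule compact_nhds_cover[OF X, of ?P]) (use k in auto)
 \<comment> \<open>An upper bound for the finitely many \<open>k x\<close>; the summand 1 keeps it
   positive even if the cover is empty.\<close>
 define K where "K = 1 + (\<Sum>x\<in>I. k x)"
 have kpos: "k x > 0" if "x \<in> I" for x using k I(2) that by blast
 have K0: "K > 0" unfolding K_def using kpos by (intro add_pos_nonneg sum_nonneg) (auto intro: less_imp_le)
 have K: "k x \<le> K" if "x \<in> I" for x
  unfolding K_def using member_le_sum[OF that, of k] kpos I(1) by (force intro: less_imp_le)
 show thesis
 proof (rule that[of "1 / K"])
  show "1 / K > 0" using K0 by simp
  fix x and r :: real assume x: "x \<in> topspace X" and r: "\<bar>r\<bar> < 1 / K"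
  obtain i where i: "i \<in> I" "?P i x" using I(3)[OF x] by blast
  have "\<bar>r\<bar> * k i \<le> \<bar>r\<bar> * K" using K i by (intro mult_left_mono) auto
  also have "\<dots> < 1" using r K0 by (simp add: field_simps)
  finally show "bij_betw (%u. u + scale E (of_real r) (G x u)) (fibre E x) (fibre E x)" using i(2) by blast
 qed
qed

text \<open>A subbundle \<open>V\<close> with a projection \<open>P\<close> onto it and a right
  inverse \<open>R\<close> of \<open>L\<close> modulo \<open>V\<close> that kills \<open>V\<close>.
  Transversality is encoded in the equation for \<open>R\<close>.\<close>

locale transversal_data = bpair X E F
 for X :: "'x topology"
  and E :: "('k::real_or_complex, 'x, 'e::ab_group_add, 'm::banach) banach_bundle"
  and F :: "('k, 'x, 'f::ab_group_add, 'n::banach) banach_bundle" +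
 fixes L :: "'x => 'e => 'f" and V :: "'x => 'f set" and P :: "'x => 'f => 'f" and R :: "'x => 'f => 'e"
 assumes L: "\<And>x. x \<in> topspace X ==> mor_at X E F L x"
  and kernel: "\<And>x. x \<in> topspace X ==> finite_dim (scale E) {u \<in> fibre E x. L x u = 0}"
  and V: "findim_subbundle X F V"
  and P: "\<And>x. x \<in> topspace X ==> mor_at X F F P x"
   "\<And>x u. x \<in> topspace X ==> u \<in> fibre F x ==> P x u \<in> V x"
   "\<And>x u. x \<in> topspace X ==> u \<in> V x ==> P x u = u"
  and R: "\<And>x. x \<in> topspace X ==> mor_at X F E R x"
   "\<And>x w. x \<in> topspace X ==> w \<in> fibre F x ==> L x (R x w) - P x (L x (R x w)) = w - P x w"
   "\<And>x v. x \<in> topspace X ==> v \<in> V x ==> R x v = 0"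
begin

sublocale FE: bpair X F E by unfold_locales (rule F, rule E)
sublocale EE: bbundle X E by unfold_locales (rule E)
sublocale FF: bbundle X F by unfold_locales (rule F)

lemma V_fibre: "x \<in> topspace X ==> v \<in> V x ==> v \<in> fibre F x"
 using FF.subbundle_subset[OF V] by blast

lemma V_subspace: "x \<in> topspace X ==> VF.subspace (V x)"
 by (rule FF.subbundle_subspace[OF V])

lemma L_fibre: "x \<in> topspace X ==> u \<in> fibre E x ==> L x u \<in> fibre F x"
 by (rule mor_at_fibre[OF L])

lemma R_fibre: "x \<in> topspace X ==> w \<in> fibre F x ==> R x w \<in> fibre E x"
 by (rule FE.mor_at_fibre[OF R(1)])

lemma P_fibre: "x \<in> topspace X ==> w \<in> fibre F x ==> P x w \<in> fibre F x"
 using P(2) V_fibre by blast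

lemma defect:
 assumes x: "x \<in> topspace X" and w: "w \<in> fibre F x"
 shows "w - L x (R x w) \<in> V x"
proof -
 have "w - L x (R x w) = P x w - P x (L x (R x w))" using R(2)[OF x w] by (simp add: algebra_simps)
 also have "\<dots> \<in> V x" by (intro VF.subspace_diff[OF V_subspace[OF x]] P(2)[OF x] w L_fibre[OF x] R_fibre[OF x])
 finally show ?thesis .
qed

text \<open>By \<open>defect\<close> the vectors \<open>w\<close> and \<open>L R w\<close> differ by
  an element of \<open>V\<close>, which \<open>R\<close> kills. Hence \<open>R L\<close> and
  \<open>L R\<close> are idempotent.\<close>

lemma RLR:
 assumes x: "x \<in> topspace X" and w: "w \<in> fibre F x"
 shows "R x (L x (R x w)) = R x w"
 using R(3)[OF x defect[OF x w]] FE.mor_at_diff_arg[OF R(1)[OF x] x w L_fibre[OF x R_fibre[OF x w]]] by simp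

lemma index_domain_facts:
 shows "findim_subbundle X E (index_domain E L V)"
  "x \<in> topspace X ==> mor_at X E E (%x u. u - R x (L x u)) x"
  "x \<in> topspace X ==> u \<in> fibre E x ==> u - R x (L x u) \<in> index_domain E L V x"
  "x \<in> topspace X ==> u \<in> index_domain E L V x ==> R x (L x u) = 0"
 by (rule index_domain_subbundle[OF L kernel V P R]; assumption)+

lemma transversal: "x \<in> topspace X ==> w \<in> fibre F x ==> \<exists>u\<in>fibre E x. \<exists>v\<in>V x. w = L x u + v"
 using defect R_fibre by (intro bexI[of _ "R x w"] bexI[of _ "w - L x (R x w)"]) auto

context
 fixes W :: "'x => 'f set"
 assumes W: "findim_subbundle X F W" and VW: "\<And>x. x \<in> topspace X ==> V x \<inter> W x \<subseteq> {0}"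
begin

abbreviation VplusW :: "'x => 'f set" where
 "VplusW \<equiv> %x. {v + w |v w. v \<in> V x \<and> w \<in> W x}"

lemma W_fibre: "x \<in> topspace X ==> w \<in> W x ==> w \<in> fibre F x"
 using FF.subbundle_subset[OF W] by blast

lemma W_subspace: "x \<in> topspace X ==> VF.subspace (W x)"
 by (rule FF.subbundle_subspace[OF W])

lemma V_W_zero:
 assumes x: "x \<in> topspace X" and "v \<in> V x" "w \<in> W x" "v + w = 0"
 shows "v = 0" "w = 0"
using assms(4) VF.subspace_neg[OF W_subspace[OF x] assms(3)] VW[OF x] assms(2) by (auto simp: add_eq_0_iff)

lemma sum_isomorphic: "vb_isomorphic X (whitney_sum (subbundle_vb X F V) (subbundle_vb X F W)) (subbundle_vb X F VplusW)"
proof (rule FF.vb_isomorphic_subbundleI)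
 note Vb = FF.vector_bundle_subbundle[OF V] and Wb = FF.vector_bundle_subbundle[OF W]
 note VWb = vector_bundle_whitney_sum[OF Vb Wb]
 let ?f = "%x (u :: 'f \<times> 'f). fst u + snd u"
 show "vector_bundle X (whitney_sum (subbundle_vb X F V) (subbundle_vb X F W))" by (rule VWb(1))
 show "findim_subbundle X F VplusW" by (rule FF.sum_subbundle[OF V W VW])
 fix x assume x: "x \<in> topspace X"
 show "lin_on (vscale (whitney_sum (subbundle_vb X F V) (subbundle_vb X F W))) (scale F)
   (vfibre (whitney_sum (subbundle_vb X F V) (subbundle_vb X F W)) x) (?f x)"
  by (auto simp: lin_on_def whitney_sum_scale FF.subbundle_vb_simps VF.scale_right_distrib)
 show "bij_betw (?f x) (vfibre (whitney_sum (subbundle_vb X F V) (subbundle_vb X F W)) x) (VplusW x)"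
  unfolding bij_betw_def whitney_sum_fibre FF.subbundle_vb_simps
 proof
  show "inj_on (?f x) (V x \<times> W x)"
  proof (rule inj_onI, clarify)
   fix v w v' w' assume h: "v \<in> V x" "w \<in> W x" "v' \<in> V x" "w' \<in> W x" "fst (v, w) + snd (v, w) = fst (v', w') + snd (v', w')"
   have "v - v' = 0" "w - w' = 0"
    using h(5) V_W_zero[OF x VF.subspace_diff[OF V_subspace[OF x] h(1,3)] VF.subspace_diff[OF W_subspace[OF x] h(2,4)]] by (auto simp: algebra_simps)
   then show "v = v' \<and> w = w'" by simp
  qed
  show "?f x ` (V x \<times> W x) = VplusW x"
  proof
   show "?f x ` (V x \<times> W x) \<subseteq> VplusW x" by clarsimp blast
   show "VplusW x \<subseteq> ?f x ` (V x \<times> W x)"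
   proof
    fix z assume "z \<in> VplusW x"
    then obtain v w where z: "z = v + w" "v \<in> V x" "w \<in> W x" by blast
    then show "z \<in> ?f x ` (V x \<times> W x)" by (intro image_eqI[of _ _ "(v, w)"]) auto
   qed
  qed
 qed
 show "sec_at X F (%y. ?f y (s y)) x" if s: "vsec_at X (whitney_sum (subbundle_vb X F V) (subbundle_vb X F W)) s x" for s
  using s unfolding VWb(2)[OF x] FF.subbundle_vb_sec[OF V x] FF.subbundle_vb_sec[OF W x]
  by (intro FF.sec_at_add x) auto
qed

text \<open>The map is \<open>(u, w) |-> u + R w\<close>. If \<open>L e = v + w\<close>, then
  \<open>e\<close> comes from \<open>(e - R w, w)\<close>; conversely \<open>L (u + R w)\<close> is
  \<open>w\<close> modulo \<open>V\<close>, which gives injectivity.\<close>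

lemma enlarged_domain_isomorphic:
 assumes D: "findim_subbundle X E (index_domain E L VplusW)"
 shows "vb_isomorphic X (whitney_sum (subbundle_vb X E (index_domain E L V)) (subbundle_vb X F W))
  (subbundle_vb X E (index_domain E L VplusW))"
proof (rule EE.vb_isomorphic_subbundleI[OF _ D])
 note ED = index_domain_facts(1)
 note Eb = EE.vector_bundle_subbundle[OF ED] and Wb = FF.vector_bundle_subbundle[OF W]
 note EWb = vector_bundle_whitney_sum[OF Eb Wb]
 let ?S = "whitney_sum (subbundle_vb X E (index_domain E L V)) (subbundle_vb X F W)"
 let ?f = "%x (u :: 'e \<times> 'f). fst u + R x (snd u)"
 show "vector_bundle X ?S" by (rule EWb(1))
 fix x assume x: "x \<in> topspace X"
 show "lin_on (vscale ?S) (scale E) (vfibre ?S x) (?f x)"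
  using FE.mor_at_add_arg[OF R(1)[OF x] x] FE.mor_at_scale_arg[OF R(1)[OF x] x] W_fibre[OF x] by (auto simp: lin_on_def whitney_sum_fibre whitney_sum_scale FF.subbundle_vb_simps EE.subbundle_vb_simps VE.scale_right_distrib)
 have Lf: "L x (?f x (u, w)) = (L x u - (w - L x (R x w))) + w" if "u \<in> fibre E x" "w \<in> fibre F x" for u w
  using mor_at_add_arg[OF L[OF x] x that(1) R_fibre[OF x that(2)]] by simp
 show "bij_betw (?f x) (vfibre ?S x) (index_domain E L VplusW x)"
  unfolding bij_betw_def whitney_sum_fibre FF.subbundle_vb_simps EE.subbundle_vb_simps
 proof
  show "inj_on (?f x) (index_domain E L V x \<times> W x)"
  proof (rule inj_onI, clarify)
   fix u w u' w' assume h: "u \<in> index_domain E L V x" "w \<in> W x" "u' \<in> index_domain E L V x" "w' \<in> W x"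
    "fst (u, w) + R x (snd (u, w)) = fst (u', w') + R x (snd (u', w'))"
   have uf: "u \<in> fibre E x" "u' \<in> fibre E x" "L x u \<in> V x" "L x u' \<in> V x" using h by (auto simp: index_domain_mem)
   have wf: "w \<in> fibre F x" "w' \<in> fibre F x" using h W_fibre[OF x] by auto
   have "((L x u - (w - L x (R x w))) - (L x u' - (w' - L x (R x w')))) + (w - w') = 0"
    using Lf[OF uf(1) wf(1)] Lf[OF uf(2) wf(2)] h(5) by (simp add: algebra_simps)
   moreover have "(L x u - (w - L x (R x w))) - (L x u' - (w' - L x (R x w'))) \<in> V x"
    by (intro VF.subspace_diff[OF V_subspace[OF x]] uf defect[OF x] wf)
   ultimately have "w - w' = 0" using V_W_zero(2)[OF x] VF.subspace_diff[OF W_subspace[OF x] h(2,4)] by blast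
   then show "u = u' \<and> w = w'" using h(5) by simp
  qed
  show "?f x ` (index_domain E L V x \<times> W x) = index_domain E L VplusW x"
  proof
   show "?f x ` (index_domain E L V x \<times> W x) \<subseteq> index_domain E L VplusW x"
   proof clarify
    fix u w assume h: "u \<in> index_domain E L V x" "w \<in> W x"
    have uf: "u \<in> fibre E x" "L x u \<in> V x" using h by (auto simp: index_domain_mem)
    have wf: "w \<in> fibre F x" using h W_fibre[OF x] by auto
    have "L x u - (w - L x (R x w)) \<in> V x" by (intro VF.subspace_diff[OF V_subspace[OF x]] uf defect[OF x] wf)
    then have "L x (?f x (u, w)) \<in> VplusW x" unfolding Lf[OF uf(1) wf] using h(2) by blast
    moreover have "?f x (u, w) \<in> fibre E x" using VE.subspace_add[OF subE[OF x] uf(1) R_fibre[OF x wf]] by simp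
    ultimately show "?f x (u, w) \<in> index_domain E L VplusW x" by (simp add: index_domain_mem)
   qed
   show "index_domain E L VplusW x \<subseteq> ?f x ` (index_domain E L V x \<times> W x)"
   proof
    fix e assume "e \<in> index_domain E L VplusW x"
    then obtain v w where e: "e \<in> fibre E x" "L x e = v + w" "v \<in> V x" "w \<in> W x" by (auto simp: index_domain_mem)
    have wf: "w \<in> fibre F x" using e W_fibre[OF x] by auto
    have ef: "e - R x w \<in> fibre E x" by (rule VE.subspace_diff[OF subE[OF x] e(1) R_fibre[OF x wf]])
    have "L x (e - R x w) = v + (w - L x (R x w))"
     using mor_at_diff_arg[OF L[OF x] x e(1) R_fibre[OF x wf]] e(2) by simp
    also have "\<dots> \<in> V x" by (intro VF.subspace_add[OF V_subspace[OF x]] e(3) defect[OF x wf])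
    finally have "(e - R x w, w) \<in> index_domain E L V x \<times> W x" using ef e(4) by (simp add: index_domain_mem)
    then show "e \<in> ?f x ` (index_domain E L V x \<times> W x)" by (intro image_eqI[of _ _ "(e - R x w, w)"]) auto
   qed
  qed
 qed
 show "sec_at X E (%y. ?f y (s y)) x" if s: "vsec_at X ?S s x" for s
  using s unfolding EWb(2)[OF x] EE.subbundle_vb_sec[OF ED x] FF.subbundle_vb_sec[OF W x]
  by (intro EE.sec_at_add x FE.sec_at_mor[OF R(1)[OF x]]) auto
qed

end

end

lemma (in bpair) exists_transversal_data:
 assumes X: "compact_space X" "Hausdorff_space X"
  and L: "\<And>x. x \<in> topspace X ==> mor_at X E F L x"
  and ker: "\<And>x. x \<in> topspace X ==> finite_dim (scale E) {u \<in> fibre E x. L x u = 0}"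
  and V: "findim_subbundle X F V" and trans: "transversal X E F L V"
 obtains P R where "transversal_data X E F L V P R"
proof -
 interpret FF: bbundle X F by unfold_locales (rule F)
 obtain P where P: "\<And>x. x \<in> topspace X ==> mor_at X F F P x"
  "\<And>x u. x \<in> topspace X ==> u \<in> fibre F x ==> P x u \<in> V x"
  "\<And>x u. x \<in> topspace X ==> u \<in> V x ==> P x u = u"
  by (rule FF.subbundle_projection[OF X V]) (rule that; assumption)
 obtain R where "\<And>x. x \<in> topspace X ==> mor_at X F E R x"
  "\<And>x w. x \<in> topspace X ==> w \<in> fibre F x ==> L x (R x w) - P x (L x (R x w)) = w - P x w"
  "\<And>x v. x \<in> topspace X ==> v \<in> V x ==> R x v = 0"
  by (rule transversal_right_inverse[OF X L ker V P trans]) (assumption | (rule that; assumption))+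
 with P have "transversal_data X E F L V P R"
  using L ker V by unfold_locales auto
 then show thesis by (rule that)
qed

lemma (in bpair) transversal_if_spans:
 assumes V: "findim_subbundle X F V" and "\<And>x. x \<in> topspace X ==> spans_cokernel L x (V x)"
  and L: "\<And>x. x \<in> topspace X ==> mor_at X E F L x"
 shows "transversal X E F L V"
 unfolding transversal_def
proof
 interpret FF: bbundle X F by unfold_locales (rule F)
 fix x assume x: "x \<in> topspace X"
 have s: "VF.span (V x) = V x" using FF.subbundle_subspace[OF V x] by (rule VF.span_eq_iff[THEN iffD2])
 show "{L x u + v |u v. u \<in> fibre E x \<and> v \<in> V x} = fibre F x"
 proof
  show "{L x u + v |u v. u \<in> fibre E x \<and> v \<in> V x} \<subseteq> fibre F x"
   using VF.subspace_add[OF subF[OF x]] mor_at_fibre[OF L[OF x] x] FF.subbundle_subset[OF V x] by blast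
  show "fibre F x \<subseteq> {L x u + v |u v. u \<in> fibre E x \<and> v \<in> V x}"
   using assms(2)[OF x] unfolding spans_cokernel_def s by blast
 qed
qed

section \<open>Fredholm morphisms and their index bundles\<close>

lemma compact_operator_compose:
 fixes S :: "'c::real_normed_vector => 'a::real_normed_vector"
 assumes T: "compact_operator T" and S: "bounded_linear S"
 shows "compact_operator (%x. T (S x))"
 unfolding compact_operator_def
using T S bounded_linear_compose[of T S] bounded_linear_image by (force simp: compact_operator_def image_image)

context bpair
begin

text \<open>The constant pencil, by which the results on pencils apply to a single morphism.\<close>

lemma fredholm_morphism_pencil:
 assumes X: "compact_space X" "Hausdorff_space X" and L: "L \<in> fredholm_morphisms X E F"
 shows "fredholm_pencil X E F L (%x u. 0)"
proof -
 obtain k where k: "L \<in> bundle_morphisms X E F"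
  "\<And>x. x \<in> topspace X ==> fredholm_on (scale E) (scale F) (fibre E x) (fibre F x) (L x) k"
  using L unfolding fredholm_morphisms_def fredholm_morphisms_of_index_def by blast
 have p: "pencil L (%x u. 0) t x u = L x u" for t x u by (simp add: pencil_def)
 show ?thesis
 proof unfold_locales
  fix x assume x: "x \<in> topspace X"
  show "mor_at X E F L x" using k(1) x unfolding bundle_morphisms_iff[OF E F] by blast
  show "mor_at X E F (%x u. 0) x" by (rule mor_at_zero[OF x])
  fix t :: real
  obtain m n C where C: "has_dim (scale E) {u \<in> fibre E x. L x u = 0} m" "has_dim (scale F) C n" "C \<subseteq> fibre F x"
   "{c + L x u |c u. c \<in> C \<and> u \<in> fibre E x} = fibre F x"
   using k(2)[OF x] unfolding fredholm_on_def by blast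
  show "finite_dim (scale E) {u \<in> fibre E x. pencil L (%x u. 0) t x u = 0}"
   using C(1) unfolding p finite_dim_def by blast
  have "spans_cokernel (pencil L (%x u. 0) t) x C"
   unfolding spans_cokernel_def p
  proof
   fix w assume "w \<in> fibre F x"
   then obtain c u where "w = c + L x u" "c \<in> C" "u \<in> fibre E x" using C(4) by blast
   then show "\<exists>u\<in>fibre E x. \<exists>d\<in>VF.span C. w = L x u + d"
    by (intro bexI[of _ u] bexI[of _ c]) (auto intro: VF.span_base)
  qed
  then show "\<exists>C. finite_dim (scale F) C \<and> C \<subseteq> fibre F x \<and> spans_cokernel (pencil L (%x u. 0) t) x C"
   using C(2,3) unfolding finite_dim_def by blast
 qed (fact X)+
qed

text \<open>In charts, \<open>M + t K = (1 + t K M\<^sup>-\<^sup>1) M\<close>.\<close>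

lemma iso_compact_pencil:
 assumes X: "compact_space X" "Hausdorff_space X"
  and M: "M \<in> bundle_isos X E F" and K: "K \<in> compact_morphisms X E F"
 shows "fredholm_pencil X E F M K"
proof -
 interpret FE: bpair X F E by unfold_locales (rule F, rule E)
 interpret FF: bbundle X F by unfold_locales (rule F)
 obtain N where MN: "M \<in> bundle_morphisms X E F" "N \<in> bundle_morphisms X F E"
  "\<And>x u. x \<in> topspace X ==> u \<in> fibre E x ==> N x (M x u) = u"
  "\<And>x v. x \<in> topspace X ==> v \<in> fibre F x ==> M x (N x v) = v"
  using M unfolding bundle_isos_def by blast
 have mM: "mor_at X E F M x" if "x \<in> topspace X" for x using MN(1) that unfolding bundle_morphisms_iff[OF E F] by blast
 have mN: "mor_at X F E N x" if "x \<in> topspace X" for x using MN(2) that unfolding bundle_morphisms_iff[OF F E] by blast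
 have mK: "mor_at X E F K x" if "x \<in> topspace X" for x
  using K that by (simp add: compact_morphisms_def bundle_morphisms_iff[OF E F])
 have fd: "finite_dim (scale E) {u \<in> fibre E x. pencil M K t x u = 0} \<and>
   (\<exists>C. finite_dim (scale F) C \<and> C \<subseteq> fibre F x \<and> spans_cokernel (pencil M K t) x C)"
  if x: "x \<in> topspace X" for x t
 proof -
  obtain U phi where c: "(U, phi) \<in> atlas E" "x \<in> U" using exists_chart[OF E x] by blast
  obtain V psi where d: "(V, psi) \<in> atlas F" "x \<in> V" using exists_chart[OF F x] by blast
  note ca = admissible_atlas[OF E c(1)] and da = admissible_atlas[OF F d(1)]
  obtain BM where BM: "rep X E x phi psi M BM" using mor_at_rep[OF E F mM[OF x] ca da c(2) d(2)] ..
  obtain BK where BK: "rep X E x phi psi K BK" using mor_at_rep[OF E F mK[OF x] ca da c(2) d(2)] ..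
  obtain BN where BN: "rep X F x psi phi N BN" using mor_at_rep[OF F E mN[OF x] da ca d(2) c(2)] ..
  have rM: "psi x (M x u) = BM x (phi x u)" if "u \<in> fibre E x" for u
   using eventually_nhdsin_self[OF x rep_eventually[OF BM]] that by blast
  have rK: "psi x (K x u) = BK x (phi x u)" if "u \<in> fibre E x" for u
   using eventually_nhdsin_self[OF x rep_eventually[OF BK]] that by blast
  have rN: "phi x (N x u) = BN x (psi x u)" if "u \<in> fibre F x" for u
   using eventually_nhdsin_self[OF x rep_eventually[OF BN]] that by blast
  have BMN: "BM x (BN x w) = w" for w
  using chart_inv[OF da d(2), of w] rM[OF FE.mor_at_fibre[OF mN[OF x] x]] rN MN(4)[OF x] by force
  have BNM: "BN x (BM x v) = v" for v
  using chart_inv[OF ca c(2), of v] rN[OF mor_at_fibre[OF mM[OF x] x]] rM MN(3)[OF x] by force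
  have kN: "klin (mscale F) (mscale E) (BN x)"
   using eventually_nhdsin_self[OF x FE.mor_rep_klin[OF mN[OF x] da ca d(2) c(2) BN]] .
  have kK: "klin (mscale E) (mscale F) (BK x)"
   using eventually_nhdsin_self[OF x mor_rep_klin[OF mK[OF x] ca da c(2) d(2) BK]] .
  have "compact_operator (in_charts (fibre E) phi psi K x)"
   using K c d unfolding compact_morphisms_def by blast
  moreover have "in_charts (fibre E) phi psi K x = BK x"
   using rK chart_inv[OF ca c(2)] by (intro ext) (simp add: in_charts_def)
  ultimately have cK: "compact_operator (BK x)" by simp
  \<comment> \<open>This is \<open>t K N\<close> with \<open>N\<close> the inverse of
    \<open>M\<close>. It is compact, and the pencil composed with \<open>N\<close> is
    \<open>1 + T\<close>, so kernel and cokernel can be read off from the Riesz theory.\<close>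
  define T where "T w = BK x (t *\<^sub>R BN x w)" for w
  have cT: "compact_operator T"
   unfolding T_def by (intro compact_operator_compose[OF cK] bounded_linear_const_scaleR blinfun.bounded_linear_right)
  have kT: "klin (mscale F) (mscale F) T"
   using kN kK unfolding klin_def T_def by (simp add: ME.scale_scaleR_right[symmetric])
  define B where "B v = BM x v + t *\<^sub>R BK x v" for v
  have BT: "B (BN x w) = w + T w" for w by (simp add: B_def T_def BMN blinfun.scaleR_right)
  have Bp: "psi x (pencil M K t x u) = B (phi x u)" if u: "u \<in> fibre E x" for u
  using mor_at_fibre[OF mM[OF x] x u] mor_at_fibre[OF mK[OF x] x u] chart_add[OF da d(2) _ VF.subspace_scale[OF subF[OF x]]] chart_scale[OF da d(2)] rM[OF u] rK[OF u] by (simp add: pencil_def B_def MF.scale_of_real)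
  have mp: "mor_at X E F (pencil M K t) x" by (rule mor_at_pencil[OF mM[OF x] mK[OF x] x])
  have "finite_dim (mscale E) (BN x ` {w. w + T w = 0})"
   using kN by (intro finite_dim_image[OF MF.vector_space_axioms ME.vector_space_axioms MF.compact_perturbation_kernel[OF cT kT]])
    (auto simp: blinfun.add_right klin_def)
  also have "BN x ` {w. w + T w = 0} = {v. B v = 0}"
  proof
   show "BN x ` {w. w + T w = 0} \<subseteq> {v. B v = 0}" using BT by auto
   show "{v. B v = 0} \<subseteq> BN x ` {w. w + T w = 0}"
   proof
    fix v assume "v \<in> {v. B v = 0}"
    then have "BM x v + T (BM x v) = 0" using BT[of "BM x v"] BNM[of v] by simp
    then show "v \<in> BN x ` {w. w + T w = 0}" using BNM[of v] by (intro image_eqI[of _ _ "BM x v"]) auto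
   qed
  qed
  finally have ker: "finite_dim (scale E) {u \<in> fibre E x. pencil M K t x u = 0}"
   using finite_dim_chart_kernel[OF mp ca c(2) da d(2), of B] Bp by blast
  obtain D where D: "finite_dim (mscale F) D" "\<And>y. \<exists>u. \<exists>d\<in>D. y = u + T u + d"
   using MF.compact_perturbation_cokernel[OF cT] by blast
  define C where "C = inv_into (fibre F x) (psi x) ` D"
  have Cf: "C \<subseteq> fibre F x" unfolding C_def using chart_inv[OF da d(2)] by blast
  have fC: "finite_dim (scale F) C"
   using FF.finite_dim_chart[OF da d(2) Cf] D(1) by (simp add: C_def image_image chart_inv(2)[OF da d(2)])
  have "spans_cokernel (pencil M K t) x C"
   unfolding spans_cokernel_def
  proof
   fix w assume w: "w \<in> fibre F x"
   obtain y e where y: "psi x w = y + T y + e" "e \<in> D" using D(2) by blast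
   let ?u = "inv_into (fibre E x) (phi x) (BN x y)" and ?e = "inv_into (fibre F x) (psi x) e"
   note i = chart_inv[OF ca c(2), of "BN x y"] and j = chart_inv[OF da d(2), of e]
   have pf: "pencil M K t x ?u \<in> fibre F x" by (rule mor_at_fibre[OF mp x i(1)])
   have "pencil M K t x ?u + ?e = w"
    using chart_add[OF da d(2) pf j(1)] Bp[OF i(1)] i(2) j(2) BT y(1) chart_inj[OF da d(2) VF.subspace_add[OF subF[OF x] pf j(1)] w] by simp
   moreover have "?e \<in> VF.span C" unfolding C_def using y(2) by (blast intro: VF.span_base)
   ultimately show "\<exists>u\<in>fibre E x. \<exists>d\<in>VF.span C. w = pencil M K t x u + d" using i(1) by blast
  qed
  then show ?thesis using ker Cf fC by blast
 qed
 show ?thesis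
  by unfold_locales (use X mM mK fd in blast)+
qed

lemma finite_rank_morphism_compact:
 assumes K: "\<And>x. x \<in> topspace X ==> mor_at X E F K x" and S: "findim_subbundle X F S"
  and KS: "\<And>x u. x \<in> topspace X ==> u \<in> fibre E x ==> K x u \<in> S x"
 shows "K \<in> compact_morphisms X E F"
 unfolding compact_morphisms_def
proof (intro CollectI conjI ballI, goal_cases)
 case 1
 show ?case using K unfolding bundle_morphisms_iff[OF E F] by blast
next
 case (2 A)
 interpret FF: bbundle X F by unfold_locales (rule F)
 have "compact_operator (in_charts (fibre E) phi psi K x)"
  if c: "(U, phi) \<in> atlas E" "(V, psi) \<in> atlas F" "x \<in> U" "x \<in> V" for U phi V psi x
 proof -
  note ca = admissible_atlas[OF E c(1)] and da = admissible_atlas[OF F c(2)]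
  have x: "x \<in> topspace X" by (rule admissible_topspace[OF ca c(3)])
  obtain B where B: "rep X E x phi psi K B" using mor_at_rep[OF E F K[OF x] ca da c(3,4)] ..
  have eq: "in_charts (fibre E) phi psi K x = B x"
   using eventually_nhdsin_self[OF x rep_eventually[OF B]] chart_inv[OF ca c(3)] by (intro ext) (simp add: in_charts_def)
  have "in_charts (fibre E) phi psi K x v \<in> psi x ` S x" for v
   unfolding in_charts_def using KS[OF x chart_inv(1)[OF ca c(3)]] by blast
  then have "range (B x) \<subseteq> psi x ` S x" unfolding eq by blast
  then show ?thesis
   unfolding eq using FF.finite_dim_chart[OF da c(4) FF.subbundle_subset[OF S x]] FF.subbundle_finite_dim[OF S x]
   by (intro MF.finite_rank_compact[OF blinfun.bounded_linear_right]) auto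
 qed
 then show ?case using 2 by blast
qed

text \<open>If the model of \<open>F\<close> is finite dimensional, all of \<open>F\<close> serves;
  otherwise general position supplies a subbundle, as a complement of the zero subbundle.\<close>

lemma exists_transversal_subbundle:
 assumes X: "compact_space X" "Hausdorff_space X" and L: "L \<in> fredholm_morphisms X E F"
 shows "\<exists>V. findim_subbundle X F V \<and> transversal X E F L V"
proof (cases "finite_dim (mscale F) UNIV")
 case True
 interpret FF: bbundle X F by unfold_locales (rule F)
 interpret fredholm_pencil X E F L "%x u. 0" by (rule fredholm_morphism_pencil[OF X L])
 have fd: "finite_dim (scale F) (fibre F x)" if x: "x \<in> topspace X" for x
 proof -
  obtain U psi where c: "admissible X F U psi" "x \<in> U" using exists_admissible[OF F x] by blast
  show ?thesis using chart_bij[OF c] FF.finite_dim_chart[OF c, of "fibre F x"] True by (simp add: bij_betw_def)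
 qed
 have "findim_subbundle X F (fibre F)"
  by (rule FF.idempotent_subbundle[of "%x u. u"]) (auto simp: fd intro: mor_at_id[OF F])
 moreover have "transversal X E F L (fibre F)"
 proof (rule transversal_if_spans[OF calculation _ L0])
  fix x assume x: "x \<in> topspace X"
  show "spans_cokernel L x (fibre F x)"
   unfolding spans_cokernel_def
   using VE.subspace_0[OF subE[OF x]] mor_at_zero_arg[OF L0[OF x] x] by (force intro: VF.span_base)
 qed
 ultimately show ?thesis by blast
next
 case False
 interpret fredholm_pencil X E F L "%x u. 0" by (rule fredholm_morphism_pencil[OF X L])
 obtain W where W: "findim_subbundle X F W"
  "\<And>x t. x \<in> topspace X ==> t \<in> {0..1} ==> spans_cokernel (pencil L (%x u. 0) t) x ({0} \<union> W x)"
  by (rule exists_transversal_complement[OF False FF.zero_subbundle]) (rule that; assumption)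
 have "spans_cokernel L x (W x)" if x: "x \<in> topspace X" for x
 using W(2)[OF x, of 0] by (simp add: spans_cokernel_def pencil_def)
 then have "transversal X E F L W" by (intro transversal_if_spans[OF W(1) _ L0])
 then show ?thesis using W(1) by blast
qed

text \<open>The data are built around the very \<open>V\<close> selected by the choice operator in
  \<open>index_bundle\<close>, so the index is literally this difference of classes.\<close>

lemma index_bundle_transversal_data:
 assumes X: "compact_space X" "Hausdorff_space X" and L: "L \<in> fredholm_morphisms X E F"
 obtains V P R where "transversal_data X E F L V P R"
  "index_bundle X E F L = K_class X (subbundle_vb X E (index_domain E L V)) \<otimes>\<^bsub>K_group X\<^esub>
    inv\<^bsub>K_group X\<^esub> K_class X (subbundle_vb X F V)"
proof -
 interpret fredholm_pencil X E F L "%x u. 0" by (rule fredholm_morphism_pencil[OF X L])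
 define V where "V = (SOME V. findim_subbundle X F V \<and> transversal X E F L V)"
 have V: "findim_subbundle X F V \<and> transversal X E F L V"
  unfolding V_def using exists_transversal_subbundle[OF X L] by (rule someI_ex)
 have ker: "finite_dim (scale E) {u \<in> fibre E x. L x u = 0}" if "x \<in> topspace X" for x
  using kernel[OF that, of 0] by (simp add: pencil_def)
 obtain P R where "transversal_data X E F L V P R"
  by (rule exists_transversal_data[OF X L0 ker conjunct1[OF V] conjunct2[OF V]]) (assumption | (rule that; assumption))+
 then show thesis by (rule that) (simp add: index_bundle_def V_def Let_def)
qed

end

section \<open>Compact perturbations of isomorphisms have trivial index\<close>

text \<open>For small \<open>r\<close> the projection \<open>1 - R L\<close> onto the index domain of \<open>L\<close> restricts to an isomorphism
 on the index domain of \<open>L + r D\<close>, because \<open>1 + r (1 - P) D R\<close> is then invertible.\<close>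

lemma (in transversal_data) index_domain_perturbation:
 assumes X: "compact_space X" and D: "\<And>x. x \<in> topspace X ==> mor_at X E F D x"
 obtains \<delta> where "\<delta> > 0" "\<And>r. \<bar>r\<bar> < \<delta> ==> findim_subbundle X E (index_domain E (pencil L D r) V) ==>
  vb_isomorphic X (subbundle_vb X E (index_domain E (pencil L D r) V)) (subbundle_vb X E (index_domain E L V))"
proof -
 define G where "G x w = D x (R x w) - P x (D x (R x w))" for x w
 have DR: "mor_at X F F (%x w. D x (R x w)) x" if "x \<in> topspace X" for x
  by (rule mor_at_comp[OF F E F R(1)[OF that] D[OF that] that])
 have G: "mor_at X F F G x" if "x \<in> topspace X" for x
  unfolding G_def by (intro FF.mor_at_diff DR mor_at_comp[OF F F F DR P(1)] that)
 obtain \<delta> where \<delta>: "\<delta> > 0" "\<And>x r. x \<in> topspace X ==> \<bar>r\<bar> < \<delta> ==>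
  bij_betw (%u. u + scale F (of_real r) (G x u)) (fibre F x) (fibre F x)"
  by (rule FF.small_perturbation_bij[OF X G]) (assumption | (rule that; assumption))+
 have "vb_isomorphic X (subbundle_vb X E (index_domain E (pencil L D r) V)) (subbundle_vb X E (index_domain E L V))"
  if r: "\<bar>r\<bar> < \<delta>" and sub: "findim_subbundle X E (index_domain E (pencil L D r) V)" for r
 proof (rule EE.subbundle_vb_isomorphic[OF sub index_domain_facts(1,2)])
  fix x assume x: "x \<in> topspace X"
  let ?T = "pencil L D r x" and ?B = "%w. w + scale F (of_real r) (G x w)" and ?Q = "%u. u - R x (L x u)"
  let ?C = "%w. w - P x w"
  note mT = mor_at_pencil[OF L[OF x] D[OF x] x, of r]
  have Vf: "v \<in> V x ==> v \<in> fibre F x" for v by (rule V_fibre[OF x])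
  have PV: "P x v = v" if "v \<in> V x" for v by (rule P(3)[OF x that])
  have Pd: "P x (u - v) = P x u - P x v" if "u \<in> fibre F x" "v \<in> fibre F x" for u v
   by (rule FF.mor_at_diff_arg[OF P(1)[OF x] x that])
  have Pa: "P x (u + v) = P x u + P x v" if "u \<in> fibre F x" "v \<in> fibre F x" for u v
   by (rule FF.mor_at_add_arg[OF P(1)[OF x] x that])
  have Ps: "P x (scale F c u) = scale F c (P x u)" if "u \<in> fibre F x" for u c
   by (rule FF.mor_at_scale_arg[OF P(1)[OF x] x that])
  have Rf: "R x w \<in> fibre E x" if "w \<in> fibre F x" for w by (rule R_fibre[OF x that])
  have Lf: "L x u \<in> fibre F x" if "u \<in> fibre E x" for u by (rule L_fibre[OF x that])
  have Df: "D x u \<in> fibre F x" if "u \<in> fibre E x" for u by (rule mor_at_fibre[OF D[OF x] x that])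
  have Pf: "P x w \<in> fibre F x" if "w \<in> fibre F x" for w by (rule P_fibre[OF x that])
  have Cf: "?C w \<in> fibre F x" if "w \<in> fibre F x" for w by (rule VF.subspace_diff[OF subF[OF x] that Pf[OF that]])
  have PC: "P x (?C w) = 0" if "w \<in> fibre F x" for w
   using Pd[OF that Pf[OF that]] PV[OF P(2)[OF x that]] by simp
  have Gf: "G x w \<in> fibre F x" "P x (G x w) = 0" if "w \<in> fibre F x" for w
   unfolding G_def using Cf[OF Df[OF Rf[OF that]]] PC[OF Df[OF Rf[OF that]]] .
  have PB: "P x (?B w) = P x w" if "w \<in> fibre F x" for w
   using Pa[OF that VF.subspace_scale[OF subF[OF x] Gf(1)[OF that]]] Ps[OF Gf(1)[OF that]] Gf(2)[OF that] by simp
  have CT: "?C (?T u) = ?C (L x u) + scale F (of_real r) (?C (D x u))" if u: "u \<in> fibre E x" for u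
   unfolding pencil_def
    using Pa[OF Lf[OF u] VF.subspace_scale[OF subF[OF x] Df[OF u]]] Ps[OF Df[OF u]] by (simp add: VF.scale_right_diff_distrib)
  have CTR: "?C (?T (R x w)) = ?B w - P x w" if w: "w \<in> fibre F x" for w
   unfolding CT[OF Rf[OF w]] G_def using R(2)[OF x w] by simp
  have bB: "bij_betw ?B (fibre F x) (fibre F x)" by (rule \<delta>(2)[OF x r])
  have B0: "?B 0 = 0"
   using FF.mor_at_zero_arg[OF G[OF x] x] by simp
  have CV: "?C v = 0" if "v \<in> V x" for v using PV[OF that] by simp
  show "bij_betw ?Q (index_domain E (pencil L D r) V x) (index_domain E L V x)"
   unfolding bij_betw_def
  proof
   show "inj_on ?Q (index_domain E (pencil L D r) V x)"
   proof (rule inj_onI)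
    fix u1 u2 assume "u1 \<in> index_domain E (pencil L D r) V x" "u2 \<in> index_domain E (pencil L D r) V x"
    then have u12: "u1 \<in> fibre E x" "u2 \<in> fibre E x" "?T u1 \<in> V x" "?T u2 \<in> V x" by (simp_all add: index_domain_mem)
    assume Q: "?Q u1 = ?Q u2"
    define u where "u = u1 - u2"
    have u: "u \<in> fibre E x" unfolding u_def by (rule VE.subspace_diff[OF subE[OF x] u12(1,2)])
    have Tu: "?T u \<in> V x"
     unfolding u_def mor_at_diff_arg[OF mT x u12(1,2)] by (rule VF.subspace_diff[OF V_subspace[OF x] u12(3,4)])
    have "R x (L x u) = R x (L x u1) - R x (L x u2)"
     unfolding u_def mor_at_diff_arg[OF L[OF x] x u12(1,2)] by (rule FE.mor_at_diff_arg[OF R(1)[OF x] x Lf Lf]) (rule u12)+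
    moreover have "R x (L x u1) - R x (L x u2) = u" unfolding u_def using Q by (simp add: algebra_simps)
    ultimately have RLu: "R x (L x u) = u" by simp
    \<comment> \<open>An element killed by \<open>1 - R L\<close> equals \<open>R w\<close> for this
      \<open>w\<close> in the kernel of \<open>P\<close>; membership in the perturbed domain then
      reads \<open>?B w = 0\<close>.\<close>
    define w where "w = ?C (L x u)"
    have w: "w \<in> fibre F x" unfolding w_def by (rule Cf[OF Lf[OF u]])
    have Rw: "R x w = u"
     unfolding w_def FE.mor_at_diff_arg[OF R(1)[OF x] x Lf[OF u] Pf[OF Lf[OF u]]]
     using R(3)[OF x P(2)[OF x Lf[OF u]]] RLu by simp
    have "?B w = ?C (?T u) + P x w" using CTR[OF w] unfolding Rw by simp
    also have "\<dots> = 0" unfolding CV[OF Tu] w_def PC[OF Lf[OF u]] by simp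
    finally have "?B w = ?B 0" unfolding B0 .
    then have "w = 0" using bB w VF.subspace_0[OF subF[OF x]] unfolding bij_betw_def inj_on_def by blast
    then have "u = 0" using Rw FE.mor_at_zero_arg[OF R(1)[OF x] x] by simp
    then show "u1 = u2" by (simp add: u_def)
   qed
   show "?Q ` index_domain E (pencil L D r) V x = index_domain E L V x"
   proof
    show "?Q ` index_domain E (pencil L D r) V x \<subseteq> index_domain E L V x"
    using index_domain_facts(3)[OF x] by (auto simp: index_domain_mem)
    show "index_domain E L V x \<subseteq> ?Q ` index_domain E (pencil L D r) V x"
    proof
     fix z assume z: "z \<in> index_domain E L V x"
     then have zf: "z \<in> fibre E x" by (simp add: index_domain_mem)
     note Tz = mor_at_fibre[OF mT x zf]
     \<comment> \<open>To move \<open>z\<close> into the perturbed domain, \<open>R w\<close> is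
       added, where \<open>?B w\<close> is minus the part of \<open>?T z\<close> transversal to
       \<open>V\<close>. The projection \<open>1 - R L\<close> does not see this correction.\<close>
     have "- ?C (?T z) \<in> ?B ` fibre F x"
      using VF.subspace_neg[OF subF[OF x] Cf[OF Tz]] by (simp add: bij_betw_imp_surj_on[OF bB])
     then obtain w where w: "w \<in> fibre F x" "?B w = - ?C (?T z)" by (elim imageE) (rule that, assumption, simp)
     have "P x w = P x (- ?C (?T z))" using PB[OF w(1)] w(2) by simp
     also have "\<dots> = P x (0 - ?C (?T z))" by simp
     also have "\<dots> = 0"
      using Pd[OF VF.subspace_0[OF subF[OF x]] Cf[OF Tz]] PC[OF Tz] FF.mor_at_zero_arg[OF P(1)[OF x] x] by simp
     finally have Pw: "P x w = 0" .
     define u where "u = z + R x w"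
     have u: "u \<in> fibre E x" unfolding u_def by (rule VE.subspace_add[OF subE[OF x] zf Rf[OF w(1)]])
     have Tu: "?T u \<in> fibre F x" by (rule mor_at_fibre[OF mT x u])
     have "?C (?T u) = ?C (?T z) + ?C (?T (R x w))"
      unfolding u_def mor_at_add_arg[OF mT x zf Rf[OF w(1)]] Pa[OF Tz mor_at_fibre[OF mT x Rf[OF w(1)]]] by simp
     also have "\<dots> = 0" unfolding CTR[OF w(1)] w(2) Pw by simp
     finally have "?T u = P x (?T u)" by simp
     then have "?T u \<in> V x" using P(2)[OF x Tu] by simp
     then have "u \<in> index_domain E (pencil L D r) V x" using u by (simp add: index_domain_mem)
     moreover have "?Q u = z"
     using FE.mor_at_add_arg[OF R(1)[OF x] x Lf[OF zf] Lf[OF Rf[OF w(1)]]] by (simp add: u_def mor_at_add_arg[OF L[OF x] x zf Rf[OF w(1)]] index_domain_facts(4)[OF x z] RLR[OF x w(1)])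
     ultimately show "z \<in> ?Q ` index_domain E (pencil L D r) V x" by (intro image_eqI[of _ _ u]) auto
    qed
   qed
  qed
 qed
 then show thesis by (rule that[OF \<delta>(1)])
qed

lemma (in bpair) pencil_pencil: "pencil (pencil L0 L1 t) L1 (r - t) = pencil L0 L1 r"
 unfolding pencil_def by (intro ext) (simp add: VF.scale_left_diff_distrib)

text \<open>By \<open>pencil_pencil\<close> every \<open>t\<close> can be taken as the centre, where
  \<open>index_domain_perturbation\<close> applies. Being isomorphic is an equivalence relation, so
  connectedness of the interval joins 0 to 1.\<close>

lemma (in fredholm_pencil) index_domain_homotopy:
 assumes V: "findim_subbundle X F V"
  and span: "\<And>x t. x \<in> topspace X ==> t \<in> {0..1} ==> spans_cokernel (pencil L0 L1 t) x (V x)"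
 shows "vb_isomorphic X (subbundle_vb X E (index_domain E (pencil L0 L1 0) V))
   (subbundle_vb X E (index_domain E (pencil L0 L1 1) V))"
  and "t \<in> {0..1} ==> findim_subbundle X E (index_domain E (pencil L0 L1 t) V)"
proof -
 interpret EE: bbundle X E by unfold_locales (rule E)
 let ?D = "%t. index_domain E (pencil L0 L1 t) V"
 have data: "\<exists>P R. transversal_data X E F (pencil L0 L1 t) V P R" if t: "t \<in> {0..1}" for t
 using mor_at_pencil[OF L0 L1] transversal_if_spans[OF V span[OF _ t]] exists_transversal_data[OF X _ kernel[OF _ t] V] by force
 show fd: "findim_subbundle X E (?D t)" if t: "t \<in> {0..1}" for t
 using data[OF t] transversal_data.index_domain_facts(1) by blast
 note vb = EE.vector_bundle_subbundle[OF fd]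
 have "vb_isomorphic X (subbundle_vb X E (?D 0)) (subbundle_vb X E (?D 1))"
 proof (rule connected_equivalence_relation[of "{0..1::real}" 0 1 "%a b. vb_isomorphic X (subbundle_vb X E (?D a)) (subbundle_vb X E (?D b))"])
  show "connected {0..1::real}" "0 \<in> {0..1::real}" "1 \<in> {0..1::real}" by simp_all
  show "vb_isomorphic X (subbundle_vb X E (?D b)) (subbundle_vb X E (?D a))"
   if "vb_isomorphic X (subbundle_vb X E (?D a)) (subbundle_vb X E (?D b))" for a b
   by (rule vb_isomorphic_sym[OF that])
  show "vb_isomorphic X (subbundle_vb X E (?D a)) (subbundle_vb X E (?D c))"
   if h: "vb_isomorphic X (subbundle_vb X E (?D a)) (subbundle_vb X E (?D b))"
    "vb_isomorphic X (subbundle_vb X E (?D b)) (subbundle_vb X E (?D c))" "a \<in> {0..1}" "b \<in> {0..1}" "c \<in> {0..1}" for a b c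
   by (rule vb_isomorphic_trans[OF vb[OF h(3)] vb[OF h(4)] vb[OF h(5)] h(1,2)])
  fix t :: real assume t: "t \<in> {0..1}"
  obtain P R where "transversal_data X E F (pencil L0 L1 t) V P R" using data[OF t] by blast
  then interpret td: transversal_data X E F "pencil L0 L1 t" V P R .
  obtain \<delta> where \<delta>: "\<delta> > 0" "\<And>r. \<bar>r\<bar> < \<delta> ==> findim_subbundle X E (index_domain E (pencil (pencil L0 L1 t) L1 r) V) ==>
   vb_isomorphic X (subbundle_vb X E (index_domain E (pencil (pencil L0 L1 t) L1 r) V)) (subbundle_vb X E (?D t))"
   by (rule td.index_domain_perturbation[OF X(1) L1]) (assumption | (rule that; assumption))+
  have "vb_isomorphic X (subbundle_vb X E (?D t)) (subbundle_vb X E (?D r))" if "r \<in> {0..1}" "\<bar>r - t\<bar> < \<delta>" for r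
   using \<delta>(2)[OF that(2), unfolded pencil_pencil, OF fd[OF that(1)]] by (rule vb_isomorphic_sym)
  then show "\<exists>T. openin (top_of_set {0..1}) T \<and> t \<in> T \<and>
    (\<forall>r\<in>T. vb_isomorphic X (subbundle_vb X E (?D t)) (subbundle_vb X E (?D r)))"
   using t \<delta>(1) by (intro exI[of _ "{0..1} \<inter> ball t \<delta>"]) (auto simp: openin_open_Int dist_real_def abs_minus_commute)
 qed
 then show "vb_isomorphic X (subbundle_vb X E (?D 0)) (subbundle_vb X E (?D 1))" .
qed

text \<open>General position needs an infinite dimensional model. In the finite dimensional case the
  kernel of a projection onto \<open>V\<close> is a complement, and \<open>V + W\<close> is all of
  \<open>F\<close>, so that the span condition is clear.\<close>

lemma (in fredholm_pencil) exists_complement_spanning: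
 assumes V: "findim_subbundle X F V"
 obtains W where "findim_subbundle X F W" "\<And>x. x \<in> topspace X ==> V x \<inter> W x \<subseteq> {0}"
  "\<And>x t. x \<in> topspace X ==> t \<in> {0..1} ==> spans_cokernel (pencil L0 L1 t) x (V x \<union> W x)"
proof (cases "finite_dim (mscale F) UNIV")
 case False
 show thesis by (rule exists_transversal_complement[OF False V]) (rule that; assumption)
next
 case True
 obtain P where P: "\<And>x. x \<in> topspace X ==> mor_at X F F P x"
  "\<And>x u. x \<in> topspace X ==> u \<in> fibre F x ==> P x u \<in> V x"
  "\<And>x u. x \<in> topspace X ==> u \<in> V x ==> P x u = u"
  by (rule FF.subbundle_projection[OF X V]) (rule that; assumption)
 define W where "W x = {w \<in> fibre F x. P x w = 0}" for x
 have Vf: "V x \<subseteq> fibre F x" if "x \<in> topspace X" for x by (rule FF.subbundle_subset[OF V that])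
 have QW: "u - P x u \<in> W x" if x: "x \<in> topspace X" and u: "u \<in> fibre F x" for x u
 using P(2)[OF x u] Vf[OF x] VF.subspace_diff[OF subF[OF x] u] FF.mor_at_diff_arg[OF P(1)[OF x] x u] P(3)[OF x P(2)[OF x u]] by (auto simp: W_def)
 have "findim_subbundle X F W"
 proof (rule FF.idempotent_subbundle[of "%x u. u - P x u"])
  show "mor_at X F F (%x u. u - P x u) x" if "x \<in> topspace X" for x
   by (intro FF.mor_at_diff mor_at_id[OF F] P(1) that)
  show "u - P x u \<in> W x" if "x \<in> topspace X" "u \<in> fibre F x" for x u by (rule QW[OF that])
  show "u \<in> fibre F x \<and> u - P x u = u" if "x \<in> topspace X" "u \<in> W x" for x u using that(2) by (simp add: W_def)
  fix x assume x: "x \<in> topspace X"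
  obtain U psi where c: "admissible X F U psi" "x \<in> U" using exists_admissible[OF F x] by blast
  have "finite_dim (scale F) (fibre F x)"
   using chart_bij[OF c] FF.finite_dim_chart[OF c, of "fibre F x"] True by (simp add: bij_betw_def)
  moreover have "VF.subspace (W x)"
   unfolding W_def VF.subspace_def
   using FF.mor_at_add_arg[OF P(1)[OF x] x] FF.mor_at_scale_arg[OF P(1)[OF x] x] FF.mor_at_zero_arg[OF P(1)[OF x] x] VF.subspace_0[OF subF[OF x]] VF.subspace_add[OF subF[OF x]] VF.subspace_scale[OF subF[OF x]] by auto
  ultimately show "finite_dim (scale F) (W x)" by (rule VF.finite_dim_mono) (auto simp: W_def)
 qed
 moreover have "V x \<inter> W x \<subseteq> {0}" if "x \<in> topspace X" for x
  using P(3)[OF that] by (auto simp: W_def)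
 moreover have "spans_cokernel (pencil L0 L1 t) x (V x \<union> W x)" if x: "x \<in> topspace X" for x t
  unfolding spans_cokernel_def
 proof
  fix w assume w: "w \<in> fibre F x"
  have "P x w + (w - P x w) \<in> VF.span (V x \<union> W x)"
   using P(2)[OF x w] QW[OF x w] by (intro VF.span_add VF.span_base) auto
  then have "w \<in> VF.span (V x \<union> W x)" by simp
  moreover have "pencil L0 L1 t x 0 = 0" by (rule mor_at_zero_arg[OF mor_at_pencil[OF L0[OF x] L1[OF x] x] x])
  ultimately show "\<exists>u\<in>fibre E x. \<exists>d\<in>VF.span (V x \<union> W x). w = pencil L0 L1 t x u + d"
   using VE.subspace_0[OF subE[OF x]] by (intro bexI[of _ 0] bexI[of _ w]) auto
 qed
 ultimately show thesis by (intro that[of W])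
qed

text \<open>The given \<open>V\<close> is transversal to \<open>L\<close> but perhaps not to every
  \<open>M + t K\<close>, so it is enlarged to \<open>V' = V + W\<close>. The chain of isomorphisms
  leads from \<open>E(L, V) + W\<close> to \<open>E(L, V')\<close>, \<open>E(M + K, V')\<close>,
  \<open>E(M, V')\<close>, \<open>V'\<close> and \<open>V + W\<close>; hence \<open>W\<close> is a
  stabilising bundle.\<close>

proposition (in transversal_data) trivial_index_if_compact_perturbation:
 assumes X: "compact_space X" "Hausdorff_space X"
  and M: "M \<in> bundle_isos X E F" and K: "K \<in> compact_morphisms X E F"
  and eq: "\<And>x u. x \<in> topspace X ==> u \<in> fibre E x ==> L x u = M x u + K x u"
 shows "K_class X (subbundle_vb X E (index_domain E L V)) \<otimes>\<^bsub>K_group X\<^esub>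
  inv\<^bsub>K_group X\<^esub> K_class X (subbundle_vb X F V) = \<one>\<^bsub>K_group X\<^esub>"
proof -
 interpret p: fredholm_pencil X E F M K by (rule iso_compact_pencil[OF X M K])
 obtain W where W: "findim_subbundle X F W" "\<And>x. x \<in> topspace X ==> V x \<inter> W x \<subseteq> {0}"
  "\<And>x t. x \<in> topspace X ==> t \<in> {0..1} ==> spans_cokernel (pencil M K t) x (V x \<union> W x)"
  by (rule p.exists_complement_spanning[OF V]) (rule that; assumption)
 define V' where "V' x = {v + w |v w. v \<in> V x \<and> w \<in> W x}" for x
 have V': "findim_subbundle X F V'" unfolding V'_def by (rule FF.sum_subbundle[OF V W(1,2)])
 have VV': "V x \<subseteq> V' x" "W x \<subseteq> V' x" if "x \<in> topspace X" for x
  using VF.subspace_0[OF V_subspace[OF that]] VF.subspace_0[OF FF.subbundle_subspace[OF W(1) that]]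
  unfolding V'_def by force+
 have span: "spans_cokernel (pencil M K t) x (V' x)" if "x \<in> topspace X" "t \<in> {0..1}" for x t
  by (rule spans_cokernel_mono[OF W(3)[OF that]]) (use VV'[OF that(1)] VF.span_superset[of "V' x"] in blast)
 note hom = p.index_domain_homotopy[OF V' span]
 have p0: "pencil M K 0 = M" by (intro ext) (simp add: pencil_def)
 have "spans_cokernel L x (V' x)" if x: "x \<in> topspace X" for x
  unfolding spans_cokernel_def
 using transversal[OF x] VV'(1)[OF x] VF.span_superset[of "V' x"] by blast
 then have tr: "transversal X E F L V'" by (rule transversal_if_spans[OF V' _ L])
 obtain P' R' where td: "transversal_data X E F L V' P' R'"
  by (rule exists_transversal_data[OF X L kernel V' tr]) (assumption | (rule that; assumption))+
 note ELV' = transversal_data.index_domain_facts(1)[OF td]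
 have EM: "findim_subbundle X E (index_domain E M V')" using hom(2)[of 0] unfolding p0 by simp
 have E1: "findim_subbundle X E (index_domain E (pencil M K 1) V')" using hom(2)[of 1] by simp
 note vbs = EE.vector_bundle_subbundle[OF ELV'] EE.vector_bundle_subbundle[OF E1] EE.vector_bundle_subbundle[OF EM]
  FF.vector_bundle_subbundle[OF V'] EE.vector_bundle_subbundle[OF index_domain_facts(1)] FF.vector_bundle_subbundle[OF V]
  FF.vector_bundle_subbundle[OF W(1)]
 \<comment> \<open>\<open>L\<close> and \<open>M + K\<close> agree on the fibres only. The two index
   domains therefore coincide over the base, and the identity is the isomorphism.\<close>
 have i1: "vb_isomorphic X (subbundle_vb X E (index_domain E L V')) (subbundle_vb X E (index_domain E (pencil M K 1) V'))"
 using EE.subbundle_vb_isomorphic[OF ELV' E1 mor_at_id[OF E]] eq by (force simp: index_domain_mem pencil_def bij_betw_def)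
 have i2: "vb_isomorphic X (subbundle_vb X E (index_domain E (pencil M K 1) V')) (subbundle_vb X E (index_domain E M V'))"
  using vb_isomorphic_sym[OF hom(1)] unfolding p0 .
 have i3: "vb_isomorphic X (subbundle_vb X E (index_domain E M V')) (subbundle_vb X F V')"
 proof (rule subbundle_vb_isomorphic[OF EM V' p.L0])
  fix x assume x: "x \<in> topspace X"
  obtain N where N: "N \<in> bundle_morphisms X F E" "\<And>u. u \<in> fibre E x ==> N x (M x u) = u" "\<And>v. v \<in> fibre F x ==> M x (N x v) = v"
   using M x unfolding bundle_isos_def by blast
  have Nf: "N x v \<in> fibre E x" if "v \<in> fibre F x" for v using N(1) x that unfolding bundle_morphisms_def by blast
  have V'f: "V' x \<subseteq> fibre F x" by (rule FF.subbundle_subset[OF V' x])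
  show "bij_betw (M x) (index_domain E M V' x) (V' x)"
   by (rule bij_betw_byWitness[of _ "N x"]) (use N Nf V'f in \<open>auto simp: index_domain_mem subset_iff\<close>)
 qed
 have "vb_isomorphic X (whitney_sum (subbundle_vb X E (index_domain E L V)) (subbundle_vb X F W)) (subbundle_vb X E (index_domain E L V'))"
  using enlarged_domain_isomorphic[OF W(1,2)] ELV' unfolding V'_def by blast
 then have "vb_isomorphic X (whitney_sum (subbundle_vb X E (index_domain E L V)) (subbundle_vb X F W)) (subbundle_vb X F V')"
  using vb_isomorphic_trans[OF vector_bundle_whitney_sum(1)[OF vbs(5,7)] vbs(1,4)]
   vb_isomorphic_trans[OF vbs(1,2,4) i1] vb_isomorphic_trans[OF vbs(2,3,4) i2 i3] by blast
 moreover have "vb_isomorphic X (subbundle_vb X F V') (whitney_sum (subbundle_vb X F V) (subbundle_vb X F W))"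
  using vb_isomorphic_sym[OF sum_isomorphic[OF W(1,2)]] unfolding V'_def by blast
 ultimately have "vb_isomorphic X (whitney_sum (subbundle_vb X E (index_domain E L V)) (subbundle_vb X F W))
   (whitney_sum (subbundle_vb X F V) (subbundle_vb X F W))"
  by (rule vb_isomorphic_trans[OF vector_bundle_whitney_sum(1)[OF vbs(5,7)] vbs(4) vector_bundle_whitney_sum(1)[OF vbs(6,7)]])
 then show ?thesis by (rule K_difference_eq_oneI[OF vbs(5,6,7)])
qed

section \<open>Morphisms of trivial index\<close>

text \<open>The classical embedding into a trivial bundle: coordinates of finitely many charts,
  weighted by a partition of unity. At each point some weight is nonzero, and the coordinates of
  that chart determine the vector.\<close>

lemma (in vbundle_loc) exists_injective_coordinates:
 assumes X: "compact_space X" "Hausdorff_space X"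
 obtains N and \<kappa> :: "'x => 'v => nat => 'k" where
  "\<And>x. x \<in> topspace X ==> lin_on (vscale V) cscale (vfibre V x) (\<kappa> x)"
  "\<And>x v. x \<in> topspace X ==> v \<in> vfibre V x ==> (\<And>i. i < N ==> \<kappa> x v i = 0) ==> v = 0"
  "\<And>x s i. x \<in> topspace X ==> vsec_at X V s x ==> ((%y. \<kappa> y (s y) i) \<longlongrightarrow> \<kappa> x (s x) i) (nhdsin X x)"
proof -
 have "\<forall>x\<in>topspace X. \<exists>c. (fst c, fst (snd c), snd (snd c)) \<in> vatlas V \<and> x \<in> fst c"
 using exists_vchart by force
 from this[unfolded bchoice_iff] obtain c
  where c: "\<forall>x\<in>topspace X. (fst (c x), fst (snd (c x)), snd (snd (c x))) \<in> vatlas V \<and> x \<in> fst (c x)" ..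
 define U where "U x = fst (c x)" for x
 define n where "n x = fst (snd (c x))" for x
 define phi where "phi x = snd (snd (c x))" for x
 have at: "(U x, n x, phi x) \<in> vatlas V" "x \<in> U x" if "x \<in> topspace X" for x
  using c that by (auto simp: U_def n_def phi_def)
 have oU: "openin X (U x) \<and> x \<in> U x" if "x \<in> topspace X" for x using vchart(1)[OF at(1)] at(2) that by blast
 obtain I and rho :: "'x => 'x => real" where I: "finite I" "I \<subseteq> topspace X"
  and rho: "\<And>i y. i \<in> I ==> y \<in> topspace X ==> (rho i \<longlongrightarrow> rho i y) (nhdsin X y)"
  "\<And>y. y \<in> topspace X ==> (\<Sum>i\<in>I. rho i y) = 1"
  "\<And>i y. i \<in> I ==> y \<in> topspace X ==> y \<notin> U i ==> near X y (%z. rho i z = 0)"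
  by (rule partition_of_unity[OF X oU]) (assumption | (rule that; assumption))+
 \<comment> \<open>Pairs of a chart and one of its coordinates, since the rank may change with the
   chart; \<open>h\<close> lists them as one sequence.\<close>
 define J where "J = (SIGMA i:I. {..<n i})"
 have J: "finite J" unfolding J_def using I(1) by blast
 obtain h where h: "bij_betw h {0..<card J} J" using ex_bij_betw_nat_finite[OF J] by blast
 define g where "g i k x v = of_real (rho i x) * (if x \<in> U i then phi i x v k else 0)" for i k x v
 define \<kappa> where "\<kappa> x v m = (if m < card J then g (fst (h m)) (snd (h m)) x v else 0)" for x v m
 have hJ: "fst (h m) \<in> I" "snd (h m) < n (fst (h m))" if "m < card J" for m
  using bij_betwE[OF h] that unfolding J_def by force+
 show thesis
 proof (rule that[of \<kappa> "card J"])
  fix x assume x: "x \<in> topspace X"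
  have chart: "lin_on (vscale V) cscale (vfibre V x) (phi i x)" if "i \<in> I" "x \<in> U i" for i
   using vchart(2)[OF at(1) that(2)] that(1) I(2) by blast
  show "lin_on (vscale V) cscale (vfibre V x) (\<kappa> x)"
   unfolding lin_on_def
  using chart hJ by (auto simp: \<kappa>_def g_def lin_on_def distrib_left cscale_def)
  show "v = 0" if v: "v \<in> vfibre V x" and z: "\<And>i. i < card J ==> \<kappa> x v i = 0" for v
  proof -
   obtain i where i: "i \<in> I" "rho i x \<noteq> 0"
    by (metis rho(2)[OF x] sum.neutral zero_neq_one)
   have xU: "x \<in> U i" using rho(3)[OF i(1) x] eventually_nhdsin_self[OF x] i(2) by blast
   note ati = at(1)[OF subsetD[OF I(2) i(1)]]
   have "phi i x v k = 0" for k
   proof (cases "k < n i")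
    case True
    then have "(i, k) \<in> J" using i(1) by (simp add: J_def)
    then obtain m where m: "m < card J" "h m = (i, k)" using h unfolding bij_betw_def by (force simp: image_iff)
    then show ?thesis using z[OF m(1)] i(2) xU by (simp add: \<kappa>_def g_def)
   next
    case False
    then show ?thesis using vchart_coords[OF ati xU v] by (simp add: coords_def)
   qed
   then have "phi i x v = 0" by (intro ext) simp
   then have "v = comb (vscale V) (n i) (%k. inv_into (vfibre V x) (phi i x) (unit_coord k)) (%k. 0)"
    using vchart_expand[OF ati xU v] by (simp add: zero_fun_def)
   then show "v = 0" by (simp add: comb_def)
  qed
  show "((%y. \<kappa> y (s y) m) \<longlongrightarrow> \<kappa> x (s x) m) (nhdsin X x)" if s: "vsec_at X V s x" for s m
  proof (cases "m < card J")
   case True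
   let ?i = "fst (h m)"
   note i = hJ(1)[OF True]
   note ati = at(1)[OF subsetD[OF I(2) i]]
   have "((%y. g ?i (snd (h m)) y (s y)) \<longlongrightarrow> g ?i (snd (h m)) x (s x)) (nhdsin X x)"
   proof (cases "x \<in> U ?i")
    case xU: True
    have "((%y. phi ?i y (s y) (snd (h m))) \<longlongrightarrow> phi ?i x (s x) (snd (h m))) (nhdsin X x)"
     using vsec_tendsto[OF s ati xU] unfolding tendsto_fun_iff by blast
    then have "((%y. of_real (rho ?i y) * phi ?i y (s y) (snd (h m))) \<longlongrightarrow> of_real (rho ?i x) * phi ?i x (s x) (snd (h m))) (nhdsin X x)"
     by (intro tendsto_mult tendsto_of_real rho(1)[OF i x])
    moreover have "near X x (%y. of_real (rho ?i y) * phi ?i y (s y) (snd (h m)) = g ?i (snd (h m)) y (s y))"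
     using vchart_eventually[OF ati xU] by eventually_elim (simp add: g_def)
    moreover have "g ?i (snd (h m)) x (s x) = of_real (rho ?i x) * phi ?i x (s x) (snd (h m))"
     using xU by (simp add: g_def)
    ultimately show ?thesis by (simp only: tendsto_cong)
   next
    case False
    have "near X x (%y. g ?i (snd (h m)) y (s y) = 0)"
     using rho(3)[OF i x False] by eventually_elim (simp add: g_def)
    then show ?thesis using False by (simp add: g_def tendsto_eventually)
   qed
   then show ?thesis using True by (simp add: \<kappa>_def)
  qed (simp add: \<kappa>_def)
 qed
qed

context bbundle
begin

text \<open>Each new section avoids \<open>Z\<close> everywhere, and its line is added to
  \<open>Z\<close> before the induction continues; independence modulo the larger subbundle then
  gives independence modulo \<open>Z\<close>.\<close>

lemma generic_sections:
 fixes N :: nat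
 assumes X: "compact_space X" "Hausdorff_space X" and inf: "\<not> finite_dim (mscale E) UNIV"
  and Z: "findim_subbundle X E Z"
 shows "\<exists>s. (\<forall>m<N. global_section (s m)) \<and>
  (\<forall>x\<in>topspace X. \<forall>c. comb (scale E) N (%m. s m x) c \<in> Z x --> (\<forall>m<N. c m = 0))"
 using Z
proof (induction N arbitrary: Z)
 case 0
 show ?case by simp
next
 case (Suc N)
 note Z = Suc.prems
 have VS: "VE.subspace (Z x)" if "x \<in> topspace X" for x by (rule subbundle_subspace[OF Z that])
 have z: "global_section (%x. 0)" unfolding global_section_def using sec_at_zero by blast
 obtain s0 where s0: "global_section s0" "\<And>x. x \<in> topspace X ==> s0 x \<notin> Z x"
  by (rule generic_section[OF X inf Z open_condition_True z TrueI]) (rule that; assumption)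
 have nz: "s0 x \<noteq> 0" if "x \<in> topspace X" for x using s0(2)[OF that] VE.subspace_0[OF VS[OF that]] by auto
 have line: "c = 0" if "x \<in> topspace X" "scale E c (s0 x) \<in> Z x" for x c
 proof (rule ccontr)
  assume "c \<noteq> 0"
  then have "scale E (inverse c) (scale E c (s0 x)) = s0 x" by simp
  then show False using VE.subspace_scale[OF VS[OF that(1)] that(2), of "inverse c"] s0(2)[OF that(1)] by simp
 qed
 define Z1 where "Z1 x = {v + w |v w. v \<in> Z x \<and> w \<in> range (%c. scale E c (s0 x))}" for x
 have "findim_subbundle X E Z1"
  unfolding Z1_def using line by (intro sum_subbundle[OF Z line_subbundle[OF s0(1) nz]]) auto
 from Suc.IH[OF this] obtain s where s: "\<And>m. m < N ==> global_section (s m)"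
  "\<And>x c m. x \<in> topspace X ==> comb (scale E) N (%m. s m x) c \<in> Z1 x ==> m < N ==> c m = 0" by blast
 let ?s = "%m. if m < N then s m else s0"
 show ?case
 proof (intro exI[of _ ?s] conjI ballI allI impI)
  show "global_section (?s m)" if "m < Suc N" for m using s(1) s0(1) by simp
  fix x c m assume x: "x \<in> topspace X" and C: "comb (scale E) (Suc N) (%m. ?s m x) c \<in> Z x" and m: "m < Suc N"
  let ?w = "comb (scale E) N (%m. s m x) c"
  have eq: "comb (scale E) (Suc N) (%m. ?s m x) c = ?w + scale E (c N) (s0 x)"
   by (simp add: comb_def)
  have "?w = (?w + scale E (c N) (s0 x)) + scale E (- c N) (s0 x)" by simp
  then have "?w \<in> Z1 x" using C unfolding eq Z1_def by blast
  then have cz: "c m = 0" if "m < N" for m using s(2)[OF x _ that] by blast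
  then have "?w = 0" by (simp add: comb_def)
  then have "c N = 0" using C line[OF x] unfolding eq by simp
  then show "c m = 0" using cz m by (cases "m = N") auto
 qed
qed

text \<open>The injective coordinates of \<open>W\<close> are used as coefficients of generic
  sections of \<open>E\<close>. Independence of these sections modulo \<open>Z\<close> makes the map
  injective and keeps its image away from \<open>Z\<close>.\<close>

lemma exists_embedded_complement:
 fixes W :: "('k, 'x, 'w::ab_group_add) vbundle"
 assumes X: "compact_space X" "Hausdorff_space X" and inf: "\<not> finite_dim (mscale E) UNIV"
  and Z: "findim_subbundle X E Z" and W: "vector_bundle X W"
 obtains Z' where "findim_subbundle X E Z'" "\<And>x. x \<in> topspace X ==> Z x \<inter> Z' x \<subseteq> {0}"
  "vb_isomorphic X W (subbundle_vb X E Z')"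
proof -
 interpret W: vbundle_loc X W by unfold_locales (rule W)
 obtain N and \<kappa> :: "'x => 'w => nat => 'k" where
  \<kappa>: "\<And>x. x \<in> topspace X ==> lin_on (vscale W) cscale (vfibre W x) (\<kappa> x)"
  "\<And>x v. x \<in> topspace X ==> v \<in> vfibre W x ==> (\<And>i. i < N ==> \<kappa> x v i = 0) ==> v = 0"
  "\<And>x s i. x \<in> topspace X ==> vsec_at X W s x ==> ((%y. \<kappa> y (s y) i) \<longlongrightarrow> \<kappa> x (s x) i) (nhdsin X x)"
  by (rule W.exists_injective_coordinates[OF X]) blast
 obtain s where s: "\<And>m. m < N ==> global_section (s m)"
  "\<And>x c m. x \<in> topspace X ==> comb (scale E) N (%m. s m x) c \<in> Z x ==> m < N ==> c m = 0"
  using generic_sections[OF X inf Z, of N] by blast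
 define j where "j x w = comb (scale E) N (%m. s m x) (\<kappa> x w)" for x w
 have jZ: "w = 0" if "x \<in> topspace X" "w \<in> vfibre W x" "j x w \<in> Z x" for x w
  using s(2)[OF that(1)] that(3) unfolding j_def by (intro \<kappa>(2)[OF that(1,2)]) blast
 have Z0: "0 \<in> Z x" if "x \<in> topspace X" for x by (rule VE.subspace_0[OF subbundle_subspace[OF Z that]])
 have lin: "lin_on (vscale W) (scale E) (vfibre W x) (j x)" if x: "x \<in> topspace X" for x
  using \<kappa>(1)[OF x] unfolding lin_on_def j_def
  by (auto simp: VE.comb_add[symmetric] VE.comb_scale[symmetric] cscale_def plus_fun_def)
 have j0: "w = 0" if "x \<in> topspace X" "w \<in> vfibre W x" "j x w = 0" for x w
  using jZ[OF that(1,2)] that(3) Z0[OF that(1)] by simp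
 have sec: "sec_at X E (%y. j y (t y)) x" if "x \<in> topspace X" "vsec_at X W t x" for x t
  unfolding j_def using s(1) \<kappa>(3)[OF that] that(1) by (intro sec_at_comb) (auto simp: global_section_def)
 note im = image_subbundle[OF W lin j0 sec]
 show thesis
 proof (rule that[OF im(1) _ im(2)])
  fix x assume x: "x \<in> topspace X"
  have "j x 0 = 0" using lin_on_zero[OF W.vector_space_axioms VE.vector_space_axioms lin[OF x] W.subspace_0[OF W.vsub[OF x]]] .
  then show "Z x \<inter> j x ` vfibre W x \<subseteq> {0}" using jZ[OF x] by auto
 qed
qed

end

context transversal_data
begin

text \<open>The isomorphisms lead from \<open>E(L, V')\<close> to \<open>E(L, V) + W\<close>,
  \<open>E(L, V) + Z\<close>, \<open>V + Z\<close>, \<open>V + W\<close> and \<open>V'\<close>,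
  where \<open>W\<close> is the copy of \<open>Z\<close> in \<open>F\<close>; the first is
  \<open>enlarged_domain_isomorphic\<close>.\<close>

lemma exists_isomorphic_transversal_data:
 assumes X: "compact_space X" "Hausdorff_space X" and inf: "\<not> finite_dim (mscale F) UNIV"
  and index: "K_class X (subbundle_vb X E (index_domain E L V)) \<otimes>\<^bsub>K_group X\<^esub>
   inv\<^bsub>K_group X\<^esub> K_class X (subbundle_vb X F V) = \<one>\<^bsub>K_group X\<^esub>"
 obtains V' P' R' where "transversal_data X E F L V' P' R'"
  "vb_isomorphic X (subbundle_vb X E (index_domain E L V')) (subbundle_vb X F V')"
proof -
 let ?E = "%V. subbundle_vb X E (index_domain E L V)" and ?F = "subbundle_vb X F"
 note Eb = EE.vector_bundle_subbundle[OF index_domain_facts(1)] and Vb = FF.vector_bundle_subbundle[OF V]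
 obtain Z :: "('k, 'x, nat => 'k) vbundle" where Z: "vector_bundle X Z"
  "vb_isomorphic X (whitney_sum (?E V) Z) (whitney_sum (?F V) Z)"
  using index unfolding K_difference_eq_one[OF Eb Vb] by blast
 obtain W where W: "findim_subbundle X F W" "\<And>x. x \<in> topspace X ==> V x \<inter> W x \<subseteq> {0}" "vb_isomorphic X Z (?F W)"
  by (rule FF.exists_embedded_complement[OF X inf V Z(1)]) (rule that; assumption)
 define V' where "V' x = {v + w |v w. v \<in> V x \<and> w \<in> W x}" for x
 have V': "findim_subbundle X F V'" unfolding V'_def by (rule FF.sum_subbundle[OF V W(1,2)])
 have VV': "V x \<subseteq> V' x" if "x \<in> topspace X" for x
  using VF.subspace_0[OF FF.subbundle_subspace[OF W(1) that]] unfolding V'_def by force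
 have "spans_cokernel L x (V' x)" if x: "x \<in> topspace X" for x
  unfolding spans_cokernel_def
 using transversal[OF x] VV'[OF x] VF.span_superset[of "V' x"] by blast
 then have tr: "transversal X E F L V'" by (rule transversal_if_spans[OF V' _ L])
 obtain P' R' where td: "transversal_data X E F L V' P' R'"
  by (rule exists_transversal_data[OF X L kernel V' tr]) (assumption | (rule that; assumption))+
 note EV' = transversal_data.index_domain_facts(1)[OF td]
 note Wb = FF.vector_bundle_subbundle[OF W(1)] and V'b = FF.vector_bundle_subbundle[OF V']
  and EV'b = EE.vector_bundle_subbundle[OF EV']
 note EW = vector_bundle_whitney_sum(1)[OF Eb Wb] and EZ = vector_bundle_whitney_sum(1)[OF Eb Z(1)]
  and VZ = vector_bundle_whitney_sum(1)[OF Vb Z(1)] and VWb = vector_bundle_whitney_sum(1)[OF Vb Wb]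
 have "vb_isomorphic X (whitney_sum (?E V) (?F W)) (?E V')"
  using enlarged_domain_isomorphic[OF W(1,2)] EV' unfolding V'_def by blast
 then have 1: "vb_isomorphic X (?E V') (whitney_sum (?E V) (?F W))" by (rule vb_isomorphic_sym)
 have 2: "vb_isomorphic X (whitney_sum (?E V) (?F W)) (whitney_sum (?E V) Z)"
  by (rule whitney_sum_cong[OF Eb Eb vb_isomorphic_refl[OF Eb] Wb Z(1) vb_isomorphic_sym[OF W(3)]])
 have 3: "vb_isomorphic X (whitney_sum (?F V) Z) (whitney_sum (?F V) (?F W))"
  by (rule whitney_sum_cong[OF Vb Vb vb_isomorphic_refl[OF Vb] Z(1) Wb W(3)])
 have 4: "vb_isomorphic X (whitney_sum (?F V) (?F W)) (?F V')"
  using sum_isomorphic[OF W(1,2)] unfolding V'_def .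
 have "vb_isomorphic X (?E V') (whitney_sum (?E V) Z)" by (rule vb_isomorphic_trans[OF EV'b EW EZ 1 2])
 then have "vb_isomorphic X (?E V') (whitney_sum (?F V) Z)" by (rule vb_isomorphic_trans[OF EV'b EZ VZ _ Z(2)])
 then have "vb_isomorphic X (?E V') (whitney_sum (?F V) (?F W))" by (rule vb_isomorphic_trans[OF EV'b VZ VWb _ 3])
 then have "vb_isomorphic X (?E V') (?F V')" by (rule vb_isomorphic_trans[OF EV'b VWb V'b _ 4])
 with td show thesis by (rule that)
qed

text \<open>The inverse of \<open>M\<close> is \<open>N = R + B (1 - L R)\<close>, with
  \<open>B\<close> inverse to \<open>A\<close>: \<open>R\<close> recovers \<open>R L u\<close> from
  \<open>M u\<close>, and \<open>1 - L R\<close> isolates the summand in \<open>V\<close>. Moreover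
  \<open>L - M = (L - A) (1 - R L)\<close>.\<close>

lemma compact_perturbation_if_isomorphic:
 assumes iso: "vb_isomorphic X (subbundle_vb X E (index_domain E L V)) (subbundle_vb X F V)"
 shows "\<exists>M\<in>bundle_isos X E F. \<exists>K\<in>compact_morphisms X E F. \<forall>x\<in>topspace X. \<forall>u\<in>fibre E x. L x u = M x u + K x u"
proof -
 let ?D = "index_domain E L V"
 note EV = index_domain_facts(1)
 obtain A B where AB: "section_iso X (subbundle_vb X E ?D) (subbundle_vb X F V) A B"
  using iso unfolding vb_isomorphic_iff[OF EE.vector_bundle_subbundle[OF EV] FF.vector_bundle_subbundle[OF V]] by blast
 have A: "lin_on (scale E) (scale F) (?D x) (A x)" "\<And>u. u \<in> ?D x ==> A x u \<in> V x"
  and B: "lin_on (scale F) (scale E) (V x) (B x)" "\<And>u. u \<in> V x ==> B x u \<in> ?D x"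
  and inverse: "\<And>u. u \<in> ?D x ==> B x (A x u) = u" "\<And>v. v \<in> V x ==> A x (B x v) = v"
  if "x \<in> topspace X" for x
  using AB that unfolding section_iso_def fibrewise_linear_def EE.subbundle_vb_simps FF.subbundle_vb_simps by blast+
 have As: "sec_at X F (%y. A y (s y)) x" if "x \<in> topspace X" "sec_at X E s x" "near X x (%y. s y \<in> ?D y)" for x s
  using AB that EE.subbundle_vb_sec[OF EV that(1)] FF.subbundle_vb_sec[OF V that(1)]
  unfolding section_iso_def preserves_sections_def by blast
 have Bs: "sec_at X E (%y. B y (s y)) x" if "x \<in> topspace X" "sec_at X F s x" "near X x (%y. s y \<in> V y)" for x s
  using AB that EE.subbundle_vb_sec[OF EV that(1)] FF.subbundle_vb_sec[OF V that(1)]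
  unfolding section_iso_def preserves_sections_def by blast
 have Df: "u \<in> fibre E x" "L x u \<in> V x" if "u \<in> ?D x" for x u using that by (simp_all add: index_domain_mem)
 define Q where "Q x u = u - R x (L x u)" for x u
 define C where "C x w = w - L x (R x w)" for x w
 have Q: "mor_at X E E Q x" "u \<in> fibre E x ==> Q x u \<in> ?D x" "u \<in> ?D x ==> R x (L x u) = 0"
  if "x \<in> topspace X" for x u
  unfolding Q_def using index_domain_facts(2-4)[OF that] by blast+
 have LR: "mor_at X F F (%x w. L x (R x w)) x" if "x \<in> topspace X" for x
  by (rule mor_at_comp[OF F E F R(1)[OF that] L[OF that] that])
 have C: "mor_at X F F C x" "w \<in> fibre F x ==> C x w \<in> V x" if "x \<in> topspace X" for x w
  unfolding C_def by (rule FF.mor_at_diff[OF mor_at_id[OF F] LR], (rule that)+) (rule defect[OF that])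
 \<comment> \<open>\<open>A\<close> and \<open>B\<close> are defined on finite dimensional
   subbundles only; composed with projections onto these they become morphisms of the Banach
   bundles.\<close>
 have AQ: "mor_at X E F (%y u. A y (Q y u)) x" if x: "x \<in> topspace X" for x
  by (rule finite_rank_mor[OF EV x Q(1,2) A(1) V_fibre[OF _ A(2)] As])
 have BC: "mor_at X F E (%y w. B y (C y w)) x" if x: "x \<in> topspace X" for x
  by (rule FE.finite_rank_mor[OF V x C B(1) Df(1)[OF B(2)] Bs])
 define M where "M x u = L x (R x (L x u)) + A x (Q x u)" for x u
 define N where "N x w = R x w + B x (C x w)" for x w
 define K where "K x u = L x u - M x u" for x u
 have mM: "mor_at X E F M x" if x: "x \<in> topspace X" for x
  unfolding M_def by (intro mor_at_add AQ mor_at_comp[OF E F F L LR] x)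
 have mN: "mor_at X F E N x" if x: "x \<in> topspace X" for x
  unfolding N_def by (intro FE.mor_at_add BC R(1) x)
 have NM: "N x (M x u) = u" if x: "x \<in> topspace X" and u: "u \<in> fibre E x" for x u
 using L_fibre[OF x u] R_fibre[OF x] A(2)[OF x Q(2)[OF x u]] inverse(1)[OF x Q(2)[OF x u]] by (simp add: M_def FE.mor_at_add_arg[OF R(1)[OF x] x L_fibre[OF x] V_fibre[OF x]] R(3)[OF x] RLR[OF x] C_def N_def Q_def)
 have MN: "M x (N x w) = w" if x: "x \<in> topspace X" and w: "w \<in> fibre F x" for x w
 using R_fibre[OF x w] B(2)[OF x C(2)[OF x w]] FE.mor_at_add_arg[OF R(1)[OF x] x L_fibre[OF x] L_fibre[OF x Df(1)]] inverse(2)[OF x C(2)[OF x w]] by (simp add: N_def mor_at_add_arg[OF L[OF x] x _ Df(1)] RLR[OF x w] Q(3)[OF x] Q_def M_def C_def)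
 have "M \<in> bundle_isos X E F"
  unfolding bundle_isos_def bundle_morphisms_iff[OF E F]
 proof (intro CollectI conjI ballI)
  have "N \<in> bundle_morphisms X F E" unfolding bundle_morphisms_iff[OF F E] using mN by blast
  then show "\<exists>N\<in>bundle_morphisms X F E. \<forall>x\<in>topspace X.
    (\<forall>u\<in>fibre E x. N x (M x u) = u) \<and> (\<forall>v\<in>fibre F x. M x (N x v) = v)"
   using NM MN by (intro bexI[of _ N]) simp_all
 qed (rule mM)
 moreover have "K \<in> compact_morphisms X E F"
 proof (rule finite_rank_morphism_compact[OF _ V])
  show "mor_at X E F K x" if "x \<in> topspace X" for x unfolding K_def by (intro mor_at_diff L mM that)
  fix x u assume x: "x \<in> topspace X" and u: "u \<in> fibre E x"
  have "K x u = L x (Q x u) - A x (Q x u)"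
   unfolding K_def M_def Q_def mor_at_diff_arg[OF L[OF x] x u R_fibre[OF x L_fibre[OF x u]]] by simp
  then show "K x u \<in> V x"
   using VF.subspace_diff[OF V_subspace[OF x] Df(2)[OF Q(2)[OF x u]] A(2)[OF x Q(2)[OF x u]]] by simp
 qed
 ultimately show ?thesis by (intro bexI[of _ M] bexI[of _ K]) (simp_all add: K_def)
qed

end

theorem proposition5p1:
  fixes X :: "'x topology"
    and E :: "('k::real_or_complex, 'x, 'e::ab_group_add, 'm::banach) banach_bundle"
    and F :: "('k, 'x, 'f::ab_group_add, 'n::banach) banach_bundle"
    and L :: "'x \<Rightarrow> 'e \<Rightarrow> 'f"
  assumes "compact_space X" and "Hausdorff_space X"
    and "banach_bundle X E" and "banach_bundle X F"
    and "L \<in> fredholm_morphisms X E F"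
  shows "let decomposes =
           (\<exists>M\<in>bundle_isos X E F. \<exists>K\<in>compact_morphisms X E F.
              \<forall>x\<in>topspace X. \<forall>u\<in>fibre E x. L x u = M x u + K x u)
         in (\<not> finite_dim (mscale F) UNIV \<longrightarrow>
               (index_bundle X E F L = \<one>\<^bsub>K_group X\<^esub> \<longleftrightarrow> decomposes)) \<and>
            (decomposes \<longrightarrow> index_bundle X E F L = \<one>\<^bsub>K_group X\<^esub>)"
proof -
 note X = assms(1,2)
 interpret bpair X E F by unfold_locales (rule assms)+
 obtain V P R where td: "transversal_data X E F L V P R"
  and index: "index_bundle X E F L = K_class X (subbundle_vb X E (index_domain E L V)) \<otimes>\<^bsub>K_group X\<^esub>
    inv\<^bsub>K_group X\<^esub> K_class X (subbundle_vb X F V)"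
  by (rule index_bundle_transversal_data[OF X assms(5)]) (rule that; assumption)
 have "index_bundle X E F L = \<one>\<^bsub>K_group X\<^esub>"
  if "\<exists>M\<in>bundle_isos X E F. \<exists>K\<in>compact_morphisms X E F. \<forall>x\<in>topspace X. \<forall>u\<in>fibre E x. L x u = M x u + K x u"
  using that transversal_data.trivial_index_if_compact_perturbation[OF td X] unfolding index by blast
 moreover have "\<exists>M\<in>bundle_isos X E F. \<exists>K\<in>compact_morphisms X E F. \<forall>x\<in>topspace X. \<forall>u\<in>fibre E x. L x u = M x u + K x u"
  if inf: "\<not> finite_dim (mscale F) UNIV" and one: "index_bundle X E F L = \<one>\<^bsub>K_group X\<^esub>"
 by (metis transversal_data.exists_isomorphic_transversal_data[OF td X inf one[unfolded index]] transversal_data.compact_perturbation_if_isomorphic)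
 ultimately show ?thesis unfolding Let_def by blast
qed

end
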